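(* There exists a unique continuous, symmetric, $\mathbb{R}_{\geq 0}$-bilinear functional \[ \mathcal{N}\colon \mathcal{S}\mathrm{Curr}(F_N)\times \mathcal{S}\mathrm{Curr}(F_N)\to \mathbb{R}_{\geq 0}\] such that for all nontrivial finitely generated subgroups $H,K\leq F_N$ we have $\mathcal{N}(\eta_H,\eta_K)=\mathcal{N}(H,K)$. Moreover, $\mathcal{N}$ is $\mathrm{Out}(F_N)$-invariant: $\mathcal{N}(\varphi\mu,\varphi\nu)=\mathcal{N}(\mu,\nu)$ for all $\varphi\in\mathrm{Out}(F_N)$ and $\mu,\nu\in\mathcal{S}\mathrm{Curr}(F_N)$.
   Context: Let $N\geq 2$ and let $F_N$ be the free group of rank $N$ with a fixed free basis $A=\{a_1,\dots,a_N\}$ and identity $1$. Let $X$ be the Cayley graph of $(F_N,A)$ (vertex set $F_N$, an edge joining $g$ and $ga$ for $g\in F_N,a\in A$, each edge of length $1$); $X$ is a tree on which $F_N$ acts on the left, and its boundary $\partial X$ (classes of geodesic rays) is identified with $\partial F_N$. Let $\mathcal{C}_N$ be the set of all closed subsets $S\subset\partial X$ with at least two points, with the subspace topology of the Vietoris topology on the space of closed subsets of $\partial X$ (equivalently, the Hausdorff-distance topology); $F_N$ acts on $\mathcal{C}_N$. A subset current is a Borel measure on $\mathcal{C}_N$ that is $F_N$-invariant and finite on compact sets; $\mathcal{S}\mathrm{Curr}(F_N)$ denotes the set of subset currents, with the weak-* topology (convergence of integrals of compactly supported continuous functions), addition and multiplication by nonnegative scalars. For a nontrivial finitely generated $H\leq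 F_N$, $\Lambda(H)\subset\partial X$ is its limit set (accumulation points in $\partial X$ of sequences in $H$), $\widehat H=\mathrm{Comm}_{F_N}(H)=\{g: [H:H\cap gHg^{-1}]<\infty,[gHg^{-1}:H\cap gHg^{-1}]<\infty\}$ (which contains $H$ with finite index), and the counting current is $\eta_H=[\widehat H:H]\sum_{H'}\delta_{\Lambda(H')}$, the sum over all conjugates $H'$ of $\widehat H$; for the trivial subgroup $\eta_{\{1\}}=0$. For a finitely generated free group $F$, $\overline{\mathrm{rk}}(F)=\max\{\mathrm{rank}(F)-1,0\}$. For finitely generated $H,K\leq F_N$, $\mathcal{N}(H,K)=\sum_{HgK\in H\backslash F_N/K}\overline{\mathrm{rk}}(H\cap gKg^{-1})$ (only finitely many terms are nonzero). Each $\varphi\in\mathrm{Aut}(F_N)$ extends to a homeomorphism of $\partial X$, hence acts on $\mathcal{C}_N$, and acts on currents by $(\varphi\mu)(U)=\mu(\varphi^{-1}(U))$; this action factors through $\mathrm{Out}(F_N)$. *)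

theory Defs
  imports "HOL-Analysis.Analysis" "HOL-Algebra.Algebra"
begin

text \<open>Letters: the integer i (1 \<le> i \<le> N) stands for a_i, and -i for its inverse.\<close>
definition letters :: "nat \<Rightarrow> int set" where
  "letters N = {a. a \<noteq> 0 \<and> \<bar>a\<bar> \<le> int N}"

definition reduced :: "int list \<Rightarrow> bool" where
  "reduced w \<longleftrightarrow> (\<forall>i. Suc i < length w \<longrightarrow> w ! Suc i \<noteq> - (w ! i))"

definition FN_carrier :: "nat \<Rightarrow> int list set" where
  "FN_carrier N = {w. set w \<subseteq> letters N \<and> reduced w}"

fun red :: "int list \<Rightarrow> int list" where
  "red [] = []"
| "red (x # xs) = (case red xs of [] \<Rightarrow> [x] | y # ys \<Rightarrow> (if y = - x then ys else x # y # ys))"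

definition FN :: "nat \<Rightarrow> int list monoid" where
  "FN N = \<lparr>carrier = FN_carrier N, mult = (\<lambda>u v. red (u @ v)), one = []\<rparr>"

text \<open>Boundary points = geodesic rays from 1 = infinite reduced words.\<close>
definition bd :: "nat \<Rightarrow> (nat \<Rightarrow> int) set" where
  "bd N = {\<xi>. (\<forall>n. \<xi> n \<in> letters N) \<and> (\<forall>n. \<xi> (Suc n) \<noteq> - \<xi> n)}"

definition pre :: "(nat \<Rightarrow> int) \<Rightarrow> nat \<Rightarrow> int list" where
  "pre \<xi> k = map \<xi> [0..<k]"

definition bdT :: "nat \<Rightarrow> (nat \<Rightarrow> int) topology" where
  "bdT N = topology_generated_by
     {{\<xi> \<in> bd N. pre \<xi> (length w) = w} | w. w \<in> FN_carrier N}"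

definition bact :: "int list \<Rightarrow> (nat \<Rightarrow> int) \<Rightarrow> (nat \<Rightarrow> int)" where
  "bact g \<xi> = (let m = length g;
                   c = (GREATEST k. k \<le> m \<and> (\<forall>i<k. \<xi> i = - (g ! (m - 1 - i))))
               in (\<lambda>n. if n < m - c then g ! n else \<xi> (n - (m - c) + c)))"

text \<open>Length of the common prefix of a vertex w and a boundary point \<xi>
  (the Gromov product based at 1).\<close>
definition cpl :: "int list \<Rightarrow> (nat \<Rightarrow> int) \<Rightarrow> nat" where
  "cpl w \<xi> = (GREATEST k. k \<le> length w \<and> take k w = pre \<xi> k)"

definition conv_bd :: "(nat \<Rightarrow> int list) \<Rightarrow> (nat \<Rightarrow> int) \<Rightarrow> bool" where
  "conv_bd s \<xi> \<longleftrightarrow> filterlim (\<lambda>n. cpl (s n) \<xi>) at_top sequentially"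

definition limset :: "nat \<Rightarrow> int list set \<Rightarrow> (nat \<Rightarrow> int) set" where
  "limset N H = {\<xi> \<in> bd N. \<exists>s. (\<forall>n. s n \<in> H) \<and> conv_bd s \<xi>}"

definition bdext :: "nat \<Rightarrow> (int list \<Rightarrow> int list) \<Rightarrow> (nat \<Rightarrow> int) \<Rightarrow> (nat \<Rightarrow> int)" where
  "bdext N \<phi> \<xi> = (THE \<zeta>. \<zeta> \<in> bd N \<and> conv_bd (\<lambda>n. \<phi> (pre \<xi> n)) \<zeta>)"

definition vietoris :: "'a topology \<Rightarrow> 'a set topology" where
  "vietoris T = topology_generated_by
     ({{S. closedin T S \<and> S \<subseteq> U} | U. openin T U} \<union>
      {{S. closedin T S \<and> S \<inter> U \<noteq> {}} | U. openin T U})"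

definition CN :: "nat \<Rightarrow> (nat \<Rightarrow> int) set set" where
  "CN N = {S. closedin (bdT N) S \<and> (\<exists>x y. x \<in> S \<and> y \<in> S \<and> x \<noteq> y)}"

definition CT :: "nat \<Rightarrow> (nat \<Rightarrow> int) set topology" where
  "CT N = subtopology (vietoris (bdT N)) (CN N)"

definition borel_of :: "'a topology \<Rightarrow> 'a measure" where
  "borel_of T = sigma (topspace T) {U. openin T U}"

definition SCurr :: "nat \<Rightarrow> (nat \<Rightarrow> int) set measure set" where
  "SCurr N = {\<mu>. sets \<mu> = sets (borel_of (CT N)) \<and>
     (\<forall>g \<in> FN_carrier N. \<forall>A \<in> sets \<mu>. emeasure \<mu> ((\<lambda>S. bact g ` S) ` A) = emeasure \<mu> A) \<and>
     (\<forall>K. compactin (CT N) K \<longrightarrow> emeasure \<mu> K < \<infinity>)}"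

definition Cc :: "'a topology \<Rightarrow> ('a \<Rightarrow> real) set" where
  "Cc T = {f. continuous_map T euclideanreal f \<and>
              compactin T (T closure_of {x \<in> topspace T. f x \<noteq> 0})}"

definition weakT :: "nat \<Rightarrow> (nat \<Rightarrow> int) set measure topology" where
  "weakT N = topology_generated_by
     {{\<mu> \<in> SCurr N. integral\<^sup>L \<mu> f \<in> V} | f V. f \<in> Cc (CT N) \<and> open V}"

definition madd :: "'a measure \<Rightarrow> 'a measure \<Rightarrow> 'a measure" where
  "madd \<mu> \<nu> = measure_of (space \<mu>) (sets \<mu>) (\<lambda>A. emeasure \<mu> A + emeasure \<nu> A)"

definition mscale :: "real \<Rightarrow> 'a measure \<Rightarrow> 'a measure" where
  "mscale c \<mu> = scale_measure (ennreal c) \<mu>"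

definition autc :: "nat \<Rightarrow> (int list \<Rightarrow> int list) \<Rightarrow> (nat \<Rightarrow> int) set measure \<Rightarrow> (nat \<Rightarrow> int) set measure" where
  "autc N \<phi> \<mu> = distr \<mu> (borel_of (CT N)) (\<lambda>S. bdext N \<phi> ` S)"

definition fg_subgroup :: "nat \<Rightarrow> int list set \<Rightarrow> bool" where
  "fg_subgroup N H \<longleftrightarrow> subgroup H (FN N) \<and>
     (\<exists>S. finite S \<and> S \<subseteq> carrier (FN N) \<and> generate (FN N) S = H)"

definition conjg :: "nat \<Rightarrow> int list \<Rightarrow> int list set \<Rightarrow> int list set" where
  "conjg N g H = (\<lambda>h. g \<otimes>\<^bsub>FN N\<^esub> h \<otimes>\<^bsub>FN N\<^esub> inv\<^bsub>FN N\<^esub> g) ` H"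

definition cosets_in :: "nat \<Rightarrow> int list set \<Rightarrow> int list set \<Rightarrow> int list set set" where
  "cosets_in N H K = rcosets\<^bsub>(FN N)\<lparr>carrier := H\<rparr>\<^esub> K"

definition Comm :: "nat \<Rightarrow> int list set \<Rightarrow> int list set" where
  "Comm N H = {g \<in> carrier (FN N).
     finite (cosets_in N H (H \<inter> conjg N g H)) \<and>
     finite (cosets_in N (conjg N g H) (H \<inter> conjg N g H))}"

definition eta :: "nat \<Rightarrow> int list set \<Rightarrow> (nat \<Rightarrow> int) set measure" where
  "eta N H = measure_of (CN N) (sets (borel_of (CT N)))
     (\<lambda>A. of_nat (card (cosets_in N (Comm N H) H)) *
          (\<integral>\<^sup>+ H'. indicator A (limset N H')
             \<partial>count_space {conjg N g (Comm N H) | g. g \<in> carrier (FN N)}))"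

definition rank :: "nat \<Rightarrow> int list set \<Rightarrow> nat" where
  "rank N H = (LEAST n. \<exists>S. finite S \<and> card S = n \<and> S \<subseteq> H \<and> generate (FN N) S = H)"

text \<open>Reduced rank max(rank - 1, 0) (natural-number subtraction).\<close>
definition rrank :: "nat \<Rightarrow> int list set \<Rightarrow> nat" where
  "rrank N H = rank N H - 1"

definition dcosets :: "nat \<Rightarrow> int list set \<Rightarrow> int list set \<Rightarrow> int list set set" where
  "dcosets N H K = {H <#>\<^bsub>FN N\<^esub> {g} <#>\<^bsub>FN N\<^esub> K | g. g \<in> carrier (FN N)}"

definition dterm :: "nat \<Rightarrow> int list set \<Rightarrow> int list set \<Rightarrow> int list set \<Rightarrow> nat" where
  "dterm N H K D = rrank N (H \<inter> conjg N (SOME g. g \<in> D) K)"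

text \<open>N(H,K): the sum over double cosets HgK (only finitely many nonzero terms).\<close>
definition Nsub :: "nat \<Rightarrow> int list set \<Rightarrow> int list set \<Rightarrow> nat" where
  "Nsub N H K = (\<Sum>D \<in> {D \<in> dcosets N H K. dterm N H K D \<noteq> 0}. dterm N H K D)"

definition is_intersection_functional ::
  "nat \<Rightarrow> ((nat \<Rightarrow> int) set measure \<Rightarrow> (nat \<Rightarrow> int) set measure \<Rightarrow> real) \<Rightarrow> bool" where
  "is_intersection_functional N Nf \<longleftrightarrow>
     continuous_map (prod_topology (weakT N) (weakT N)) euclideanreal (\<lambda>(\<mu>, \<nu>). Nf \<mu> \<nu>) \<and>
     (\<forall>\<mu> \<in> SCurr N. \<forall>\<nu> \<in> SCurr N. Nf \<mu> \<nu> \<ge> 0) \<and>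
     (\<forall>\<mu> \<in> SCurr N. \<forall>\<nu> \<in> SCurr N. Nf \<mu> \<nu> = Nf \<nu> \<mu>) \<and>
     (\<forall>\<mu>1 \<in> SCurr N. \<forall>\<mu>2 \<in> SCurr N. \<forall>\<nu> \<in> SCurr N.
        Nf (madd \<mu>1 \<mu>2) \<nu> = Nf \<mu>1 \<nu> + Nf \<mu>2 \<nu>) \<and>
     (\<forall>c::real. \<forall>\<mu> \<in> SCurr N. \<forall>\<nu> \<in> SCurr N. c \<ge> 0 \<longrightarrow>
        Nf (mscale c \<mu>) \<nu> = c * Nf \<mu> \<nu>) \<and>
     (\<forall>H K. fg_subgroup N H \<and> H \<noteq> {\<one>\<^bsub>FN N\<^esub>} \<and> fg_subgroup N K \<and> K \<noteq> {\<one>\<^bsub>FN N\<^esub>} \<longrightarrow>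
        Nf (eta N H) (eta N K) = real (Nsub N H K))"

end

theory Submission
  imports Defs
begin

text \<open>
  For closed subsets \<open>S\<close>, \<open>S'\<close> of the boundary let \<open>T\<close> be the intersection of their convex hulls in the
  Cayley tree. If both hulls contain the identity, put \<open>f(S, S') = deg\<^sub>T(1) / 2 - 1\<close>, plus \<open>1 / |T|\<close> when \<open>T\<close>
  is finite; the functional is the integral of \<open>f\<close> over such pairs. Replacing \<open>|T| < \<infinity>\<close> by \<open>|T| \<le> k\<close>
  makes \<open>f\<close> locally constant and changes the integral by at most \<open>\<mu>(1) \<nu>(1) / k\<close>, where \<open>\<mu>(1)\<close> is the mass of the sets
  whose hull contains 1; this gives continuity. For counting currents the integral is a sum over the vertices of the fibre
  product of two core graphs. Its components are the quotients of the trees \<open>T\<close> by the groups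
  \<open>H \<inter> g K g\<^sup>-\<^sup>1\<close>, and the terms of one component add up to minus its Euler characteristic, corrected to 0 for
  finite trees, that is, to the reduced rank.

  The masses of local types under a current satisfy the matching equations of half-edges. By Dirichlet's
  simultaneous approximation theorem these have nearby integral solutions, which are realised by finite
  core graphs. So the cone spanned by the counting currents is dense, and uniqueness, nonnegativity and
  invariance under automorphisms follow from the values on counting currents.
\<close>

section \<open>Reduced words\<close>

text \<open>The obstacle is that the local term is not continuous: whether \<open>T\<close> is
  finite cannot be read off from bounded parts of \<open>S\<close> and \<open>S'\<close>. The
  correction is nevertheless forced. A component with trivial group has Euler characteristic 1 but
  must contribute 0, and spreading the missing 1 evenly over the vertices of \<open>T\<close> makes
  the term at one vertex small exactly when finiteness is hard to see: a subtree through the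
  identity with at most \<open>k\<close> vertices lies in the ball of radius \<open>k\<close>. The
  rest is read off from prefixes of bounded length, so no product measure is formed; the truncated
  integrals are finite sums of products of cell masses.

  The commensurator is eliminated early: a counting current is the push-forward of the counting
  measure on the right cosets of \<open>H\<close> itself, because the passage from these cosets to
  the conjugates of the commensurator has fibres of size equal to the index. The local term can be
  negative at leaves, and it depends on the basis, so neither nonnegativity nor invariance can be
  seen from the integral.\<close>

definition cr :: "int \<Rightarrow> int list \<Rightarrow> int list" where
  "cr x w = (case w of [] \<Rightarrow> [x] | y # ys \<Rightarrow> if y = - x then ys else x # w)"

definition mul :: "int list \<Rightarrow> int list \<Rightarrow> int list" where
  "mul u v = red (u @ v)"

definition winv :: "int list \<Rightarrow> int list" where
  "winv w = rev (map uminus w)"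

lemma red_Cons: "red (x # w) = cr x (red w)"
  by (simp add: cr_def split: list.split)

declare red.simps(2) [simp del]

lemma reduced_Nil [simp]: "reduced []"
  and reduced_single [simp]: "reduced [x]"
  by (simp_all add: reduced_def)

lemma reduced_Cons: "reduced (x # w) \<longleftrightarrow> reduced w \<and> (w = [] \<or> hd w \<noteq> - x)"
proof (cases w)
  case (Cons y v)
  show ?thesis
  proof
    assume r: "reduced (x # w)"
    have "w ! Suc i \<noteq> - (w ! i)" if "Suc i < length w" for i
      using r that unfolding reduced_def by (auto dest: spec[of _ "Suc i"])
    moreover have "y \<noteq> - x" using r unfolding reduced_def Cons by (auto dest: spec[of _ 0])
    ultimately show "reduced w \<and> (w = [] \<or> hd w \<noteq> - x)"
      unfolding reduced_def Cons by auto
  next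
    assume r: "reduced w \<and> (w = [] \<or> hd w \<noteq> - x)"
    show "reduced (x # w)"
      unfolding reduced_def
    proof (intro allI impI)
      fix i assume "Suc i < length (x # w)"
      then show "(x # w) ! Suc i \<noteq> - ((x # w) ! i)"
        using r unfolding Cons by (cases i) (auto simp: reduced_def)
    qed
  qed
qed simp

lemma reduced_append:
  "reduced (u @ v) \<longleftrightarrow> reduced u \<and> reduced v \<and> (u = [] \<or> v = [] \<or> hd v \<noteq> - last u)"
  by (induct u) (auto simp: reduced_Cons)

lemma reduced_cr: "reduced w \<Longrightarrow> reduced (cr x w)"
  by (auto simp: cr_def reduced_Cons split: list.split)

lemma reduced_red [simp]: "reduced (red w)"
  by (induct w) (auto simp: red_Cons reduced_cr)

lemma red_reduced: "reduced w \<Longrightarrow> red w = w"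
  by (induct w) (auto simp: red_Cons reduced_Cons cr_def split: list.split)

text \<open>Van der Waerden's argument: each letter permutes the reduced words, and the opposite
  letter acts as the inverse permutation. Associativity of \<open>mul\<close> comes from this
  instead of from confluence of the cancellation rules.\<close>

lemma cr_cr: "reduced w \<Longrightarrow> cr x (cr (- x) w) = w"
  by (auto simp: cr_def reduced_Cons split: list.split)

lemma red_append_red [simp]: "red (u @ red v) = red (u @ v)"
  by (induct u) (auto simp: red_Cons red_reduced)

lemma red_cr_append: "reduced w \<Longrightarrow> red (cr x w @ v) = cr x (red (w @ v))"
  using cr_cr[of "red (tl w @ v)" x]
  by (cases w) (auto simp: cr_def[of x "[]"] cr_def[of x "_ # _"] red_Cons)

lemma red_red_append [simp]: "red (red u @ v) = red (u @ v)"
  by (induct u) (auto simp: red_Cons red_cr_append)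

lemma mul_assoc: "mul (mul u v) w = mul u (mul v w)"
  by (simp add: mul_def)

lemma mul_Nil_right: "reduced u \<Longrightarrow> mul u [] = u"
  and mul_Nil_left: "reduced u \<Longrightarrow> mul [] u = u"
  by (simp_all add: mul_def red_reduced)

lemma reduced_mul [simp]: "reduced (mul u v)"
  by (simp add: mul_def)

lemma mul_append_reduced: "reduced (u @ v) \<Longrightarrow> mul u v = u @ v"
  by (simp add: mul_def red_reduced)

lemma winv_winv [simp]: "winv (winv w) = w"
  and length_winv [simp]: "length (winv w) = length w"
  and winv_append: "winv (u @ v) = winv v @ winv u"
  and winv_Nil [simp]: "winv [] = []"
  and winv_Cons: "winv (x # v) = winv v @ [- x]"
  and winv_eq_Nil [simp]: "winv w = [] \<longleftrightarrow> w = []"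
  by (simp_all add: winv_def rev_map)

lemma hd_winv: "w \<noteq> [] \<Longrightarrow> hd (winv w) = - last w"
  by (simp add: winv_def hd_rev last_map)

lemma last_winv: "w \<noteq> [] \<Longrightarrow> last (winv w) = - hd w"
  by (simp add: winv_def last_rev hd_map)

lemma reduced_winv [simp]: "reduced (winv w) = reduced w"
proof -
  have "reduced w \<Longrightarrow> reduced (winv w)" for w
    by (induct w) (auto simp: reduced_Cons winv_Cons reduced_append last_winv)
  from this[of w] this[of "winv w"] show ?thesis by auto
qed

lemma mul_winv [simp]: "mul w (winv w) = []"
proof (induct w)
  case (Cons x w)
  have "red (w @ winv w @ [- x]) = red (red (w @ winv w) @ [- x])"
    by (simp del: red_append_red add: red_red_append)
  also have "\<dots> = [- x]" using Cons by (simp add: mul_def red_Cons cr_def)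
  finally show ?case by (simp add: mul_def winv_Cons red_Cons cr_def)
qed (simp add: mul_def)

lemma winv_mul [simp]: "mul (winv w) w = []"
  using mul_winv[of "winv w"] by simp

lemma mul_winv_cancel: "reduced v \<Longrightarrow> mul u (mul (winv u) v) = v"
  and winv_mul_cancel: "reduced v \<Longrightarrow> mul (winv u) (mul u v) = v"
  by (simp_all add: mul_assoc[symmetric] mul_Nil_left)

lemma mul_cancel_right: "reduced v \<Longrightarrow> mul (mul v u) (winv u) = v"
  and mul_cancel_right': "reduced v \<Longrightarrow> mul (mul v (winv u)) u = v"
  by (simp_all add: mul_assoc mul_Nil_right)

section \<open>Cancellation in products of reduced words\<close>

lemma mul_decomp:
  assumes "reduced u" "reduced v"
  obtains p r q where "u = p @ r" "v = winv r @ q" "mul u v = p @ q" "reduced (p @ q)"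
proof -
  have "\<exists>p r q. u = p @ r \<and> v = winv r @ q \<and> mul u v = p @ q \<and> reduced (p @ q)"
    using assms(1)
  proof (induct u)
    case Nil
    then show ?case using assms(2) by (auto simp: mul_Nil_left)
  next
    case (Cons x u)
    then obtain p r q where h: "u = p @ r" "v = winv r @ q" "mul u v = p @ q" "reduced (p @ q)"
      by (auto simp: reduced_Cons)
    have m: "mul (x # u) v = cr x (p @ q)" using h(3) by (simp add: mul_def red_Cons)
    show ?case
    proof (cases "p = [] \<and> q \<noteq> [] \<and> hd q = - x")
      \<comment> \<open>With \<open>p\<close> empty, \<open>x\<close> meets \<open>q\<close>: it
        joins the cancelled block \<open>r\<close>, and \<open>q\<close> loses its first
        letter.\<close>
      case True
      then obtain q' where q': "q = - x # q'" by (cases q) auto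
      show ?thesis
        by (rule exI[of _ "[]"], rule exI[of _ "x # r"], rule exI[of _ q'])
          (use h m True q' in \<open>auto simp: winv_Cons cr_def reduced_Cons\<close>)
    next
      case False
      have "cr x (p @ q) = x # p @ q \<and> reduced (x # p @ q)"
        using False h Cons.prems by (cases p; cases q) (auto simp: cr_def reduced_Cons)
      then show ?thesis
        by (intro exI[of _ "x # p"] exI[of _ r] exI[of _ q]) (use h m in auto)
    qed
  qed
  then show ?thesis using that by blast
qed

lemma length_mul_le: "reduced u \<Longrightarrow> reduced v \<Longrightarrow> length (mul u v) \<le> length u + length v"
  by (rule mul_decomp[of u v]) auto

lemma winv_mul_decomp:
  assumes "reduced x" "reduced y"
  obtains c x' y' where "x = c @ x'" "y = c @ y'" "mul (winv x) y = winv x' @ y'" "reduced (winv x' @ y')"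
proof -
  obtain p r q where h: "winv x = p @ r" "y = winv r @ q" "mul (winv x) y = p @ q" "reduced (p @ q)"
    using mul_decomp[of "winv x" y] assms by auto
  have "x = winv r @ winv p" using h(1) by (metis winv_append winv_winv)
  then show ?thesis using that[of "winv r" "winv p" q] h by auto
qed

text \<open>Geodesics from the identity to two vertices at distance at most \<open>C\<close> share
  all but the last \<open>C\<close> steps, because the reduced word \<open>mul (winv x) y\<close>
  consists of the two unshared ends. The estimates for right translations and for automorphisms rest
  on this.\<close>

lemma take_eq_if_close:
  assumes "reduced x" "reduced y" "length (mul (winv x) y) \<le> C" "k + C \<le> length x"
  shows "take k x = take k y \<and> k \<le> length y"
proof -
  obtain c x' y' where h: "x = c @ x'" "y = c @ y'" "mul (winv x) y = winv x' @ y'"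
    using winv_mul_decomp assms(1,2) by metis
  then have "k \<le> length c" using assms(3,4) by auto
  then show ?thesis using h by simp
qed

lemma mul_snoc:
  assumes "reduced w"
  shows "mul w [a] = (if w \<noteq> [] \<and> last w = - a then butlast w else w @ [a])"
proof (cases "w \<noteq> [] \<and> last w = - a")
  case True
  then obtain v where v: "w = v @ [- a]" by (metis append_butlast_last_id)
  then have "mul w [a] = mul v (mul [- a] [a])" using assms
    by (metis mul_append_reduced mul_assoc)
  also have "mul [- a] [a] = []" by (simp add: mul_def red_Cons cr_def)
  finally show ?thesis using v assms by (simp add: mul_Nil_right reduced_append)
next
  case False
  then show ?thesis using assms by (auto intro!: mul_append_reduced simp: reduced_append equation_minus_iff)
qed

section \<open>The free group\<close>

lemma letters_uminus [simp]: "- a \<in> letters N \<longleftrightarrow> a \<in> letters N"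
  by (simp add: letters_def)

lemma finite_letters [simp]: "finite (letters N)"
  by (rule finite_subset[of _ "{- int N..int N}"]) (auto simp: letters_def)

lemma set_red: "set (red w) \<subseteq> set w"
proof (induct w)
  case (Cons x w)
  have "set (cr x v) \<subseteq> insert x (set v)" for v by (auto simp: cr_def split: list.splits if_splits)
  then show ?case using Cons by (force simp: red_Cons)
qed simp

lemma FN_carrier_reduced: "w \<in> FN_carrier N \<Longrightarrow> reduced w"
  by (simp add: FN_carrier_def)

lemma Nil_FN [simp]: "[] \<in> FN_carrier N"
  by (simp add: FN_carrier_def)

lemma single_FN: "a \<in> letters N \<Longrightarrow> [a] \<in> FN_carrier N"
  by (simp add: FN_carrier_def)

lemma mul_FN [simp, intro]: "u \<in> FN_carrier N \<Longrightarrow> v \<in> FN_carrier N \<Longrightarrow> mul u v \<in> FN_carrier N"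
  using set_red[of "u @ v"] by (auto simp: FN_carrier_def mul_def)

lemma winv_FN [simp, intro]: "u \<in> FN_carrier N \<Longrightarrow> winv u \<in> FN_carrier N"
  unfolding FN_carrier_def by (auto simp: winv_def[of u]) (metis reduced_winv winv_def)

lemma take_FN: "u \<in> FN_carrier N \<Longrightarrow> take k u \<in> FN_carrier N"
  unfolding FN_carrier_def using set_take_subset[of k u] reduced_append[of "take k u" "drop k u"] by auto

lemma append_FN: "u @ v \<in> FN_carrier N \<Longrightarrow> u \<in> FN_carrier N \<and> v \<in> FN_carrier N"
  unfolding FN_carrier_def by (auto simp: reduced_append)

lemma finite_FN_length: "finite {w \<in> FN_carrier N. length w \<le> n}"
  by (rule finite_subset[OF _ finite_lists_length_le[OF finite_letters, of N n]])
    (auto simp: FN_carrier_def)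

lemma FN_simps [simp]: "carrier (FN N) = FN_carrier N" "\<one>\<^bsub>FN N\<^esub> = []" "u \<otimes>\<^bsub>FN N\<^esub> v = mul u v"
  by (simp_all add: FN_def mul_def)

lemma group_FN: "group (FN N)"
proof (rule groupI)
  fix x assume "x \<in> carrier (FN N)"
  then show "\<exists>y\<in>carrier (FN N). y \<otimes>\<^bsub>FN N\<^esub> x = \<one>\<^bsub>FN N\<^esub>"
    by (intro bexI[of _ "winv x"]) auto
qed (auto simp: mul_assoc mul_Nil_left FN_carrier_reduced)

interpretation FN: group "FN N" for N by (rule group_FN)

lemma inv_FN [simp]: "g \<in> FN_carrier N \<Longrightarrow> inv\<^bsub>FN N\<^esub> g = winv g"
  by (rule FN.inv_equality) auto

lemma winv_mul_distrib: "u \<in> FN_carrier N \<Longrightarrow> v \<in> FN_carrier N \<Longrightarrow> winv (mul u v) = mul (winv v) (winv u)"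
  using FN.inv_mult_group[of u N v] by simp

lemma mul_left_inj: "u \<in> FN_carrier N \<Longrightarrow> v \<in> FN_carrier N \<Longrightarrow> w \<in> FN_carrier N \<Longrightarrow> mul u v = mul u w \<longleftrightarrow> v = w"
  by (metis FN_carrier_reduced winv_mul_cancel)

lemma mul_right_inj: "u \<in> FN_carrier N \<Longrightarrow> v \<in> FN_carrier N \<Longrightarrow> w \<in> FN_carrier N \<Longrightarrow> mul v u = mul w u \<longleftrightarrow> v = w"
  by (metis FN_carrier_reduced mul_cancel_right)

lemma subgroup_FN_iff: "subgroup H (FN N) \<longleftrightarrow>
  H \<subseteq> FN_carrier N \<and> [] \<in> H \<and> (\<forall>u\<in>H. \<forall>v\<in>H. mul u v \<in> H) \<and> (\<forall>u\<in>H. winv u \<in> H)"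
proof
  assume "subgroup H (FN N)"
  then interpret subgroup H "FN N" .
  have "winv u \<in> H" if "u \<in> H" for u using m_inv_closed[OF that] inv_FN[of u N] that subset by (metis FN_simps(1) subsetD)
  then show "H \<subseteq> FN_carrier N \<and> [] \<in> H \<and> (\<forall>u\<in>H. \<forall>v\<in>H. mul u v \<in> H) \<and> (\<forall>u\<in>H. winv u \<in> H)"
    using subset m_closed one_closed by auto
next
  assume h: "H \<subseteq> FN_carrier N \<and> [] \<in> H \<and> (\<forall>u\<in>H. \<forall>v\<in>H. mul u v \<in> H) \<and> (\<forall>u\<in>H. winv u \<in> H)"
  show "subgroup H (FN N)"
    by (rule FN.subgroupI) (use h in \<open>auto simp: subset_iff\<close>)
qed

lemma conjg_eq: "g \<in> FN_carrier N \<Longrightarrow> conjg N g H = (\<lambda>h. mul (mul g h) (winv g)) ` H"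
  by (simp add: conjg_def)

lemma mem_conjg:
  assumes "g \<in> FN_carrier N" "H \<subseteq> FN_carrier N"
  shows "x \<in> conjg N g H \<longleftrightarrow> x \<in> FN_carrier N \<and> mul (winv g) (mul x g) \<in> H"
proof
  assume "x \<in> conjg N g H"
  then obtain h where h: "h \<in> H" "x = mul (mul g h) (winv g)" using assms by (auto simp: conjg_eq)
  then have "mul (winv g) (mul x g) = h" using assms
    by (auto simp: mul_assoc mul_cancel_right' winv_mul_cancel mul_Nil_right FN_carrier_reduced subset_iff)
  then show "x \<in> FN_carrier N \<and> mul (winv g) (mul x g) \<in> H" using h assms by auto
next
  assume x: "x \<in> FN_carrier N \<and> mul (winv g) (mul x g) \<in> H"
  have "mul (mul g (mul (winv g) (mul x g))) (winv g) = x"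
    using x FN_carrier_reduced[of x N] by (simp add: mul_winv_cancel mul_cancel_right)
  then show "x \<in> conjg N g H" using x assms by (metis (no_types, lifting) conjg_eq image_eqI)
qed

lemma subgroup_conjg:
  assumes "g \<in> FN_carrier N" "subgroup H (FN N)"
  shows "subgroup (conjg N g H) (FN N)"
proof -
  note H = assms(2)[unfolded subgroup_FN_iff]
  have "mul (winv g) (mul (mul u v) g) = mul (mul (winv g) (mul u g)) (mul (winv g) (mul v g))"
    if "u \<in> FN_carrier N" "v \<in> FN_carrier N" for u v
    using that assms by (simp add: mul_assoc mul_winv_cancel FN_carrier_reduced)
  moreover have "mul (winv g) (mul (winv u) g) = winv (mul (winv g) (mul u g))" if "u \<in> FN_carrier N" for u
    using that assms(1) by (simp add: winv_mul_distrib[of _ N] mul_assoc)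
  ultimately show ?thesis
    using H assms(1) by (auto simp: subgroup_FN_iff mem_conjg mul_Nil_left FN_carrier_reduced)
qed

lemma conjg_conjg:
  assumes "g \<in> FN_carrier N" "k \<in> FN_carrier N" "H \<subseteq> FN_carrier N"
  shows "conjg N g (conjg N k H) = conjg N (mul g k) H"
  using assms unfolding conjg_eq[OF assms(1)] conjg_eq[OF assms(2)] conjg_eq[OF mul_FN[OF assms(1,2)]]
  by (simp add: image_image mul_assoc winv_mul_distrib[of _ N])

lemma conjg_Nil:
  assumes "H \<subseteq> FN_carrier N"
  shows "conjg N [] H = H"
proof -
  have "reduced h" if "h \<in> H" for h using that assms by (auto dest: FN_carrier_reduced)
  then show ?thesis by (simp add: conjg_eq mul_Nil_left mul_Nil_right)
qed

lemma conjg_sub: "g \<in> FN_carrier N \<Longrightarrow> H \<subseteq> FN_carrier N \<Longrightarrow> conjg N g H \<subseteq> FN_carrier N"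
  by (auto simp: mem_conjg)

text \<open>Opposite end letters are stripped off as long as possible. The integer 0 equals its own
  negative, so it is excluded to keep a single letter from counting as its own inverse.\<close>

lemma cyclic_reduction:
  assumes "reduced h" "h \<noteq> []" "0 \<notin> set h"
  obtains u c where "h = u @ c @ winv u" "c \<noteq> []" "hd c \<noteq> - last c"
proof -
  have "\<exists>u c. h = u @ c @ winv u \<and> c \<noteq> [] \<and> hd c \<noteq> - last c"
    using assms
  proof (induct "length h" arbitrary: h rule: less_induct)
    case less
    show ?case
    proof (cases "hd h = - last h")
      case False
      then show ?thesis using less by (intro exI[of _ "[]"] exI[of _ h]) auto
    next
      case True
      obtain x w where xw: "h = x # w" using less by (cases h) auto
      show ?thesis
      proof (cases "w = []")
        case True
        have "x \<noteq> - x" using less.prems xw by auto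
        then show ?thesis using xw True by (intro exI[of _ "[]"] exI[of _ h]) auto
      next
        case False
        then obtain v where v: "h = x # v @ [- x]" using xw True
          by (metis append_butlast_last_id last_ConsR list.sel(1) minus_minus)
        have "v \<noteq> []" using v less by (auto simp: reduced_Cons)
        moreover have "reduced v" using v less by (auto simp: reduced_Cons reduced_append)
        moreover have "0 \<notin> set v" using v less by auto
        ultimately obtain u c where "v = u @ c @ winv u \<and> c \<noteq> [] \<and> hd c \<noteq> - last c"
          using less.hyps[of v] v by auto
        then show ?thesis using v by (intro exI[of _ "x # u"] exI[of _ c]) (auto simp: winv_Cons)
      qed
    qed
  qed
  then show ?thesis using that by blast
qed

section \<open>The boundary and hulls\<close>

definition lact :: "int \<Rightarrow> (nat \<Rightarrow> int) \<Rightarrow> (nat \<Rightarrow> int)" where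
  "lact a \<xi> = (if \<xi> 0 = - a then (\<lambda>n. \<xi> (Suc n)) else case_nat a \<xi>)"

text \<open>Composing one-letter maps avoids the maximal cancellation length in \<open>bact\<close>;
  the action laws are then inherited from \<open>cr\<close>. \<open>bact_eq_act\<close> identifies
  the two.\<close>

definition act :: "int list \<Rightarrow> (nat \<Rightarrow> int) \<Rightarrow> (nat \<Rightarrow> int)" where
  "act g \<xi> = foldr lact g \<xi>"

definition conc :: "int list \<Rightarrow> (nat \<Rightarrow> int) \<Rightarrow> (nat \<Rightarrow> int)" where
  "conc w \<xi> = (\<lambda>n. if n < length w then w ! n else \<xi> (n - length w))"

lemma act_Nil [simp]: "act [] \<xi> = \<xi>"
  and act_Cons: "act (a # g) \<xi> = lact a (act g \<xi>)"
  and act_append: "act (u @ v) \<xi> = act u (act v \<xi>)"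
  by (simp_all add: act_def)

lemma conc_Nil [simp]: "conc [] \<xi> = \<xi>"
  by (simp add: conc_def)

lemma conc_Cons: "conc (a # w) \<xi> = case_nat a (conc w \<xi>)"
  by (auto simp: conc_def fun_eq_iff split: nat.split)

lemma length_pre [simp]: "length (pre \<xi> k) = k"
  and nth_pre [simp]: "i < k \<Longrightarrow> pre \<xi> k ! i = \<xi> i"
  and pre_Suc: "pre \<xi> (Suc k) = pre \<xi> k @ [\<xi> k]"
  and pre_0 [simp]: "pre \<xi> 0 = []"
  by (simp_all add: pre_def)

lemma pre_eq_Nil [simp]: "pre \<xi> k = [] \<longleftrightarrow> k = 0"
  by (metis length_0_conv length_pre)

lemma pre_Suc_Cons: "pre \<xi> (Suc k) = \<xi> 0 # pre (\<lambda>n. \<xi> (Suc n)) k"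
  by (rule nth_equalityI) (auto simp: nth_Cons split: nat.split)

lemma take_pre: "take k (pre \<xi> n) = pre \<xi> (min k n)"
  by (rule nth_equalityI) auto

lemma pre_eq_iff: "pre \<xi> n = pre \<eta> n \<longleftrightarrow> (\<forall>i<n. \<xi> i = \<eta> i)"
  by (auto simp: list_eq_iff_nth_eq)

lemma pre_eq_mono: "pre \<xi> n = pre \<eta> n \<Longrightarrow> k \<le> n \<Longrightarrow> pre \<xi> k = pre \<eta> k"
  by (auto simp: pre_eq_iff)

lemma ext_pre: "(\<And>n. pre \<xi> n = pre \<eta> n) \<Longrightarrow> \<xi> = \<eta>"
  by (rule ext) (metis lessI nth_pre)

lemma pre_conc: "k \<le> length w \<Longrightarrow> pre (conc w \<xi>) k = take k w"
  by (rule nth_equalityI) (auto simp: conc_def)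

lemma bd_reduced: "\<xi> \<in> bd N \<Longrightarrow> \<xi> (Suc n) \<noteq> - \<xi> n"
  by (simp add: bd_def)

lemma pre_FN: "\<xi> \<in> bd N \<Longrightarrow> pre \<xi> n \<in> FN_carrier N"
  by (auto simp: FN_carrier_def reduced_def pre_def bd_def)

lemma shift_bd: "\<xi> \<in> bd N \<Longrightarrow> (\<lambda>i. \<xi> (i + n)) \<in> bd N"
  by (auto simp: bd_def)

lemma lact_bd:
  assumes "a \<in> letters N" "\<xi> \<in> bd N"
  shows "lact a \<xi> \<in> bd N"
  using assms by (auto simp: lact_def bd_def split: nat.split)

lemma lact_cancel: "\<xi> \<in> bd N \<Longrightarrow> lact a (lact (- a) \<xi>) = \<xi>"
  using bd_reduced[of \<xi> N 0] by (auto simp: lact_def fun_eq_iff split: nat.split)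

lemma act_bd': "set g \<subseteq> letters N \<Longrightarrow> \<xi> \<in> bd N \<Longrightarrow> act g \<xi> \<in> bd N"
  by (induct g) (auto simp: act_Cons lact_bd)

lemma act_bd [simp, intro]: "g \<in> FN_carrier N \<Longrightarrow> \<xi> \<in> bd N \<Longrightarrow> act g \<xi> \<in> bd N"
  by (rule act_bd') (auto simp: FN_carrier_def)

lemma act_cr:
  assumes "set w \<subseteq> letters N" "\<xi> \<in> bd N"
  shows "act (cr a w) \<xi> = lact a (act w \<xi>)"
proof (cases "w \<noteq> [] \<and> hd w = - a")
  case True
  then obtain v where v: "w = - a # v" by (cases w) auto
  have "act v \<xi> \<in> bd N" using assms v by (auto intro: act_bd')
  then show ?thesis using v by (simp add: cr_def act_Cons lact_cancel)
next
  case False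
  then have "cr a w = a # w" by (cases w) (auto simp: cr_def)
  then show ?thesis by (simp add: act_Cons)
qed

lemma act_red: "set w \<subseteq> letters N \<Longrightarrow> \<xi> \<in> bd N \<Longrightarrow> act (red w) \<xi> = act w \<xi>"
proof (induct w)
  case (Cons a w)
  then have "set (red w) \<subseteq> letters N" using set_red[of w] by auto
  then show ?case using Cons by (simp add: red_Cons act_cr act_Cons)
qed simp

lemma act_mul: "u \<in> FN_carrier N \<Longrightarrow> v \<in> FN_carrier N \<Longrightarrow> \<xi> \<in> bd N \<Longrightarrow> act (mul u v) \<xi> = act u (act v \<xi>)"
  unfolding mul_def act_append[symmetric] by (rule act_red) (auto simp: FN_carrier_def)

lemma act_winv: "u \<in> FN_carrier N \<Longrightarrow> \<xi> \<in> bd N \<Longrightarrow> act (winv u) (act u \<xi>) = \<xi>"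
  and act_winv': "u \<in> FN_carrier N \<Longrightarrow> \<xi> \<in> bd N \<Longrightarrow> act u (act (winv u) \<xi>) = \<xi>"
  using act_mul[of "winv u" N u \<xi>] act_mul[of u N "winv u" \<xi>] by simp_all

lemma act_conc: "reduced w \<Longrightarrow> w = [] \<or> \<xi> 0 \<noteq> - last w \<Longrightarrow> act w \<xi> = conc w \<xi>"
proof (induct w)
  case (Cons a w)
  have "conc w \<xi> 0 \<noteq> - a" using Cons.prems by (cases w) (auto simp: reduced_Cons conc_def)
  moreover have "act w \<xi> = conc w \<xi>" using Cons by (auto simp: reduced_Cons split: if_splits)
  ultimately show ?case by (simp add: act_Cons conc_Cons lact_def)
qed simp

text \<open>The cancelled block is a final segment of \<open>g\<close>, so putting a letter in front
  keeps its length \<open>c\<close>, unless all of \<open>g\<close> cancels and the next letter of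
  \<xi> cancels the new one as well.\<close>

lemma bact_eq_act:
  assumes "reduced g"
  shows "bact g \<xi> = act g \<xi>"
proof -
  define P where "P = (\<lambda>g k. k \<le> length g \<and> (\<forall>i<k. \<xi> i = - (g ! (length g - 1 - i))))"
  define c where "c = (\<lambda>g. GREATEST k. P g k)"
  have P0: "P g 0" for g by (simp add: P_def)
  have cP: "P g (c g)" for g
    unfolding c_def by (rule GreatestI_nat[where P="P g" and k=0 and b="length g"]) (auto simp: P_def)
  have cmax: "P g k \<Longrightarrow> k \<le> c g" for g k
    unfolding c_def by (rule Greatest_le_nat[where P="P g" and b="length g"]) (auto simp: P_def)
  have b: "bact g \<xi> = (\<lambda>n. if n < length g - c g then g ! n else \<xi> (n - (length g - c g) + c g))" for g
    unfolding bact_def c_def P_def Let_def by simp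
  have Pm: "P g k \<Longrightarrow> j \<le> k \<Longrightarrow> P g j" for g k j by (auto simp: P_def)
  have PC: "P (a # g) k \<longleftrightarrow> P g k" if "k \<le> length g" for a g k
    using that by (auto simp: P_def nth_Cons')
  show ?thesis using assms
  proof (induct g)
    case Nil
    have "c [] = 0" using cP[of "[]"] by (simp add: P_def)
    then show ?case by (simp add: b)
  next
    case (Cons a g)
    then have IH: "bact g \<xi> = act g \<xi>" and r: "g = [] \<or> hd g \<noteq> - a" by (auto simp: reduced_Cons)
    have cl: "c g \<le> length g" "c (a # g) \<le> Suc (length g)" using cP[of g] cP[of "a # g"] by (auto simp: P_def)
    show ?case
    proof (cases "c g = length g \<and> \<xi> (length g) = - a")
      case True
      have "P (a # g) (Suc (length g))" using cP[of g] True
        by (auto simp: P_def nth_Cons' less_Suc_eq)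
      then have c': "c (a # g) = Suc (length g)" using cmax cl(2) by force
      have "bact g \<xi> = (\<lambda>n. \<xi> (n + length g))" using True by (simp add: b)
      then show ?thesis using c' True by (simp add: b[of "a # g"] act_Cons IH[symmetric] lact_def)
    next
      case False
      have nP: "\<not> P (a # g) (Suc (length g))"
      proof
        assume p: "P (a # g) (Suc (length g))"
        then have "P g (length g)" using PC[of "length g" g a] Pm[of "a # g" "Suc (length g)" "length g"] by simp
        then have "c g = length g" using cmax cl(1) by (simp add: le_antisym)
        moreover have "\<xi> (length g) = - a" using p by (auto simp: P_def)
        ultimately show False using False by simp
      qed
      have "c (a # g) \<le> length g" using cP[of "a # g"] nP cl(2) by (metis le_SucE)
      then have c': "c (a # g) = c g"
        using PC[OF cl(1), of a] PC[of "c (a # g)" g a] cP[of g] cP[of "a # g"] cmax[of g] cmax[of "a # g"]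
        by (intro le_antisym) auto
      have "bact g \<xi> 0 \<noteq> - a"
      proof (cases "c g = length g")
        case True
        then show ?thesis using False by (simp add: b)
      next
        case False
        then have "g \<noteq> []" "0 < length g - c g" using cl by auto
        then show ?thesis using r by (simp add: b hd_conv_nth)
      qed
      then have "act (a # g) \<xi> = case_nat a (bact g \<xi>)" by (simp add: act_Cons IH lact_def)
      also have "\<dots> = bact (a # g) \<xi>"
      proof
        fix n
        show "(case n of 0 \<Rightarrow> a | Suc m \<Rightarrow> bact g \<xi> m) = bact (a # g) \<xi> n"
          using cl(1) by (cases n) (auto simp: b[of "a # g"] b[of g] c' Suc_diff_le)
      qed
      finally show ?thesis by simp
    qed
  qed
qed

lemma act_winv_pre: "\<xi> \<in> bd N \<Longrightarrow> act (winv (pre \<xi> n)) \<xi> = (\<lambda>i. \<xi> (i + n))"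
proof (induct n)
  case (Suc n)
  have "act (winv (pre \<xi> (Suc n))) \<xi> = lact (- \<xi> n) (\<lambda>i. \<xi> (i + n))"
    using Suc by (simp add: pre_Suc winv_append winv_Cons act_append act_Cons)
  then show ?case by (simp add: lact_def)
qed simp

lemma act_pre_shift: "\<xi> \<in> bd N \<Longrightarrow> act (pre \<xi> n) (\<lambda>i. \<xi> (i + n)) = \<xi>"
  using act_winv_pre[of \<xi> N n] act_winv'[of "pre \<xi> n" N \<xi>] pre_FN[of \<xi> N n] by simp

text \<open>At most \<open>length g\<close> letters of the ray cancel, so that many extra letters of
  \<xi> fix \<open>k\<close> letters of the image; hence the modulus of continuity in
  \<open>act_modulus\<close>.\<close>

lemma pre_act:
  assumes "g \<in> FN_carrier N" "\<xi> \<in> bd N" "k + length g \<le> n"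
  shows "pre (act g \<xi>) k = take k (mul g (pre \<xi> n)) \<and> k \<le> length (mul g (pre \<xi> n))"
proof (cases "k = 0")
  case False
  obtain p r q where h: "g = p @ r" "pre \<xi> n = winv r @ q" "mul g (pre \<xi> n) = p @ q" "reduced (p @ q)"
    using mul_decomp[of g "pre \<xi> n"] assms FN_carrier_reduced pre_FN by metis
  have "n = length r + length q" using h(2) by (metis length_append length_pre length_winv)
  then have q: "k \<le> length q" using h(1) assms(3) by auto
  have "q \<noteq> []" using q False by auto
  then have n0: "n \<noteq> 0" using \<open>n = _\<close> by auto
  then have "last (pre \<xi> n) = \<xi> (n - 1)" by (cases n) (auto simp: pre_Suc)
  then have l: "last (p @ q) = \<xi> (n - 1)" using h(2) \<open>q \<noteq> []\<close> by simp
  have "act g \<xi> = act (mul g (pre \<xi> n)) (\<lambda>i. \<xi> (i + n))"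
    using act_mul[OF assms(1) pre_FN[OF assms(2)] shift_bd[OF assms(2)]] act_pre_shift[OF assms(2)] by simp
  also have "\<dots> = conc (p @ q) (\<lambda>i. \<xi> (i + n))"
    unfolding h(3) using h(4) l bd_reduced[OF assms(2), of "n - 1"] n0
    by (intro act_conc) auto
  finally show ?thesis using q by (simp add: pre_conc h(3))
qed simp

lemma act_modulus:
  assumes "g \<in> FN_carrier N" "\<xi> \<in> bd N" "\<eta> \<in> bd N" "pre \<xi> (k + length g) = pre \<eta> (k + length g)"
  shows "pre (act g \<xi>) k = pre (act g \<eta>) k"
  using assms pre_act[of g N \<xi> k "k + length g"] pre_act[of g N \<eta> k "k + length g"] by simp

text \<open>The first letter of the ray from the vertex \<open>g\<close> to \<open>\<xi>\<close>; the convex hull of \<open>S\<close> consists of the vertices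
  with at least two such directions towards \<open>S\<close>.\<close>
definition dir :: "int list \<Rightarrow> (nat \<Rightarrow> int) \<Rightarrow> int" where
  "dir g \<xi> = act (winv g) \<xi> 0"

lemma dir_Nil [simp]: "dir [] \<xi> = \<xi> 0"
  by (simp add: dir_def)

lemma dir_prefix: "\<xi> \<in> bd N \<Longrightarrow> dir (pre \<xi> n) \<xi> = \<xi> n"
  by (simp add: dir_def act_winv_pre)

text \<open>A vertex off the ray from the identity to \<xi> can reach \<xi> only by going back
  towards the identity first, as far as the branch point at position \<open>k\<close>.\<close>

lemma dir_not_prefix:
  assumes "g \<in> FN_carrier N" "\<xi> \<in> bd N" "pre \<xi> (length g) \<noteq> g"
  shows "dir g \<xi> = - last g"
proof -
  define k where "k = (LEAST i. i < length g \<and> \<xi> i \<noteq> g ! i)"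
  have "\<exists>i. i < length g \<and> \<xi> i \<noteq> g ! i"
    using assms(3) by (auto simp: list_eq_iff_nth_eq)
  then have k: "k < length g" "\<xi> k \<noteq> g ! k"
    unfolding k_def using LeastI_ex[of "\<lambda>i. i < length g \<and> \<xi> i \<noteq> g ! i"] by blast+
  have km: "\<xi> i = g ! i" if "i < k" for i
    using not_less_Least[of i "\<lambda>i. i < length g \<and> \<xi> i \<noteq> g ! i"] that k(1) unfolding k_def by auto
  have pk: "take k g = pre \<xi> k" using k(1) km by (auto simp: list_eq_iff_nth_eq)
  define v where "v = drop k g"
  have g: "g = pre \<xi> k @ v" using pk unfolding v_def by (metis append_take_drop_id)
  have v: "v \<noteq> []" "hd v = g ! k" using k(1) by (auto simp: v_def hd_drop_conv_nth)
  have "reduced v" using assms(1) g by (metis append_FN FN_carrier_reduced)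
  have "act (winv g) \<xi> = act (winv v) (\<lambda>i. \<xi> (i + k))"
    by (subst g) (simp add: winv_append act_append act_winv_pre[OF assms(2)])
  also have "\<dots> = conc (winv v) (\<lambda>i. \<xi> (i + k))"
    using \<open>reduced v\<close> v k(2) by (intro act_conc) (auto simp: last_winv)
  finally have "dir g \<xi> = hd (winv v)" using v by (simp add: dir_def conc_def hd_conv_nth)
  then show ?thesis using v g by (simp add: hd_winv)
qed

lemma dir_act:
  assumes "g \<in> FN_carrier N" "x \<in> FN_carrier N" "\<xi> \<in> bd N"
  shows "dir (mul g x) (act g \<xi>) = dir x \<xi>"
  using assms unfolding dir_def
  by (simp add: winv_mul_distrib[of _ N] act_mul[of _ N] act_winv[of _ N])

section \<open>Convex hulls in the Cayley tree\<close>

definition chull :: "nat \<Rightarrow> (nat \<Rightarrow> int) set \<Rightarrow> int list set" where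
  "chull N S = {g \<in> FN_carrier N. \<exists>\<xi>\<in>S. \<exists>\<eta>\<in>S. dir g \<xi> \<noteq> dir g \<eta>}"

definition Pref :: "(nat \<Rightarrow> int) set \<Rightarrow> int list set" where
  "Pref S = {pre \<xi> n |\<xi> n. \<xi> \<in> S}"

lemma mem_Pref: "w \<in> Pref S \<longleftrightarrow> (\<exists>\<xi>\<in>S. pre \<xi> (length w) = w)"
proof
  assume "w \<in> Pref S"
  then show "\<exists>\<xi>\<in>S. pre \<xi> (length w) = w" by (auto simp: Pref_def)
next
  assume "\<exists>\<xi>\<in>S. pre \<xi> (length w) = w"
  then obtain \<xi> where "\<xi> \<in> S" "w = pre \<xi> (length w)" by auto
  then show "w \<in> Pref S" unfolding Pref_def by blast
qed

lemma chull_FN: "chull N S \<subseteq> FN_carrier N"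
  by (auto simp: chull_def)

lemma chull_mono: "S \<subseteq> S' \<Longrightarrow> chull N S \<subseteq> chull N S'"
  by (auto simp: chull_def)

lemma Nil_chull: "[] \<in> chull N S \<longleftrightarrow> (\<exists>\<xi>\<in>S. \<exists>\<eta>\<in>S. \<xi> 0 \<noteq> \<eta> 0)"
  by (simp add: chull_def)

lemma act_image_act: "u \<in> FN_carrier N \<Longrightarrow> v \<in> FN_carrier N \<Longrightarrow> S \<subseteq> bd N \<Longrightarrow> act u ` act v ` S = act (mul u v) ` S"
  unfolding image_image by (intro image_cong refl) (auto simp: act_mul[of _ N])

lemma act_image_bd: "g \<in> FN_carrier N \<Longrightarrow> S \<subseteq> bd N \<Longrightarrow> act g ` S \<subseteq> bd N"
  by auto

lemma act_image_winv: "g \<in> FN_carrier N \<Longrightarrow> S \<subseteq> bd N \<Longrightarrow> act (winv g) ` act g ` S = S"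
  and act_image_winv': "g \<in> FN_carrier N \<Longrightarrow> S \<subseteq> bd N \<Longrightarrow> act g ` act (winv g) ` S = S"
  unfolding image_image by (auto simp: act_winv[of _ N] act_winv'[of _ N] subset_iff image_iff)

lemma mem_chull_act:
  assumes "g \<in> FN_carrier N" "x \<in> FN_carrier N" "S \<subseteq> bd N"
  shows "x \<in> chull N (act g ` S) \<longleftrightarrow> mul (winv g) x \<in> chull N S"
proof -
  have "dir x (act g \<xi>) = dir (mul (winv g) x) \<xi>" if "\<xi> \<in> S" for \<xi>
    using dir_act[OF assms(1), of "mul (winv g) x" \<xi>] assms that
    by (auto simp: mul_winv_cancel FN_carrier_reduced)
  then show ?thesis using assms by (simp add: chull_def)
qed

lemma chull_act:
  assumes "g \<in> FN_carrier N" "S \<subseteq> bd N"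
  shows "chull N (act g ` S) = mul g ` chull N S"
proof (intro equalityI subsetI)
  fix x assume x: "x \<in> chull N (act g ` S)"
  then have xF: "x \<in> FN_carrier N" using chull_FN by auto
  then have "mul (winv g) x \<in> chull N S" using x mem_chull_act assms by auto
  then show "x \<in> mul g ` chull N S"
    using xF by (metis FN_carrier_reduced image_eqI mul_winv_cancel)
next
  fix x assume "x \<in> mul g ` chull N S"
  then obtain y where y: "y \<in> chull N S" "x = mul g y" by auto
  then have yF: "y \<in> FN_carrier N" using chull_FN by auto
  show "x \<in> chull N (act g ` S)"
    using y yF assms by (simp add: mem_chull_act winv_mul_cancel FN_carrier_reduced)
qed

text \<open>If \<open>g\<close> is a prefix of no point of \<open>S\<close>, then all points of
  \<open>S\<close> lie in the single direction back to the identity, so \<open>g\<close> is outside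
  the hull.\<close>

lemma chull_sub_Pref:
  assumes "S \<subseteq> bd N"
  shows "chull N S \<subseteq> Pref S"
proof
  fix g assume "g \<in> chull N S"
  then obtain \<xi> \<eta> where h: "g \<in> FN_carrier N" "\<xi> \<in> S" "\<eta> \<in> S" "dir g \<xi> \<noteq> dir g \<eta>" by (auto simp: chull_def)
  then have "pre \<xi> (length g) = g \<or> pre \<eta> (length g) = g"
    using dir_not_prefix[of g N] assms by (metis subsetD)
  then show "g \<in> Pref S" using h unfolding mem_Pref by blast
qed

text \<open>With the identity in the hull, every \<xi> in \<open>S\<close> has a companion \<eta>
  with another first letter. Seen from a nonempty prefix of \<xi>, the companion lies behind and
  \<xi> ahead. Thus hulls through the identity can be read off from prefixes.\<close>

lemma chull_eq_Pref:
  assumes "S \<subseteq> bd N" "[] \<in> chull N S"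
  shows "chull N S = Pref S"
proof (intro equalityI chull_sub_Pref[OF assms(1)] subsetI)
  fix g assume "g \<in> Pref S"
  then obtain \<xi> n where g: "\<xi> \<in> S" "g = pre \<xi> n" by (auto simp: Pref_def)
  have \<xi>: "\<xi> \<in> bd N" using g assms by auto
  show "g \<in> chull N S"
  proof (cases n)
    case 0
    then show ?thesis using g assms(2) by simp
  next
    case (Suc m)
    obtain \<eta> where \<eta>: "\<eta> \<in> S" "\<eta> 0 \<noteq> \<xi> 0"
    proof -
      obtain \<alpha> \<beta> where "\<alpha> \<in> S" "\<beta> \<in> S" "\<alpha> 0 \<noteq> \<beta> 0" using assms(2) by (auto simp: Nil_chull)
      then show ?thesis using that by (cases "\<alpha> 0 = \<xi> 0") auto
    qed
    have "pre \<eta> (length g) \<noteq> g" using \<eta> g Suc by (auto simp: pre_eq_iff)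
    then have "dir g \<eta> = - last g" using dir_not_prefix[of g N \<eta>] pre_FN[OF \<xi>] g \<eta> assms(1) by auto
    moreover have "dir g \<xi> = \<xi> n" using g dir_prefix[OF \<xi>] by simp
    moreover have "last g = \<xi> m" using g Suc by (simp add: pre_Suc)
    ultimately have "dir g \<eta> \<noteq> dir g \<xi>" using bd_reduced[OF \<xi>, of m] Suc by simp
    then show ?thesis using g \<eta> pre_FN[OF \<xi>] by (auto simp: chull_def)
  qed
qed

lemma Pref_prefix_closed: "w \<in> Pref S \<Longrightarrow> take k w \<in> Pref S"
  unfolding Pref_def by (smt (verit) mem_Collect_eq take_pre)

lemma Pref_FN: "S \<subseteq> bd N \<Longrightarrow> Pref S \<subseteq> FN_carrier N"
  by (auto simp: Pref_def pre_FN)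

lemma chull_nonempty:
  assumes "S \<subseteq> bd N" "\<xi> \<in> S" "\<eta> \<in> S" "\<xi> \<noteq> \<eta>"
  obtains n where "pre \<xi> n \<in> chull N S" "pre \<xi> n = pre \<eta> n" "\<xi> n \<noteq> \<eta> n"
proof -
  define n where "n = (LEAST n. \<xi> n \<noteq> \<eta> n)"
  have "\<exists>n. \<xi> n \<noteq> \<eta> n" using assms by auto
  then have n: "\<xi> n \<noteq> \<eta> n" "\<And>i. i < n \<Longrightarrow> \<xi> i = \<eta> i"
    unfolding n_def using LeastI_ex[of "\<lambda>n. \<xi> n \<noteq> \<eta> n"] by (auto dest: not_less_Least)
  then have p: "pre \<xi> n = pre \<eta> n" by (simp add: pre_eq_iff)
  have "dir (pre \<xi> n) \<xi> \<noteq> dir (pre \<xi> n) \<eta>"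
    using n p dir_prefix[of \<xi> N n] dir_prefix[of \<eta> N n] assms(1-3) by (metis subsetD)
  then have "pre \<xi> n \<in> chull N S" using assms pre_FN[of \<xi> N n] by (auto simp: chull_def)
  then show ?thesis using that p n by blast
qed

section \<open>Limit sets\<close>

definition agrees :: "nat \<Rightarrow> int list \<Rightarrow> (nat \<Rightarrow> int) \<Rightarrow> bool" where
  "agrees k w \<xi> \<longleftrightarrow> k \<le> length w \<and> take k w = pre \<xi> k"

lemma agrees_mono: "agrees n w \<xi> \<Longrightarrow> k \<le> n \<Longrightarrow> agrees k w \<xi>"
  unfolding agrees_def by (metis le_trans min.absorb1 take_pre take_take)

lemma le_cpl_iff: "k \<le> cpl w \<xi> \<longleftrightarrow> agrees k w \<xi>"
proof -
  have P: "agrees (cpl w \<xi>) w \<xi>" unfolding cpl_def agrees_def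
    by (rule GreatestI_nat[where k=0 and b="length w"]) auto
  have "agrees k w \<xi> \<Longrightarrow> k \<le> cpl w \<xi>" unfolding cpl_def agrees_def
    by (rule Greatest_le_nat[where b="length w"]) auto
  then show ?thesis using P agrees_mono by blast
qed

lemma conv_bd_iff: "conv_bd s \<xi> \<longleftrightarrow> (\<forall>k. \<forall>\<^sub>F n in sequentially. agrees k (s n) \<xi>)"
  unfolding conv_bd_def filterlim_at_top le_cpl_iff ..

lemma mem_limset: "\<xi> \<in> limset N H \<longleftrightarrow> \<xi> \<in> bd N \<and> (\<forall>k. \<exists>h\<in>H. agrees k h \<xi>)"
proof
  assume "\<xi> \<in> limset N H"
  then obtain s where "\<xi> \<in> bd N" "\<forall>n. s n \<in> H" "conv_bd s \<xi>" by (auto simp: limset_def)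
  then show "\<xi> \<in> bd N \<and> (\<forall>k. \<exists>h\<in>H. agrees k h \<xi>)"
    unfolding conv_bd_iff by (metis eventually_sequentially order_refl)
next
  assume h: "\<xi> \<in> bd N \<and> (\<forall>k. \<exists>h\<in>H. agrees k h \<xi>)"
  then obtain s where s: "\<And>k. s k \<in> H \<and> agrees k (s k) \<xi>" by metis
  have "conv_bd s \<xi>" unfolding conv_bd_iff eventually_sequentially
    using s agrees_mono by blast
  then show "\<xi> \<in> limset N H" using h s by (auto simp: limset_def)
qed

lemma limset_bd: "limset N H \<subseteq> bd N"
  by (auto simp: limset_def)

lemma limset_mono: "H \<subseteq> K \<Longrightarrow> limset N H \<subseteq> limset N K"
  by (auto simp: mem_limset) blast

lemma limset_closed:
  assumes "\<xi> \<in> bd N" "\<And>n. \<exists>\<eta>\<in>limset N H. pre \<eta> n = pre \<xi> n"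
  shows "\<xi> \<in> limset N H"
proof -
  have "\<exists>h\<in>H. agrees k h \<xi>" for k
  proof -
    obtain \<eta> where \<eta>: "\<eta> \<in> limset N H" "pre \<eta> k = pre \<xi> k" using assms(2) by blast
    then obtain h where "h \<in> H" "agrees k h \<eta>" unfolding mem_limset by blast
    then show ?thesis using \<eta> by (auto simp: agrees_def)
  qed
  then show ?thesis using assms(1) by (simp add: mem_limset)
qed

lemma agrees_all_bd:
  assumes "\<And>k. \<exists>w\<in>FN_carrier N. agrees k w \<xi>"
  shows "\<xi> \<in> bd N"
proof -
  have p: "pre \<xi> k \<in> FN_carrier N" for k 
  proof -
    obtain w where "w \<in> FN_carrier N" "take k w = pre \<xi> k" using assms[of k] by (auto simp: agrees_def)
    then show ?thesis using take_FN[of w N k] by simp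
  qed
  have "\<xi> n \<in> letters N" for n using p[of "Suc n"] by (auto simp: pre_Suc FN_carrier_def)
  moreover have "\<xi> (Suc n) \<noteq> - \<xi> n" for n
    using p[of "Suc (Suc n)"] by (auto simp: pre_Suc FN_carrier_def reduced_append reduced_Cons)
  ultimately show ?thesis by (simp add: bd_def)
qed

lemma agrees_mul_left:
  assumes "g \<in> FN_carrier N" "w \<in> FN_carrier N" "\<xi> \<in> bd N" "agrees (k + length g) w \<xi>"
  shows "agrees k (mul g w) (act g \<xi>)"
proof (cases "k = 0")
  case False
  define n where "n = k + length g"
  obtain w' where w': "w = pre \<xi> n @ w'" using assms(4) unfolding agrees_def n_def by (metis append_take_drop_id)
  obtain p r q where h: "g = p @ r" "pre \<xi> n = winv r @ q" "mul g (pre \<xi> n) = p @ q" "reduced (p @ q)"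
    using mul_decomp[of g "pre \<xi> n"] assms(1) pre_FN[OF assms(3)] FN_carrier_reduced by metis
  have "n = length r + length q" using h(2) by (metis length_append length_pre length_winv)
  then have q: "k \<le> length q" using h(1) by (auto simp: n_def)
  then have "q \<noteq> []" using False by auto
  have "reduced (q @ w')" using w' h(2) FN_carrier_reduced[OF assms(2)] by (auto simp: reduced_append)
  then have "reduced ((p @ q) @ w')" using h(4) \<open>q \<noteq> []\<close> by (auto simp: reduced_append)
  moreover have "mul g w = mul (mul g (pre \<xi> n)) w'"
    using w' FN_carrier_reduced[OF assms(2)] by (metis mul_append_reduced mul_assoc)
  ultimately have "mul g w = (p @ q) @ w'" using h(3) by (simp add: mul_append_reduced)
  moreover have "pre (act g \<xi>) k = take k (p @ q)" using pre_act[OF assms(1,3), of k n] h(3) by (simp add: n_def)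
  ultimately show ?thesis using q by (simp add: agrees_def)
qed (simp add: agrees_def)

lemma agrees_mul_right:
  assumes "reduced w" "reduced u" "agrees (k + length u) w \<xi>"
  shows "agrees k (mul w u) \<xi>"
proof -
  have "take k w = take k (mul w u) \<and> k \<le> length (mul w u)"
    by (rule take_eq_if_close[where C="length u"])
      (use assms in \<open>auto simp: agrees_def winv_mul_cancel\<close>)
  then show ?thesis using agrees_mono[OF assms(3), of k] by (simp add: agrees_def)
qed

lemma limset_act_sub:
  assumes "g \<in> FN_carrier N" "H \<subseteq> FN_carrier N"
  shows "act g ` limset N H \<subseteq> limset N (conjg N g H)"
proof
  fix \<zeta> assume "\<zeta> \<in> act g ` limset N H"
  then obtain \<xi> where \<xi>: "\<zeta> = act g \<xi>" "\<xi> \<in> bd N" "\<forall>k. \<exists>h\<in>H. agrees k h \<xi>" by (auto simp: mem_limset)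
  have "\<exists>h\<in>conjg N g H. agrees k h \<zeta>" for k
  proof -
    \<comment> \<open>One \<open>length g\<close> is spent on the left factor \<open>g\<close>, the
      other on the right factor \<open>winv g\<close>.\<close>
    obtain h where h: "h \<in> H" "agrees (k + length g + length g) h \<xi>" using \<xi> by blast
    then have hF: "h \<in> FN_carrier N" using assms by auto
    have "agrees (k + length g) (mul g h) \<zeta>"
      unfolding \<xi>(1) by (rule agrees_mul_left[OF assms(1) hF \<xi>(2) h(2)])
    then have "agrees k (mul (mul g h) (winv g)) \<zeta>"
      using agrees_mul_right[of "mul g h" "winv g" k \<zeta>] FN_carrier_reduced[OF assms(1)] by simp
    then show ?thesis using h assms by (auto simp: conjg_eq)
  qed
  then show "\<zeta> \<in> limset N (conjg N g H)" using \<xi> assms by (auto simp: mem_limset)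
qed

lemma limset_conjg:
  assumes "g \<in> FN_carrier N" "H \<subseteq> FN_carrier N"
  shows "limset N (conjg N g H) = act g ` limset N H"
proof
  have "act (winv g) ` limset N (conjg N g H) \<subseteq> limset N (conjg N (winv g) (conjg N g H))"
    by (rule limset_act_sub) (use assms conjg_sub in auto)
  also have "conjg N (winv g) (conjg N g H) = H" using assms by (simp add: conjg_conjg conjg_Nil)
  finally have "act g ` act (winv g) ` limset N (conjg N g H) \<subseteq> act g ` limset N H" by blast
  then show "limset N (conjg N g H) \<subseteq> act g ` limset N H"
    by (simp add: act_image_winv'[OF assms(1) limset_bd])
qed (rule limset_act_sub[OF assms])

lemma conjg_self:
  assumes "subgroup H (FN N)" "h \<in> H"
  shows "conjg N h H = H"
proof -
  note H = assms(1)[unfolded subgroup_FN_iff]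
  have hF: "h \<in> FN_carrier N" using H assms(2) by auto
  have "mul (winv h) (mul x h) \<in> H \<Longrightarrow> x \<in> FN_carrier N \<Longrightarrow> x \<in> H" for x
  proof -
    assume a: "mul (winv h) (mul x h) \<in> H" "x \<in> FN_carrier N"
    have "mul (mul h (mul (winv h) (mul x h))) (winv h) = x"
      using a(2) by (simp add: mul_winv_cancel mul_cancel_right FN_carrier_reduced)
    then show "x \<in> H" using a H assms(2) by metis
  qed
  moreover have "mul (winv h) (mul x h) \<in> H" "x \<in> FN_carrier N" if "x \<in> H" for x
    using that H assms(2) by blast+
  moreover have "x \<in> conjg N h H \<longleftrightarrow> x \<in> FN_carrier N \<and> mul (winv h) (mul x h) \<in> H" for x
    using mem_conjg[of h N H] H hF by blast
  ultimately show ?thesis by blast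
qed

lemma limset_invariant: "subgroup H (FN N) \<Longrightarrow> h \<in> H \<Longrightarrow> act h ` limset N H = limset N H"
  using limset_conjg[of h N H] conjg_self[of H N h] by (auto simp: subgroup_FN_iff)

text \<open>A right factor of bounded length moves a vertex by a bounded distance and does not
  affect limits at infinity. It is applied with coset representatives of a finite-index
  subgroup.\<close>

lemma limset_cobounded:
  assumes "H \<subseteq> FN_carrier N" "K \<subseteq> FN_carrier N"
    and "\<And>h. h \<in> H \<Longrightarrow> \<exists>k\<in>K. \<exists>u\<in>FN_carrier N. h = mul k u \<and> length u \<le> C"
  shows "limset N H \<subseteq> limset N K"
proof
  fix \<xi> assume "\<xi> \<in> limset N H"
  then have \<xi>: "\<xi> \<in> bd N" "\<forall>k. \<exists>h\<in>H. agrees k h \<xi>" by (auto simp: mem_limset)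
  have "\<exists>x\<in>K. agrees k x \<xi>" for k
  proof -
    obtain h where h: "h \<in> H" "agrees (k + C) h \<xi>" using \<xi> by blast
    obtain x u where x: "x \<in> K" "u \<in> FN_carrier N" "h = mul x u" "length u \<le> C" using assms(3)[OF h(1)] by blast
    have rx: "reduced x" "reduced u" "reduced h" using x h assms FN_carrier_reduced by auto
    have "agrees (k + length (winv u)) h \<xi>" using agrees_mono[OF h(2)] x(4) by simp
    then have "agrees k (mul h (winv u)) \<xi>" using rx by (intro agrees_mul_right) auto
    then show ?thesis using x rx by (auto simp: mul_cancel_right)
  qed
  then show "\<xi> \<in> limset N K" using \<xi> by (auto simp: mem_limset)
qed

section \<open>Fixed points of single elements and cocompactness of hulls\<close>

lemma nth_concat_replicate: "j < n * length c \<Longrightarrow> concat (replicate n c) ! j = c ! (j mod length c)"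
proof (induct n arbitrary: j)
  case (Suc n)
  then show ?case by (cases "j < length c") (auto simp: nth_append le_mod_geq)
qed simp

lemma length_concat_replicate: "length (concat (replicate n c)) = n * length c"
  by (induct n) auto

lemma reduced_power:
  assumes "reduced c" "c \<noteq> []" "hd c \<noteq> - last c"
  shows "reduced (concat (replicate n c)) \<and>
    (n \<noteq> 0 \<longrightarrow> hd (concat (replicate n c)) = hd c \<and> last (concat (replicate n c)) = last c)"
proof (induct n)
  case (Suc n)
  then show ?case using assms by (cases n) (auto simp: reduced_append)
qed simp

text \<open>No letters cancel in the powers \<open>u c ... c winv u\<close>, since \<open>c\<close>
  is cyclically reduced; they converge to the eventually periodic ray \<xi>, the attracting fixed
  point of \<open>u @ c @ winv u\<close>.\<close>

lemma limset_axis: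
  assumes H: "subgroup H (FN N)" and "u @ c @ winv u \<in> H" "c \<noteq> []" "hd c \<noteq> - last c"
  obtains \<xi> where "\<xi> \<in> limset N H" "\<xi> (length u) = hd c"
proof -
  note HH = H[unfolded subgroup_FN_iff]
  define h where "h = u @ c @ winv u"
  define pw where "pw = (\<lambda>n. concat (replicate n c))"
  have rh: "reduced h" using HH assms(2) FN_carrier_reduced h_def by auto
  have rc: "reduced c" using rh by (simp add: h_def reduced_append)
  have pr: "reduced (u @ pw (Suc n) @ winv u)" for n
  proof -
    have "pw (Suc n) \<noteq> []" "reduced (pw (Suc n))" "hd (pw (Suc n)) = hd c" "last (pw (Suc n)) = last c"
      using reduced_power[OF rc assms(3,4), of "Suc n"] assms(3) unfolding pw_def by auto
    then show ?thesis using rh assms(3) unfolding h_def by (auto simp: reduced_append)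
  qed
  have pH: "u @ pw (Suc n) @ winv u \<in> H" for n
  proof (induct n)
    case 0
    then show ?case using assms(2) by (simp add: pw_def)
  next
    case (Suc n)
    have comm: "pw (Suc n) @ c = pw (Suc (Suc n))"
      unfolding pw_def by (metis append_Nil2 concat.simps(1) concat.simps(2) concat_append replicate_append_same replicate_Suc)
    have "mul (u @ pw (Suc n) @ winv u) h = red ((u @ pw (Suc n)) @ red (winv u @ u) @ (c @ winv u))"
      by (simp add: mul_def h_def) (metis append.assoc red_append_red red_red_append)
    also have "red (winv u @ u) = []" using winv_mul[of u] by (simp add: mul_def)
    also have "red ((u @ pw (Suc n)) @ [] @ (c @ winv u)) = red (u @ pw (Suc (Suc n)) @ winv u)"
      using comm by (metis append.assoc append_Nil)
    also have "\<dots> = u @ pw (Suc (Suc n)) @ winv u" by (rule red_reduced[OF pr])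
    finally show ?case using HH Suc assms(2) h_def by metis
  qed
  define \<xi> where "\<xi> = (\<lambda>i. if i < length u then u ! i else c ! ((i - length u) mod length c))"
  have ag: "agrees k (u @ pw (Suc k) @ winv u) \<xi>" for k
  proof -
    have lk: "k \<le> Suc k * length c" using assms(3) by (cases "length c") auto
    have "take k (u @ pw (Suc k) @ winv u) ! i = \<xi> i" if "i < k" for i
    proof (cases "i < length u")
      case False
      then have "i - length u < Suc k * length c" using that lk by linarith
      moreover have "(u @ pw (Suc k) @ winv u) ! i = pw (Suc k) ! (i - length u)"
        using False calculation length_concat_replicate[of "Suc k" c]
        by (simp add: nth_append pw_def del: replicate_Suc)
      ultimately show ?thesis using False that nth_concat_replicate[of "i - length u" "Suc k" c]
        by (simp add: \<xi>_def pw_def del: replicate_Suc take_append)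
    qed (use that in \<open>simp add: nth_append \<xi>_def\<close>)
    moreover have "k \<le> length (u @ pw (Suc k) @ winv u)"
      using lk length_concat_replicate[of "Suc k" c] by (simp add: pw_def del: replicate_Suc)
    ultimately show ?thesis unfolding agrees_def by (auto intro!: nth_equalityI)
  qed
  have "\<xi> \<in> bd N" by (rule agrees_all_bd) (use ag pH HH in blast)
  then have "\<xi> \<in> limset N H" using ag pH by (auto simp: mem_limset)
  moreover have "\<xi> (length u) = hd c" using assms(3) by (simp add: \<xi>_def hd_conv_nth)
  ultimately show ?thesis using that by blast
qed

text \<open>The two ends of the axis of one nontrivial element. They part at position
  \<open>length u\<close>, where their letters are \<open>hd c\<close> and
  \<open>- last c\<close>.\<close>

lemma limset_two_points:
  assumes H: "subgroup H (FN N)" and "H \<noteq> {[]}"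
  obtains \<xi> \<eta> where "\<xi> \<in> limset N H" "\<eta> \<in> limset N H" "\<xi> \<noteq> \<eta>"
proof -
  note HH = H[unfolded subgroup_FN_iff]
  obtain h where h: "h \<in> H" "h \<noteq> []" using HH assms(2) by blast
  have hF: "h \<in> FN_carrier N" using h HH by auto
  then have "reduced h" "0 \<notin> set h" by (auto simp: FN_carrier_def letters_def)
  then obtain u c where uc: "h = u @ c @ winv u" "c \<noteq> []" "hd c \<noteq> - last c"
    using cyclic_reduction[of h] h by metis
  obtain \<xi> where \<xi>: "\<xi> \<in> limset N H" "\<xi> (length u) = hd c"
    using limset_axis[OF H] h uc by metis
  have "winv h = u @ winv c @ winv u" using uc by (simp add: winv_append)
  then have "u @ winv c @ winv u \<in> H" using HH h by metis
  then obtain \<eta> where \<eta>: "\<eta> \<in> limset N H" "\<eta> (length u) = hd (winv c)"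
    using limset_axis[OF H, of u "winv c"] uc by (auto simp: hd_winv last_winv)
  have "\<xi> \<noteq> \<eta>" using \<xi>(2) \<eta>(2) uc by (metis hd_winv)
  then show ?thesis using that[OF \<xi>(1) \<eta>(1)] by blast
qed

lemma chull_limset_nonempty:
  assumes "subgroup H (FN N)" "H \<noteq> {[]}"
  shows "chull N (limset N H) \<noteq> {}"
  using limset_two_points[OF assms] chull_nonempty[OF limset_bd] by (metis empty_iff)

text \<open>The vertices \<open>x\<close> and \<open>y\<close> lie in different branches at
  \<open>g\<close>, so the path from \<open>x\<close> to \<open>y\<close> runs through
  \<open>g\<close>.\<close>

lemma length_if_separated:
  assumes "x \<in> FN_carrier N" "y \<in> FN_carrier N" "g \<in> FN_carrier N"
    "mul (winv g) x \<noteq> []" "mul (winv g) y \<noteq> []" "hd (mul (winv g) x) \<noteq> hd (mul (winv g) y)"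
  shows "length (mul (winv x) g) \<le> length (mul (winv x) y)"
proof -
  define a b where "a = mul (winv g) x" and "b = mul (winv g) y"
  have wa: "winv a = mul (winv x) g" using assms by (simp add: a_def winv_mul_distrib[of _ N])
  have "mul (winv x) y = mul (winv a) b"
    using assms wa by (simp add: b_def mul_assoc mul_winv_cancel FN_carrier_reduced)
  moreover have "reduced (winv a @ b)" using assms(4-6)
    by (auto simp: reduced_append a_def[symmetric] b_def[symmetric] last_winv) (simp_all add: a_def b_def)
  ultimately show ?thesis using wa by (metis le_add1 length_append mul_append_reduced)
qed

text \<open>Let \<open>R\<close> be the length of the longest generator. A vertex \<open>g\<close>
  farther than \<open>R\<close> from all of \<open>H\<close> cannot be jumped over by a step from
  \<open>x\<close> to \<open>mul x s\<close>, so \<open>H\<close> stays in one branch at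
  \<open>g\<close>. Its limit points then all lie in one direction, and \<open>g\<close> is not in
  the hull.\<close>

lemma chull_limset_cobounded:
  assumes fg: "fg_subgroup N H"
  obtains R where "\<And>g. g \<in> chull N (limset N H) \<Longrightarrow> \<exists>h\<in>H. length (mul (winv h) g) \<le> R"
proof -
  obtain S where S: "finite S" "S \<subseteq> FN_carrier N" "generate (FN N) S = H" and H: "subgroup H (FN N)"
    using fg by (auto simp: fg_subgroup_def)
  note HH = H[unfolded subgroup_FN_iff]
  define R where "R = Max (insert 0 (length ` S))"
  have R: "length s \<le> R" if "s \<in> S" for s unfolding R_def using S(1) that by (intro Max_ge) auto
  have "\<exists>h\<in>H. length (mul (winv h) g) \<le> R" if g: "g \<in> chull N (limset N H)" for g
  proof (rule ccontr)
    assume nc: "\<not> ?thesis"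
    \<comment> \<open>\<open>vd x\<close> names the branch at \<open>g\<close> in which the vertex
      \<open>x\<close> lies.\<close>
    define vd where "vd = (\<lambda>x. hd (mul (winv g) x))"
    have gF: "g \<in> FN_carrier N" using g chull_FN by auto
    have ne: "mul (winv g) x \<noteq> []" if "x \<in> H" for x
    proof
      assume "mul (winv g) x = []"
      then have "x = g" using that HH gF by (metis FN_carrier_reduced mul_Nil_right mul_winv_cancel subsetD)
      then show False using nc that by auto
    qed
    have step: "vd (mul x s) = vd x" if "x \<in> H" "s \<in> H" "length s \<le> R" for x s
    proof (rule ccontr)
      assume "vd (mul x s) \<noteq> vd x"
      then have "length (mul (winv x) g) \<le> length (mul (winv x) (mul x s))"
        using that HH gF ne by (intro length_if_separated[of _ N]) (auto simp: vd_def)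
      also have "mul (winv x) (mul x s) = s" using that HH by (auto simp: winv_mul_cancel FN_carrier_reduced)
      finally show False using nc that by auto
    qed
    have gen: "\<forall>x\<in>H. vd (mul x h) = vd x" if "h \<in> generate (FN N) S" for h
      using that
    proof (induct rule: generate.induct)
      case one
      then show ?case using HH by (auto simp: mul_Nil_right FN_carrier_reduced)
    next
      case (incl h)
      then show ?case using step R S(3) generate.incl by metis
    next
      case (inv h)
      have "winv h \<in> H" "length (winv h) \<le> R" using inv R S(2,3) HH generate.incl[OF inv, of "FN N"] by auto
      then show ?case using step S(2) inv by (metis inv_FN subsetD)
    next
      case (eng h1 h2)
      then show ?case using S(3) HH by (simp add: mul_assoc[symmetric])
    qed
    obtain \<xi> \<eta> where xi: "\<xi> \<in> limset N H" "\<eta> \<in> limset N H" "dir g \<xi> \<noteq> dir g \<eta>" using g by (auto simp: chull_def)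
    have vdir: "\<exists>h\<in>H. vd h = dir g \<zeta>" if z: "\<zeta> \<in> limset N H" for \<zeta>
    proof -
      obtain h where h: "h \<in> H" "agrees (1 + length (winv g)) h \<zeta>" using z unfolding mem_limset by blast
      have "agrees 1 (mul (winv g) h) (act (winv g) \<zeta>)"
        by (rule agrees_mul_left[of _ N]) (use h HH gF z limset_bd in auto)
      then have "vd h = dir g \<zeta>" unfolding vd_def dir_def agrees_def
        by (cases "mul (winv g) h") (auto simp: pre_Suc)
      then show ?thesis using h by auto
    qed
    obtain h1 h2 where h: "h1 \<in> H" "h2 \<in> H" "vd h1 = dir g \<xi>" "vd h2 = dir g \<eta>" using vdir xi by metis
    have "vd (mul h1 (mul (winv h1) h2)) = vd h1" using gen h S(3) HH by blast
    moreover have "mul h1 (mul (winv h1) h2) = h2" using h HH by (auto simp: mul_winv_cancel FN_carrier_reduced)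
    ultimately show False using h xi by simp
  qed
  then show ?thesis using that by blast
qed

section \<open>Cosets and commensurators\<close>

lemma r_coset_eq: "H #>\<^bsub>FN N\<^esub> x = (\<lambda>h. mul h x) ` H"
  by (auto simp: r_coset_def)

lemma rcos_self: "subgroup H (FN N) \<Longrightarrow> x \<in> FN_carrier N \<Longrightarrow> x \<in> H #>\<^bsub>FN N\<^esub> x"
  using mul_Nil_left[of x] by (force simp: r_coset_eq subgroup_FN_iff FN_carrier_reduced)

lemma rcos_eq_iff:
  assumes "subgroup H (FN N)" "x \<in> FN_carrier N" "y \<in> FN_carrier N"
  shows "H #>\<^bsub>FN N\<^esub> x = H #>\<^bsub>FN N\<^esub> y \<longleftrightarrow> mul x (winv y) \<in> H"
proof -
  note H = assms(1)[unfolded subgroup_FN_iff]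
  have "x \<in> H #>\<^bsub>FN N\<^esub> y \<longleftrightarrow> mul x (winv y) \<in> H"
  proof
    assume "x \<in> H #>\<^bsub>FN N\<^esub> y"
    then obtain h where "h \<in> H" "x = mul h y" by (auto simp: r_coset_eq)
    then show "mul x (winv y) \<in> H" using H by (auto simp: mul_cancel_right FN_carrier_reduced)
  next
    assume "mul x (winv y) \<in> H"
    moreover have "x = mul (mul x (winv y)) y" using assms by (simp add: mul_cancel_right' FN_carrier_reduced)
    ultimately show "x \<in> H #>\<^bsub>FN N\<^esub> y" unfolding r_coset_eq by (metis image_eqI)
  qed
  moreover have "x \<in> H #>\<^bsub>FN N\<^esub> y \<longleftrightarrow> H #>\<^bsub>FN N\<^esub> x = H #>\<^bsub>FN N\<^esub> y"
    using FN.repr_independence[of x N H y] assms rcos_self[OF assms(1,2)] by auto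
  ultimately show ?thesis by simp
qed

lemma rcos_mul_left:
  assumes "subgroup H (FN N)" "x \<in> FN_carrier N" "h \<in> H"
  shows "H #>\<^bsub>FN N\<^esub> (mul h x) = H #>\<^bsub>FN N\<^esub> x"
  using assms by (subst rcos_eq_iff) (auto simp: subgroup_FN_iff mul_cancel_right FN_carrier_reduced)

lemma cosets_in_eq: "cosets_in N A K = {K #>\<^bsub>FN N\<^esub> a |a. a \<in> A}"
  by (auto simp: cosets_in_def RCOSETS_def r_coset_def)

lemma finite_image_factor:
  assumes "finite (f ` A)" "\<And>a b. a \<in> A \<Longrightarrow> b \<in> A \<Longrightarrow> f a = f b \<Longrightarrow> g a = g b"
  shows "finite (g ` A)"
proof -
  have "g ` A \<subseteq> (\<lambda>y. g (SOME a. a \<in> A \<and> f a = y)) ` (f ` A)"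
  proof
    fix z assume "z \<in> g ` A"
    then obtain a where a: "a \<in> A" "z = g a" by auto
    have "(SOME b. b \<in> A \<and> f b = f a) \<in> A \<and> f (SOME b. b \<in> A \<and> f b = f a) = f a"
      by (rule someI) (use a in auto)
    then have "z = g (SOME b. b \<in> A \<and> f b = f a)" using assms(2)[OF a(1)] a by metis
    then show "z \<in> (\<lambda>y. g (SOME a. a \<in> A \<and> f a = y)) ` (f ` A)" using a(1) by (intro image_eqI) auto
  qed
  then show ?thesis using assms(1) finite_surj by blast
qed

lemma finite_orbits_chull:
  assumes fg: "fg_subgroup N H"
  shows "finite ((\<lambda>g. H #>\<^bsub>FN N\<^esub> g) ` chull N (limset N H))"
proof -
  have H: "subgroup H (FN N)" using fg by (auto simp: fg_subgroup_def)
  obtain R where R: "\<And>g. g \<in> chull N (limset N H) \<Longrightarrow> \<exists>h\<in>H. length (mul (winv h) g) \<le> R"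
    using chull_limset_cobounded[OF fg] by blast
  have "(\<lambda>g. H #>\<^bsub>FN N\<^esub> g) ` chull N (limset N H) \<subseteq> (\<lambda>g. H #>\<^bsub>FN N\<^esub> g) ` {w \<in> FN_carrier N. length w \<le> R}"
  proof (rule image_subsetI)
    fix g assume g: "g \<in> chull N (limset N H)"
    have gF: "g \<in> FN_carrier N" using g chull_FN by auto
    obtain h where h: "h \<in> H" "length (mul (winv h) g) \<le> R" using R[OF g] by auto
    have wh: "winv h \<in> H" "winv h \<in> FN_carrier N" using h H by (auto simp: subgroup_FN_iff)
    then have "H #>\<^bsub>FN N\<^esub> (mul (winv h) g) = H #>\<^bsub>FN N\<^esub> g" using H gF rcos_mul_left by metis
    then show "H #>\<^bsub>FN N\<^esub> g \<in> (\<lambda>g. H #>\<^bsub>FN N\<^esub> g) ` {w \<in> FN_carrier N. length w \<le> R}"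
      using h wh gF by (metis (mono_tags, lifting) image_eqI mem_Collect_eq mul_FN)
  qed
  then show ?thesis using finite_FN_length finite_surj by blast
qed

text \<open>Translations are free, so sending \<open>a\<close> to the \<open>B\<close>-coset of
  \<open>mul a t\<close> is injective modulo \<open>A \<inter> B\<close>; the values lie among the
  finitely many \<open>B\<close>-orbits that meet \<open>T\<close>.\<close>

lemma finite_index_if_cofinite:
  assumes "subgroup A (FN N)" "subgroup B (FN N)" "T \<subseteq> FN_carrier N" "t \<in> T"
    "\<And>a t. a \<in> A \<Longrightarrow> t \<in> T \<Longrightarrow> mul a t \<in> T" "finite ((\<lambda>g. B #>\<^bsub>FN N\<^esub> g) ` T)"
  shows "finite (cosets_in N A (A \<inter> B))"
proof -
  have AB: "subgroup (A \<inter> B) (FN N)" using assms(1,2) by (auto simp: subgroup_FN_iff)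
  have F: "A \<subseteq> FN_carrier N" "t \<in> FN_carrier N" using assms by (auto simp: subgroup_FN_iff)
  have "finite ((\<lambda>a. (A \<inter> B) #>\<^bsub>FN N\<^esub> a) ` A)"
  proof (rule finite_image_factor[where f="\<lambda>a. B #>\<^bsub>FN N\<^esub> (mul a t)"])
    show "finite ((\<lambda>a. B #>\<^bsub>FN N\<^esub> mul a t) ` A)"
      by (rule finite_subset[OF _ assms(6)]) (use assms in blast)
    fix a b assume ab: "a \<in> A" "b \<in> A" "B #>\<^bsub>FN N\<^esub> mul a t = B #>\<^bsub>FN N\<^esub> mul b t"
    then have "mul (mul a t) (winv (mul b t)) \<in> B" using F assms(2)
      by (subst rcos_eq_iff[symmetric]) auto
    also have "mul (mul a t) (winv (mul b t)) = mul a (winv b)"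
      using F ab by (subst winv_mul_distrib[of _ N]) (auto simp: mul_assoc mul_winv_cancel FN_carrier_reduced subset_iff)
    finally have "mul a (winv b) \<in> A \<inter> B" using ab assms(1) by (auto simp: subgroup_FN_iff)
    then show "(A \<inter> B) #>\<^bsub>FN N\<^esub> a = (A \<inter> B) #>\<^bsub>FN N\<^esub> b"
      using AB ab F by (subst rcos_eq_iff) auto
  qed
  moreover have "cosets_in N A (A \<inter> B) = (\<lambda>a. (A \<inter> B) #>\<^bsub>FN N\<^esub> a) ` A" by (auto simp: cosets_in_eq)
  ultimately show ?thesis by simp
qed

lemma limset_finite_index:
  assumes "subgroup A (FN N)" "subgroup K (FN N)" "K \<subseteq> A" "finite (cosets_in N A K)"
  shows "limset N A = limset N K"
proof
  show "limset N K \<subseteq> limset N A" by (rule limset_mono[OF assms(3)])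
  define Rp where "Rp = (\<lambda>D. SOME a. a \<in> A \<and> D = r_coset (FN N) K a) ` cosets_in N A K"
  have fRp: "finite Rp" using assms(4) by (simp add: Rp_def)
  note A = assms(1)[unfolded subgroup_FN_iff] and K = assms(2)[unfolded subgroup_FN_iff]
  show "limset N A \<subseteq> limset N K"
  proof (rule limset_cobounded[where C="Max (insert 0 (length ` Rp))"])
    fix a assume a: "a \<in> A"
    define r where "r = (SOME b. b \<in> A \<and> r_coset (FN N) K a = r_coset (FN N) K b)"
    have r: "r \<in> A \<and> K #>\<^bsub>FN N\<^esub> a = K #>\<^bsub>FN N\<^esub> r" unfolding r_def by (rule someI) (use a in auto)
    have "r \<in> Rp" unfolding Rp_def r_def using a by (auto simp: cosets_in_eq)
    then have "length r \<le> Max (insert 0 (length ` Rp))" using fRp by (intro Max_ge) auto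
    moreover have "mul a (winv r) \<in> K" using r a A assms(2) by (subst rcos_eq_iff[symmetric]) auto
    moreover have "a = mul (mul a (winv r)) r" using a A by (auto simp: mul_cancel_right' FN_carrier_reduced)
    ultimately show "\<exists>k\<in>K. \<exists>u\<in>FN_carrier N. a = mul k u \<and> length u \<le> Max (insert 0 (length ` Rp))"
      using r A by blast
  qed (use A K in auto)
qed

section \<open>Commensurators as stabilisers of limit sets\<close>

definition Stab :: "nat \<Rightarrow> (nat \<Rightarrow> int) set \<Rightarrow> int list set" where
  "Stab N S = {g \<in> FN_carrier N. act g ` S = S}"

lemma subgroup_Stab:
  assumes "S \<subseteq> bd N"
  shows "subgroup (Stab N S) (FN N)"
proof -
  have "act (winv g) ` S = S" if "g \<in> FN_carrier N" "act g ` S = S" for g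
    using act_image_winv[OF that(1) assms] that by simp
  moreover have "act (mul g k) ` S = S"
    if "g \<in> FN_carrier N" "act g ` S = S" "k \<in> FN_carrier N" "act k ` S = S" for g k
    using act_image_act[OF that(1,3) assms] that by simp
  moreover have "act [] ` S = S" by simp
  ultimately show ?thesis unfolding subgroup_FN_iff Stab_def
    by (intro conjI ballI) (simp_all add: subset_iff)
qed

lemma Stab_chull:
  assumes "S \<subseteq> bd N" "g \<in> Stab N S" "t \<in> chull N S"
  shows "mul g t \<in> chull N S"
  using chull_act[of g N S] assms by (auto simp: Stab_def)

lemma subgroup_sub_Stab: "subgroup H (FN N) \<Longrightarrow> H \<subseteq> Stab N (limset N H)"
proof
  fix h assume h: "subgroup H (FN N)" "h \<in> H"
  then have "h \<in> FN_carrier N" by (auto simp: subgroup_FN_iff)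
  then show "h \<in> Stab N (limset N H)" using limset_invariant[OF h] by (simp add: Stab_def)
qed

text \<open>Left translation by \<open>winv g\<close> turns orbits of the conjugate into orbits of
  \<open>H\<close> and maps \<open>T\<close> into itself.\<close>

lemma finite_orbits_conjg:
  assumes "subgroup H (FN N)" "g \<in> FN_carrier N" "T \<subseteq> FN_carrier N" "mul (winv g) ` T \<subseteq> T"
    "finite ((\<lambda>x. H #>\<^bsub>FN N\<^esub> x) ` T)"
  shows "finite ((\<lambda>x. conjg N g H #>\<^bsub>FN N\<^esub> x) ` T)"
proof (rule finite_image_factor[where f="\<lambda>x. H #>\<^bsub>FN N\<^esub> mul (winv g) x"])
  show "finite ((\<lambda>x. H #>\<^bsub>FN N\<^esub> mul (winv g) x) ` T)"
    by (rule finite_subset[OF _ assms(5)]) (use assms(4) in blast)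
  fix x y assume h: "x \<in> T" "y \<in> T" "H #>\<^bsub>FN N\<^esub> mul (winv g) x = H #>\<^bsub>FN N\<^esub> mul (winv g) y"
  have F: "x \<in> FN_carrier N" "y \<in> FN_carrier N" using h assms by auto
  have "mul (mul (winv g) x) (winv (mul (winv g) y)) \<in> H"
    using h F assms by (subst rcos_eq_iff[symmetric]) auto
  then have "mul (winv g) (mul (mul x (winv y)) g) \<in> H"
    using F assms(2) by (simp add: winv_mul_distrib[of _ N] mul_assoc)
  then have "mul x (winv y) \<in> conjg N g H" using F assms by (subst mem_conjg) (auto simp: subgroup_FN_iff)
  then show "conjg N g H #>\<^bsub>FN N\<^esub> x = conjg N g H #>\<^bsub>FN N\<^esub> y"
    using F subgroup_conjg[OF assms(2,1)] by (subst rcos_eq_iff) auto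
qed

text \<open>Passing to a finite-index subgroup keeps the limit set, so commensurating elements
  stabilise it. Conversely, if \<open>g\<close> stabilises it, then \<open>H\<close> and its
  conjugate act on one and the same hull with finitely many orbits each, and their intersection has
  finite index in both.\<close>

lemma Comm_eq_Stab:
  assumes fg: "fg_subgroup N H" and nt: "H \<noteq> {[]}"
  shows "Comm N H = Stab N (limset N H)"
proof (intro equalityI subsetI)
  have H: "subgroup H (FN N)" using fg by (auto simp: fg_subgroup_def)
  then have HF: "H \<subseteq> FN_carrier N" by (simp add: subgroup_FN_iff)
  {
    fix g assume "g \<in> Comm N H"
    then have g: "g \<in> FN_carrier N" "finite (cosets_in N H (H \<inter> conjg N g H))"
      "finite (cosets_in N (conjg N g H) (H \<inter> conjg N g H))" by (auto simp: Comm_def)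
    have c: "subgroup (conjg N g H) (FN N)" by (rule subgroup_conjg[OF g(1) H])
    have i: "subgroup (H \<inter> conjg N g H) (FN N)" using c H by (auto simp: subgroup_FN_iff)
    have "limset N H = limset N (conjg N g H)"
      using limset_finite_index[OF H i _ g(2)] limset_finite_index[OF c i _ g(3)] by simp
    then show "g \<in> Stab N (limset N H)" using limset_conjg[OF g(1) HF] g(1) by (simp add: Stab_def)
  next
    fix g assume gS: "g \<in> Stab N (limset N H)"
    then have g: "g \<in> FN_carrier N" "act g ` limset N H = limset N H" by (auto simp: Stab_def)
    define T where "T = chull N (limset N H)"
    obtain t where t: "t \<in> T" using chull_limset_nonempty[OF H nt] T_def by auto
    have TF: "T \<subseteq> FN_carrier N" by (simp add: T_def chull_FN)
    have c: "subgroup (conjg N g H) (FN N)" by (rule subgroup_conjg[OF g(1) H])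
    have f1: "finite ((\<lambda>x. H #>\<^bsub>FN N\<^esub> x) ` T)" unfolding T_def by (rule finite_orbits_chull[OF fg])
    have wg: "winv g \<in> Stab N (limset N H)"
      using subgroup_Stab[OF limset_bd, of N H] gS by (auto simp: subgroup_FN_iff)
    have f2: "finite ((\<lambda>x. conjg N g H #>\<^bsub>FN N\<^esub> x) ` T)"
      by (rule finite_orbits_conjg[OF H g(1) TF _ f1]) (use Stab_chull[OF limset_bd wg] T_def in auto)
    have inv1: "mul a x \<in> T" if "a \<in> H" "x \<in> T" for a x
      using that subgroup_sub_Stab[OF H] Stab_chull[OF limset_bd] T_def by auto
    have "limset N (conjg N g H) = limset N H" using limset_conjg[OF g(1) HF] g by simp
    then have inv2: "mul a x \<in> T" if "a \<in> conjg N g H" "x \<in> T" for a x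
      using that subgroup_sub_Stab[OF c] Stab_chull[OF limset_bd] T_def by auto
    have "finite (cosets_in N H (H \<inter> conjg N g H))"
      by (rule finite_index_if_cofinite[OF H c TF t inv1 f2])
    moreover have "finite (cosets_in N (conjg N g H) (conjg N g H \<inter> H))"
      by (rule finite_index_if_cofinite[OF c H TF t inv2 f1])
    ultimately show "g \<in> Comm N H" using g by (simp add: Comm_def Int_commute)
  }
qed

lemma finite_index_Comm:
  assumes fg: "fg_subgroup N H" and nt: "H \<noteq> {[]}"
  shows "finite (cosets_in N (Comm N H) H)"
proof -
  have H: "subgroup H (FN N)" using fg by (auto simp: fg_subgroup_def)
  obtain t where t: "t \<in> chull N (limset N H)" using chull_limset_nonempty[OF H nt] by auto
  have "finite (cosets_in N (Stab N (limset N H)) (Stab N (limset N H) \<inter> H))"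
    by (rule finite_index_if_cofinite[OF subgroup_Stab[OF limset_bd] H chull_FN t
        Stab_chull[OF limset_bd] finite_orbits_chull[OF fg]])
  moreover have "Stab N (limset N H) \<inter> H = H" using subgroup_sub_Stab[OF H] by auto
  ultimately show ?thesis by (simp add: Comm_eq_Stab[OF assms])
qed

lemma limset_Comm:
  assumes fg: "fg_subgroup N H" and nt: "H \<noteq> {[]}"
  shows "limset N (Comm N H) = limset N H"
proof -
  have H: "subgroup H (FN N)" using fg by (auto simp: fg_subgroup_def)
  show ?thesis
    by (rule limset_finite_index[OF _ H _ finite_index_Comm[OF assms]])
      (use Comm_eq_Stab[OF assms] subgroup_Stab[OF limset_bd] subgroup_sub_Stab[OF H] in auto)
qed

section \<open>Rank and Euler characteristic\<close>

lemma generate_image: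
  assumes "\<phi> \<in> hom (FN N) (FN N)" "S \<subseteq> FN_carrier N"
  shows "generate (FN N) (\<phi> ` S) = \<phi> ` generate (FN N) S"
proof -
  interpret group_hom "FN N" "FN N" \<phi>
    by (simp add: group_hom_def group_hom_axioms_def assms(1) group_FN)
  show ?thesis by (rule generate_img) (use assms in auto)
qed

lemma generated_by_image:
  assumes "\<phi> \<in> hom (FN N) (FN N)" "inj_on \<phi> (FN_carrier N)" "L \<subseteq> FN_carrier N"
  shows "(\<exists>S. finite S \<and> card S = n \<and> S \<subseteq> \<phi> ` L \<and> generate (FN N) S = \<phi> ` L) \<longleftrightarrow>
    (\<exists>S. finite S \<and> card S = n \<and> S \<subseteq> L \<and> generate (FN N) S = L)"
proof
  assume "\<exists>S. finite S \<and> card S = n \<and> S \<subseteq> L \<and> generate (FN N) S = L"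
  then obtain S where S: "finite S" "card S = n" "S \<subseteq> L" "generate (FN N) S = L" by blast
  have "inj_on \<phi> S" using assms S inj_on_subset by (metis subset_trans)
  then show "\<exists>S. finite S \<and> card S = n \<and> S \<subseteq> \<phi> ` L \<and> generate (FN N) S = \<phi> ` L"
    using S assms generate_image[OF assms(1), of S] by (intro exI[of _ "\<phi> ` S"]) (auto simp: card_image)
next
  assume "\<exists>S. finite S \<and> card S = n \<and> S \<subseteq> \<phi> ` L \<and> generate (FN N) S = \<phi> ` L"
  then obtain S where S: "finite S" "card S = n" "S \<subseteq> \<phi> ` L" "generate (FN N) S = \<phi> ` L" by blast
  obtain S' where S': "S' \<subseteq> L" "S = \<phi> ` S'" using S(3) by (meson subset_imageE)
  have inj: "inj_on \<phi> S'" using assms S' inj_on_subset by (metis subset_trans)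
  have gF: "generate (FN N) S' \<subseteq> FN_carrier N" using FN.generate_incl[of S' N] S' assms by auto
  have "\<phi> ` generate (FN N) S' = \<phi> ` L" using generate_image[OF assms(1), of S'] S S' assms by auto
  then have "generate (FN N) S' = L" using assms(2,3) gF by (simp add: inj_on_image_eq_iff)
  then show "\<exists>S. finite S \<and> card S = n \<and> S \<subseteq> L \<and> generate (FN N) S = L"
    using S S' inj by (intro exI[of _ S']) (auto simp: card_image finite_image_iff)
qed

lemma rank_image:
  assumes "\<phi> \<in> hom (FN N) (FN N)" "inj_on \<phi> (FN_carrier N)" "L \<subseteq> FN_carrier N"
  shows "rank N (\<phi> ` L) = rank N L"
  unfolding rank_def generated_by_image[OF assms] ..

lemma conj_hom:
  assumes "g \<in> FN_carrier N"
  shows "(\<lambda>h. mul (mul g h) (winv g)) \<in> hom (FN N) (FN N)"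
  using assms by (auto simp: hom_def mul_assoc winv_mul_cancel FN_carrier_reduced)

lemma conj_inj:
  assumes "g \<in> FN_carrier N"
  shows "inj_on (\<lambda>h. mul (mul g h) (winv g)) (FN_carrier N)"
  using assms by (auto simp: inj_on_def mul_right_inj[of _ N] mul_left_inj[of _ N])

lemma rank_conjg: "g \<in> FN_carrier N \<Longrightarrow> L \<subseteq> FN_carrier N \<Longrightarrow> rank N (conjg N g L) = rank N L"
  by (simp add: conjg_eq rank_image[OF conj_hom conj_inj])

text \<open>\<open>T\<close> is an \<open>L\<close>-invariant subtree through the identity, and
  \<open>D\<close> is a lift of a spanning tree of the finite quotient graph: a subtree with exactly
  one vertex in every orbit.\<close>

locale schreier =
  fixes N :: nat and L T D :: "int list set"
  assumes L: "subgroup L (FN N)" and TF: "T \<subseteq> FN_carrier N"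
    and Tpre: "\<And>w k. w \<in> T \<Longrightarrow> take k w \<in> T"
    and Linv: "\<And>l t. l \<in> L \<Longrightarrow> t \<in> T \<Longrightarrow> mul l t \<in> T"
    and DT: "D \<subseteq> T" and ND: "[] \<in> D" and finD: "finite D"
    and Dpre: "\<And>w k. w \<in> D \<Longrightarrow> take k w \<in> D"
    and Drep: "\<And>t. t \<in> T \<Longrightarrow> \<exists>!d. d \<in> D \<and> mul t (winv d) \<in> L"
begin

lemma LL: "L \<subseteq> FN_carrier N" "[] \<in> L" "u \<in> L \<Longrightarrow> v \<in> L \<Longrightarrow> mul u v \<in> L" "u \<in> L \<Longrightarrow> winv u \<in> L"
  using L by (auto simp: subgroup_FN_iff)

lemma NT: "[] \<in> T"
  using ND DT by auto

lemma LT: "L \<subseteq> T"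
proof
  fix l assume l: "l \<in> L"
  then have "mul l [] = l" using LL(1) by (auto simp: mul_Nil_right FN_carrier_reduced)
  then show "l \<in> T" using Linv[OF l NT] by simp
qed

lemma Tred: "t \<in> T \<Longrightarrow> reduced t" and TFN: "t \<in> T \<Longrightarrow> t \<in> FN_carrier N"
  and Dred: "t \<in> D \<Longrightarrow> reduced t" and DFN: "t \<in> D \<Longrightarrow> t \<in> FN_carrier N"
  and Lred: "t \<in> L \<Longrightarrow> reduced t" and LFN: "t \<in> L \<Longrightarrow> t \<in> FN_carrier N"
  using TF DT LL(1) by (auto intro: FN_carrier_reduced)

definition rep :: "int list \<Rightarrow> int list" where
  "rep t = (THE d. d \<in> D \<and> mul t (winv d) \<in> L)"

lemma rep: assumes "t \<in> T" shows "rep t \<in> D" "mul t (winv (rep t)) \<in> L"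
  using theI'[OF Drep[OF assms]] by (simp_all add: rep_def)

lemma rep_eq: "t \<in> T \<Longrightarrow> d \<in> D \<Longrightarrow> mul t (winv d) \<in> L \<Longrightarrow> rep t = d"
  using Drep[of t] rep[of t] by auto

lemma rep_D: "d \<in> D \<Longrightarrow> rep d = d"
  using rep_eq[of d d] DT LL by auto

lemma rep_mul: assumes "l \<in> L" "t \<in> T" shows "rep (mul l t) = rep t"
  using assms rep[OF assms(2)] by (intro rep_eq Linv) (auto simp: mul_assoc LL)

lemma rep_decomp: assumes "t \<in> T" shows "t = mul (mul t (winv (rep t))) (rep t)"
  using assms by (simp add: mul_cancel_right' Tred)

lemma rep_step:
  assumes "t \<in> T" "mul t [a] \<in> T"
  shows "mul (rep t) [a] \<in> T" "rep (mul (rep t) [a]) = rep (mul t [a])"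
proof -
  define l where "l = winv (mul t (winv (rep t)))"
  have l: "l \<in> L" using rep[OF assms(1)] LL by (simp add: l_def)
  have "mul l t = rep t" unfolding l_def
    using assms rep[OF assms(1)] by (metis DFN TFN mul_FN rep_decomp winv_FN winv_mul_cancel Dred)
  then have "mul l (mul t [a]) = mul (rep t) [a]" by (simp add: mul_assoc[symmetric])
  then show "mul (rep t) [a] \<in> T" "rep (mul (rep t) [a]) = rep (mul t [a])"
    using Linv[OF l assms(2)] rep_mul[OF l assms(2)] by auto
qed

text \<open>One entry for each edge of the quotient graph, oriented by its positive label and
  starting at its representative in \<open>D\<close>.\<close>

definition Edg :: "(int list \<times> int) set" where
  "Edg = {(d, a). d \<in> D \<and> a \<in> letters N \<and> a > 0 \<and> mul d [a] \<in> T}"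

lemma finE: "finite Edg"
  by (rule finite_subset[of _ "D \<times> letters N"]) (auto simp: Edg_def finD)

section \<open>Schreier generators and the upper bound for the rank\<close>

definition gen :: "int list \<Rightarrow> int \<Rightarrow> int list" where
  "gen d a = mul (mul d [a]) (winv (rep (mul d [a])))"

lemma gen_L: "mul d [a] \<in> T \<Longrightarrow> gen d a \<in> L"
  using rep(2) by (simp add: gen_def)

text \<open>Traversing an edge of the quotient backwards inverts its Schreier generator. In this way
  negative letters are reduced to the positive ones in \<open>Edg\<close>.\<close>

lemma flip:
  assumes "d \<in> D" "mul d [a] \<in> T"
  shows "mul (rep (mul d [a])) [- a] \<in> T" "rep (mul (rep (mul d [a])) [- a]) = d"
    "gen (rep (mul d [a])) (- a) = winv (gen d a)"
proof -
  define l where "l = gen d a"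
  define d2 where "d2 = rep (mul d [a])"
  have l: "l \<in> L" using gen_L assms by (simp add: l_def)
  have d2: "d2 \<in> D" using rep(1)[OF assms(2)] by (simp add: d2_def)
  have e: "mul d [a] = mul l d2" unfolding l_def gen_def d2_def by (rule rep_decomp[OF assms(2)])
  have aa: "mul [a] [- a] = []" by (simp add: mul_def red_Cons cr_def)
  have "mul d2 [- a] = mul (winv l) (mul (mul l d2) [- a])"
    using d2 by (simp add: mul_assoc winv_mul_cancel)
  also have "\<dots> = mul (winv l) d" unfolding e[symmetric] using assms(1) by (simp add: mul_assoc aa mul_Nil_right Dred)
  finally have f: "mul d2 [- a] = mul (winv l) d" .
  have wl: "winv l \<in> L" "d \<in> T" using l LL assms DT by auto
  show "mul (rep (mul d [a])) [- a] \<in> T" using f Linv[OF wl] by (simp add: d2_def)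
  have r: "rep (mul d2 [- a]) = d" using f rep_mul[OF wl] rep_D[OF assms(1)] by simp
  then show "rep (mul (rep (mul d [a])) [- a]) = d" by (simp add: d2_def)
  have "gen d2 (- a) = mul (mul (winv l) d) (winv d)" unfolding gen_def r by (simp add: f)
  also have "\<dots> = winv l" using Lred[OF wl(1)] by (rule mul_cancel_right)
  finally have "gen d2 (- a) = winv l" .
  then show "gen (rep (mul d [a])) (- a) = winv (gen d a)" by (simp add: d2_def l_def)
qed

text \<open>The edge from \<open>d\<close> to its parent \<open>butlast d\<close> in the lifted
  spanning tree, written in its positive orientation; its Schreier generator is trivial
  (\<open>tredge_E\<close>).\<close>

definition tredge :: "int list \<Rightarrow> int list \<times> int" where
  "tredge d = (if last d > 0 then (butlast d, last d) else (d, - last d))"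

lemma butlast_D: "d \<in> D \<Longrightarrow> butlast d \<in> D"
  using Dpre[of d "length d - 1"] by (simp add: butlast_conv_take)

lemma tredge_E:
  assumes "d \<in> D" "d \<noteq> []"
  shows "tredge d \<in> Edg" "(case tredge d of (d, a) \<Rightarrow> gen d a) = []"
proof -
  obtain d' a where d: "d = d' @ [a]" using assms by (metis append_butlast_last_id)
  have a: "a \<in> letters N" using DFN[OF assms(1)] d by (auto simp: FN_carrier_def)
  then have a0: "a \<noteq> 0" by (simp add: letters_def)
  have d': "d' \<in> D" using butlast_D[OF assms(1)] d by simp
  have m: "mul d' [a] = d" using Dred[OF assms(1)] d by (simp add: mul_append_reduced)
  have m2: "mul d [- a] = d'" using Dred[OF assms(1)] d by (subst mul_snoc) auto
  show "tredge d \<in> Edg" "(case tredge d of (d, a) \<Rightarrow> gen d a) = []"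
    using d a a0 d' m m2 DT assms rep_D[OF d'] rep_D[OF assms(1)]
    by (auto simp: tredge_def Edg_def gen_def)
qed

lemma tredge_inj: "inj_on tredge (D - {[]})"
proof (rule inj_onI)
  fix x y assume h: "x \<in> D - {[]}" "y \<in> D - {[]}" "tredge x = tredge y"
  have ne: "x \<noteq> []" "y \<noteq> []" "reduced x" "reduced y" using h Dred by auto
  \<comment> \<open>If the last letters have different signs, one word would be the parent of the
    other and the two last letters would be inverse, which is impossible in a reduced word.\<close>
  have bl: "last (butlast z) \<noteq> - last z \<or> butlast z = []" if "z \<noteq> []" "reduced z" for z
  proof (rule ccontr)
    assume c: "\<not> ?thesis"
    have "z = butlast z @ [last z]" using that by simp
    then have "reduced (butlast z @ [last z])" using that by simp
    then show False using c by (auto simp: reduced_append)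
  qed
  show "x = y"
  proof (cases "last x > 0 \<longleftrightarrow> last y > 0")
    case True
    then show ?thesis using h(3) ne by (auto simp: tredge_def split: if_splits) (metis append_butlast_last_id)
  next
    case False
    then show ?thesis using h(3) ne bl[of x] bl[of y] by (auto simp: tredge_def split: if_splits)
  qed
qed

definition Gens :: "int list set" where
  "Gens = (\<lambda>(d, a). gen d a) ` (Edg - tredge ` (D - {[]}))"

lemma card_Gens: "finite Gens" "card Gens + card D \<le> card Edg + 1"
proof -
  show "finite Gens" by (simp add: Gens_def finE)
  have "tredge ` (D - {[]}) \<subseteq> Edg" by (rule image_subsetI) (use tredge_E(1) in blast)
  then have le: "card (tredge ` (D - {[]})) \<le> card Edg"
    and "card (Edg - tredge ` (D - {[]})) = card Edg - card (tredge ` (D - {[]}))"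
    using finE finD by (auto intro: card_mono simp: card_Diff_subset)
  moreover have "card (tredge ` (D - {[]})) = card D - 1"
    using card_image[OF tredge_inj] ND finD by simp
  moreover have "card Gens \<le> card (Edg - tredge ` (D - {[]}))"
    unfolding Gens_def by (rule card_image_le) (simp add: finE)
  moreover have "card D \<ge> 1" using ND finD by (metis One_nat_def Suc_leI card_gt_0_iff empty_iff)
  ultimately show "card Gens + card D \<le> card Edg + 1" by linarith
qed

lemma Gens_L: "Gens \<subseteq> L"
  using gen_L by (auto simp: Gens_def Edg_def)

lemma gen_in_generate:
  assumes "d \<in> D" "a \<in> letters N" "mul d [a] \<in> T"
  shows "gen d a \<in> generate (FN N) Gens"
proof -
  have pos: "gen d a \<in> generate (FN N) Gens" if "(d, a) \<in> Edg" for d a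
  proof (cases "(d, a) \<in> tredge ` (D - {[]})")
    case True
    then obtain x where x: "(d, a) = tredge x" "x \<in> D" "x \<noteq> []" by blast
    have "gen d a = []" using tredge_E(2)[OF x(2,3)] unfolding x(1)[symmetric] by simp
    then show ?thesis using generate.one[of "FN N" Gens] by simp
  next
    case False
    then show ?thesis using that by (intro generate.incl) (force simp: Gens_def)
  qed
  show ?thesis
  proof (cases "a > 0")
    case True
    then show ?thesis using pos assms by (simp add: Edg_def)
  next
    case False
    then have "- a > 0" using assms(2) by (auto simp: letters_def)
    then have "(rep (mul d [a]), - a) \<in> Edg" using flip[OF assms(1,3)] rep(1)[OF assms(3)] assms
      by (auto simp: Edg_def)
    then have "winv (gen d a) \<in> generate (FN N) Gens" using pos flip(3)[OF assms(1,3)] by metis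
    moreover have "Gens \<subseteq> FN_carrier N" using Gens_L LL by auto
    ultimately show ?thesis
      using FN.generate_m_inv_closed[of Gens N "winv (gen d a)"] gen_L[OF assms(3)] LL
      by (metis FN_simps(1) inv_FN subsetD winv_FN winv_winv)
  qed
qed

text \<open>Reidemeister-Schreier rewriting: while a vertex \<open>t\<close> is read letter by
  letter, \<open>mul t (winv (rep t))\<close> picks up one factor \<open>gen\<close> at each letter.
  An element of \<open>L\<close> has representative \<open>[]\<close>, so it is itself the
  product.\<close>

lemma generate_Gens: "generate (FN N) Gens = L"
proof
  show "generate (FN N) Gens \<subseteq> L"
    by (rule FN.generate_subgroup_incl[OF Gens_L L])
  have m: "mul u v \<in> generate (FN N) Gens" if "u \<in> generate (FN N) Gens" "v \<in> generate (FN N) Gens" for u v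
    using generate.eng[OF that] by simp
  have *: "t \<in> T \<Longrightarrow> mul t (winv (rep t)) \<in> generate (FN N) Gens" for t
  proof (induct t rule: rev_induct)
    case Nil
    then show ?case using rep_D[OF ND] generate.one[of "FN N" Gens] by (simp add: mul_Nil_left)
  next
    case (snoc a t)
    have t: "t \<in> T" using Tpre[OF snoc.prems, of "length t"] by simp
    define u where "u = mul t (winv (rep t))"
    have u: "u \<in> generate (FN N) Gens" using snoc.hyps[OF t] by (simp add: u_def)
    have ta: "mul t [a] = t @ [a]" using Tred[OF snoc.prems] by (rule mul_append_reduced)
    have aL: "a \<in> letters N" using TFN[OF snoc.prems] by (auto simp: FN_carrier_def)
    note rs = rep_step[OF t, of a, unfolded ta, OF snoc.prems]
    have "t @ [a] = mul u (mul (rep t) [a])"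
      unfolding u_def ta[symmetric] using t by (simp add: mul_assoc[symmetric] mul_cancel_right' Tred)
    also have "mul (rep t) [a] = mul (gen (rep t) a) (rep (t @ [a]))"
      using rep_decomp[OF rs(1)] rs(2) by (simp add: gen_def)
    finally have "mul (t @ [a]) (winv (rep (t @ [a]))) = mul u (gen (rep t) a)"
      by (metis mul_assoc mul_cancel_right reduced_mul)
    then show ?case using m[OF u gen_in_generate[OF rep(1)[OF t] aL rs(1)]] by simp
  qed
  show "L \<subseteq> generate (FN N) Gens"
  proof
    fix l assume l: "l \<in> L"
    have "rep l = []" using l LT ND by (intro rep_eq) (auto simp: mul_Nil_right Lred)
    then show "l \<in> generate (FN N) Gens" using *[of l] l LT by (auto simp: mul_Nil_right Lred)
  qed
qed

section \<open>Parity cocycles and the lower bound for the rank\<close>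

definition edge :: "(int list \<times> int) set \<Rightarrow> int list \<Rightarrow> int \<Rightarrow> bool" where
  "edge Xs d a \<longleftrightarrow> (if a > 0 then (d, a) else (rep (mul d [a]), - a)) \<in> Xs"

text \<open>\<open>cocyc Xs t\<close> is the parity of the number of crossings of edges in
  \<open>Xs\<close> on the path from the identity to \<open>t\<close>. The word is stored backwards
  so that appending a letter becomes a constructor.\<close>

primrec par :: "(int list \<times> int) set \<Rightarrow> int list \<Rightarrow> bool" where
  "par Xs [] = False"
| "par Xs (a # r) = (par Xs r \<noteq> edge Xs (rep (rev r)) a)"

definition cocyc :: "(int list \<times> int) set \<Rightarrow> int list \<Rightarrow> bool" where
  "cocyc Xs t = par Xs (rev t)"

lemma edge_flip:
  assumes "d \<in> D" "a \<noteq> 0" "mul d [a] \<in> T"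
  shows "edge Xs (rep (mul d [a])) (- a) = edge Xs d a"
  using flip[OF assms(1,3)] assms(2) by (auto simp: edge_def)

lemma cocyc_snoc: "cocyc Xs (t @ [a]) = (cocyc Xs t \<noteq> edge Xs (rep t) a)"
  by (simp add: cocyc_def)

lemma cocyc_Nil [simp]: "cocyc Xs [] = False"
  by (simp add: cocyc_def)

lemma cocyc_step:
  assumes "t \<in> T" "mul t [a] \<in> T" "a \<noteq> 0"
  shows "cocyc Xs (mul t [a]) = (cocyc Xs t \<noteq> edge Xs (rep t) a)"
proof (cases "t \<noteq> [] \<and> last t = - a")
  case False
  then show ?thesis using Tred[OF assms(1)] by (auto simp: mul_snoc cocyc_snoc)
next
  case True
  then obtain t' where t: "t = t' @ [- a]" by (metis append_butlast_last_id)
  have m: "mul t [a] = t'" using t Tred[OF assms(1)] by (subst mul_snoc) auto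
  have t': "t' \<in> T" "mul t' [- a] = t" using Tpre[OF assms(1), of "length t'"] t Tred[OF assms(1)]
    by (auto simp: mul_append_reduced)
  have rs: "mul (rep t') [- a] \<in> T" "rep (mul (rep t') [- a]) = rep t" using rep_step[OF t'(1), of "- a"] t' assms(1) by auto
  have "edge Xs (rep t) a = edge Xs (rep t') (- a)"
    using edge_flip[OF rep(1)[OF t'(1)] _ rs(1), of Xs] rs(2) assms(3) by simp
  then show ?thesis unfolding m using cocyc_snoc[of Xs t' "- a"] t by auto
qed

text \<open>The lift of \<open>Xs\<close> to \<open>T\<close> is invariant under \<open>L\<close>,
  so the path from \<open>l\<close> to \<open>mul l t\<close> has the parity of the path from the
  identity to \<open>t\<close>.\<close>

lemma cocyc_mul:
  assumes "l \<in> L"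
  shows "t \<in> T \<Longrightarrow> cocyc Xs (mul l t) = (cocyc Xs l \<noteq> cocyc Xs t)"
proof (induct t rule: rev_induct)
  case Nil
  then show ?case using assms by (simp add: mul_Nil_right Lred)
next
  case (snoc a t)
  have t: "t \<in> T" using Tpre[OF snoc.prems, of "length t"] by simp
  have a: "a \<noteq> 0" using TFN[OF snoc.prems] by (auto simp: FN_carrier_def letters_def)
  have ta: "mul t [a] = t @ [a]" using Tred[OF snoc.prems] by (rule mul_append_reduced)
  have e: "mul l (t @ [a]) = mul (mul l t) [a]" unfolding ta[symmetric] by (simp add: mul_assoc)
  have "cocyc Xs (mul l (t @ [a])) = (cocyc Xs (mul l t) \<noteq> edge Xs (rep (mul l t)) a)"
    unfolding e by (rule cocyc_step[OF Linv[OF assms t] _ a]) (use Linv[OF assms snoc.prems] e in simp)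
  then show ?case using snoc.hyps[OF t] rep_mul[OF assms t] by (auto simp: cocyc_snoc)
qed

text \<open>A mod 2 cocycle on the quotient graph is determined by its values on generators of \<open>L\<close>
  together with its values on the transversal; this bounds the number of generators from below.\<close>
lemma card_Edg_le:
  assumes S: "finite S" "generate (FN N) S = L" "S \<subseteq> L"
  shows "card Edg + 1 \<le> card S + card D"
proof -
  define \<Phi> where "\<Phi> = (\<lambda>Xs. ({s \<in> S. cocyc Xs s}, {d \<in> D - {[]}. cocyc Xs d}))"
  have inj: "inj_on \<Phi> (Pow Edg)"
  proof (rule inj_onI)
    fix Xs Ys assume XY: "Xs \<in> Pow Edg" "Ys \<in> Pow Edg" "\<Phi> Xs = \<Phi> Ys"
    have onS: "cocyc Xs s = cocyc Ys s" if "s \<in> S" for s using XY(3) that by (auto simp: \<Phi>_def)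
    have onD: "cocyc Xs d = cocyc Ys d" if "d \<in> D" for d
      using XY(3) that by (cases "d = []") (auto simp: \<Phi>_def)
    have onL: "cocyc Xs l = cocyc Ys l" if "l \<in> generate (FN N) S" for l using that
    proof (induct rule: generate.induct)
      case (inv h)
      have h: "h \<in> L" using inv S by auto
      have "cocyc Zs (winv h) = cocyc Zs h" for Zs
        using cocyc_mul[OF LL(4)[OF h], of h Zs] LT h by auto
      then show ?case using onS[OF inv] inv_FN[OF LFN[OF h]] by simp
    next
      case (eng h1 h2)
      then have "h1 \<in> L" "h2 \<in> T" using S LT by auto
      then show ?case using eng cocyc_mul by simp
    qed (use onS in auto)
    have onT: "cocyc Xs t = cocyc Ys t" if "t \<in> T" for t
    proof -
      have "rep t \<in> T" using rep(1)[OF that] DT by auto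
      then show ?thesis
        using cocyc_mul[OF rep(2)[OF that], of "rep t"] rep_decomp[OF that] onL rep[OF that] S onD by metis
    qed
    have "(d, a) \<in> Xs \<longleftrightarrow> (d, a) \<in> Ys" if "(d, a) \<in> Edg" for d a
    proof -
      have h: "d \<in> D" "a > 0" "mul d [a] \<in> T" "d \<in> T" using that DT by (auto simp: Edg_def)
      have "cocyc Zs (mul d [a]) = (cocyc Zs d \<noteq> ((d, a) \<in> Zs))" for Zs
        using cocyc_step[OF h(4,3), of Zs] h rep_D[OF h(1)] by (simp add: edge_def)
      then show ?thesis using onT[OF h(3)] onT[OF h(4)] by blast
    qed
    then show "Xs = Ys" using XY by auto
  qed
  have "\<Phi> ` Pow Edg \<subseteq> Pow S \<times> Pow (D - {[]})" by (auto simp: \<Phi>_def)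
  then have "card (Pow Edg) \<le> card (Pow S \<times> Pow (D - {[]}))"
    using inj S finD by (intro card_inj_on_le) auto
  then have "(2::nat) ^ card Edg \<le> 2 ^ (card S + card (D - {[]}))"
    using finE finD S by (simp add: card_Pow card_cartesian_product power_add)
  then have "card Edg \<le> card S + card (D - {[]})" by simp
  moreover have "card (D - {[]}) + 1 = card D" using ND finD by (metis Suc_eq_plus1 card_Suc_Diff1)
  ultimately show ?thesis by linarith
qed

lemma rank_L: "rank N L + card D = card Edg + 1"
proof -
  have ex: "\<exists>S. finite S \<and> card S = card Gens \<and> S \<subseteq> L \<and> generate (FN N) S = L"
    using card_Gens Gens_L generate_Gens by auto
  have "rank N L \<le> card Gens" unfolding rank_def by (rule Least_le) (rule ex)
  moreover obtain S where "finite S" "card S = rank N L" "S \<subseteq> L" "generate (FN N) S = L"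
    unfolding rank_def 
    using LeastI[where P="\<lambda>n. \<exists>S. finite S \<and> card S = n \<and> S \<subseteq> L \<and> generate (FN N) S = L", OF ex] by blast
  ultimately show ?thesis using card_Edg_le[of S] card_Gens(2) by linarith
qed

lemma fg_L: "fg_subgroup N L"
  using L card_Gens Gens_L generate_Gens LL(1) by (auto simp: fg_subgroup_def intro!: exI[of _ Gens])

definition deg :: "int list \<Rightarrow> nat" where
  "deg t = card {a \<in> letters N. mul t [a] \<in> T}"

text \<open>Each quotient edge has one half-edge with positive and one with negative label;
  \<open>flip\<close> exchanges them.\<close>

lemma sum_deg: "(\<Sum>d\<in>D. deg d) = 2 * card Edg"
proof -
  define En where "En = {(d, a). d \<in> D \<and> a \<in> letters N \<and> a < 0 \<and> mul d [a] \<in> T}"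
  have finn: "finite En" by (rule finite_subset[of _ "D \<times> letters N"]) (auto simp: En_def finD)
  have "(\<Sum>d\<in>D. deg d) = card (SIGMA d:D. {a \<in> letters N. mul d [a] \<in> T})"
    unfolding deg_def by (rule card_SigmaI[symmetric]) (auto simp: finD)
  also have "(SIGMA d:D. {a \<in> letters N. mul d [a] \<in> T}) = Edg \<union> En"
    by (auto simp: Edg_def En_def letters_def)
  also have "card (Edg \<union> En) = card Edg + card En"
    by (rule card_Un_disjoint) (use finE finn in auto, auto simp: Edg_def En_def)
  also have "card En = card Edg"
  proof (rule bij_betw_same_card)
    show "bij_betw (\<lambda>(d, a). (rep (mul d [a]), - a)) En Edg"
      by (rule bij_betw_byWitness[where f'="\<lambda>(d, a). (rep (mul d [a]), - a)"])
        (use flip rep(1) in \<open>force simp: Edg_def En_def\<close>)+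
  qed
  finally show ?thesis by simp
qed

end

text \<open>\<open>D\<close> is a largest subtree through the identity that meets every orbit at
  most once. If a path of \<open>T\<close> left the orbits of \<open>D\<close>, the first vertex
  beyond could be translated by \<open>L\<close> next to \<open>D\<close> and added.\<close>

lemma ex_schreier:
  assumes L: "subgroup L (FN N)" and TF: "T \<subseteq> FN_carrier N"
    and NT: "[] \<in> T" and Tpre: "\<And>w k. w \<in> T \<Longrightarrow> take k w \<in> T"
    and Linv: "\<And>l t. l \<in> L \<Longrightarrow> t \<in> T \<Longrightarrow> mul l t \<in> T"
    and fin: "finite ((\<lambda>t. L #>\<^bsub>FN N\<^esub> t) ` T)"
  obtains D where "schreier N L T D" "bij_betw (\<lambda>t. L #>\<^bsub>FN N\<^esub> t) D ((\<lambda>t. L #>\<^bsub>FN N\<^esub> t) ` T)"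
proof -
  define q where "q = (\<lambda>t. L #>\<^bsub>FN N\<^esub> t)"
  define P where "P = (\<lambda>D. D \<subseteq> T \<and> [] \<in> D \<and> (\<forall>w\<in>D. \<forall>k. take k w \<in> D) \<and> inj_on q D)"
  have finP: "finite D" "card D \<le> card (q ` T)" if "P D" for D
  proof -
    have "q ` D \<subseteq> q ` T" "inj_on q D" using that by (auto simp: P_def)
    then show "finite D" "card D \<le> card (q ` T)"
      using fin[folded q_def] by (auto intro: inj_on_finite card_inj_on_le)
  qed
  have "P {[]}" using NT by (auto simp: P_def)
  then obtain D where D: "P D" and Dmax: "\<And>D'. P D' \<Longrightarrow> card D' \<le> card D"
    using ex_has_greatest_nat[of P "{[]}" card "Suc (card (q ` T))"] finP(2) by (auto simp: less_Suc_eq_le)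
  have DT: "D \<subseteq> T" and ND: "[] \<in> D" and Dpre: "\<And>w k. w \<in> D \<Longrightarrow> take k w \<in> D" and Dinj: "inj_on q D"
    using D by (auto simp: P_def)
  have surj: "t \<in> T \<Longrightarrow> q t \<in> q ` D" for t
  proof (induct t rule: rev_induct)
    case Nil
    then show ?case using ND by auto
  next
    case (snoc a t)
    have t: "t \<in> T" using Tpre[OF snoc.prems, of "length t"] by simp
    then obtain d where d: "d \<in> D" "q t = q d" using snoc.hyps by auto
    have F: "t \<in> FN_carrier N" "d \<in> FN_carrier N" "t @ [a] \<in> FN_carrier N" using t d DT TF snoc.prems by auto
    define l where "l = mul d (winv t)"
    have l: "l \<in> L" using d F L rcos_eq_iff[of L N d t] by (simp add: l_def q_def)
    have "mul l t = d" using F by (simp add: l_def mul_cancel_right' FN_carrier_reduced)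
    then have e: "mul l (t @ [a]) = mul d [a]"
      using F(3) by (metis FN_carrier_reduced mul_append_reduced mul_assoc)
    have daT: "mul d [a] \<in> T" using Linv[OF l snoc.prems] e by simp
    have qe: "q (t @ [a]) = q (mul d [a])" unfolding q_def using rcos_mul_left[OF L F(3) l] e by simp
    show ?case
    proof (cases "d \<noteq> [] \<and> last d = - a")
      case True
      then have "mul d [a] = take (length d - 1) d" using F by (simp add: mul_snoc FN_carrier_reduced butlast_conv_take)
      then show ?thesis using Dpre[OF d(1)] qe by auto
    next
      case False
      then have da: "mul d [a] = d @ [a]" using F by (auto simp: mul_snoc FN_carrier_reduced)
      show ?thesis
      proof (rule ccontr)
        assume n: "q (t @ [a]) \<notin> q ` D"
        have "take k (d @ [a]) \<in> insert (d @ [a]) D" for k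
          using Dpre[OF d(1), of k] by (cases "k \<le> length d") auto
        then have "P (insert (d @ [a]) D)"
          using D n daT da qe by (auto simp: P_def)
        moreover have "d @ [a] \<notin> D" using n qe da by auto
        ultimately show False using Dmax[of "insert (d @ [a]) D"] finP(1)[OF D] by simp
      qed
    qed
  qed
  have F: "t \<in> FN_carrier N" if "t \<in> T" for t using that TF by auto
  have "schreier N L T D"
  proof (rule schreier.intro)
    fix t assume t: "t \<in> T"
    obtain d where d: "d \<in> D" "q t = q d" using surj[OF t] by auto
    show "\<exists>!d. d \<in> D \<and> mul t (winv d) \<in> L"
    proof (rule ex1I[of _ d])
      show "d \<in> D \<and> mul t (winv d) \<in> L"
        using d rcos_eq_iff[OF L, of t d] F t DT by (auto simp: q_def)
      fix d' assume d': "d' \<in> D \<and> mul t (winv d') \<in> L"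
      then have "q t = q d'" using rcos_eq_iff[OF L, of t d'] F t DT by (auto simp: q_def)
      then show "d' = d" using Dinj d d' by (auto simp: inj_on_def)
    qed
  qed (use L TF Tpre Linv DT ND Dpre finP(1)[OF D] in auto)
  moreover have "bij_betw q D (q ` T)" using Dinj surj DT by (auto simp: bij_betw_def)
  ultimately show ?thesis using that unfolding q_def by blast
qed

text \<open>\<open>rank N L - 1\<close> equals \<open>card Edg - card D\<close>, and each edge is
  shared out by halves to its ends. The summand is a function \<open>f\<close> of orbits, so the
  transversal is invisible from outside.\<close>

lemma rank_formula:
  assumes L: "subgroup L (FN N)" and TF: "T \<subseteq> FN_carrier N"
    and NT: "[] \<in> T" and Tpre: "\<And>w k. w \<in> T \<Longrightarrow> take k w \<in> T"
    and Linv: "\<And>l t. l \<in> L \<Longrightarrow> t \<in> T \<Longrightarrow> mul l t \<in> T"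
    and fin: "finite ((\<lambda>t. L #>\<^bsub>FN N\<^esub> t) ` T)"
    and f: "\<And>t. t \<in> T \<Longrightarrow> f (L #>\<^bsub>FN N\<^esub> t) = real (card {a \<in> letters N. mul t [a] \<in> T}) / 2 - 1"
  shows "real (rank N L) = 1 + (\<Sum>C\<in>(\<lambda>t. L #>\<^bsub>FN N\<^esub> t) ` T. f C)" and "fg_subgroup N L"
proof -
  obtain D where D: "schreier N L T D" "bij_betw (\<lambda>t. L #>\<^bsub>FN N\<^esub> t) D ((\<lambda>t. L #>\<^bsub>FN N\<^esub> t) ` T)"
    using ex_schreier[OF assms(1-6)] by blast
  interpret schreier N L T D by (rule D)
  show "fg_subgroup N L" by (rule fg_L)
  have "(\<Sum>C\<in>(\<lambda>t. L #>\<^bsub>FN N\<^esub> t) ` T. f C) = (\<Sum>d\<in>D. f (L #>\<^bsub>FN N\<^esub> d))"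
    by (rule sum.reindex_bij_betw[OF D(2), symmetric])
  also have "\<dots> = (\<Sum>d\<in>D. real (deg d) / 2 - 1)"
    by (rule sum.cong) (use f DT in \<open>auto simp: deg_def\<close>)
  also have "\<dots> = real (\<Sum>d\<in>D. deg d) / 2 - real (card D)"
    by (simp add: sum_subtractf sum_divide_distrib)
  also have "\<dots> = real (card Edg) - real (card D)" by (simp add: sum_deg)
  finally show "real (rank N L) = 1 + (\<Sum>C\<in>(\<lambda>t. L #>\<^bsub>FN N\<^esub> t) ` T. f C)" using rank_L by linarith
qed

section \<open>Topology of the space of closed subsets of the boundary\<close>

text \<open>Koenig's lemma for a space with finitely many cells at every level \<open>q n\<close>:
  if there is no finite subcover, some coherent sequence of cells has none either, yet its limit
  point has a whole cell inside one member of the cover. It serves both for closed sets of boundary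
  points and for the spaces \<open>Kc\<close>.\<close>

lemma tree_compact:
  fixes q :: "nat \<Rightarrow> 'a \<Rightarrow> 'b"
  assumes fin: "\<And>n. finite (q n ` X0)"
    and complete: "\<And>s. (\<And>n::nat. s n \<in> X0) \<Longrightarrow> (\<And>n. q n (s (Suc n)) = q n (s n)) \<Longrightarrow> \<exists>x\<in>X0. \<forall>n. q n x = q n (s n)"
    and cover: "X0 \<subseteq> \<Union>\<U>"
    and opn: "\<And>U x. U \<in> \<U> \<Longrightarrow> x \<in> U \<Longrightarrow> x \<in> X0 \<Longrightarrow> \<exists>n. \<forall>y\<in>X0. q n y = q n x \<longrightarrow> y \<in> U"
  shows "\<exists>\<V>. finite \<V> \<and> \<V> \<subseteq> \<U> \<and> X0 \<subseteq> \<Union>\<V>"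
proof (rule ccontr)
  assume nf: "\<not> ?thesis"
  define bad where "bad = (\<lambda>Y. \<not> (\<exists>\<V>. finite \<V> \<and> \<V> \<subseteq> \<U> \<and> Y \<subseteq> \<Union>\<V>))"
  define cell where "cell = (\<lambda>n x. {y \<in> X0. q n y = q n x})"
  have split: "\<exists>y\<in>Y. bad (cell n y)" if "bad Y" "Y \<subseteq> X0" for Y n
  proof (rule ccontr)
    assume "\<not> ?thesis"
    then have "\<forall>y\<in>Y. \<exists>\<V>. finite \<V> \<and> \<V> \<subseteq> \<U> \<and> cell n y \<subseteq> \<Union>\<V>" by (auto simp: bad_def)
    then obtain V where V: "\<And>y. y \<in> Y \<Longrightarrow> finite (V y) \<and> V y \<subseteq> \<U> \<and> cell n y \<subseteq> \<Union>(V y)" by metis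
    define r where "r = (\<lambda>v. SOME y. y \<in> Y \<and> q n y = v)"
    have r: "r (q n y) \<in> Y \<and> q n (r (q n y)) = q n y" if "y \<in> Y" for y
      unfolding r_def by (rule someI) (use that in auto)
    define W where "W = (\<Union>v\<in>q n ` Y. V (r v))"
    have "finite (q n ` Y)" using fin[of n] that(2) by (meson finite_subset image_mono)
    then have "finite W" unfolding W_def by (rule finite_UN_I) (use V r in blast)
    moreover have "W \<subseteq> \<U>" using V r by (force simp: W_def)
    moreover have "Y \<subseteq> \<Union>W"
    proof
      fix y assume y: "y \<in> Y"
      have "y \<in> cell n (r (q n y))" using r[OF y] y that(2) by (auto simp: cell_def)
      then have "y \<in> \<Union>(V (r (q n y)))" using V r[OF y] by blast
      then show "y \<in> \<Union>W" using y by (auto simp: W_def)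
    qed
    ultimately show False using that(1) by (auto simp: bad_def)
  qed
  have "bad X0" using nf by (simp add: bad_def)
  then obtain x0 where x0: "x0 \<in> X0" "bad (cell 0 x0)" using split[of X0 0] by auto
  have "\<exists>s. \<forall>n. (s n \<in> X0 \<and> bad (cell n (s n))) \<and> q n (s (Suc n)) = q n (s n)"
  proof (rule dependent_nat_choice)
    show "\<exists>x. x \<in> X0 \<and> bad (cell 0 x)" using x0 by auto
    fix x n assume h: "x \<in> X0 \<and> bad (cell n x)"
    then obtain y where "y \<in> cell n x" "bad (cell (Suc n) y)" using split[of "cell n x" "Suc n"]
      by (auto simp: cell_def)
    then show "\<exists>y. (y \<in> X0 \<and> bad (cell (Suc n) y)) \<and> q n y = q n x" by (auto simp: cell_def)
  qed
  then obtain s where s: "\<And>n. s n \<in> X0" "\<And>n. bad (cell n (s n))" "\<And>n. q n (s (Suc n)) = q n (s n)" by blast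
  obtain x where x: "x \<in> X0" "\<forall>n. q n x = q n (s n)" using complete[of s] s by blast
  obtain U where U: "U \<in> \<U>" "x \<in> U" using cover x by auto
  obtain n where n: "\<forall>y\<in>X0. q n y = q n x \<longrightarrow> y \<in> U" using opn[OF U x(1)] by blast
  have "cell n (s n) \<subseteq> U" using n x by (auto simp: cell_def)
  then have "finite {U} \<and> {U} \<subseteq> \<U> \<and> cell n (s n) \<subseteq> \<Union>{U}" using U by simp
  then show False using s(2)[of n] unfolding bad_def by blast
qed

text \<open>The pattern of \<open>S\<close> at level \<open>n\<close>. Sets with a common pattern
  form the basic open sets of the Vietoris topology (\<open>openin_CT\<close>), so continuity and
  compactness become combinatorial.\<close>

definition Pl :: "nat \<Rightarrow> (nat \<Rightarrow> int) set \<Rightarrow> int list set" where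
  "Pl n S = (\<lambda>\<xi>. pre \<xi> n) ` S"

lemma Pl_take: "k \<le> n \<Longrightarrow> Pl k S = take k ` Pl n S"
  by (simp add: Pl_def image_image take_pre min_absorb1)

lemma Pl_mono: "Pl n S = Pl n S' \<Longrightarrow> k \<le> n \<Longrightarrow> Pl k S = Pl k S'"
  by (metis Pl_take)

lemma Pl_words: "S \<subseteq> bd N \<Longrightarrow> Pl n S \<subseteq> {w \<in> FN_carrier N. length w \<le> n}"
  by (auto simp: Pl_def pre_FN)

lemma finite_Pl: "S \<subseteq> bd N \<Longrightarrow> finite (Pl n S)"
  using Pl_words finite_FN_length finite_subset by metis

lemma finite_Pl_image: "(\<And>S. S \<in> X0 \<Longrightarrow> S \<subseteq> bd N) \<Longrightarrow> finite (Pl n ` X0)"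
  by (rule finite_subset[of _ "Pow {w \<in> FN_carrier N. length w \<le> n}"])
    (auto simp: finite_FN_length dest!: Pl_words[of _ N n])

section \<open>Topology of the boundary\<close>

lemma bd_complete:
  assumes "\<And>n. s n \<in> bd N" "\<And>n. pre (s (Suc n)) n = pre (s n) n"
  obtains \<xi> where "\<xi> \<in> bd N" "\<And>n. pre \<xi> n = pre (s n) n"
proof -
  define \<xi> where "\<xi> = (\<lambda>i. s (Suc i) i)"
  have m: "n \<le> m \<Longrightarrow> pre (s m) n = pre (s n) n" for n m
  proof (induct m)
    case (Suc m)
    then show ?case using assms(2)[of m] pre_eq_mono[of "s (Suc m)" m "s m" n] by (cases "n = Suc m") auto
  qed simp
  have p: "pre \<xi> n = pre (s n) n" for n
  proof -
    have "\<xi> i = s n i" if "i < n" for i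
      using m[of "Suc i" n] that by (auto simp: pre_eq_iff \<xi>_def)
    then show ?thesis by (simp add: pre_eq_iff)
  qed
  have "\<xi> \<in> bd N"
    by (rule agrees_all_bd) (use p pre_FN[OF assms(1)] in \<open>force simp: agrees_def\<close>)
  then show ?thesis using that p by blast
qed

lemma openin_bdT:
  "openin (bdT N) U \<longleftrightarrow> U \<subseteq> bd N \<and> (\<forall>\<xi>\<in>U. \<exists>n. \<forall>\<eta>\<in>bd N. pre \<eta> n = pre \<xi> n \<longrightarrow> \<eta> \<in> U)"
proof
  define B where "B = {{\<xi> \<in> bd N. pre \<xi> (length w) = w} | w. w \<in> FN_carrier N}"
  have T: "bdT N = topology_generated_by B" by (simp add: bdT_def B_def)
  {
    assume "openin (bdT N) U"
    then have "generate_topology_on B U" by (simp add: T openin_topology_generated_by_iff)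
    then show "U \<subseteq> bd N \<and> (\<forall>\<xi>\<in>U. \<exists>n. \<forall>\<eta>\<in>bd N. pre \<eta> n = pre \<xi> n \<longrightarrow> \<eta> \<in> U)"
    proof induct
      case (Int a b)
      have "\<exists>n. \<forall>\<eta>\<in>bd N. pre \<eta> n = pre \<xi> n \<longrightarrow> \<eta> \<in> a \<inter> b" if "\<xi> \<in> a \<inter> b" for \<xi>
      proof -
        have "\<xi> \<in> a" "\<xi> \<in> b" using that by auto
        obtain n where n: "\<forall>\<eta>\<in>bd N. pre \<eta> n = pre \<xi> n \<longrightarrow> \<eta> \<in> a" using \<open>\<xi> \<in> a\<close> Int.hyps by blast
        obtain m where m: "\<forall>\<eta>\<in>bd N. pre \<eta> m = pre \<xi> m \<longrightarrow> \<eta> \<in> b" using \<open>\<xi> \<in> b\<close> Int.hyps by blast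
        show ?thesis
          by (rule exI[of _ "max n m"]) (metis n m pre_eq_mono IntI max.cobounded1 max.cobounded2)
      qed
      then show ?case using Int by auto
    next
      case (UN K)
      have "\<exists>n. \<forall>\<eta>\<in>bd N. pre \<eta> n = pre \<xi> n \<longrightarrow> \<eta> \<in> \<Union>K" if \<xi>: "\<xi> \<in> \<Union>K" for \<xi>
      proof -
        obtain k where k: "k \<in> K" "\<xi> \<in> k" using \<xi> by blast
        then obtain n where "\<forall>\<eta>\<in>bd N. pre \<eta> n = pre \<xi> n \<longrightarrow> \<eta> \<in> k" using UN by blast
        then show ?thesis using k by blast
      qed
      moreover have "\<Union>K \<subseteq> bd N" using UN by blast
      ultimately show ?case by blast
    next
      case (Basis s)
      then obtain w where "s = {\<xi> \<in> bd N. pre \<xi> (length w) = w}" by (auto simp: B_def)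
      then show ?case by (auto intro!: exI[of _ "length w"])
    qed simp
  next
    assume h: "U \<subseteq> bd N \<and> (\<forall>\<xi>\<in>U. \<exists>n. \<forall>\<eta>\<in>bd N. pre \<eta> n = pre \<xi> n \<longrightarrow> \<eta> \<in> U)"
    show "openin (bdT N) U"
    proof (subst openin_subopen, intro ballI)
      fix \<xi> assume \<xi>: "\<xi> \<in> U"
      then obtain n where n: "\<forall>\<eta>\<in>bd N. pre \<eta> n = pre \<xi> n \<longrightarrow> \<eta> \<in> U" using h by blast
      have "\<xi> \<in> bd N" using h \<xi> by auto
      then have "{\<eta> \<in> bd N. pre \<eta> (length (pre \<xi> n)) = pre \<xi> n} \<in> B" using pre_FN unfolding B_def by blast
      then have "openin (bdT N) {\<eta> \<in> bd N. pre \<eta> n = pre \<xi> n}"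
        unfolding T using topology_generated_by_Basis by fastforce
      then show "\<exists>V. openin (bdT N) V \<and> \<xi> \<in> V \<and> V \<subseteq> U"
        using n \<open>\<xi> \<in> bd N\<close> by (intro exI[of _ "{\<eta> \<in> bd N. pre \<eta> n = pre \<xi> n}"]) auto
    qed
  }
qed

lemma topspace_bdT [simp]: "topspace (bdT N) = bd N"
proof
  show "topspace (bdT N) \<subseteq> bd N" using openin_topspace[of "bdT N"] by (simp add: openin_bdT del: openin_topspace)
  have "openin (bdT N) (bd N)" by (auto simp: openin_bdT)
  then show "bd N \<subseteq> topspace (bdT N)" by (rule openin_subset)
qed

lemma closedin_bdT:
  "closedin (bdT N) S \<longleftrightarrow> S \<subseteq> bd N \<and> (\<forall>\<xi>\<in>bd N. (\<forall>n. \<exists>\<eta>\<in>S. pre \<eta> n = pre \<xi> n) \<longrightarrow> \<xi> \<in> S)"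
  unfolding closedin_def openin_bdT topspace_bdT by (auto 4 4)

section \<open>Cells and compact sets in the space of closed subsets\<close>

definition Zc :: "nat \<Rightarrow> nat \<Rightarrow> int list set \<Rightarrow> (nat \<Rightarrow> int) set set" where
  "Zc N n W = {S \<in> CN N. Pl n S = W}"

text \<open>A sequence in \<open>CN N\<close> may shrink to a point, so the space is exhausted by
  these open sets, on which two points are already told apart at level \<open>n\<close>. Each is
  compact, and every compact set lies in one of them.\<close>

definition Kc :: "nat \<Rightarrow> nat \<Rightarrow> (nat \<Rightarrow> int) set set" where
  "Kc N n = {S \<in> CN N. 2 \<le> card (Pl n S)}"

lemma CN_iff: "S \<in> CN N \<longleftrightarrow> closedin (bdT N) S \<and> (\<exists>\<xi>\<in>S. \<exists>\<eta>\<in>S. \<xi> \<noteq> \<eta>)"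
  by (auto simp: CN_def)

lemma CN_bd: "S \<in> CN N \<Longrightarrow> S \<subseteq> bd N"
  by (auto simp: CN_def closedin_bdT)

text \<open>Compactness of \<open>S\<close> yields one prefix length for all its points; this
  handles the Vietoris sets of the form \<open>S \<subseteq> U\<close>.\<close>

lemma closed_sub_uniform:
  assumes "closedin (bdT N) S" "openin (bdT N) U" "S \<subseteq> U"
  obtains n where "\<And>\<xi>. \<xi> \<in> bd N \<Longrightarrow> pre \<xi> n \<in> Pl n S \<Longrightarrow> \<xi> \<in> U"
proof -
  define V where "V = (\<lambda>n. {\<xi> \<in> S. \<forall>\<eta>\<in>bd N. pre \<eta> n = pre \<xi> n \<longrightarrow> \<eta> \<in> U})"
  have Sbd: "S \<subseteq> bd N" using assms(1) by (simp add: closedin_bdT)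
  have "\<exists>\<V>. finite \<V> \<and> \<V> \<subseteq> range V \<and> S \<subseteq> \<Union>\<V>"
  proof (rule tree_compact[where q="\<lambda>n \<xi>. pre \<xi> n"])
    show "finite ((\<lambda>\<xi>. pre \<xi> n) ` S)" for n using finite_Pl[OF Sbd, of n] by (simp add: Pl_def)
    show "S \<subseteq> \<Union> (range V)" using assms(2,3) unfolding openin_bdT V_def by blast
    show "\<exists>n. \<forall>y\<in>S. pre y n = pre x n \<longrightarrow> y \<in> U'" if U': "U' \<in> range V" "x \<in> U'" "x \<in> S" for U' x
    proof -
      obtain i where "U' = V i" using U'(1) by auto
      then show ?thesis using U'(2) by (intro exI[of _ i]) (auto simp: V_def)
    qed
    fix s assume s: "\<And>n::nat. s n \<in> S" "\<And>n. pre (s (Suc n)) n = pre (s n) n"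
    obtain \<xi> where \<xi>: "\<xi> \<in> bd N" "\<And>n. pre \<xi> n = pre (s n) n"
      using bd_complete[of s N] s Sbd by blast
    then have "\<xi> \<in> S" using assms(1) s unfolding closedin_bdT by metis
    then show "\<exists>x\<in>S. \<forall>n. pre x n = pre (s n) n" using \<xi> by auto
  qed
  then obtain I where I: "finite I" "S \<subseteq> \<Union>(V ` I)" by (metis finite_subset_image subset_UNIV)
  define n where "n = Max (insert 0 I)"
  have "\<xi> \<in> U" if xi: "\<xi> \<in> bd N" "pre \<xi> n \<in> Pl n S" for \<xi>
  proof -
    obtain \<eta> where \<eta>: "\<eta> \<in> S" "pre \<xi> n = pre \<eta> n" using xi by (auto simp: Pl_def)
    obtain i where i: "i \<in> I" "\<eta> \<in> V i" using I \<eta> by auto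
    have "i \<le> n" unfolding n_def using I i by (intro Max_ge) auto
    then have "pre \<xi> i = pre \<eta> i" using \<eta> pre_eq_mono by metis
    then show ?thesis using i xi by (auto simp: V_def)
  qed
  then show ?thesis using that by blast
qed

lemma openin_vietoris_bdT:
  assumes "openin (vietoris (bdT N)) U" "S \<in> U"
  shows "\<exists>n. \<forall>S'. closedin (bdT N) S' \<and> Pl n S' = Pl n S \<longrightarrow> S' \<in> U"
proof -
  define B where "B = {{S. closedin (bdT N) S \<and> S \<subseteq> U} | U. openin (bdT N) U} \<union>
      {{S. closedin (bdT N) S \<and> S \<inter> U \<noteq> {}} | U. openin (bdT N) U}"
  have "generate_topology_on B U" using assms(1)
    by (simp add: vietoris_def B_def openin_topology_generated_by_iff)
  then show ?thesis using assms(2)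
  proof (induct arbitrary: S)
    case (Int a b)
    then obtain n m where "\<forall>S'. closedin (bdT N) S' \<and> Pl n S' = Pl n S \<longrightarrow> S' \<in> a"
      "\<forall>S'. closedin (bdT N) S' \<and> Pl m S' = Pl m S \<longrightarrow> S' \<in> b" by blast
    then show ?case by (intro exI[of _ "max n m"]) (metis IntI Pl_mono max.cobounded1 max.cobounded2)
  next
    case (UN K)
    then obtain k where k: "k \<in> K" "S \<in> k" by blast
    then obtain n where "\<forall>S'. closedin (bdT N) S' \<and> Pl n S' = Pl n S \<longrightarrow> S' \<in> k" using UN by blast
    then show ?case using k by blast
  next
    case (Basis s)
    then consider (1) V where "openin (bdT N) V" "s = {S. closedin (bdT N) S \<and> S \<subseteq> V}"
      | (2) V where "openin (bdT N) V" "s = {S. closedin (bdT N) S \<and> S \<inter> V \<noteq> {}}"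
      unfolding B_def by blast
    then show ?case
    proof cases
      case 1
      obtain n where n: "\<And>\<xi>. \<xi> \<in> bd N \<Longrightarrow> pre \<xi> n \<in> Pl n S \<Longrightarrow> \<xi> \<in> V"
        using closed_sub_uniform[of N S V] 1 Basis by auto
      have "S' \<subseteq> V" if "closedin (bdT N) S'" "Pl n S' = Pl n S" for S'
      proof
        fix \<xi> assume "\<xi> \<in> S'"
        then show "\<xi> \<in> V" using that n[of \<xi>] by (auto simp: closedin_bdT Pl_def)
      qed
      then show ?thesis using 1 by auto
    next
      case 2
      then obtain \<xi> where \<xi>: "\<xi> \<in> S" "\<xi> \<in> V" using Basis by auto
      obtain n where n: "\<forall>\<eta>\<in>bd N. pre \<eta> n = pre \<xi> n \<longrightarrow> \<eta> \<in> V" using 2 \<xi> by (auto simp: openin_bdT)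
      have "S' \<inter> V \<noteq> {}" if "closedin (bdT N) S'" "Pl n S' = Pl n S" for S'
      proof -
        have "pre \<xi> n \<in> Pl n S'" using that \<xi> by (simp add: Pl_def)
        then show ?thesis using that n by (auto simp: Pl_def closedin_bdT) force
      qed
      then show ?thesis using 2 by auto
    qed
  qed simp
qed

lemma topspace_CT [simp]: "topspace (CT N) = CN N"
proof -
  have "openin (vietoris (bdT N)) {S. closedin (bdT N) S \<and> S \<subseteq> bd N}"
    unfolding vietoris_def by (rule topology_generated_by_Basis) (use openin_topspace[of "bdT N"] in force)
  then have "{S. closedin (bdT N) S \<and> S \<subseteq> bd N} \<subseteq> topspace (vietoris (bdT N))" by (rule openin_subset)
  moreover have "CN N \<subseteq> {S. closedin (bdT N) S \<and> S \<subseteq> bd N}" by (auto simp: CN_def closedin_bdT)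
  ultimately show ?thesis by (auto simp: CT_def)
qed

lemma openin_CT_Zc:
  assumes "S \<in> CN N"
  shows "openin (CT N) (Zc N n (Pl n S))"
proof -
  define A where "A = {\<xi> \<in> bd N. pre \<xi> n \<in> Pl n S}"
  define C where "C = (\<lambda>w. {S'. closedin (bdT N) S' \<and> S' \<inter> {\<xi> \<in> bd N. pre \<xi> n = w} \<noteq> {}})"
  have oA: "openin (bdT N) A" unfolding openin_bdT A_def by (auto intro!: exI[of _ n])
  have oC: "openin (bdT N) {\<xi> \<in> bd N. pre \<xi> n = w}" for w unfolding openin_bdT by (auto intro!: exI[of _ n])
  have 1: "openin (vietoris (bdT N)) {S'. closedin (bdT N) S' \<and> S' \<subseteq> A}"
    unfolding vietoris_def by (rule topology_generated_by_Basis) (use oA in blast)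
  have "openin (vietoris (bdT N)) (C w)" for w
    unfolding vietoris_def C_def by (rule topology_generated_by_Basis) (use oC in blast)
  then have "openin (vietoris (bdT N)) ((\<Inter>w\<in>Pl n S. C w) \<inter> topspace (vietoris (bdT N)))"
    using finite_Pl[OF CN_bd[OF assms]] by (intro openin_INT) auto
  then have "openin (vietoris (bdT N)) ({S'. closedin (bdT N) S' \<and> S' \<subseteq> A} \<inter> ((\<Inter>w\<in>Pl n S. C w) \<inter> topspace (vietoris (bdT N))))"
    using 1 by (rule openin_Int[rotated])
  then have "openin (CT N) ({S'. closedin (bdT N) S' \<and> S' \<subseteq> A} \<inter> ((\<Inter>w\<in>Pl n S. C w) \<inter> topspace (vietoris (bdT N))) \<inter> CN N)"
    unfolding CT_def openin_subtopology by blast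
  also have "{S'. closedin (bdT N) S' \<and> S' \<subseteq> A} \<inter> ((\<Inter>w\<in>Pl n S. C w) \<inter> topspace (vietoris (bdT N))) \<inter> CN N
      = Zc N n (Pl n S)" (is "?L = _")
  proof (intro equalityI subsetI)
    fix S' assume h: "S' \<in> ?L"
    then have "Pl n S' \<subseteq> Pl n S" by (auto simp: A_def Pl_def)
    moreover have "Pl n S \<subseteq> Pl n S'"
    proof
      fix w assume "w \<in> Pl n S"
      then have "S' \<inter> {\<xi> \<in> bd N. pre \<xi> n = w} \<noteq> {}" using h unfolding C_def by blast
      then show "w \<in> Pl n S'" by (auto simp: Pl_def)
    qed
    ultimately show "S' \<in> Zc N n (Pl n S)" using h by (auto simp: Zc_def)
  next
    fix S' assume h: "S' \<in> Zc N n (Pl n S)"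
    then have S': "S' \<in> CN N" "Pl n S' = Pl n S" "closedin (bdT N) S'" "S' \<subseteq> bd N"
      by (auto simp: Zc_def CN_iff closedin_bdT)
    have "S' \<subseteq> A" using S' by (auto simp: A_def Pl_def)
    moreover have "S' \<in> C w" if "w \<in> Pl n S" for w
    proof -
      have "w \<in> Pl n S'" using that S' by simp
      then obtain \<xi> where "\<xi> \<in> S'" "w = pre \<xi> n" by (auto simp: Pl_def)
      then show ?thesis using S' by (auto simp: C_def)
    qed
    moreover have "S' \<in> topspace (vietoris (bdT N))" using S'(1) topspace_CT[of N] unfolding CT_def by auto
    ultimately show "S' \<in> ?L" using S' by auto
  qed
  finally show ?thesis .
qed

lemma openin_CT:
  "openin (CT N) U \<longleftrightarrow> U \<subseteq> CN N \<and> (\<forall>S\<in>U. \<exists>n. \<forall>S'\<in>CN N. Pl n S' = Pl n S \<longrightarrow> S' \<in> U)"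
proof
  assume U: "openin (CT N) U"
  then obtain V where V: "openin (vietoris (bdT N)) V" "U = V \<inter> CN N"
    unfolding CT_def openin_subtopology by auto
  have "\<exists>n. \<forall>S'\<in>CN N. Pl n S' = Pl n S \<longrightarrow> S' \<in> U" if "S \<in> U" for S
  proof -
    have "S \<in> V" using that V(2) by simp
    then obtain n where "\<forall>S'. closedin (bdT N) S' \<and> Pl n S' = Pl n S \<longrightarrow> S' \<in> V"
      using openin_vietoris_bdT[OF V(1), of S] V(2) \<open>S \<in> U\<close> by blast
    then show ?thesis using V(2) by (intro exI[of _ n]) (auto simp: CN_iff)
  qed
  then show "U \<subseteq> CN N \<and> (\<forall>S\<in>U. \<exists>n. \<forall>S'\<in>CN N. Pl n S' = Pl n S \<longrightarrow> S' \<in> U)" using V by auto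
next
  assume h: "U \<subseteq> CN N \<and> (\<forall>S\<in>U. \<exists>n. \<forall>S'\<in>CN N. Pl n S' = Pl n S \<longrightarrow> S' \<in> U)"
  show "openin (CT N) U"
  proof (subst openin_subopen, intro ballI)
    fix S assume S: "S \<in> U"
    then obtain n where n: "\<forall>S'\<in>CN N. Pl n S' = Pl n S \<longrightarrow> S' \<in> U" using h by blast
    have "S \<in> CN N" using h S by auto
    then show "\<exists>V. openin (CT N) V \<and> S \<in> V \<and> V \<subseteq> U"
      using openin_CT_Zc[of S N n] n by (intro exI[of _ "Zc N n (Pl n S)"]) (auto simp: Zc_def)
  qed
qed

lemma openin_CT_level: "openin (CT N) {S \<in> CN N. R (Pl n S)}"
  and closedin_CT_level: "closedin (CT N) {S \<in> CN N. R (Pl n S)}"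
proof -
  show o: "openin (CT N) {S \<in> CN N. R (Pl n S)}" for R unfolding openin_CT by (auto intro!: exI[of _ n])
  have "CN N - {S \<in> CN N. R (Pl n S)} = {S \<in> CN N. \<not> R (Pl n S)}" by auto
  then show "closedin (CT N) {S \<in> CN N. R (Pl n S)}"
    unfolding closedin_def using o[of "\<lambda>P. \<not> R P"] by auto
qed

lemma Kc_mono:
  assumes "m \<le> n"
  shows "Kc N m \<subseteq> Kc N n"
proof
  fix S assume S: "S \<in> Kc N m"
  then have "card (Pl m S) \<le> card (Pl n S)"
    unfolding Pl_take[OF assms] by (intro card_image_le finite_Pl[OF CN_bd[of S N]]) (simp add: Kc_def)
  then show "S \<in> Kc N n" using S by (auto simp: Kc_def)
qed

lemma two_le_card_iff: "finite A \<Longrightarrow> 2 \<le> card A \<longleftrightarrow> (\<exists>x\<in>A. \<exists>y\<in>A. x \<noteq> y)"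
  by (metis (full_types) One_nat_def Suc_1 card_le_Suc0_iff_eq not_less_eq_eq)

lemma ex_Kc:
  assumes "S \<in> CN N"
  obtains m where "S \<in> Kc N m"
proof -
  obtain \<xi> \<eta> where h: "\<xi> \<in> S" "\<eta> \<in> S" "\<xi> \<noteq> \<eta>" using assms by (auto simp: CN_iff)
  then obtain n where "\<xi> n \<noteq> \<eta> n" by auto
  then have "pre \<xi> (Suc n) \<noteq> pre \<eta> (Suc n)" by (auto simp: pre_eq_iff)
  then have "2 \<le> card (Pl (Suc n) S)"
    unfolding two_le_card_iff[OF finite_Pl[OF CN_bd[OF assms]]] using h by (auto simp: Pl_def)
  then show ?thesis using that assms by (auto simp: Kc_def)
qed

text \<open>A coherent sequence of patterns has as its limit the set \<open>S\<close> of all rays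
  whose prefixes all occur. Two different prefixes at level \<open>m\<close> survive in the limit,
  so it does not degenerate to a point.\<close>

lemma compactin_Kc: "compactin (CT N) (Kc N m)"
  unfolding compactin_def
proof (intro conjI allI impI)
  show "Kc N m \<subseteq> topspace (CT N)" by (auto simp: Kc_def)
  fix \<U> assume U: "(\<forall>U\<in>\<U>. openin (CT N) U) \<and> Kc N m \<subseteq> \<Union>\<U>"
  have "\<exists>\<V>. finite \<V> \<and> \<V> \<subseteq> \<U> \<and> Kc N m \<subseteq> \<Union>\<V>"
  proof (rule tree_compact[where q=Pl])
    show "finite (Pl n ` Kc N m)" for n by (rule finite_Pl_image[where N=N]) (use CN_bd in \<open>auto simp: Kc_def\<close>)
    show "Kc N m \<subseteq> \<Union>\<U>" using U by simp
    show "\<exists>n. \<forall>y\<in>Kc N m. Pl n y = Pl n x \<longrightarrow> y \<in> V" if V: "V \<in> \<U>" "x \<in> V" "x \<in> Kc N m" for V x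
    proof -
      obtain n where "\<forall>S'\<in>CN N. Pl n S' = Pl n x \<longrightarrow> S' \<in> V" using U V unfolding openin_CT by blast
      then show ?thesis by (intro exI[of _ n]) (simp add: Kc_def)
    qed
    fix s assume s: "\<And>n::nat. s n \<in> Kc N m" "\<And>n. Pl n (s (Suc n)) = Pl n (s n)"
    define S where "S = {\<xi> \<in> bd N. \<forall>n. pre \<xi> n \<in> Pl n (s n)}"
    have sc: "s n \<in> CN N" "s n \<subseteq> bd N" for n using s(1)[of n] CN_bd by (auto simp: Kc_def)
    have PS: "Pl n S = Pl n (s n)" for n
    proof
      show "Pl n S \<subseteq> Pl n (s n)" by (auto simp: S_def Pl_def)
      show "Pl n (s n) \<subseteq> Pl n S"
      proof
        fix w assume w: "w \<in> Pl n (s n)"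
        then obtain \<xi>0 where x0: "\<xi>0 \<in> s n" "pre \<xi>0 n = w" by (auto simp: Pl_def)
        \<comment> \<open>To find a ray of \<open>S\<close> through the prefix \<open>w\<close>,
          points of \<open>s (n + k)\<close> are chosen so that each continues the prefix of the
          previous one.\<close>
        have "\<exists>z. \<forall>k. (z k \<in> s (n + k)) \<and> pre (z (Suc k)) (n + k) = pre (z k) (n + k) \<and> (k = 0 \<longrightarrow> z k = \<xi>0)"
        proof -
          have "\<exists>z. \<forall>k. (z k \<in> s (n + k) \<and> (k = 0 \<longrightarrow> z k = \<xi>0)) \<and> pre (z (Suc k)) (n + k) = pre (z k) (n + k)"
          proof (rule dependent_nat_choice)
            show "\<exists>x. x \<in> s (n + 0) \<and> (0 = (0::nat) \<longrightarrow> x = \<xi>0)" using x0 by auto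
            fix x k assume x: "x \<in> s (n + k) \<and> (k = 0 \<longrightarrow> x = \<xi>0)"
            then have "pre x (n + k) \<in> Pl (n + k) (s (Suc (n + k)))" unfolding s(2) by (auto simp: Pl_def)
            then show "\<exists>y. (y \<in> s (n + Suc k) \<and> (Suc k = 0 \<longrightarrow> y = \<xi>0)) \<and> pre y (n + k) = pre x (n + k)"
              by (auto simp: Pl_def)
          qed
          then show ?thesis by blast
        qed
        then obtain z where z: "\<And>k. z k \<in> s (n + k)" "\<And>k. pre (z (Suc k)) (n + k) = pre (z k) (n + k)" "z 0 = \<xi>0"
          by metis
        \<comment> \<open>Reindexing by the level, constant up to \<open>n\<close>, so that
          \<open>bd_complete\<close> applies from level 0 on.\<close>
        define y where "y = (\<lambda>j. if j \<le> n then z 0 else z (j - n))"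
        have ybd: "y j \<in> bd N" for j using z(1) sc by (auto simp: y_def)
        have ystep: "pre (y (Suc j)) j = pre (y j) j" for j
        proof (cases "j < n")
          case False
          then obtain k where "j = n + k" by (metis le_add_diff_inverse not_less)
          then show ?thesis using z(2)[of k] by (cases k) (auto simp: y_def)
        qed (simp add: y_def)
        obtain \<xi> where \<xi>: "\<xi> \<in> bd N" "\<And>j. pre \<xi> j = pre (y j) j"
          using bd_complete[of y N] ybd ystep by blast
        have big: "pre \<xi> (n + k) \<in> Pl (n + k) (s (n + k))" for k
        proof -
          have "y (n + k) = z k" by (simp add: y_def)
          then show ?thesis using \<xi>(2)[of "n + k"] z(1)[of k] by (auto simp: Pl_def)
        qed
        have dn: "Pl j (s (j + k)) = Pl j (s j)" for j k
        proof (induct k)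
          case (Suc k)
          then show ?case using Pl_mono[OF s(2)[of "j + k"], of j] by simp
        qed simp
        have "pre \<xi> j \<in> Pl j (s j)" for j
        proof (cases "j \<le> n")
          case True
          have "pre \<xi> n \<in> Pl n (s n)" using big[of 0] by simp
          then have "take j (pre \<xi> n) \<in> take j ` Pl n (s n)" by (rule imageI)
          then have "pre \<xi> j \<in> Pl j (s n)" using True Pl_take[OF True, of "s n"] by (simp add: take_pre min_absorb1)
          then show ?thesis using dn[of j "n - j"] True by simp
        next
          case False
          then show ?thesis using big[of "j - n"] by simp
        qed
        then have "\<xi> \<in> S" using \<xi> by (simp add: S_def)
        moreover have "pre \<xi> n = w" using \<xi>(2)[of n] z(3) x0 by (simp add: y_def)
        ultimately show "w \<in> Pl n S" by (auto simp: Pl_def)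
      qed
    qed
    have "closedin (bdT N) S" unfolding closedin_bdT
    proof (intro conjI ballI impI)
      fix \<xi> assume \<xi>: "\<xi> \<in> bd N" "\<forall>n. \<exists>\<eta>\<in>S. pre \<eta> n = pre \<xi> n"
      have "pre \<xi> n \<in> Pl n (s n)" for n
      proof -
        obtain \<eta> where \<eta>: "\<eta> \<in> S" "pre \<eta> n = pre \<xi> n" using \<xi> by blast
        have "pre \<eta> n \<in> Pl n S" unfolding Pl_def using \<eta>(1) by (rule imageI)
        then show ?thesis using PS[of n] \<eta>(2) by simp
      qed
      then show "\<xi> \<in> S" using \<xi> by (simp add: S_def)
    qed (simp add: S_def)
    moreover have "2 \<le> card (Pl m S)" using PS[of m] s(1)[of m] by (simp add: Kc_def)
    moreover have "\<exists>\<xi>\<in>S. \<exists>\<eta>\<in>S. \<xi> \<noteq> \<eta>"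
    proof -
      have "finite (Pl m S)" by (rule finite_Pl[of _ N]) (auto simp: S_def)
      then obtain x y where xy: "x \<in> Pl m S" "y \<in> Pl m S" "x \<noteq> y"
        using \<open>2 \<le> card (Pl m S)\<close> two_le_card_iff[of "Pl m S"] by blast
      obtain \<xi> where "\<xi> \<in> S" "x = pre \<xi> m" using xy(1) unfolding Pl_def by blast
      moreover obtain \<eta> where "\<eta> \<in> S" "y = pre \<eta> m" using xy(2) unfolding Pl_def by blast
      ultimately show ?thesis using xy(3) by (intro bexI[of _ \<xi>] bexI[of _ \<eta>]) auto
    qed
    ultimately have "S \<in> Kc N m" by (simp add: Kc_def CN_iff)
    then show "\<exists>x\<in>Kc N m. \<forall>n. Pl n x = Pl n (s n)" using PS by blast
  qed
  then show "\<exists>\<F>. finite \<F> \<and> \<F> \<subseteq> \<U> \<and> Kc N m \<subseteq> \<Union>\<F>" .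
qed

lemma compactin_sub_Kc:
  assumes "compactin (CT N) C"
  obtains m where "C \<subseteq> Kc N m"
proof -
  have o: "openin (CT N) (Kc N m)" for m unfolding Kc_def by (rule openin_CT_level)
  have "C \<subseteq> CN N" using assms compactin_subset_topspace by fastforce
  then have "C \<subseteq> \<Union>(range (Kc N))" by (meson UN_I ex_Kc iso_tuple_UNIV_I subset_iff)
  then obtain \<F> where F: "finite \<F>" "\<F> \<subseteq> range (Kc N)" "C \<subseteq> \<Union>\<F>"
    using assms o unfolding compactin_def by (metis (no_types, lifting) imageE)
  then obtain I where I: "finite I" "\<F> = Kc N ` I" by (meson finite_subset_image)
  define m where "m = Max (insert 0 I)"
  have "Kc N i \<subseteq> Kc N m" if "i \<in> I" for i
    unfolding m_def using that I by (intro Kc_mono Max_ge) auto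
  then show ?thesis using that[of m] F I by blast
qed

lemma Cc_iff: "f \<in> Cc (CT N) \<longleftrightarrow> continuous_map (CT N) euclideanreal f \<and> (\<exists>m. \<forall>S\<in>CN N. f S \<noteq> 0 \<longrightarrow> S \<in> Kc N m)"
proof
  assume f: "f \<in> Cc (CT N)"
  then obtain m where "CT N closure_of {x \<in> CN N. f x \<noteq> 0} \<subseteq> Kc N m"
    using compactin_sub_Kc[of N] by (force simp: Cc_def)
  moreover have "{x \<in> CN N. f x \<noteq> 0} \<subseteq> CT N closure_of {x \<in> CN N. f x \<noteq> 0}"
    by (rule closure_of_subset) auto
  ultimately show "continuous_map (CT N) euclideanreal f \<and> (\<exists>m. \<forall>S\<in>CN N. f S \<noteq> 0 \<longrightarrow> S \<in> Kc N m)"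
    using f by (auto simp: Cc_def)
next
  assume "continuous_map (CT N) euclideanreal f \<and> (\<exists>m. \<forall>S\<in>CN N. f S \<noteq> 0 \<longrightarrow> S \<in> Kc N m)"
  then obtain m where f: "continuous_map (CT N) euclideanreal f" "\<forall>S\<in>CN N. f S \<noteq> 0 \<longrightarrow> S \<in> Kc N m" by auto
  have "CT N closure_of {x \<in> topspace (CT N). f x \<noteq> 0} \<subseteq> Kc N m"
    by (rule closure_of_minimal) (use f closedin_CT_level[of N "\<lambda>P. 2 \<le> card P" m] in \<open>auto simp: Kc_def\<close>)
  then have "compactin (CT N) (CT N closure_of {x \<in> topspace (CT N). f x \<noteq> 0})"
    by (rule closed_compactin[OF compactin_Kc]) simp
  then show "f \<in> Cc (CT N)" using f by (simp add: Cc_def)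
qed

section \<open>Borel sets\<close>

lemma space_borel_CT [simp]: "space (borel_of (CT N)) = CN N"
  by (simp add: borel_of_def space_measure_of_conv)

lemma sets_borel_of: "sets (borel_of T) = sigma_sets (topspace T) {U. openin T U}"
  unfolding borel_of_def by (rule sets_measure_of) (auto dest: openin_subset)

lemma openin_sets: "openin T U \<Longrightarrow> U \<in> sets (borel_of T)"
  by (simp add: sets_borel_of sigma_sets.Basic)

lemma level_sets: "{S \<in> CN N. R (Pl n S)} \<in> sets (borel_of (CT N))"
  by (rule openin_sets[OF openin_CT_level])

lemma Zc_sets: "Zc N n W \<in> sets (borel_of (CT N))"
  and Kc_sets: "Kc N n \<in> sets (borel_of (CT N))"
  unfolding Zc_def Kc_def by (rule level_sets)+

lemma continuous_map_measurable:
  assumes "continuous_map (CT N) euclideanreal f"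
  shows "f \<in> borel_measurable (borel_of (CT N))"
proof (rule borel_measurableI)
  fix V :: "real set" assume "open V"
  then have "openin (CT N) {x \<in> topspace (CT N). f x \<in> V}"
    using assms by (intro openin_continuous_map_preimage[OF assms]) auto
  then show "f -` V \<inter> space (borel_of (CT N)) \<in> sets (borel_of (CT N))"
    by (intro openin_sets) (simp add: vimage_def Int_def conj_commute)
qed

section \<open>Homeomorphisms of the boundary\<close>

text \<open>A homeomorphism, its inverse and moduli of continuity in terms of prefixes; translations
  and extensions of automorphisms are treated together in this form.\<close>

definition bdhomeo :: "nat \<Rightarrow> ((nat \<Rightarrow> int) \<Rightarrow> (nat \<Rightarrow> int)) \<Rightarrow> ((nat \<Rightarrow> int) \<Rightarrow> (nat \<Rightarrow> int)) \<Rightarrow> bool" where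
  "bdhomeo N \<theta> \<theta>' \<longleftrightarrow>
     (\<forall>\<xi>\<in>bd N. \<theta> \<xi> \<in> bd N \<and> \<theta>' \<xi> \<in> bd N \<and> \<theta>' (\<theta> \<xi>) = \<xi> \<and> \<theta> (\<theta>' \<xi>) = \<xi>) \<and>
     (\<forall>k. \<exists>m. \<forall>\<xi>\<in>bd N. \<forall>\<eta>\<in>bd N. pre \<xi> m = pre \<eta> m \<longrightarrow> pre (\<theta> \<xi>) k = pre (\<theta> \<eta>) k) \<and>
     (\<forall>k. \<exists>m. \<forall>\<xi>\<in>bd N. \<forall>\<eta>\<in>bd N. pre \<xi> m = pre \<eta> m \<longrightarrow> pre (\<theta>' \<xi>) k = pre (\<theta>' \<eta>) k)"

lemma bdhomeo_sym: "bdhomeo N \<theta> \<theta>' \<Longrightarrow> bdhomeo N \<theta>' \<theta>"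
  unfolding bdhomeo_def by blast

lemma bdhomeo_act: "g \<in> FN_carrier N \<Longrightarrow> bdhomeo N (act g) (act (winv g))"
proof -
  assume g: "g \<in> FN_carrier N"
  have "\<exists>m. \<forall>\<xi>\<in>bd N. \<forall>\<eta>\<in>bd N. pre \<xi> m = pre \<eta> m \<longrightarrow> pre (act h \<xi>) k = pre (act h \<eta>) k"
    if "h \<in> FN_carrier N" for h k
    using act_modulus[OF that] by blast
  then show ?thesis unfolding bdhomeo_def using g act_winv[OF g] act_winv'[OF g] by simp
qed

context
  fixes N \<theta> \<theta>' assumes hom: "bdhomeo N \<theta> \<theta>'"
begin

lemma bdhomeo_bd: "\<xi> \<in> bd N \<Longrightarrow> \<theta> \<xi> \<in> bd N" "\<xi> \<in> bd N \<Longrightarrow> \<theta>' \<xi> \<in> bd N"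
  and bdhomeo_inv: "\<xi> \<in> bd N \<Longrightarrow> \<theta>' (\<theta> \<xi>) = \<xi>" "\<xi> \<in> bd N \<Longrightarrow> \<theta> (\<theta>' \<xi>) = \<xi>"
  using hom by (auto simp: bdhomeo_def)

lemma bdhomeo_image_inv: "S \<subseteq> bd N \<Longrightarrow> \<theta>' ` \<theta> ` S = S" "S \<subseteq> bd N \<Longrightarrow> \<theta> ` \<theta>' ` S = S"
  by (force simp: image_image bdhomeo_inv subset_iff image_iff)+

lemma bdhomeo_inj: "inj_on \<theta> (bd N)"
  by (metis inj_onI bdhomeo_inv(1))

lemma bdhomeo_modulus: obtains m where
  "\<And>\<xi> \<eta>. \<xi> \<in> bd N \<Longrightarrow> \<eta> \<in> bd N \<Longrightarrow> pre \<xi> m = pre \<eta> m \<Longrightarrow> pre (\<theta> \<xi>) k = pre (\<theta> \<eta>) k"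
  using hom unfolding bdhomeo_def by blast

lemma bdhomeo_Pl: obtains m where
  "\<And>S S'. S \<subseteq> bd N \<Longrightarrow> S' \<subseteq> bd N \<Longrightarrow> Pl m S = Pl m S' \<Longrightarrow> Pl k (\<theta> ` S) = Pl k (\<theta> ` S')"
  "\<And>S. S \<subseteq> bd N \<Longrightarrow> 2 \<le> card (Pl k (\<theta> ` S)) \<Longrightarrow> 2 \<le> card (Pl m S)"
proof -
  obtain m where m: "\<And>\<xi> \<eta>. \<xi> \<in> bd N \<Longrightarrow> \<eta> \<in> bd N \<Longrightarrow> pre \<xi> m = pre \<eta> m \<Longrightarrow> pre (\<theta> \<xi>) k = pre (\<theta> \<eta>) k"
    using bdhomeo_modulus by blast
  have sub: "Pl k (\<theta> ` S) \<subseteq> Pl k (\<theta> ` S')" if S: "S \<subseteq> bd N" "S' \<subseteq> bd N" "Pl m S = Pl m S'" for S S'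
  proof
    fix w assume "w \<in> Pl k (\<theta> ` S)"
    then obtain \<xi> where \<xi>: "\<xi> \<in> S" "w = pre (\<theta> \<xi>) k" by (auto simp: Pl_def)
    have "pre \<xi> m \<in> Pl m S'" using \<xi> S(3) by (auto simp: Pl_def)
    then obtain \<eta> where \<eta>: "\<eta> \<in> S'" "pre \<xi> m = pre \<eta> m" by (auto simp: Pl_def)
    then show "w \<in> Pl k (\<theta> ` S')" using m[of \<xi> \<eta>] \<xi> S by (auto simp: Pl_def)
  qed
  have "2 \<le> card (Pl m S)" if S: "S \<subseteq> bd N" "2 \<le> card (Pl k (\<theta> ` S))" for S
  proof -
    have "\<theta> ` S \<subseteq> bd N" using S bdhomeo_bd by auto
    then obtain \<xi> \<eta> where x: "\<xi> \<in> S" "\<eta> \<in> S" "pre (\<theta> \<xi>) k \<noteq> pre (\<theta> \<eta>) k"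
      using S(2) two_le_card_iff[OF finite_Pl, of "\<theta> ` S" N k] by (auto simp: Pl_def)
    then have "pre \<xi> m \<noteq> pre \<eta> m" using m[of \<xi> \<eta>] S(1) by blast
    moreover have "pre \<xi> m \<in> Pl m S" "pre \<eta> m \<in> Pl m S" using x by (auto simp: Pl_def)
    ultimately show ?thesis unfolding two_le_card_iff[OF finite_Pl[OF S(1)]] by blast
  qed
  then show ?thesis using that[of m] sub by (metis equalityI)
qed

lemma bdhomeo_CN:
  assumes "S \<in> CN N"
  shows "\<theta> ` S \<in> CN N"
proof -
  have S: "S \<subseteq> bd N" "closedin (bdT N) S" using assms CN_bd by (auto simp: CN_iff)
  have "\<xi> \<in> \<theta> ` S" if \<xi>: "\<xi> \<in> bd N" "\<forall>n. \<exists>\<eta>\<in>\<theta> ` S. pre \<eta> n = pre \<xi> n" for \<xi>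
  proof -
    have "\<exists>\<eta>\<in>S. pre \<eta> k = pre (\<theta>' \<xi>) k" for k
    proof -
      obtain m where m: "\<forall>\<xi>\<in>bd N. \<forall>\<eta>\<in>bd N. pre \<xi> m = pre \<eta> m \<longrightarrow> pre (\<theta>' \<xi>) k = pre (\<theta>' \<eta>) k"
        using hom unfolding bdhomeo_def by blast
      obtain \<eta> where "\<eta> \<in> S" "pre (\<theta> \<eta>) m = pre \<xi> m" using \<xi>(2) by auto
      then show ?thesis using m \<xi>(1) S(1) bdhomeo_bd bdhomeo_inv by (metis subsetD)
    qed
    then have "\<theta>' \<xi> \<in> S" using S(2) bdhomeo_bd(2)[OF \<xi>(1)] unfolding closedin_bdT by blast
    then show ?thesis using bdhomeo_inv(2)[OF \<xi>(1)] by (metis imageI)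
  qed
  then have "closedin (bdT N) (\<theta> ` S)" using S(1) bdhomeo_bd unfolding closedin_bdT by auto
  moreover obtain \<xi> \<eta> where h: "\<xi> \<in> S" "\<eta> \<in> S" "\<xi> \<noteq> \<eta>" using assms by (auto simp: CN_iff)
  then have "\<theta> \<xi> \<noteq> \<theta> \<eta>" using bdhomeo_inj S by (auto simp: inj_on_def)
  ultimately show ?thesis using h by (auto simp: CN_iff)
qed

lemma bdhomeo_continuous: "continuous_map (CT N) (CT N) (\<lambda>S. \<theta> ` S)"
  unfolding continuous_map_def
proof (intro conjI allI impI)
  show "(\<lambda>S. \<theta> ` S) \<in> topspace (CT N) \<rightarrow> topspace (CT N)" using bdhomeo_CN by auto
  fix U assume U: "openin (CT N) U"
  show "openin (CT N) {S \<in> topspace (CT N). \<theta> ` S \<in> U}"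
    unfolding openin_CT
  proof (intro conjI ballI)
    fix S assume S: "S \<in> {S \<in> topspace (CT N). \<theta> ` S \<in> U}"
    then obtain k where k: "\<forall>S'\<in>CN N. Pl k S' = Pl k (\<theta> ` S) \<longrightarrow> S' \<in> U" using U unfolding openin_CT by blast
    obtain m where m: "\<And>S S'. S \<subseteq> bd N \<Longrightarrow> S' \<subseteq> bd N \<Longrightarrow> Pl m S = Pl m S' \<Longrightarrow> Pl k (\<theta> ` S) = Pl k (\<theta> ` S')"
      using bdhomeo_Pl[of k] by metis
    have "\<theta> ` S' \<in> U" if "S' \<in> CN N" "Pl m S' = Pl m S" for S'
      using k m[of S' S] bdhomeo_CN[OF that(1)] that CN_bd S by auto
    then show "\<exists>n. \<forall>S'\<in>CN N. Pl n S' = Pl n S \<longrightarrow> S' \<in> {S \<in> topspace (CT N). \<theta> ` S \<in> U}" by auto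
  qed auto
qed

lemma bdhomeo_measurable: "(\<lambda>S. \<theta> ` S) \<in> measurable (borel_of (CT N)) (borel_of (CT N))"
proof -
  have "(\<lambda>S. \<theta> ` S) \<in> measurable (borel_of (CT N)) (sigma (CN N) {U. openin (CT N) U})"
  proof (rule measurable_measure_of)
    show "{U. openin (CT N) U} \<subseteq> Pow (CN N)" using openin_subset[of "CT N"] by auto
    show "(\<lambda>S. \<theta> ` S) \<in> space (borel_of (CT N)) \<rightarrow> CN N" using bdhomeo_CN by auto
    fix U assume "U \<in> {U. openin (CT N) U}"
    then have "openin (CT N) {x \<in> topspace (CT N). \<theta> ` x \<in> U}"
      using bdhomeo_continuous by (auto simp: continuous_map_def)
    then show "(\<lambda>S. \<theta> ` S) -` U \<inter> space (borel_of (CT N)) \<in> sets (borel_of (CT N))"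
      by (intro openin_sets) (simp add: vimage_def Int_def conj_commute)
  qed
  then show ?thesis by (simp add: borel_of_def[of "CT N"])
qed

lemma bdhomeo_Cc: "f \<in> Cc (CT N) \<Longrightarrow> (\<lambda>S. f (\<theta> ` S)) \<in> Cc (CT N)"
proof -
  assume "f \<in> Cc (CT N)"
  then obtain k where f: "continuous_map (CT N) euclideanreal f" and k: "\<forall>S\<in>CN N. f S \<noteq> 0 \<longrightarrow> S \<in> Kc N k"
    by (auto simp: Cc_iff)
  obtain m where m: "\<And>S. S \<subseteq> bd N \<Longrightarrow> 2 \<le> card (Pl k (\<theta> ` S)) \<Longrightarrow> 2 \<le> card (Pl m S)"
    using bdhomeo_Pl[of k] by metis
  have "continuous_map (CT N) euclideanreal (\<lambda>S. f (\<theta> ` S))"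
    using continuous_map_compose[OF bdhomeo_continuous f] by (simp add: o_def)
  moreover have "\<forall>S\<in>CN N. f (\<theta> ` S) \<noteq> 0 \<longrightarrow> S \<in> Kc N m"
    using k m bdhomeo_CN CN_bd by (auto simp: Kc_def)
  ultimately show ?thesis by (auto simp: Cc_iff)
qed

end

text \<open>Invariance of currents is stated with images; they are measurable because they are
  preimages under the inverse.\<close>

lemma bdhomeo_sets_image:
  assumes hom: "bdhomeo N \<theta> \<theta>'" and A: "A \<in> sets (borel_of (CT N))"
  shows "(\<lambda>S. \<theta> ` S) ` A = (\<lambda>S. \<theta>' ` S) -` A \<inter> CN N" and "(\<lambda>S. \<theta> ` S) ` A \<in> sets (borel_of (CT N))"
proof -
  have AC: "A \<subseteq> CN N" using sets.sets_into_space[OF A] by simp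
  note h' = bdhomeo_sym[OF hom]
  show e: "(\<lambda>S. \<theta> ` S) ` A = (\<lambda>S. \<theta>' ` S) -` A \<inter> CN N"
  proof (intro equalityI subsetI)
    fix S assume "S \<in> (\<lambda>S. \<theta> ` S) ` A"
    then obtain S' where S': "S' \<in> A" "S = \<theta> ` S'" by auto
    then have "S' \<in> CN N" using AC by auto
    then show "S \<in> (\<lambda>S. \<theta>' ` S) -` A \<inter> CN N"
      using S' bdhomeo_CN[OF hom, of S'] bdhomeo_image_inv(1)[OF hom CN_bd] by auto
  next
    fix S assume S: "S \<in> (\<lambda>S. \<theta>' ` S) -` A \<inter> CN N"
    then have "\<theta> ` \<theta>' ` S = S" using bdhomeo_image_inv(2)[OF hom CN_bd] by auto
    then show "S \<in> (\<lambda>S. \<theta> ` S) ` A" using S by (metis IntD1 imageI vimageD)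
  qed
  show "(\<lambda>S. \<theta> ` S) ` A \<in> sets (borel_of (CT N))"
    unfolding e using measurable_sets[OF bdhomeo_measurable[OF h'] A] by simp
qed

section \<open>Subset currents\<close>

lemma SCurr_sets: "\<mu> \<in> SCurr N \<Longrightarrow> sets \<mu> = sets (borel_of (CT N))"
  by (simp add: SCurr_def)

lemma SCurr_space: "\<mu> \<in> SCurr N \<Longrightarrow> space \<mu> = CN N"
  using sets_eq_imp_space_eq[of \<mu> "borel_of (CT N)"] by (simp add: SCurr_def)

lemma SCurr_emeasure_finite:
  assumes "\<mu> \<in> SCurr N" "A \<subseteq> Kc N m"
  shows "emeasure \<mu> A < \<infinity>"
proof -
  have "Kc N m \<in> sets \<mu>" using Kc_sets SCurr_sets[OF assms(1)] by simp
  then have "emeasure \<mu> A \<le> emeasure \<mu> (Kc N m)" by (rule emeasure_mono[OF assms(2)])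
  also have "\<dots> < \<infinity>" using assms(1) compactin_Kc by (auto simp: SCurr_def)
  finally show ?thesis .
qed

lemma bact_image: "g \<in> FN_carrier N \<Longrightarrow> (\<lambda>S. bact g ` S) ` A = (\<lambda>S. act g ` S) ` A"
  by (simp add: bact_eq_act[OF FN_carrier_reduced])

lemma SCurr_emeasure_act:
  "\<mu> \<in> SCurr N \<Longrightarrow> g \<in> FN_carrier N \<Longrightarrow> A \<in> sets (borel_of (CT N)) \<Longrightarrow>
    emeasure \<mu> ((\<lambda>S. act g ` S) ` A) = emeasure \<mu> A"
  using SCurr_sets[of \<mu> N] bact_image[of g N A] unfolding SCurr_def by force

lemma SCurr_measure_act:
  "\<mu> \<in> SCurr N \<Longrightarrow> g \<in> FN_carrier N \<Longrightarrow> A \<in> sets (borel_of (CT N)) \<Longrightarrow>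
    measure \<mu> ((\<lambda>S. act g ` S) ` A) = measure \<mu> A"
  by (simp add: measure_def SCurr_emeasure_act)

lemma Zc_sub_Kc:
  assumes "m \<le> n" "W \<in> Pl n ` Kc N m"
  shows "Zc N n W \<subseteq> Kc N m"
proof
  fix S assume S: "S \<in> Zc N n W"
  obtain S' where S': "S' \<in> Kc N m" "W = Pl n S'" using assms(2) by blast
  have "Pl n S = Pl n S'" using S S'(2) by (simp add: Zc_def)
  then have "Pl m S = Pl m S'" using assms(1) by (rule Pl_mono)
  then show "S \<in> Kc N m" using S S' by (simp add: Zc_def Kc_def)
qed

lemma finite_Pl_Kc: "finite (Pl n ` Kc N m)"
  by (rule finite_Pl_image[where N=N]) (use CN_bd in \<open>auto simp: Kc_def\<close>)

lemma measure_level: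
  assumes "\<mu> \<in> SCurr N" "m \<le> n"
  shows "measure \<mu> {S \<in> Kc N m. R (Pl n S)} = (\<Sum>W\<in>{W \<in> Pl n ` Kc N m. R W}. measure \<mu> (Zc N n W))"
proof -
  have "{S \<in> Kc N m. R (Pl n S)} = (\<Union>W\<in>{W \<in> Pl n ` Kc N m. R W}. Zc N n W)"
    using Zc_sub_Kc[OF assms(2)] by (fastforce simp: Zc_def Kc_def)
  also have "measure \<mu> \<dots> = (\<Sum>W\<in>{W \<in> Pl n ` Kc N m. R W}. measure \<mu> (Zc N n W))"
  proof (rule measure_finite_Union)
    show "finite {W \<in> Pl n ` Kc N m. R W}" using finite_Pl_Kc by simp
    show "Zc N n ` {W \<in> Pl n ` Kc N m. R W} \<subseteq> sets \<mu>" using SCurr_sets[OF assms(1)] Zc_sets by auto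
    show "disjoint_family_on (Zc N n) {W \<in> Pl n ` Kc N m. R W}" by (auto simp: disjoint_family_on_def Zc_def)
    show "emeasure \<mu> (Zc N n W) \<noteq> \<infinity>" if "W \<in> {W \<in> Pl n ` Kc N m. R W}" for W
      using SCurr_emeasure_finite[OF assms(1) Zc_sub_Kc[OF assms(2)], of W] that by auto
  qed
  finally show ?thesis .
qed

lemma measure_Kc:
  assumes "\<mu> \<in> SCurr N" "m \<le> n"
  shows "measure \<mu> (Kc N m) = (\<Sum>W\<in>Pl n ` Kc N m. measure \<mu> (Zc N n W))"
  using measure_level[OF assms, of "\<lambda>_. True"] by simp

lemma measure_Zc_refine:
  assumes "\<mu> \<in> SCurr N" "n \<le> n'" "W \<in> Pl n ` Kc N m" "m \<le> n"
  shows "measure \<mu> (Zc N n W) = (\<Sum>W'\<in>{W' \<in> Pl n' ` Kc N m. take n ` W' = W}. measure \<mu> (Zc N n' W'))"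
proof -
  have "Zc N n W = {S \<in> Kc N m. take n ` (Pl n' S) = W}"
    using Zc_sub_Kc[OF assms(4,3)] Pl_take[OF assms(2)] by (auto simp: Zc_def Kc_def)
  then show ?thesis using measure_level[OF assms(1), of m n' "\<lambda>P. take n ` P = W"] assms by simp
qed

text \<open>Compactness gives one level \<open>n\<close> that works on \<open>Kc N m\<close>.
  Outside, \<open>f\<close> vanishes, and since \<open>m \<le> n\<close> the pattern of a set
  decides on which side it lies.\<close>

lemma Cc_uniform:
  assumes f: "continuous_map (CT N) euclideanreal f" "\<forall>S\<in>CN N. f S \<noteq> 0 \<longrightarrow> S \<in> Kc N m" and "\<epsilon> > 0"
  obtains n where "m \<le> n" "\<And>S S'. S \<in> CN N \<Longrightarrow> S' \<in> CN N \<Longrightarrow> Pl n S = Pl n S' \<Longrightarrow> \<bar>f S - f S'\<bar> \<le> \<epsilon>"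
proof -
  define osc where "osc = (\<lambda>n P. \<forall>S'\<in>CN N. \<forall>S''\<in>CN N. Pl n S' = P \<and> Pl n S'' = P \<longrightarrow> \<bar>f S' - f S''\<bar> \<le> \<epsilon>)"
  define U where "U = (\<lambda>n. {S \<in> CN N. osc n (Pl n S)})"
  have Uo: "openin (CT N) (U n)" for n unfolding U_def by (rule openin_CT_level)
  have Umono: "U n \<subseteq> U n'" if "n \<le> n'" for n n'
  proof
    fix S assume S: "S \<in> U n"
    have "\<bar>f S' - f S''\<bar> \<le> \<epsilon>" if h: "S' \<in> CN N" "S'' \<in> CN N" "Pl n' S' = Pl n' S" "Pl n' S'' = Pl n' S" for S' S''
      using S h(1,2) Pl_mono[OF h(3) \<open>n \<le> n'\<close>] Pl_mono[OF h(4) \<open>n \<le> n'\<close>] by (auto simp: U_def osc_def)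
    then show "S \<in> U n'" using S by (auto simp: U_def osc_def)
  qed
  have "S \<in> (\<Union>n. U n)" if S: "S \<in> CN N" for S
  proof -
    have "openin (CT N) {S' \<in> topspace (CT N). f S' \<in> ball (f S) (\<epsilon> / 2)}"
      using f(1) by (intro openin_continuous_map_preimage[OF f(1)]) auto
    then obtain n where n: "\<forall>S'\<in>CN N. Pl n S' = Pl n S \<longrightarrow> f S' \<in> ball (f S) (\<epsilon> / 2)"
      unfolding openin_CT using S assms(3) by force
    have "\<bar>f S' - f S''\<bar> \<le> \<epsilon>" if h: "S' \<in> CN N" "S'' \<in> CN N" "Pl n S' = Pl n S" "Pl n S'' = Pl n S" for S' S''
    proof -
      have "f S' \<in> ball (f S) (\<epsilon> / 2)" "f S'' \<in> ball (f S) (\<epsilon> / 2)" using n h by blast+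
      then show ?thesis unfolding mem_ball dist_real_def by linarith
    qed
    then have "S \<in> U n" using S by (auto simp: U_def osc_def)
    then show ?thesis by blast
  qed
  then have "Kc N m \<subseteq> \<Union>(range U)" by (auto simp: Kc_def)
  then obtain \<F> where F: "finite \<F>" "\<F> \<subseteq> range U" "Kc N m \<subseteq> \<Union>\<F>"
    using compactin_Kc[of N m] Uo unfolding compactin_def by (metis (no_types, lifting) imageE)
  then obtain I where I: "finite I" "\<F> = U ` I" by (meson finite_subset_image)
  define n where "n = Max (insert m I)"
  have mn: "m \<le> n" unfolding n_def using I by auto
  have KU: "Kc N m \<subseteq> U n"
  proof -
    have "U i \<subseteq> U n" if "i \<in> I" for i unfolding n_def using that I by (intro Umono Max_ge) auto
    then show ?thesis using F I by blast
  qed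
  have "\<bar>f S - f S'\<bar> \<le> \<epsilon>" if h: "S \<in> CN N" "S' \<in> CN N" "Pl n S = Pl n S'" for S S'
  proof (cases "S \<in> Kc N m")
    case True
    then show ?thesis using KU h by (auto simp: U_def osc_def)
  next
    case False
    then have "S' \<notin> Kc N m" using h Pl_mono[OF h(3) mn] by (auto simp: Kc_def)
    then have "f S = 0" "f S' = 0" using False f(2) h by blast+
    then show ?thesis using assms(3) by simp
  qed
  then show ?thesis using that mn by blast
qed

text \<open>These sets are open and compact, so their indicators are admissible test functions;
  hence the masses of cells depend continuously on the current.\<close>

lemma indicator_level_Cc: "indicator {S \<in> Kc N m. R (Pl n S)} \<in> Cc (CT N)"
proof -
  define A where "A = {S \<in> Kc N m. R (Pl n S)}"
  have "openin (CT N) {S \<in> topspace (CT N). indicator A S \<in> V}" for V :: "real set"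
  proof -
    have "{S \<in> topspace (CT N). indicator A S \<in> V} =
      {S \<in> CN N. (if 2 \<le> card (take m ` Pl (max m n) S) \<and> R (take n ` Pl (max m n) S) then 1 else 0) \<in> V}"
      by (auto simp: A_def Kc_def indicator_def Pl_take[of m "max m n"] Pl_take[of n "max m n"] split: if_splits)
    then show ?thesis
      using openin_CT_level[of N "\<lambda>P. (if 2 \<le> card (take m ` P) \<and> R (take n ` P) then 1 else 0) \<in> V" "max m n"] by simp
  qed
  then have "continuous_map (CT N) euclideanreal (indicator A)" by (auto simp: continuous_map_def)
  then show ?thesis unfolding Cc_iff A_def by (auto simp: indicator_def)
qed

section \<open>The weak topology in terms of cell masses\<close>

lemma topspace_weakT [simp]: "topspace (weakT N) = SCurr N"
proof -
  have "(\<lambda>_. 0) \<in> Cc (CT N)" by (simp add: Cc_iff)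
  then have "{\<mu> \<in> SCurr N. integral\<^sup>L \<mu> (\<lambda>_. 0::real) \<in> UNIV} \<in>
      {{\<mu> \<in> SCurr N. integral\<^sup>L \<mu> f \<in> V} | f V. f \<in> Cc (CT N) \<and> open V}" by blast
  then show ?thesis unfolding weakT_def topology_generated_by_topspace by auto
qed

lemma continuous_integral:
  assumes "f \<in> Cc (CT N)"
  shows "continuous_map (weakT N) euclideanreal (\<lambda>\<mu>. integral\<^sup>L \<mu> f)"
proof -
  have "openin (weakT N) {\<mu> \<in> SCurr N. integral\<^sup>L \<mu> f \<in> V}" if "open V" for V
    unfolding weakT_def by (rule topology_generated_by_Basis) (use assms that in blast)
  then show ?thesis by (simp add: continuous_map_def)
qed

lemma continuous_measure_level:
  "continuous_map (weakT N) euclideanreal (\<lambda>\<mu>. measure \<mu> {S \<in> Kc N m. R (Pl n S)})"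
proof -
  have s: "{S \<in> Kc N m. R (Pl n S)} \<in> sets (borel_of (CT N))"
  proof -
    have "{S \<in> Kc N m. R (Pl n S)} = Kc N m \<inter> {S \<in> CN N. R (Pl n S)}" by (auto simp: Kc_def)
    then show ?thesis using sets.Int[OF Kc_sets[of N m] level_sets[of N R n]] by simp
  qed
  have "integral\<^sup>L \<mu> (indicator {S \<in> Kc N m. R (Pl n S)}) = measure \<mu> {S \<in> Kc N m. R (Pl n S)}"
    if "\<mu> \<in> topspace (weakT N)" for \<mu>
  proof -
    have m: "\<mu> \<in> SCurr N" using that by simp
    have "{S \<in> Kc N m. R (Pl n S)} \<subseteq> space \<mu>" using SCurr_space[OF m] by (auto simp: Kc_def)
    then show ?thesis using s SCurr_sets[OF m] by (simp add: Int_absorb2)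
  qed
  then show ?thesis
    by (rule continuous_map_eq[OF continuous_integral[OF indicator_level_Cc]])
qed

lemma continuous_measure_Zc:
  assumes "m \<le> n" "W \<in> Pl n ` Kc N m"
  shows "continuous_map (weakT N) euclideanreal (\<lambda>\<mu>. measure \<mu> (Zc N n W))"
proof -
  have "Zc N n W = {S \<in> Kc N m. Pl n S = W}" using Zc_sub_Kc[OF assms] by (auto simp: Zc_def Kc_def)
  then show ?thesis using continuous_measure_level[of N m "\<lambda>P. P = W" n] by simp
qed

text \<open>\<open>f\<close> is replaced by the step function \<open>h\<close> that takes one sample
  value \<open>fv W\<close> on each cell; the comparison with \<open>h\<close> also yields the
  integrability of \<open>f\<close>.\<close>

lemma integral_level_approx:
  assumes \<mu>: "\<mu> \<in> SCurr N" and f: "continuous_map (CT N) euclideanreal f" "\<forall>S\<in>CN N. f S \<noteq> 0 \<longrightarrow> S \<in> Kc N m"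
    and mn: "m \<le> n" and osc: "\<And>S S'. S \<in> CN N \<Longrightarrow> S' \<in> CN N \<Longrightarrow> Pl n S = Pl n S' \<Longrightarrow> \<bar>f S - f S'\<bar> \<le> \<epsilon>" and "\<epsilon> \<ge> 0"
    and fv: "\<And>W. W \<in> Pl n ` Kc N m \<Longrightarrow> \<exists>S\<in>Kc N m. Pl n S = W \<and> fv W = f S"
  shows "\<bar>integral\<^sup>L \<mu> f - (\<Sum>W\<in>Pl n ` Kc N m. fv W * measure \<mu> (Zc N n W))\<bar> \<le> \<epsilon> * measure \<mu> (Kc N m)"
proof -
  note sp = SCurr_space[OF \<mu>] and st = SCurr_sets[OF \<mu>]
  define h where "h = (\<lambda>S. \<Sum>W\<in>Pl n ` Kc N m. fv W * indicator (Zc N n W) S)"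
  have iK: "integrable \<mu> (indicator (Kc N m) :: _ \<Rightarrow> real)"
    using SCurr_emeasure_finite[OF \<mu> order_refl, of m] Kc_sets st by (auto intro!: integrable_real_indicator)
  have iZ: "integrable \<mu> (\<lambda>S. fv W * indicator (Zc N n W) S)" if "W \<in> Pl n ` Kc N m" for W
    using SCurr_emeasure_finite[OF \<mu> Zc_sub_Kc[OF mn that]] Zc_sets st by (auto intro!: integrable_real_indicator)
  have ih: "integrable \<mu> h" unfolding h_def by (rule Bochner_Integration.integrable_sum[OF iZ])
  have "integral\<^sup>L \<mu> h = (\<Sum>W\<in>Pl n ` Kc N m. integral\<^sup>L \<mu> (\<lambda>S. fv W * indicator (Zc N n W) S))"
    unfolding h_def by (rule Bochner_Integration.integral_sum[OF iZ])
  also have "\<dots> = (\<Sum>W\<in>Pl n ` Kc N m. fv W * measure \<mu> (Zc N n W))"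
  proof (rule sum.cong[OF refl])
    fix W
    have "Zc N n W \<subseteq> space \<mu>" using sp by (auto simp: Zc_def)
    then show "integral\<^sup>L \<mu> (\<lambda>S. fv W * indicator (Zc N n W) S) = fv W * measure \<mu> (Zc N n W)"
      using Zc_sets st by (simp add: Int_absorb2)
  qed
  finally have Ih: "integral\<^sup>L \<mu> h = (\<Sum>W\<in>Pl n ` Kc N m. fv W * measure \<mu> (Zc N n W))" .
  have hv: "h S = (if S \<in> Kc N m then fv (Pl n S) else 0)" if S: "S \<in> CN N" for S
  proof (cases "S \<in> Kc N m")
    case True
    have "h S = (\<Sum>W\<in>Pl n ` Kc N m. if W = Pl n S then fv W else 0)"
      unfolding h_def by (rule sum.cong) (use S in \<open>auto simp: Zc_def indicator_def\<close>)
    then show ?thesis using True finite_Pl_Kc[of n N m] by simp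
  next
    case False
    then have "S \<notin> Zc N n W" if "W \<in> Pl n ` Kc N m" for W using Zc_sub_Kc[OF mn that] by auto
    then show ?thesis using False unfolding h_def by simp
  qed
  have dif: "\<bar>f S - h S\<bar> \<le> \<epsilon> * indicator (Kc N m) S" if S: "S \<in> space \<mu>" for S
  proof (cases "S \<in> Kc N m")
    case True
    then obtain S' where "S' \<in> Kc N m" "Pl n S' = Pl n S" "fv (Pl n S) = f S'" using fv[of "Pl n S"] by auto
    then show ?thesis using True hv osc[of S S'] by (auto simp: Kc_def)
  next
    case False
    then show ?thesis using S sp f hv by auto
  qed
  have fm: "f \<in> borel_measurable \<mu>"
    using continuous_map_measurable[OF f(1)] measurable_cong_sets[OF st refl] by blast
  have "integrable \<mu> (\<lambda>S. \<epsilon> * indicator (Kc N m) S + \<bar>h S\<bar>)" using iK ih by simp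
  then have if': "integrable \<mu> f"
  proof (rule Bochner_Integration.integrable_bound[OF _ fm])
    show "AE S in \<mu>. norm (f S) \<le> norm (\<epsilon> * indicator (Kc N m) S + \<bar>h S\<bar>)"
    proof (rule AE_I2)
      fix S assume "S \<in> space \<mu>"
      from dif[OF this] show "norm (f S) \<le> norm (\<epsilon> * indicator (Kc N m) S + \<bar>h S\<bar>)" by simp
    qed
  qed
  have "\<bar>integral\<^sup>L \<mu> f - integral\<^sup>L \<mu> h\<bar> = \<bar>integral\<^sup>L \<mu> (\<lambda>S. f S - h S)\<bar>" using if' ih by simp
  also have "\<dots> \<le> integral\<^sup>L \<mu> (\<lambda>S. \<bar>f S - h S\<bar>)" by (rule integral_abs_bound)
  also have "\<dots> \<le> integral\<^sup>L \<mu> (\<lambda>S. \<epsilon> * indicator (Kc N m) S)"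
    by (rule integral_mono) (use if' ih iK dif in auto)
  also have "\<dots> = \<epsilon> * measure \<mu> (Kc N m)"
    using Kc_sets st sp by (simp add: Int_absorb2 Kc_def)
  finally show ?thesis unfolding Ih .
qed

text \<open>Closeness of finitely many cell masses. By \<open>weakT_nbhd\<close> this describes
  arbitrarily small neighbourhoods in the weak topology, so density only has to be checked on
  cells.\<close>

definition near :: "nat \<Rightarrow> nat \<Rightarrow> real \<Rightarrow> (nat \<Rightarrow> int) set measure \<Rightarrow> (nat \<Rightarrow> int) set measure \<Rightarrow> bool" where
  "near N n \<delta> \<mu> \<nu> \<longleftrightarrow> (\<forall>W\<in>Pl n ` Kc N n. \<bar>measure \<mu> (Zc N n W) - measure \<nu> (Zc N n W)\<bar> < \<delta>)"

lemma near_sum: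
  assumes "near N n \<delta> \<mu> \<nu>" "\<W> \<subseteq> Pl n ` Kc N n" "\<delta> > 0"
  shows "\<bar>(\<Sum>W\<in>\<W>. c W * measure \<mu> (Zc N n W)) - (\<Sum>W\<in>\<W>. c W * measure \<nu> (Zc N n W))\<bar> \<le> (\<Sum>W\<in>\<W>. \<bar>c W\<bar>) * \<delta>"
proof -
  have "\<bar>(\<Sum>W\<in>\<W>. c W * measure \<mu> (Zc N n W)) - (\<Sum>W\<in>\<W>. c W * measure \<nu> (Zc N n W))\<bar>
      = \<bar>\<Sum>W\<in>\<W>. c W * (measure \<mu> (Zc N n W) - measure \<nu> (Zc N n W))\<bar>"
    by (simp add: sum_subtractf right_diff_distrib)
  also have "\<dots> \<le> (\<Sum>W\<in>\<W>. \<bar>c W * (measure \<mu> (Zc N n W) - measure \<nu> (Zc N n W))\<bar>)" by (rule sum_abs)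
  also have "\<dots> \<le> (\<Sum>W\<in>\<W>. \<bar>c W\<bar> * \<delta>)"
    unfolding abs_mult using assms by (intro sum_mono mult_left_mono) (auto simp: near_def less_imp_le)
  finally show ?thesis by (simp add: sum_distrib_right)
qed

lemma near_refine:
  assumes "n \<le> n'" "\<delta> > 0"
  obtains \<delta>' where "\<delta>' > 0" "\<And>\<mu> \<nu>. \<mu> \<in> SCurr N \<Longrightarrow> \<nu> \<in> SCurr N \<Longrightarrow> near N n' \<delta>' \<mu> \<nu> \<Longrightarrow> near N n \<delta> \<mu> \<nu>"
proof -
  define c where "c = real (card (Pl n' ` Kc N n))"
  \<comment> \<open>A coarse cell splits into at most \<open>c\<close> fine ones; the added 1 makes
    the resulting bound strict.\<close>
  define \<delta>' where "\<delta>' = \<delta> / (c + 1)"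
  have c: "c \<ge> 0" by (simp add: c_def)
  then have d': "\<delta>' > 0" "c * \<delta>' < \<delta>" using assms(2) by (auto simp: \<delta>'_def field_simps)
  have "near N n \<delta> \<mu> \<nu>" if "\<mu> \<in> SCurr N" "\<nu> \<in> SCurr N" "near N n' \<delta>' \<mu> \<nu>" for \<mu> \<nu>
    unfolding near_def
  proof
    fix W assume W: "W \<in> Pl n ` Kc N n"
    define \<W> where "\<W> = {W' \<in> Pl n' ` Kc N n. take n ` W' = W}"
    have sub: "\<W> \<subseteq> Pl n' ` Kc N n'" using Kc_mono[OF assms(1)] by (auto simp: \<W>_def)
    have "\<bar>measure \<mu> (Zc N n W) - measure \<nu> (Zc N n W)\<bar> \<le> (\<Sum>W\<in>\<W>. \<bar>1::real\<bar>) * \<delta>'"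
      using near_sum[OF that(3) sub d'(1), of "\<lambda>_. 1"]
        measure_Zc_refine[OF that(1) assms(1) W order_refl] measure_Zc_refine[OF that(2) assms(1) W order_refl]
      by (simp add: \<W>_def)
    also have "\<dots> \<le> c * \<delta>'"
      unfolding c_def using d'(1) finite_Pl_Kc[of n' N n]
      by (intro mult_right_mono) (auto simp: \<W>_def intro!: card_mono)
    finally show "\<bar>measure \<mu> (Zc N n W) - measure \<nu> (Zc N n W)\<bar> < \<delta>" using d' by simp
  qed
  then show ?thesis using that d' by blast
qed

lemma near_mono: "near N n \<delta> \<mu> \<nu> \<Longrightarrow> \<delta> \<le> \<delta>' \<Longrightarrow> near N n \<delta>' \<mu> \<nu>"
  unfolding near_def by force

lemma integral_near:
  assumes \<mu>: "\<mu> \<in> SCurr N" and f: "f \<in> Cc (CT N)" and e: "e > 0"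
  obtains n \<delta> where "\<delta> > 0" "\<And>\<nu>. \<nu> \<in> SCurr N \<Longrightarrow> near N n \<delta> \<mu> \<nu> \<Longrightarrow> \<bar>integral\<^sup>L \<nu> f - integral\<^sup>L \<mu> f\<bar> < e"
proof -
  obtain m where fc: "continuous_map (CT N) euclideanreal f" and fm: "\<forall>S\<in>CN N. f S \<noteq> 0 \<longrightarrow> S \<in> Kc N m"
    using f by (auto simp: Cc_iff)
  define M where "M = measure \<mu> (Kc N m)"
  have M: "M \<ge> 0" by (simp add: M_def)
  \<comment> \<open>The step functions cost \<open>\<epsilon>\<close> times the masses of
    \<open>Kc N m\<close>, which are \<open>M\<close> and, for the nearby current, at most
    \<open>M + 1\<close>; together this stays below \<open>e / 2\<close>.\<close>
  define \<epsilon> where "\<epsilon> = e / (2 * (2 * M + 2))"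
  have ep: "\<epsilon> > 0" "\<epsilon> * (2 * M + 1) < e / 2" using M e by (auto simp: \<epsilon>_def field_simps)
  obtain n where n: "m \<le> n" "\<And>S S'. S \<in> CN N \<Longrightarrow> S' \<in> CN N \<Longrightarrow> Pl n S = Pl n S' \<Longrightarrow> \<bar>f S - f S'\<bar> \<le> \<epsilon>"
    using Cc_uniform[OF fc fm ep(1)] by blast
  define fv where "fv = (\<lambda>W. f (SOME S. S \<in> Kc N m \<and> Pl n S = W))"
  have fv: "\<exists>S\<in>Kc N m. Pl n S = W \<and> fv W = f S" if W: "W \<in> Pl n ` Kc N m" for W
  proof -
    have "\<exists>S. S \<in> Kc N m \<and> Pl n S = W" using W by auto
    from someI_ex[OF this] show ?thesis unfolding fv_def by blast
  qed
  define c B where "c = real (card (Pl n ` Kc N m))" and "B = (\<Sum>W\<in>Pl n ` Kc N m. \<bar>fv W\<bar>)"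
  have cB: "c \<ge> 0" "B \<ge> 0" by (auto simp: c_def B_def sum_nonneg)
  \<comment> \<open>The first bound keeps the mass of the nearby current at most
    \<open>M + 1\<close>, the second changes the integral of the step function by at most
    \<open>e / 2\<close>.\<close>
  define \<delta> where "\<delta> = min (1 / (c + 1)) (e / (2 * (B + 1)))"
  have d: "\<delta> > 0" using cB e by (simp add: \<delta>_def)
  have "c * \<delta> \<le> c * (1 / (c + 1))" using cB by (intro mult_left_mono) (auto simp: \<delta>_def)
  also have "\<dots> \<le> 1" using cB by (simp add: field_simps)
  finally have cd: "c * \<delta> \<le> 1" .
  have "B * \<delta> \<le> B * (e / (2 * (B + 1)))" using cB by (intro mult_left_mono) (auto simp: \<delta>_def)
  also have "\<dots> \<le> e / 2" using cB e by (simp add: field_simps)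
  finally have Bd: "B * \<delta> \<le> e / 2" .
  have "\<bar>integral\<^sup>L \<nu> f - integral\<^sup>L \<mu> f\<bar> < e" if \<nu>: "\<nu> \<in> SCurr N" "near N n \<delta> \<mu> \<nu>" for \<nu>
  proof -
    have sub: "Pl n ` Kc N m \<subseteq> Pl n ` Kc N n" using Kc_mono[OF n(1)] by auto
    have "\<bar>measure \<mu> (Kc N m) - measure \<nu> (Kc N m)\<bar> \<le> c * \<delta>"
      using near_sum[OF \<nu>(2) sub d, of "\<lambda>_. 1"] measure_Kc[OF \<mu> n(1)] measure_Kc[OF \<nu>(1) n(1)] by (simp add: c_def)
    then have "measure \<nu> (Kc N m) \<le> M + 1" using cd by (simp add: M_def)
    then have "\<epsilon> * measure \<nu> (Kc N m) \<le> \<epsilon> * (M + 1)" using ep by (intro mult_left_mono) auto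
    moreover have "\<bar>integral\<^sup>L \<nu> f - (\<Sum>W\<in>Pl n ` Kc N m. fv W * measure \<nu> (Zc N n W))\<bar> \<le> \<epsilon> * measure \<nu> (Kc N m)"
      by (rule integral_level_approx[OF \<nu>(1) fc fm n]) (use ep fv in auto)
    moreover have "\<bar>integral\<^sup>L \<mu> f - (\<Sum>W\<in>Pl n ` Kc N m. fv W * measure \<mu> (Zc N n W))\<bar> \<le> \<epsilon> * M"
      unfolding M_def by (rule integral_level_approx[OF \<mu> fc fm n]) (use ep fv in auto)
    moreover have "\<bar>(\<Sum>W\<in>Pl n ` Kc N m. fv W * measure \<mu> (Zc N n W)) - (\<Sum>W\<in>Pl n ` Kc N m. fv W * measure \<nu> (Zc N n W))\<bar> \<le> e / 2"
      using near_sum[OF \<nu>(2) sub d, of fv] Bd by (simp add: B_def)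
    moreover have "\<epsilon> * (M + 1) + \<epsilon> * M < e / 2" using ep(2) by (simp add: algebra_simps)
    ultimately show ?thesis by linarith
  qed
  then show ?thesis using that d by blast
qed

lemma weakT_nbhd:
  assumes "openin (weakT N) U" "\<mu> \<in> U"
  shows "\<exists>n \<delta>. \<delta> > 0 \<and> (\<forall>\<nu>\<in>SCurr N. near N n \<delta> \<mu> \<nu> \<longrightarrow> \<nu> \<in> U)"
proof -
  define B where "B = {{\<mu> \<in> SCurr N. integral\<^sup>L \<mu> f \<in> V} | f V. f \<in> Cc (CT N) \<and> open (V :: real set)}"
  have "generate_topology_on B U" using assms(1)
    by (simp add: weakT_def B_def openin_topology_generated_by_iff)
  moreover have "\<mu> \<in> SCurr N" using assms openin_subset[of "weakT N" U] by auto
  ultimately show ?thesis using assms(2)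
  proof induct
    case (Int a b)
    then have "\<mu> \<in> a" "\<mu> \<in> b" by auto
    obtain n \<delta> where n: "\<delta> > 0" "\<forall>\<nu>\<in>SCurr N. near N n \<delta> \<mu> \<nu> \<longrightarrow> \<nu> \<in> a" using Int \<open>\<mu> \<in> a\<close> by blast
    obtain m \<gamma> where m: "\<gamma> > 0" "\<forall>\<nu>\<in>SCurr N. near N m \<gamma> \<mu> \<nu> \<longrightarrow> \<nu> \<in> b" using Int \<open>\<mu> \<in> b\<close> by blast
    obtain \<delta>' where d: "\<delta>' > 0" "\<And>\<mu> \<nu>. \<mu> \<in> SCurr N \<Longrightarrow> \<nu> \<in> SCurr N \<Longrightarrow> near N (max n m) \<delta>' \<mu> \<nu> \<Longrightarrow> near N n \<delta> \<mu> \<nu>"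
      using near_refine[of n "max n m" \<delta> N] n by auto
    obtain \<gamma>' where g: "\<gamma>' > 0" "\<And>\<mu> \<nu>. \<mu> \<in> SCurr N \<Longrightarrow> \<nu> \<in> SCurr N \<Longrightarrow> near N (max n m) \<gamma>' \<mu> \<nu> \<Longrightarrow> near N m \<gamma> \<mu> \<nu>"
      using near_refine[of m "max n m" \<gamma> N] m by auto
    have "\<nu> \<in> a \<inter> b" if "\<nu> \<in> SCurr N" "near N (max n m) (min \<delta>' \<gamma>') \<mu> \<nu>" for \<nu>
    proof -
      have "near N (max n m) \<delta>' \<mu> \<nu>" "near N (max n m) \<gamma>' \<mu> \<nu>"
        using near_mono[OF that(2)] by auto
      then show ?thesis using n m d g that Int.prems by blast
    qed
    then show ?case using d g by (intro exI[of _ "max n m"] exI[of _ "min \<delta>' \<gamma>'"]) auto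
  next
    case (UN K)
    then obtain k where k: "k \<in> K" "\<mu> \<in> k" by blast
    then obtain n \<delta> where "\<delta> > 0" "\<forall>\<nu>\<in>SCurr N. near N n \<delta> \<mu> \<nu> \<longrightarrow> \<nu> \<in> k" using UN by blast
    then show ?case using k by blast
  next
    case (Basis s)
    then obtain f V where fV: "f \<in> Cc (CT N)" "open V" "s = {\<mu> \<in> SCurr N. integral\<^sup>L \<mu> f \<in> V}" by (auto simp: B_def)
    then have "integral\<^sup>L \<mu> f \<in> V" using Basis by simp
    then obtain e where e: "e > 0" "ball (integral\<^sup>L \<mu> f) e \<subseteq> V" using fV(2) openE by blast
    obtain n \<delta> where n: "\<delta> > 0" "\<And>\<nu>. \<nu> \<in> SCurr N \<Longrightarrow> near N n \<delta> \<mu> \<nu> \<Longrightarrow> \<bar>integral\<^sup>L \<nu> f - integral\<^sup>L \<mu> f\<bar> < e"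
      using integral_near[OF Basis(2) fV(1) e(1)] by blast
    have "\<nu> \<in> s" if "\<nu> \<in> SCurr N" "near N n \<delta> \<mu> \<nu>" for \<nu>
      using n(2)[OF that] e(2) that(1) fV(3) by (auto simp: subset_iff dist_real_def abs_minus_commute)
    then show ?case using n(1) by blast
  qed simp
qed

section \<open>Sums and multiples of currents\<close>

lemma emeasure_madd:
  assumes "\<mu> \<in> SCurr N" "\<nu> \<in> SCurr N" "A \<in> sets (borel_of (CT N))"
  shows "emeasure (madd \<mu> \<nu>) A = emeasure \<mu> A + emeasure \<nu> A"
  unfolding madd_def
proof (rule emeasure_measure_of_sigma)
  have s: "sets \<nu> = sets \<mu>" using assms SCurr_sets by auto
  show "sigma_algebra (space \<mu>) (sets \<mu>)" by (rule sets.sigma_algebra_axioms)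
  show "positive (sets \<mu>) (\<lambda>A. emeasure \<mu> A + emeasure \<nu> A)" by (simp add: positive_def)
  show "countably_additive (sets \<mu>) (\<lambda>A. emeasure \<mu> A + emeasure \<nu> A)"
    unfolding countably_additive_def
  proof (intro allI impI)
    fix A :: "nat \<Rightarrow> _" assume A: "range A \<subseteq> sets \<mu>" "disjoint_family A"
    have "suminf (\<lambda>i. emeasure \<mu> (A i) + emeasure \<nu> (A i)) = suminf (\<lambda>i. emeasure \<mu> (A i)) + suminf (\<lambda>i. emeasure \<nu> (A i))"
      by (rule suminf_add[symmetric]) auto
    also have "\<dots> = emeasure \<mu> (\<Union> (range A)) + emeasure \<nu> (\<Union> (range A))"
      using A s by (simp add: suminf_emeasure)
    finally show "suminf (\<lambda>i. emeasure \<mu> (A i) + emeasure \<nu> (A i)) = emeasure \<mu> (\<Union> (range A)) + emeasure \<nu> (\<Union> (range A))" .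
  qed
  show "A \<in> sets \<mu>" using assms SCurr_sets by auto
qed

lemma sets_madd [simp]: "sets (madd \<mu> \<nu>) = sets \<mu>"
  by (simp add: madd_def)

lemma SCurrI:
  assumes "sets \<mu> = sets (borel_of (CT N))"
    and "\<And>g A. g \<in> FN_carrier N \<Longrightarrow> A \<in> sets (borel_of (CT N)) \<Longrightarrow> emeasure \<mu> ((\<lambda>S. act g ` S) ` A) = emeasure \<mu> A"
    and "\<And>m. emeasure \<mu> (Kc N m) < \<infinity>"
  shows "\<mu> \<in> SCurr N"
  unfolding SCurr_def
proof (intro CollectI conjI ballI allI impI)
  fix C assume C: "compactin (CT N) C"
  obtain m where "C \<subseteq> Kc N m" using compactin_sub_Kc[OF C] by blast
  then have "emeasure \<mu> C \<le> emeasure \<mu> (Kc N m)" using Kc_sets assms(1) by (intro emeasure_mono) auto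
  then show "emeasure \<mu> C < \<infinity>" using assms(3)[of m] by (rule le_less_trans)
qed (use assms bact_image in auto)

lemma madd_SCurr:
  assumes "\<mu> \<in> SCurr N" "\<nu> \<in> SCurr N"
  shows "madd \<mu> \<nu> \<in> SCurr N"
proof (rule SCurrI)
  show "sets (madd \<mu> \<nu>) = sets (borel_of (CT N))" using SCurr_sets[OF assms(1)] by simp
  show "emeasure (madd \<mu> \<nu>) ((\<lambda>S. act g ` S) ` A) = emeasure (madd \<mu> \<nu>) A"
    if "g \<in> FN_carrier N" "A \<in> sets (borel_of (CT N))" for g A
    using that assms bdhomeo_sets_image(2)[OF bdhomeo_act[OF that(1)] that(2)]
    by (simp add: emeasure_madd[OF assms] SCurr_emeasure_act)
  show "emeasure (madd \<mu> \<nu>) (Kc N m) < \<infinity>" for m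
    using SCurr_emeasure_finite[OF assms(1), of "Kc N m" m] SCurr_emeasure_finite[OF assms(2), of "Kc N m" m]
    by (simp add: emeasure_madd[OF assms] Kc_sets)
qed

lemma measure_madd:
  assumes "\<mu> \<in> SCurr N" "\<nu> \<in> SCurr N" "A \<in> sets (borel_of (CT N))" "A \<subseteq> Kc N m"
  shows "measure (madd \<mu> \<nu>) A = measure \<mu> A + measure \<nu> A"
  unfolding measure_def emeasure_madd[OF assms(1-3)]
  by (rule enn2real_plus) (use SCurr_emeasure_finite[OF assms(1,4)] SCurr_emeasure_finite[OF assms(2,4)] in auto)

lemma mscale_SCurr:
  assumes "\<mu> \<in> SCurr N"
  shows "mscale c \<mu> \<in> SCurr N"
proof (rule SCurrI)
  show "sets (mscale c \<mu>) = sets (borel_of (CT N))" using SCurr_sets[OF assms(1)] by (simp add: mscale_def)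
  show "emeasure (mscale c \<mu>) ((\<lambda>S. act g ` S) ` A) = emeasure (mscale c \<mu>) A"
    if "g \<in> FN_carrier N" "A \<in> sets (borel_of (CT N))" for g A
    using that assms by (simp add: mscale_def SCurr_emeasure_act)
  show "emeasure (mscale c \<mu>) (Kc N m) < \<infinity>" for m
    using SCurr_emeasure_finite[OF assms(1), of "Kc N m" m] by (simp add: mscale_def ennreal_mult_less_top)
qed

lemma measure_mscale: "c \<ge> 0 \<Longrightarrow> measure (mscale c \<mu>) A = c * measure \<mu> A"
  by (simp add: mscale_def measure_def enn2real_mult)

section \<open>Counting currents\<close>

text \<open>The limit set of \<open>H\<close> as seen from a vertex \<open>x\<close> of the coset
  \<open>C\<close>, which is moved to the identity. The choice of \<open>x\<close> is immaterial
  because the limit set is \<open>H\<close>-invariant (\<open>csh_coset\<close>).\<close>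

definition csh :: "nat \<Rightarrow> int list set \<Rightarrow> int list set \<Rightarrow> (nat \<Rightarrow> int) set" where
  "csh N H C = act (winv (SOME x. x \<in> C)) ` limset N H"

lemma csh_coset:
  assumes H: "subgroup H (FN N)" and x: "x \<in> FN_carrier N"
  shows "csh N H (H #>\<^bsub>FN N\<^esub> x) = act (winv x) ` limset N H"
proof -
  define y where "y = (SOME y. y \<in> H #>\<^bsub>FN N\<^esub> x)"
  have "y \<in> H #>\<^bsub>FN N\<^esub> x" unfolding y_def by (rule someI[of _ x]) (rule rcos_self[OF H x])
  then obtain h where h: "h \<in> H" "y = mul h x" by (auto simp: r_coset_eq)
  have hF: "h \<in> FN_carrier N" "winv h \<in> H" using H h by (auto simp: subgroup_FN_iff)
  have "act (winv y) ` limset N H = act (winv x) ` act (winv h) ` limset N H"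
    using h x hF by (simp add: winv_mul_distrib[of _ N] act_image_act[OF _ _ limset_bd])
  then show ?thesis using limset_invariant[OF H hF(2)] by (simp add: csh_def y_def)
qed

lemma rcosetsE:
  assumes "C \<in> rcosets\<^bsub>FN N\<^esub> H"
  obtains x where "x \<in> FN_carrier N" "C = H #>\<^bsub>FN N\<^esub> x"
  using assms by (auto simp: RCOSETS_def)

lemma rcosetsI: "x \<in> FN_carrier N \<Longrightarrow> H #>\<^bsub>FN N\<^esub> x \<in> rcosets\<^bsub>FN N\<^esub> H"
  by (auto simp: RCOSETS_def)

lemma limset_CN:
  assumes "subgroup H (FN N)" "H \<noteq> {[]}"
  shows "limset N H \<in> CN N"
proof -
  obtain \<xi> \<eta> where "\<xi> \<in> limset N H" "\<eta> \<in> limset N H" "\<xi> \<noteq> \<eta>" using limset_two_points[OF assms] by blast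
  then have "\<exists>\<xi>\<in>limset N H. \<exists>\<eta>\<in>limset N H. \<xi> \<noteq> \<eta>" by (intro bexI[of _ \<xi>] bexI[of _ \<eta>])
  moreover have "closedin (bdT N) (limset N H)"
    unfolding closedin_bdT using limset_closed[of _ N H] by (auto simp: limset_bd)
  ultimately show ?thesis by (simp add: CN_iff)
qed

lemma act_CN: "g \<in> FN_carrier N \<Longrightarrow> S \<in> CN N \<Longrightarrow> act g ` S \<in> CN N"
  by (rule bdhomeo_CN[OF bdhomeo_act])

lemma csh_CN:
  assumes "subgroup H (FN N)" "H \<noteq> {[]}" "C \<in> rcosets\<^bsub>FN N\<^esub> H"
  shows "csh N H C \<in> CN N"
  using rcosetsE[OF assms(3)] csh_coset[OF assms(1)] act_CN limset_CN[OF assms(1,2)] by (metis winv_FN)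

lemma emeasure_count_fibers:
  assumes f: "f ` A \<subseteq> B" and m: "m > 0" and fib: "\<And>b. b \<in> B \<Longrightarrow> finite {a \<in> A. f a = b} \<and> card {a \<in> A. f a = b} = m"
  shows "emeasure (count_space UNIV) A = of_nat m * emeasure (count_space UNIV) B"
proof -
  have AU: "A = (\<Union>b\<in>B. {a \<in> A. f a = b})" using f by blast
  have sur: "f ` A = B"
  proof (intro equalityI f subsetI)
    fix b assume "b \<in> B"
    then have "{a \<in> A. f a = b} \<noteq> {}" using fib m by (metis card.empty less_irrefl)
    then show "b \<in> f ` A" by blast
  qed
  show ?thesis
  proof (cases "finite B")
    case True
    have fA: "finite A" by (subst AU) (use True fib in blast)
    have "card A = (\<Sum>b\<in>B. card {a \<in> A. f a = b})"
      by (subst AU, rule card_UN_disjoint) (use True fib in auto)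
    also have "\<dots> = m * card B" using fib by simp
    finally show ?thesis using True fA by simp
  next
    case False
    then have "infinite A" using sur by (metis finite_imageI)
    then show ?thesis using False m by (simp add: ennreal_mult_top)
  qed
qed

lemma subgroup_Comm:
  "fg_subgroup N H \<Longrightarrow> H \<noteq> {[]} \<Longrightarrow> subgroup (Comm N H) (FN N)"
  by (simp add: Comm_eq_Stab subgroup_Stab[OF limset_bd])

text \<open>The coset of \<open>x\<close> is sent to the conjugate of the commensurator by
  \<open>winv x\<close>. Each fibre has as many elements as \<open>H\<close> has cosets in its
  commensurator, which absorbs the index in front of the sum and leaves one unit of mass for each
  right coset of \<open>H\<close>.\<close>

lemma eta_weight:
  assumes fg: "fg_subgroup N H" and nt: "H \<noteq> {[]}"
  shows "of_nat (card (cosets_in N (Comm N H) H)) *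
      (\<integral>\<^sup>+ H'. indicator A (limset N H') \<partial>count_space {conjg N g (Comm N H) | g. g \<in> carrier (FN N)})
    = emeasure (count_space UNIV) {C \<in> rcosets\<^bsub>FN N\<^esub> H. csh N H C \<in> A}"
proof -
  have H: "subgroup H (FN N)" using fg by (auto simp: fg_subgroup_def)
  have HF: "H \<subseteq> FN_carrier N" using H by (simp add: subgroup_FN_iff)
  define K where "K = Comm N H"
  have KS: "K = Stab N (limset N H)" unfolding K_def by (rule Comm_eq_Stab[OF assms])
  have K: "subgroup K (FN N)" unfolding K_def by (rule subgroup_Comm[OF assms])
  have KF: "K \<subseteq> FN_carrier N" using K by (simp add: subgroup_FN_iff)
  have lK: "limset N K = limset N H" unfolding K_def by (rule limset_Comm[OF assms])
  have HK: "H \<subseteq> K" unfolding KS by (rule subgroup_sub_Stab[OF H])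
  define Cj where "Cj = {conjg N g K | g. g \<in> FN_carrier N}"
  define A' where "A' = {C \<in> rcosets\<^bsub>FN N\<^esub> H. csh N H C \<in> A}"
  define B' where "B' = {H' \<in> Cj. limset N H' \<in> A}"
  define \<pi> where "\<pi> = (\<lambda>C. conjg N (winv (SOME x. x \<in> C)) K)"
  have pi: "\<pi> (H #>\<^bsub>FN N\<^esub> x) = conjg N (winv x) K" if x: "x \<in> FN_carrier N" for x
  proof -
    define y where "y = (SOME y. y \<in> H #>\<^bsub>FN N\<^esub> x)"
    have "y \<in> H #>\<^bsub>FN N\<^esub> x" unfolding y_def by (rule someI[of _ x]) (rule rcos_self[OF H x])
    then obtain h where h: "h \<in> H" "y = mul h x" by (auto simp: r_coset_eq)
    have hF: "h \<in> FN_carrier N" "winv h \<in> K" using H h HK by (auto simp: subgroup_FN_iff)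
    have "conjg N (winv y) K = conjg N (winv x) (conjg N (winv h) K)"
      using h x hF KF by (simp add: winv_mul_distrib[of _ N] conjg_conjg)
    then show ?thesis using conjg_self[OF K hF(2)] by (simp add: \<pi>_def y_def)
  qed
  have lim: "limset N (conjg N (winv x) K) = csh N H (H #>\<^bsub>FN N\<^esub> x)" if "x \<in> FN_carrier N" for x
    using that limset_conjg[OF _ KF, of "winv x"] csh_coset[OF H that] lK by simp
  have sub: "\<pi> ` A' \<subseteq> B'"
  proof (rule image_subsetI)
    fix C assume C: "C \<in> A'"
    then obtain x where x: "x \<in> FN_carrier N" "C = H #>\<^bsub>FN N\<^esub> x" by (auto simp: A'_def elim: rcosetsE)
    show "\<pi> C \<in> B'" using C x pi lim by (auto simp: A'_def B'_def Cj_def)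
  qed
  define m where "m = card (cosets_in N K H)"
  have fm: "finite (cosets_in N K H)" unfolding K_def by (rule finite_index_Comm[OF assms])
  have "H #>\<^bsub>FN N\<^esub> [] \<in> cosets_in N K H" using K by (auto simp: cosets_in_eq subgroup_FN_iff)
  then have m0: "m > 0" using fm by (auto simp: m_def card_gt_0_iff)
  have fib: "finite {C \<in> A'. \<pi> C = b} \<and> card {C \<in> A'. \<pi> C = b} = m" if b: "b \<in> B'" for b
  proof -
    obtain g where g: "g \<in> FN_carrier N" "b = conjg N g K" using b by (auto simp: B'_def Cj_def)
    \<comment> \<open>The fibre over the conjugate by \<open>g\<close> consists of the cosets of
      \<open>H\<close> in \<open>K\<close>, shifted on the right by \<open>winv g\<close>.\<close>
    define F where "F = (\<lambda>C. (\<lambda>y. mul y (winv g)) ` C)"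
    have Fc: "F (H #>\<^bsub>FN N\<^esub> k) = H #>\<^bsub>FN N\<^esub> (mul k (winv g))" for k
      by (auto simp: F_def r_coset_eq image_image mul_assoc)
    have inj: "inj_on F (cosets_in N K H)"
    proof (rule inj_onI)
      fix C C' assume h: "C \<in> cosets_in N K H" "C' \<in> cosets_in N K H" "F C = F C'"
      then obtain k k' where k: "k \<in> K" "k' \<in> K" "C = H #>\<^bsub>FN N\<^esub> k" "C' = H #>\<^bsub>FN N\<^esub> k'"
        by (auto simp: cosets_in_eq)
      have kF: "k \<in> FN_carrier N" "k' \<in> FN_carrier N" using k KF by auto
      have "mul (mul k (winv g)) (winv (mul k' (winv g))) \<in> H"
        using h(3) k kF g rcos_eq_iff[OF H, of "mul k (winv g)" "mul k' (winv g)"] by (simp add: Fc)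
      then have "mul k (winv k') \<in> H" using kF g
        by (simp add: winv_mul_distrib[of _ N] mul_assoc winv_mul_cancel FN_carrier_reduced)
      then show "C = C'" using rcos_eq_iff[OF H kF] k by simp
    qed
    have "F ` cosets_in N K H = {C \<in> A'. \<pi> C = b}"
    proof (intro equalityI subsetI)
      fix C assume "C \<in> F ` cosets_in N K H"
      then obtain k where k: "k \<in> K" "C = H #>\<^bsub>FN N\<^esub> (mul k (winv g))" by (auto simp: cosets_in_eq Fc)
      have kF: "k \<in> FN_carrier N" "winv k \<in> K" using k K KF by (auto simp: subgroup_FN_iff)
      have x: "mul k (winv g) \<in> FN_carrier N" using kF g by auto
      have "conjg N (winv (mul k (winv g))) K = conjg N g (conjg N (winv k) K)"
        using kF g KF by (simp add: winv_mul_distrib[of _ N] conjg_conjg)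
      then have pC: "\<pi> C = b" using pi[OF x] k(2) g conjg_self[OF K kF(2)] by simp
      have "csh N H C = limset N b" using lim[OF x] pi[OF x] k(2) pC by simp
      then show "C \<in> {C \<in> A'. \<pi> C = b}" using pC b rcosetsI[OF x] k(2) by (auto simp: A'_def B'_def)
    next
      fix C assume "C \<in> {C \<in> A'. \<pi> C = b}"
      then have C: "C \<in> rcosets\<^bsub>FN N\<^esub> H" "\<pi> C = b" by (auto simp: A'_def)
      obtain x where x: "x \<in> FN_carrier N" "C = H #>\<^bsub>FN N\<^esub> x" using C rcosetsE by blast
      \<comment> \<open>Equal conjugates have equal limit sets, so \<open>mul x g\<close> stabilises
        the limit set of \<open>H\<close> and lies in \<open>K\<close> by \<open>KS\<close>.\<close>
      have e: "conjg N (winv x) K = conjg N g K" using pi[OF x(1)] x C g by simp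
      have "conjg N (mul x g) K = conjg N x (conjg N g K)" using x g KF by (simp add: conjg_conjg)
      also have "\<dots> = K" unfolding e[symmetric] using x KF by (simp add: conjg_conjg conjg_Nil)
      finally have "act (mul x g) ` limset N H = limset N H"
        using limset_conjg[OF mul_FN[OF x(1) g(1)] KF] lK by simp
      then have "mul x g \<in> K" unfolding KS Stab_def using x g by simp
      moreover have "C = F (H #>\<^bsub>FN N\<^esub> (mul x g))" using x g by (simp add: Fc mul_cancel_right FN_carrier_reduced)
      ultimately show "C \<in> F ` cosets_in N K H" by (auto simp: cosets_in_eq)
    qed
    then show ?thesis using fm card_image[OF inj] by (metis finite_imageI m_def)
  qed
  have "(\<integral>\<^sup>+ H'. indicator A (limset N H') \<partial>count_space Cj) = (\<integral>\<^sup>+ H'. indicator B' H' \<partial>count_space Cj)"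
    by (rule nn_integral_cong) (auto simp: B'_def indicator_def)
  also have "\<dots> = emeasure (count_space Cj) B'" by (rule nn_integral_indicator) (auto simp: B'_def)
  also have "\<dots> = emeasure (count_space UNIV) B'"
    by (cases "finite B'") (auto simp: B'_def)
  finally have "(\<integral>\<^sup>+ H'. indicator A (limset N H') \<partial>count_space Cj) = emeasure (count_space UNIV) B'" .
  then show ?thesis
    using emeasure_count_fibers[OF sub m0 fib] unfolding A'_def m_def K_def Cj_def by simp
qed

text \<open>As a push-forward of a counting measure, the set function in \<open>eta\<close> is
  countably additive, so \<open>measure_of\<close> returns it and not the default zero
  measure.\<close>

lemma eta_distr:
  assumes fg: "fg_subgroup N H" and nt: "H \<noteq> {[]}"
  shows "eta N H = distr (count_space (rcosets\<^bsub>FN N\<^esub> H)) (borel_of (CT N)) (csh N H)"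
    (is "_ = ?D")
proof -
  have H: "subgroup H (FN N)" using fg by (auto simp: fg_subgroup_def)
  have m: "csh N H \<in> measurable (count_space (rcosets\<^bsub>FN N\<^esub> H)) (borel_of (CT N))"
    using csh_CN[OF H nt] by auto
  have "emeasure ?D A = emeasure (count_space UNIV) {C \<in> rcosets\<^bsub>FN N\<^esub> H. csh N H C \<in> A}"
    if "A \<in> sets (borel_of (CT N))" for A
  proof -
    have "emeasure ?D A = emeasure (count_space (rcosets\<^bsub>FN N\<^esub> H)) (csh N H -` A \<inter> rcosets\<^bsub>FN N\<^esub> H)"
      using emeasure_distr[OF m that] by simp
    also have "csh N H -` A \<inter> rcosets\<^bsub>FN N\<^esub> H = {C \<in> rcosets\<^bsub>FN N\<^esub> H. csh N H C \<in> A}" by auto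
    also have "emeasure (count_space (rcosets\<^bsub>FN N\<^esub> H)) {C \<in> rcosets\<^bsub>FN N\<^esub> H. csh N H C \<in> A}
        = emeasure (count_space UNIV) {C \<in> rcosets\<^bsub>FN N\<^esub> H. csh N H C \<in> A}"
      by (cases "finite {C \<in> rcosets\<^bsub>FN N\<^esub> H. csh N H C \<in> A}") auto
    finally show ?thesis .
  qed
  then have "eta N H = measure_of (CN N) (sets (borel_of (CT N))) (emeasure ?D)"
    unfolding eta_def eta_weight[OF assms]
    using sets.sets_into_space[of _ "borel_of (CT N)"] sets.sigma_sets_eq[of "borel_of (CT N)"]
    by (intro measure_of_eq) auto
  also have "\<dots> = ?D" using measure_of_of_measure[of ?D] by simp
  finally show ?thesis .
qed

lemma emeasure_eta:
  assumes fg: "fg_subgroup N H" and nt: "H \<noteq> {[]}" and A: "A \<in> sets (borel_of (CT N))"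
  shows "emeasure (eta N H) A = emeasure (count_space UNIV) {C \<in> rcosets\<^bsub>FN N\<^esub> H. csh N H C \<in> A}"
proof -
  have H: "subgroup H (FN N)" using fg by (auto simp: fg_subgroup_def)
  have m: "csh N H \<in> measurable (count_space (rcosets\<^bsub>FN N\<^esub> H)) (borel_of (CT N))"
    using csh_CN[OF H nt] by auto
  have "csh N H -` A \<inter> rcosets\<^bsub>FN N\<^esub> H = {C \<in> rcosets\<^bsub>FN N\<^esub> H. csh N H C \<in> A}" by auto
  then have "emeasure (eta N H) A = emeasure (count_space (rcosets\<^bsub>FN N\<^esub> H)) {C \<in> rcosets\<^bsub>FN N\<^esub> H. csh N H C \<in> A}"
    unfolding eta_distr[OF fg nt] using emeasure_distr[OF m A] by simp
  also have "\<dots> = emeasure (count_space UNIV) {C \<in> rcosets\<^bsub>FN N\<^esub> H. csh N H C \<in> A}"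
    by (cases "finite {C \<in> rcosets\<^bsub>FN N\<^esub> H. csh N H C \<in> A}") auto
  finally show ?thesis .
qed

text \<open>A translate that splits before level \<open>m\<close> has a branch vertex
  \<open>g\<close> with fewer than \<open>m\<close> letters. Then \<open>mul x g\<close> lies in the
  hull of the limit set, which has finitely many \<open>H\<close>-orbits, and \<open>g\<close> runs
  through a ball.\<close>

lemma finite_csh_Kc:
  assumes fg: "fg_subgroup N H" and nt: "H \<noteq> {[]}"
  shows "finite {C \<in> rcosets\<^bsub>FN N\<^esub> H. csh N H C \<in> Kc N m}"
proof -
  have H: "subgroup H (FN N)" using fg by (auto simp: fg_subgroup_def)
  define Q where "Q = (\<lambda>g. H #>\<^bsub>FN N\<^esub> g) ` chull N (limset N H)"
  have fQ: "finite Q" unfolding Q_def by (rule finite_orbits_chull[OF fg])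
  have "{C \<in> rcosets\<^bsub>FN N\<^esub> H. csh N H C \<in> Kc N m} \<subseteq>
    (\<Union>g\<in>{w \<in> FN_carrier N. length w \<le> m}. (\<lambda>C. (\<lambda>y. mul y (winv g)) ` C) ` Q)"
  proof
    fix C assume "C \<in> {C \<in> rcosets\<^bsub>FN N\<^esub> H. csh N H C \<in> Kc N m}"
    then have C: "C \<in> rcosets\<^bsub>FN N\<^esub> H" "csh N H C \<in> Kc N m" by auto
    then obtain x where x: "x \<in> FN_carrier N" "C = H #>\<^bsub>FN N\<^esub> x" using rcosetsE by blast
    define S where "S = act (winv x) ` limset N H"
    have S: "S \<in> Kc N m" using C x csh_coset[OF H x(1)] by (simp add: S_def)
    then have Sbd: "S \<subseteq> bd N" using CN_bd by (auto simp: Kc_def)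
    have "2 \<le> card (Pl m S)" using S by (simp add: Kc_def)
    then obtain \<xi> \<eta> where xi: "\<xi> \<in> S" "\<eta> \<in> S" "pre \<xi> m \<noteq> pre \<eta> m"
      unfolding two_le_card_iff[OF finite_Pl[OF Sbd]] by (auto simp: Pl_def)
    then have "\<xi> \<noteq> \<eta>" by auto
    then obtain n where n: "pre \<xi> n \<in> chull N S" "pre \<xi> n = pre \<eta> n" "\<xi> n \<noteq> \<eta> n"
      using chull_nonempty[OF Sbd xi(1,2)] by blast
    have "n < m" using n(2) xi(3) pre_eq_mono[of \<xi> n \<eta> m] by force
    define g where "g = pre \<xi> n"
    have gF: "g \<in> FN_carrier N" using n(1) chull_FN g_def by auto
    have "mul x g \<in> chull N (limset N H)"
      using n(1) mem_chull_act[of "winv x" N g "limset N H"] x gF limset_bd by (simp add: S_def g_def)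
    then have "H #>\<^bsub>FN N\<^esub> (mul x g) \<in> Q" by (simp add: Q_def)
    moreover have "C = (\<lambda>y. mul y (winv g)) ` (H #>\<^bsub>FN N\<^esub> (mul x g))"
      using x by (simp add: r_coset_eq image_image mul_assoc mul_Nil_right FN_carrier_reduced)
    moreover have "g \<in> {w \<in> FN_carrier N. length w \<le> m}" using gF \<open>n < m\<close> by (simp add: g_def)
    ultimately show "C \<in> (\<Union>g\<in>{w \<in> FN_carrier N. length w \<le> m}. (\<lambda>C. (\<lambda>y. mul y (winv g)) ` C) ` Q)" by blast
  qed
  then show ?thesis by (rule finite_subset) (use fQ finite_FN_length in blast)
qed

lemma eta_SCurr:
  assumes fg: "fg_subgroup N H" and nt: "H \<noteq> {[]}"
  shows "eta N H \<in> SCurr N"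
proof (rule SCurrI)
  have H: "subgroup H (FN N)" using fg by (auto simp: fg_subgroup_def)
  show "sets (eta N H) = sets (borel_of (CT N))" by (simp add: eta_distr[OF assms])
  show "emeasure (eta N H) (Kc N m) < \<infinity>" for m
    using finite_csh_Kc[OF assms, of m] by (simp add: emeasure_eta[OF assms Kc_sets] of_nat_less_top)
  fix g A assume g: "g \<in> FN_carrier N" and A: "A \<in> sets (borel_of (CT N))"
  note im = bdhomeo_sets_image[OF bdhomeo_act[OF g] A]
  define P where "P = (\<lambda>A. {C \<in> rcosets\<^bsub>FN N\<^esub> H. csh N H C \<in> A})"
  define F where "F = (\<lambda>x. \<lambda>C. (\<lambda>y. mul y x) ` C)"
  have Fc: "F x (H #>\<^bsub>FN N\<^esub> y) = H #>\<^bsub>FN N\<^esub> (mul y x)" for x y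
    by (simp add: F_def r_coset_eq image_image mul_assoc)
  have F: "F x C \<in> rcosets\<^bsub>FN N\<^esub> H" "csh N H (F x C) = act (winv x) ` csh N H C" "F (winv x) (F x C) = C"
    if x: "x \<in> FN_carrier N" and C: "C \<in> rcosets\<^bsub>FN N\<^esub> H" for x C
  proof -
    obtain y where y: "y \<in> FN_carrier N" "C = H #>\<^bsub>FN N\<^esub> y" using rcosetsE[OF C] by blast
    show "F x C \<in> rcosets\<^bsub>FN N\<^esub> H" using y x by (simp add: Fc rcosetsI)
    show "csh N H (F x C) = act (winv x) ` csh N H C"
      using y x by (simp add: Fc csh_coset[OF H] winv_mul_distrib[of _ N] act_image_act[OF _ _ limset_bd])
    show "F (winv x) (F x C) = C" using y x by (simp add: Fc mul_assoc mul_Nil_right FN_carrier_reduced)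
  qed
  \<comment> \<open>Shifting cosets on the right by \<open>g\<close> translates their limit sets by
    \<open>winv g\<close>.\<close>
  have "bij_betw (F g) (P ((\<lambda>S. act g ` S) ` A)) (P A)"
  proof (rule bij_betw_byWitness[where f'="F (winv g)"])
    show "\<forall>C\<in>P ((\<lambda>S. act g ` S) ` A). F (winv g) (F g C) = C" using F(3)[OF g] by (auto simp: P_def)
    show "\<forall>C\<in>P A. F g (F (winv g) C) = C" using F(3)[of "winv g"] g by (auto simp: P_def)
    show "F g ` P ((\<lambda>S. act g ` S) ` A) \<subseteq> P A"
      using F(1,2)[OF g] unfolding im(1) by (auto simp: P_def)
    show "F (winv g) ` P A \<subseteq> P ((\<lambda>S. act g ` S) ` A)"
      using F(1,2)[of "winv g"] g by (auto simp: P_def)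
  qed
  then have "finite (P ((\<lambda>S. act g ` S) ` A)) = finite (P A)" "card (P ((\<lambda>S. act g ` S) ` A)) = card (P A)"
    by (auto simp: bij_betw_finite bij_betw_same_card)
  then have "emeasure (count_space UNIV) (P ((\<lambda>S. act g ` S) ` A)) = emeasure (count_space UNIV) (P A)"
    by (cases "finite (P A)") auto
  then show "emeasure (eta N H) ((\<lambda>S. act g ` S) ` A) = emeasure (eta N H) A"
    unfolding emeasure_eta[OF assms A] emeasure_eta[OF assms im(2)] P_def .
qed

lemma measure_eta:
  assumes fg: "fg_subgroup N H" and nt: "H \<noteq> {[]}" and A: "A \<in> sets (borel_of (CT N))" "A \<subseteq> Kc N m"
  shows "measure (eta N H) A = real (card {C \<in> rcosets\<^bsub>FN N\<^esub> H. csh N H C \<in> A})"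
proof -
  have "finite {C \<in> rcosets\<^bsub>FN N\<^esub> H. csh N H C \<in> A}"
    by (rule finite_subset[OF _ finite_csh_Kc[OF fg nt, of m]]) (use A in auto)
  then show ?thesis by (simp add: measure_def emeasure_eta[OF fg nt A(1)])
qed

section \<open>The intersection functional\<close>

text \<open>If the hulls of \<open>S\<close> and \<open>S'\<close> contain the identity, they are \<open>Pref S\<close> and \<open>Pref S'\<close>, so \<open>FF\<close> is the local
  term of the intersection of the hulls and \<open>Gk k\<close> its truncation, which is determined by the prefixes of length \<open>k\<close>.\<close>
definition PT :: "int list set \<Rightarrow> int list set" where
  "PT W = {take j w |j w. w \<in> W}"

definition isz :: "int list set \<Rightarrow> real" where
  "isz T = real (card {w \<in> T. length w = 1}) / 2 - 1"

definition Gk :: "nat \<Rightarrow> int list set \<Rightarrow> int list set \<Rightarrow> real" where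
  "Gk k W W' = isz (PT W \<inter> PT W') + (if card (PT W \<inter> PT W') \<le> k then 1 / card (PT W \<inter> PT W') else 0)"

definition FF :: "(nat \<Rightarrow> int) set \<Rightarrow> (nat \<Rightarrow> int) set \<Rightarrow> real" where
  "FF S S' = isz (Pref S \<inter> Pref S') + (if finite (Pref S \<inter> Pref S') then 1 / card (Pref S \<inter> Pref S') else 0)"

lemma PT_Pl: "PT (Pl k S) = {w \<in> Pref S. length w \<le> k}"
proof (intro equalityI subsetI)
  fix w assume "w \<in> PT (Pl k S)"
  then obtain j \<xi> where "\<xi> \<in> S" "w = take j (pre \<xi> k)" by (auto simp: PT_def Pl_def)
  then show "w \<in> {w \<in> Pref S. length w \<le> k}" unfolding take_pre by (auto simp: mem_Pref)
next
  fix w assume "w \<in> {w \<in> Pref S. length w \<le> k}"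
  then obtain \<xi> where \<xi>: "\<xi> \<in> S" "pre \<xi> (length w) = w" "length w \<le> k" by (auto simp: mem_Pref)
  then have "w = take (length w) (pre \<xi> k)" by (simp add: take_pre min_absorb1)
  then show "w \<in> PT (Pl k S)" using \<xi>(1) by (auto simp: PT_def Pl_def)
qed

text \<open>A prefix-closed \<open>T\<close> with a word longer than \<open>k\<close> has at least
  \<open>k + 1\<close> words of length at most \<open>k\<close>. Hence it is visible in the patterns
  of level \<open>k\<close> whether \<open>T\<close> has at most \<open>k\<close> vertices, and in
  that case all of \<open>T\<close> is visible.\<close>

lemma Gk_Pl:
  assumes "S \<subseteq> bd N" "S' \<subseteq> bd N" "k \<ge> 1"
  shows "Gk k (Pl k S) (Pl k S') = isz (Pref S \<inter> Pref S') +
    (if finite (Pref S \<inter> Pref S') \<and> card (Pref S \<inter> Pref S') \<le> k then 1 / card (Pref S \<inter> Pref S') else 0)"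
proof -
  define T where "T = Pref S \<inter> Pref S'"
  define Tk where "Tk = {w \<in> T. length w \<le> k}"
  have e: "PT (Pl k S) \<inter> PT (Pl k S') = Tk" by (auto simp: PT_Pl Tk_def T_def)
  have fin: "finite Tk" by (rule finite_subset[OF _ finite_FN_length[of N k]])
    (use Pref_FN[OF assms(1)] in \<open>auto simp: Tk_def T_def\<close>)
  have pc: "take j w \<in> T" if "w \<in> T" for w j using that Pref_prefix_closed by (auto simp: T_def)
  have small: "T = Tk" if c: "card Tk \<le> k"
  proof (rule ccontr)
    assume "T \<noteq> Tk"
    then obtain w where w: "w \<in> T" "length w > k" unfolding Tk_def by force
    have "(\<lambda>j. take j w) ` {0..k} \<subseteq> Tk" using pc[OF w(1)] by (auto simp: Tk_def)
    moreover have "inj_on (\<lambda>j. take j w) {0..k}"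
    proof (rule inj_onI)
      fix i j assume ij: "i \<in> {0..k}" "j \<in> {0..k}" "take i w = take j w"
      have "length (take i w) = length (take j w)" using ij(3) by simp
      then show "i = j" using ij(1,2) w(2) by simp
    qed
    ultimately have "card {0..k} \<le> card Tk" using fin by (metis card_inj_on_le)
    then show False using c by simp
  qed
  have iff: "card Tk \<le> k \<longleftrightarrow> finite T \<and> card T \<le> k"
  proof
    assume "card Tk \<le> k"
    then show "finite T \<and> card T \<le> k" using small fin by simp
  next
    assume "finite T \<and> card T \<le> k"
    moreover from this have "card Tk \<le> card T" by (intro card_mono) (auto simp: Tk_def)
    ultimately show "card Tk \<le> k" by simp
  qed
  have "{w \<in> Tk. length w = 1} = {w \<in> T. length w = 1}" using assms(3) by (auto simp: Tk_def)
  then have "isz Tk = isz T" by (simp add: isz_def)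
  moreover have "card Tk \<le> k \<Longrightarrow> card T = card Tk" using small by simp
  ultimately show ?thesis unfolding Gk_def e T_def[symmetric] iff[symmetric] by simp
qed

lemma Gk_FF:
  assumes "S \<subseteq> bd N" "S' \<subseteq> bd N" "k \<ge> 1"
  shows "\<bar>Gk k (Pl k S) (Pl k S') - FF S S'\<bar> \<le> 1 / k"
proof -
  define T where "T = Pref S \<inter> Pref S'"
  have "1 / real (card T) \<le> 1 / k" if "\<not> card T \<le> k" using that assms(3) by (intro divide_left_mono) auto
  then show ?thesis unfolding Gk_Pl[OF assms] FF_def T_def[symmetric] by auto
qed

lemma Gk_Gk:
  assumes "S \<subseteq> bd N" "S' \<subseteq> bd N" "1 \<le> k" "k \<le> l"
  shows "\<bar>Gk k (Pl k S) (Pl k S') - Gk l (Pl l S) (Pl l S')\<bar> \<le> 1 / k"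
proof -
  define T where "T = Pref S \<inter> Pref S'"
  have "1 / real (card T) \<le> 1 / k" if "\<not> card T \<le> k" using that assms(3) by (intro divide_left_mono) auto
  moreover have "card T \<le> k \<Longrightarrow> card T \<le> l" using assms(4) by simp
  moreover have "1 \<le> l" using assms by simp
  ultimately show ?thesis unfolding Gk_Pl[OF assms(1-3)] Gk_Pl[OF assms(1,2) \<open>1 \<le> l\<close>] T_def[symmetric] by auto
qed

lemma Gk_sym: "Gk k W W' = Gk k W' W"
  by (simp add: Gk_def Int_commute)

text \<open>\<open>Kc N 1\<close> consists of the sets whose hull contains the identity.\<close>
definition CW :: "nat \<Rightarrow> nat \<Rightarrow> int list set set" where
  "CW N k = Pl k ` Kc N 1"

lemma finite_CW: "finite (CW N k)"
  unfolding CW_def by (rule finite_Pl_Kc)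

text \<open>The integral of the truncated local term against the product of the two currents; it is
  a finite sum because the term is constant on products of cells of level \<open>k\<close>.\<close>

definition Nk :: "nat \<Rightarrow> nat \<Rightarrow> (nat \<Rightarrow> int) set measure \<Rightarrow> (nat \<Rightarrow> int) set measure \<Rightarrow> real" where
  "Nk N k \<mu> \<nu> = (\<Sum>W\<in>CW N k. \<Sum>W'\<in>CW N k. Gk k W W' * measure \<nu> (Zc N k W') * measure \<mu> (Zc N k W))"

lemma sum_CW_refine:
  assumes "\<mu> \<in> SCurr N" "1 \<le> k" "k \<le> l"
  shows "(\<Sum>W\<in>CW N k. c W * measure \<mu> (Zc N k W)) = (\<Sum>W\<in>CW N l. c (take k ` W) * measure \<mu> (Zc N l W))"
proof -
  have "(\<Sum>W\<in>CW N l. c (take k ` W) * measure \<mu> (Zc N l W)) =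
    (\<Sum>W\<in>CW N k. \<Sum>W'\<in>{W' \<in> CW N l. take k ` W' = W}. c (take k ` W') * measure \<mu> (Zc N l W'))"
  proof (rule sum.group[symmetric])
    show "(\<lambda>W. take k ` W) ` CW N l \<subseteq> CW N k" using assms(3) by (auto simp: CW_def Pl_take[symmetric])
  qed (rule finite_CW)+
  also have "\<dots> = (\<Sum>W\<in>CW N k. c W * measure \<mu> (Zc N k W))"
  proof (rule sum.cong[OF refl])
    fix W assume "W \<in> CW N k"
    then have "measure \<mu> (Zc N k W) = (\<Sum>W'\<in>{W' \<in> CW N l. take k ` W' = W}. measure \<mu> (Zc N l W'))"
      unfolding CW_def by (intro measure_Zc_refine) (use assms in auto)
    then show "(\<Sum>W'\<in>{W' \<in> CW N l. take k ` W' = W}. c (take k ` W') * measure \<mu> (Zc N l W')) = c W * measure \<mu> (Zc N k W)"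
      by (simp add: sum_distrib_left)
  qed
  finally show ?thesis by simp
qed

text \<open>Both sums are refined to the cells of level \<open>l\<close>, where the two truncations
  differ by at most \<open>1 / k\<close>; the total mass on which they are compared is the product
  of the masses of \<open>Kc N 1\<close>.\<close>

lemma Nk_Nk:
  assumes "\<mu> \<in> SCurr N" "\<nu> \<in> SCurr N" "1 \<le> k" "k \<le> l"
  shows "\<bar>Nk N k \<mu> \<nu> - Nk N l \<mu> \<nu>\<bar> \<le> measure \<mu> (Kc N 1) * measure \<nu> (Kc N 1) / k"
proof -
  define a b where "a = (\<lambda>W. measure \<mu> (Zc N l W))" and "b = (\<lambda>W. measure \<nu> (Zc N l W))"
  have ab: "a W \<ge> 0" "b W \<ge> 0" for W by (auto simp: a_def b_def)
  have "Nk N k \<mu> \<nu> = (\<Sum>W\<in>CW N k. (\<Sum>W'\<in>CW N k. Gk k W W' * measure \<nu> (Zc N k W')) * measure \<mu> (Zc N k W))"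
    by (simp add: Nk_def sum_distrib_right)
  also have "\<dots> = (\<Sum>W\<in>CW N l. (\<Sum>W'\<in>CW N l. Gk k (take k ` W) (take k ` W') * b W') * a W)"
    unfolding a_def b_def sum_CW_refine[OF assms(1,3,4)] sum_CW_refine[OF assms(2-4)] ..
  finally have 1: "Nk N k \<mu> \<nu> = (\<Sum>W\<in>CW N l. \<Sum>W'\<in>CW N l. Gk k (take k ` W) (take k ` W') * b W' * a W)"
    by (simp add: sum_distrib_right)
  have 2: "Nk N l \<mu> \<nu> = (\<Sum>W\<in>CW N l. \<Sum>W'\<in>CW N l. Gk l W W' * b W' * a W)"
    by (simp add: Nk_def a_def b_def)
  have "\<bar>Nk N k \<mu> \<nu> - Nk N l \<mu> \<nu>\<bar> =
      \<bar>\<Sum>W\<in>CW N l. \<Sum>W'\<in>CW N l. (Gk k (take k ` W) (take k ` W') - Gk l W W') * (b W' * a W)\<bar>"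
    unfolding 1 2 by (simp add: sum_subtractf[symmetric] algebra_simps)
  also have "\<dots> \<le> (\<Sum>W\<in>CW N l. \<Sum>W'\<in>CW N l. 1 / k * (b W' * a W))"
  proof (intro order_trans[OF sum_abs] sum_mono)
    fix W W' assume "W \<in> CW N l" "W' \<in> CW N l"
    then obtain S S' where S: "S \<subseteq> bd N" "S' \<subseteq> bd N" "W = Pl l S" "W' = Pl l S'"
      by (auto simp: CW_def Kc_def dest: CN_bd)
    have "\<bar>Gk k (take k ` W) (take k ` W') - Gk l W W'\<bar> \<le> 1 / k"
      using Gk_Gk[OF S(1,2) assms(3,4)] S by (simp add: Pl_take[OF assms(4)])
    then show "\<bar>(Gk k (take k ` W) (take k ` W') - Gk l W W') * (b W' * a W)\<bar> \<le> 1 / k * (b W' * a W)"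
      unfolding abs_mult using ab by (intro mult_mono) auto
  qed
  also have "\<dots> = 1 / k * ((\<Sum>W\<in>CW N l. a W) * (\<Sum>W'\<in>CW N l. b W'))"
    by (subst sum.swap) (simp add: sum_distrib_left sum_distrib_right mult_ac sum_divide_distrib)
  also have "(\<Sum>W\<in>CW N l. a W) = measure \<mu> (Kc N 1)"
    using measure_Kc[OF assms(1), of 1 l] assms by (simp add: a_def CW_def)
  also have "(\<Sum>W\<in>CW N l. b W) = measure \<nu> (Kc N 1)"
    using measure_Kc[OF assms(2), of 1 l] assms by (simp add: b_def CW_def)
  finally show ?thesis by simp
qed

text \<open>Starting at \<open>Suc k\<close> excludes level 0, at which the degree of the identity
  is not visible.\<close>

definition Nint :: "nat \<Rightarrow> (nat \<Rightarrow> int) set measure \<Rightarrow> (nat \<Rightarrow> int) set measure \<Rightarrow> real" where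
  "Nint N \<mu> \<nu> = lim (\<lambda>k. Nk N (Suc k) \<mu> \<nu>)"

lemma Nk_tendsto:
  assumes "\<mu> \<in> SCurr N" "\<nu> \<in> SCurr N"
  shows "(\<lambda>k. Nk N (Suc k) \<mu> \<nu>) \<longlonglongrightarrow> Nint N \<mu> \<nu>"
proof -
  define M where "M = measure \<mu> (Kc N 1) * measure \<nu> (Kc N 1)"
  have M: "M \<ge> 0" by (simp add: M_def)
  have "Cauchy (\<lambda>k. Nk N (Suc k) \<mu> \<nu>)"
  proof (rule CauchyI')
    fix e :: real assume "e > 0"
    obtain k0 :: nat where k0: "M / e < k0" using reals_Archimedean2 by blast
    have "dist (Nk N (Suc m) \<mu> \<nu>) (Nk N (Suc n) \<mu> \<nu>) < e" if "m \<ge> k0" "n > m" for m n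
    proof -
      have "\<bar>Nk N (Suc m) \<mu> \<nu> - Nk N (Suc n) \<mu> \<nu>\<bar> \<le> M / Suc m"
        unfolding M_def by (rule Nk_Nk[OF assms]) (use that in auto)
      also have "M < e * Suc m"
      proof -
        have "M < e * k0" using k0 \<open>e > 0\<close> by (simp add: field_simps)
        also have "\<dots> \<le> e * Suc m" using that \<open>e > 0\<close> by (intro mult_left_mono) auto
        finally show ?thesis .
      qed
      then have "M / Suc m < e" by (simp add: field_simps)
      finally show ?thesis by (simp add: dist_real_def)
    qed
    then show "\<exists>M. \<forall>m\<ge>M. \<forall>n>m. dist (Nk N (Suc m) \<mu> \<nu>) (Nk N (Suc n) \<mu> \<nu>) < e" by blast
  qed
  then show ?thesis unfolding Nint_def by (simp add: Cauchy_convergent_iff convergent_LIMSEQ_iff)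
qed

lemma Nk_Nint:
  assumes "\<mu> \<in> SCurr N" "\<nu> \<in> SCurr N"
  shows "\<bar>Nk N (Suc k) \<mu> \<nu> - Nint N \<mu> \<nu>\<bar> \<le> measure \<mu> (Kc N 1) * measure \<nu> (Kc N 1) / Suc k"
proof (rule tendsto_upperbound)
  show "((\<lambda>l. \<bar>Nk N (Suc k) \<mu> \<nu> - Nk N (Suc l) \<mu> \<nu>\<bar>) \<longlongrightarrow> \<bar>Nk N (Suc k) \<mu> \<nu> - Nint N \<mu> \<nu>\<bar>) sequentially"
    by (intro tendsto_intros Nk_tendsto assms)
  show "\<forall>\<^sub>F l in sequentially. \<bar>Nk N (Suc k) \<mu> \<nu> - Nk N (Suc l) \<mu> \<nu>\<bar> \<le> measure \<mu> (Kc N 1) * measure \<nu> (Kc N 1) / Suc k"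
    using eventually_ge_at_top[of k]
  proof eventually_elim
    case (elim l)
    then show ?case by (intro Nk_Nk assms) auto
  qed
qed simp

lemma Nint_sym:
  assumes "\<mu> \<in> SCurr N" "\<nu> \<in> SCurr N"
  shows "Nint N \<mu> \<nu> = Nint N \<nu> \<mu>"
proof -
  have "Nk N k \<mu> \<nu> = Nk N k \<nu> \<mu>" for k
    unfolding Nk_def by (subst sum.swap) (simp add: Gk_sym mult_ac)
  then show ?thesis by (simp add: Nint_def)
qed

lemma Zc_CW: "1 \<le> k \<Longrightarrow> W \<in> CW N k \<Longrightarrow> Zc N k W \<subseteq> Kc N 1"
  unfolding CW_def by (rule Zc_sub_Kc)

lemma Nint_add:
  assumes "\<mu>1 \<in> SCurr N" "\<mu>2 \<in> SCurr N" "\<nu> \<in> SCurr N"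
  shows "Nint N (madd \<mu>1 \<mu>2) \<nu> = Nint N \<mu>1 \<nu> + Nint N \<mu>2 \<nu>"
proof -
  have "Nk N (Suc k) (madd \<mu>1 \<mu>2) \<nu> = Nk N (Suc k) \<mu>1 \<nu> + Nk N (Suc k) \<mu>2 \<nu>" for k
  proof -
    have "measure (madd \<mu>1 \<mu>2) (Zc N (Suc k) W) = measure \<mu>1 (Zc N (Suc k) W) + measure \<mu>2 (Zc N (Suc k) W)"
      if "W \<in> CW N (Suc k)" for W
      by (rule measure_madd[OF assms(1,2) Zc_sets Zc_CW]) (use that in auto)
    then show ?thesis unfolding Nk_def by (simp add: sum.distrib[symmetric] distrib_left)
  qed
  then have "(\<lambda>k. Nk N (Suc k) (madd \<mu>1 \<mu>2) \<nu>) \<longlonglongrightarrow> Nint N \<mu>1 \<nu> + Nint N \<mu>2 \<nu>"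
    using tendsto_add[OF Nk_tendsto[OF assms(1,3)] Nk_tendsto[OF assms(2,3)]] by simp
  then show ?thesis using Nk_tendsto[OF madd_SCurr[OF assms(1,2)] assms(3)] LIMSEQ_unique by blast
qed

lemma Nint_scale:
  assumes "\<mu> \<in> SCurr N" "\<nu> \<in> SCurr N" "c \<ge> 0"
  shows "Nint N (mscale c \<mu>) \<nu> = c * Nint N \<mu> \<nu>"
proof -
  have "Nk N (Suc k) (mscale c \<mu>) \<nu> = c * Nk N (Suc k) \<mu> \<nu>" for k
    unfolding Nk_def by (simp add: measure_mscale[OF assms(3)] sum_distrib_left mult_ac)
  then have "(\<lambda>k. Nk N (Suc k) (mscale c \<mu>) \<nu>) \<longlonglongrightarrow> c * Nint N \<mu> \<nu>"
    using tendsto_mult_left[OF Nk_tendsto[OF assms(1,2)]] by simp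
  then show ?thesis using Nk_tendsto[OF mscale_SCurr[OF assms(1)] assms(2)] LIMSEQ_unique by blast
qed

lemma continuous_Nk:
  assumes "1 \<le> k"
  shows "continuous_map (prod_topology (weakT N) (weakT N)) euclideanreal (\<lambda>p. Nk N k (fst p) (snd p))"
proof -
  have "continuous_map (weakT N) euclideanreal (\<lambda>\<mu>. measure \<mu> (Zc N k W))" if "W \<in> CW N k" for W
    using that continuous_measure_Zc[OF assms] by (simp add: CW_def)
  note c = this
  have f: "continuous_map (prod_topology (weakT N) (weakT N)) euclideanreal (\<lambda>p. measure (fst p) (Zc N k W))"
    and s: "continuous_map (prod_topology (weakT N) (weakT N)) euclideanreal (\<lambda>p. measure (snd p) (Zc N k W))"
    if "W \<in> CW N k" for W
    using continuous_map_compose[OF continuous_map_fst c[OF that]] continuous_map_compose[OF continuous_map_snd c[OF that]]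
    by (auto simp: o_def)
  show ?thesis unfolding Nk_def
    by (intro continuous_map_sum finite_CW continuous_map_real_mult f s) auto
qed

text \<open>The convergence of \<open>Nk\<close> to \<open>Nint\<close> is uniform wherever the
  product \<open>V\<close> of the masses of \<open>Kc N 1\<close> is bounded. As \<open>V\<close> is
  itself continuous, every point has such a neighbourhood, and the error is split into three parts
  of size \<open>e / 3\<close>.\<close>

lemma continuous_Nint:
  "continuous_map (prod_topology (weakT N) (weakT N)) euclideanreal (\<lambda>(\<mu>, \<nu>). Nint N \<mu> \<nu>)"
proof -
  define PP where "PP = prod_topology (weakT N) (weakT N)"
  define V where "V = (\<lambda>p :: (nat \<Rightarrow> int) set measure \<times> (nat \<Rightarrow> int) set measure. measure (fst p) (Kc N 1) * measure (snd p) (Kc N 1))"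
  have cm: "continuous_map (weakT N) euclideanreal (\<lambda>\<mu>. measure \<mu> (Kc N 1))"
    using continuous_measure_level[of N 1 "\<lambda>_. True" 0] by simp
  have Vc: "continuous_map PP euclideanreal V"
    unfolding V_def PP_def
    using continuous_map_compose[OF continuous_map_fst cm] continuous_map_compose[OF continuous_map_snd cm]
    by (intro continuous_map_real_mult) (auto simp: o_def)
  have tp: "topspace PP = SCurr N \<times> SCurr N" by (simp add: PP_def)
  have "openin PP {p \<in> topspace PP. (case p of (\<mu>, \<nu>) \<Rightarrow> Nint N \<mu> \<nu>) \<in> U}" if U: "open U" for U
  proof (subst openin_subopen, intro ballI)
    fix p0 assume "p0 \<in> {p \<in> topspace PP. (case p of (\<mu>, \<nu>) \<Rightarrow> Nint N \<mu> \<nu>) \<in> U}"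
    then have p0: "p0 \<in> topspace PP" "Nint N (fst p0) (snd p0) \<in> U" by (auto split: prod.splits)
    then obtain e where e: "e > 0" "ball (Nint N (fst p0) (snd p0)) e \<subseteq> U" using U openE by blast
    \<comment> \<open>\<open>M\<close> bounds the product of masses on the open set
      \<open>O1\<close> around \<open>p0\<close>, so that one \<open>k\<close> serves all of
      it.\<close>
    define M where "M = V p0 + 1"
    have M: "M > 0" by (auto simp: M_def V_def intro!: add_nonneg_pos)
    obtain k :: nat where k: "3 * M / e < k" using reals_Archimedean2 by blast
    have "3 * M < e * k" using k e by (simp add: field_simps)
    also have "\<dots> < e * Suc k" using e by simp
    finally have Mk: "M / Suc k < e / 3" by (simp add: field_simps)
    define O1 where "O1 = {p \<in> topspace PP. V p \<in> {..<M}}"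
    define O2 where "O2 = {p \<in> topspace PP. Nk N (Suc k) (fst p) (snd p) \<in> ball (Nk N (Suc k) (fst p0) (snd p0)) (e / 3)}"
    have "openin PP O1" unfolding O1_def by (rule openin_continuous_map_preimage[OF Vc]) auto
    moreover have "openin PP O2" unfolding O2_def
      using continuous_Nk[of "Suc k" N] by (intro openin_continuous_map_preimage) (auto simp: PP_def)
    ultimately have "openin PP (O1 \<inter> O2)" by (rule openin_Int)
    moreover have "p0 \<in> O1 \<inter> O2" using p0 e by (auto simp: O1_def O2_def M_def)
    moreover have "O1 \<inter> O2 \<subseteq> {p \<in> topspace PP. (case p of (\<mu>, \<nu>) \<Rightarrow> Nint N \<mu> \<nu>) \<in> U}"
    proof
      fix p assume p: "p \<in> O1 \<inter> O2"
      then have pt: "p \<in> topspace PP" by (auto simp: O1_def)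
      have b: "\<bar>Nk N (Suc k) (fst q) (snd q) - Nint N (fst q) (snd q)\<bar> < e / 3" if "q \<in> topspace PP" "V q < M" for q
      proof -
        have "\<bar>Nk N (Suc k) (fst q) (snd q) - Nint N (fst q) (snd q)\<bar> \<le> V q / Suc k"
          using Nk_Nint[of "fst q" N "snd q" k] that(1) unfolding tp V_def by (simp add: mem_Times_iff)
        also have "\<dots> \<le> M / Suc k" using that by (intro divide_right_mono) auto
        finally show ?thesis using Mk by linarith
      qed
      have "\<bar>Nk N (Suc k) (fst p) (snd p) - Nint N (fst p) (snd p)\<bar> < e / 3" by (rule b) (use p in \<open>auto simp: O1_def\<close>)
      moreover have "\<bar>Nk N (Suc k) (fst p0) (snd p0) - Nint N (fst p0) (snd p0)\<bar> < e / 3" by (rule b) (use p0 in \<open>auto simp: M_def\<close>)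
      moreover have "\<bar>Nk N (Suc k) (fst p0) (snd p0) - Nk N (Suc k) (fst p) (snd p)\<bar> < e / 3"
        using p by (simp add: O2_def dist_real_def)
      ultimately have "dist (Nint N (fst p0) (snd p0)) (Nint N (fst p) (snd p)) < e" unfolding dist_real_def by linarith
      then have "Nint N (fst p) (snd p) \<in> U" using e(2) by (auto simp: subset_iff)
      then show "p \<in> {p \<in> topspace PP. (case p of (\<mu>, \<nu>) \<Rightarrow> Nint N \<mu> \<nu>) \<in> U}" using pt by (auto split: prod.splits)
    qed
    ultimately show "\<exists>W. openin PP W \<and> p0 \<in> W \<and> W \<subseteq> {p \<in> topspace PP. (case p of (\<mu>, \<nu>) \<Rightarrow> Nint N \<mu> \<nu>) \<in> U}" by blast
  qed
  then show ?thesis unfolding PP_def[symmetric] by (simp add: continuous_map_def)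
qed

section \<open>Evaluation on counting currents\<close>

text \<open>The vertices of the core graph of \<open>H\<close>: the orbits of \<open>H\<close> in
  the hull of its limit set (\<open>vcos_iff\<close>).\<close>

definition vcos :: "nat \<Rightarrow> int list set \<Rightarrow> int list set set" where
  "vcos N H = {C \<in> rcosets\<^bsub>FN N\<^esub> H. csh N H C \<in> Kc N 1}"

lemma Kc1_iff: "S \<in> Kc N 1 \<longleftrightarrow> S \<in> CN N \<and> [] \<in> chull N S"
proof -
  have "2 \<le> card (Pl 1 S) \<longleftrightarrow> [] \<in> chull N S" if "S \<in> CN N"
    unfolding two_le_card_iff[OF finite_Pl[OF CN_bd[OF that]]] Nil_chull by (auto simp: Pl_def pre_Suc)
  then show ?thesis by (auto simp: Kc_def)
qed

lemma sum_weighted_fibers: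
  assumes "finite A" "finite B" "f ` A \<subseteq> B"
  shows "(\<Sum>b\<in>B. c b * real (card {a \<in> A. f a = b})) = (\<Sum>a\<in>A. c (f a))"
proof -
  have "(\<Sum>a\<in>A. c (f a)) = (\<Sum>b\<in>B. \<Sum>a\<in>{a \<in> A. f a = b}. c (f a))"
    by (rule sum.group[symmetric, OF assms])
  also have "\<dots> = (\<Sum>b\<in>B. c b * real (card {a \<in> A. f a = b}))"
    by (intro sum.cong) auto
  finally show ?thesis by simp
qed

lemma Nint_eta_sum:
  assumes H: "fg_subgroup N H" "H \<noteq> {[]}" and K: "fg_subgroup N K" "K \<noteq> {[]}"
  shows "Nint N (eta N H) (eta N K) = (\<Sum>C\<in>vcos N H. \<Sum>C'\<in>vcos N K. FF (csh N H C) (csh N K C'))"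
proof -
  have fin: "finite (vcos N H)" "finite (vcos N K)" unfolding vcos_def by (rule finite_csh_Kc[OF H] finite_csh_Kc[OF K])+
  have me: "measure (eta N L) (Zc N k W) = real (card {C \<in> vcos N L. Pl k (csh N L C) = W})"
    if L: "fg_subgroup N L" "L \<noteq> {[]}" and W: "W \<in> CW N k" and k: "1 \<le> k" for L W k
  proof -
    have s: "subgroup L (FN N)" using L by (auto simp: fg_subgroup_def)
    have "{C \<in> rcosets\<^bsub>FN N\<^esub> L. csh N L C \<in> Zc N k W} = {C \<in> vcos N L. Pl k (csh N L C) = W}"
      using Zc_CW[OF k W] csh_CN[OF s L(2)] by (auto simp: vcos_def Zc_def)
    then show ?thesis using measure_eta[OF L Zc_sets Zc_CW[OF k W]] by simp
  qed
  have im: "(\<lambda>C. Pl k (csh N L C)) ` vcos N L \<subseteq> CW N k" for L k by (auto simp: vcos_def CW_def)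
  have cb: "csh N L C \<subseteq> bd N" if "C \<in> vcos N L" for L C using that CN_bd by (auto simp: vcos_def Kc_def)
  have Nk: "Nk N (Suc k) (eta N H) (eta N K) =
    (\<Sum>C\<in>vcos N H. \<Sum>C'\<in>vcos N K. Gk (Suc k) (Pl (Suc k) (csh N H C)) (Pl (Suc k) (csh N K C')))" for k
  proof -
    have "Nk N (Suc k) (eta N H) (eta N K) =
      (\<Sum>W\<in>CW N (Suc k). (\<Sum>W'\<in>CW N (Suc k). Gk (Suc k) W W' * real (card {C \<in> vcos N K. Pl (Suc k) (csh N K C) = W'}))
         * real (card {C \<in> vcos N H. Pl (Suc k) (csh N H C) = W}))"
      unfolding Nk_def sum_distrib_right by (intro sum.cong refl) (simp add: me[OF H] me[OF K])
    also have "\<dots> = (\<Sum>W\<in>CW N (Suc k). (\<Sum>C'\<in>vcos N K. Gk (Suc k) W (Pl (Suc k) (csh N K C')))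
         * real (card {C \<in> vcos N H. Pl (Suc k) (csh N H C) = W}))"
      by (subst sum_weighted_fibers[OF fin(2) finite_CW im]) simp
    also have "\<dots> = (\<Sum>C\<in>vcos N H. \<Sum>C'\<in>vcos N K. Gk (Suc k) (Pl (Suc k) (csh N H C)) (Pl (Suc k) (csh N K C')))"
      by (rule sum_weighted_fibers[OF fin(1) finite_CW im])
    finally show ?thesis .
  qed
  have "(\<lambda>k. Gk (Suc k) (Pl (Suc k) (csh N H C)) (Pl (Suc k) (csh N K C'))) \<longlonglongrightarrow> FF (csh N H C) (csh N K C')"
    if "C \<in> vcos N H" "C' \<in> vcos N K" for C C'
  proof (rule LIM_zero_cancel, rule Lim_null_comparison)
    show "\<forall>\<^sub>F k in sequentially. norm (Gk (Suc k) (Pl (Suc k) (csh N H C)) (Pl (Suc k) (csh N K C')) - FF (csh N H C) (csh N K C')) \<le> 1 / real (Suc k)"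
      using Gk_FF[OF cb cb, OF that, of "Suc _"] by (intro always_eventually allI) simp
    show "(\<lambda>k. 1 / real (Suc k)) \<longlonglongrightarrow> 0" by (rule LIMSEQ_Suc[OF lim_1_over_n])
  qed
  then have "(\<lambda>k. Nk N (Suc k) (eta N H) (eta N K)) \<longlonglongrightarrow> (\<Sum>C\<in>vcos N H. \<Sum>C'\<in>vcos N K. FF (csh N H C) (csh N K C'))"
    unfolding Nk by (intro tendsto_sum) auto
  then show ?thesis using Nk_tendsto[OF eta_SCurr[OF H] eta_SCurr[OF K]] LIMSEQ_unique by blast
qed

section \<open>Double cosets and components of the fibre product\<close>

lemma set_mult_dcoset: "H <#>\<^bsub>FN N\<^esub> {g} <#>\<^bsub>FN N\<^esub> K = {mul (mul h g) k |h k. h \<in> H \<and> k \<in> K}"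
  by (auto simp: set_mult_def)

text \<open>For the vertex of the fibre product given by the cosets of \<open>x\<close> and
  \<open>y\<close>, this is the double coset of \<open>mul x (winv y)\<close>. It labels the
  component of that vertex.\<close>

definition dc :: "int list set \<times> int list set \<Rightarrow> int list set" where
  "dc p = {mul x (winv y) |x y. x \<in> fst p \<and> y \<in> snd p}"

lemma dc_coset:
  assumes "subgroup H (FN N)" "subgroup K (FN N)" "x \<in> FN_carrier N" "y \<in> FN_carrier N"
  shows "dc (H #>\<^bsub>FN N\<^esub> x, K #>\<^bsub>FN N\<^esub> y) = H <#>\<^bsub>FN N\<^esub> {mul x (winv y)} <#>\<^bsub>FN N\<^esub> K"
proof -
  note H = assms(1)[unfolded subgroup_FN_iff] and K = assms(2)[unfolded subgroup_FN_iff]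
  have e: "mul (mul h x) (winv (mul k y)) = mul (mul h (mul x (winv y))) (winv k)" if "h \<in> H" "k \<in> K" for h k
    using that H K assms(4) by (subst winv_mul_distrib[of _ N]) (auto simp: mul_assoc)
  show ?thesis unfolding set_mult_dcoset dc_def
  proof (intro equalityI subsetI)
    fix z assume "z \<in> {mul a (winv b) |a b. a \<in> fst (H #>\<^bsub>FN N\<^esub> x, K #>\<^bsub>FN N\<^esub> y) \<and> b \<in> snd (H #>\<^bsub>FN N\<^esub> x, K #>\<^bsub>FN N\<^esub> y)}"
    then obtain h k where "h \<in> H" "k \<in> K" "z = mul (mul h x) (winv (mul k y))" by (auto simp: r_coset_eq)
    then show "z \<in> {mul (mul h (mul x (winv y))) k |h k. h \<in> H \<and> k \<in> K}" using e K by blast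
  next
    fix z assume "z \<in> {mul (mul h (mul x (winv y))) k |h k. h \<in> H \<and> k \<in> K}"
    then obtain h k where hk: "h \<in> H" "k \<in> K" "z = mul (mul h (mul x (winv y))) k" by auto
    then have "z = mul (mul h x) (winv (mul (winv k) y))" using e[of h "winv k"] K by simp
    moreover have "mul h x \<in> H #>\<^bsub>FN N\<^esub> x" "mul (winv k) y \<in> K #>\<^bsub>FN N\<^esub> y" using hk K by (auto simp: r_coset_eq)
    ultimately show "z \<in> {mul a (winv b) |a b. a \<in> fst (H #>\<^bsub>FN N\<^esub> x, K #>\<^bsub>FN N\<^esub> y) \<and> b \<in> snd (H #>\<^bsub>FN N\<^esub> x, K #>\<^bsub>FN N\<^esub> y)}"
      unfolding fst_conv snd_conv by blast
  qed
qed

text \<open>Another representative conjugates the intersection by \<open>h\<close>, so the arbitrary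
  choice in \<open>dterm\<close> does not affect the rank.\<close>

lemma rank_inter_dcoset:
  assumes "subgroup H (FN N)" "subgroup K (FN N)" "c \<in> FN_carrier N" "h \<in> H" "k \<in> K"
  shows "rank N (H \<inter> conjg N (mul (mul h c) k) K) = rank N (H \<inter> conjg N c K)"
proof -
  note H = assms(1)[unfolded subgroup_FN_iff] and K = assms(2)[unfolded subgroup_FN_iff]
  have F: "h \<in> FN_carrier N" "k \<in> FN_carrier N" "H \<subseteq> FN_carrier N" "K \<subseteq> FN_carrier N" using H K assms by auto
  have "conjg N (mul (mul h c) k) K = conjg N h (conjg N c (conjg N k K))"
    using F assms(3) by (simp add: conjg_conjg conjg_sub mul_assoc)
  also have "conjg N k K = K" by (rule conjg_self[OF assms(2,5)])
  finally have "H \<inter> conjg N (mul (mul h c) k) K = conjg N h H \<inter> conjg N h (conjg N c K)"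
    by (simp add: conjg_self[OF assms(1,4)])
  also have "\<dots> = conjg N h (H \<inter> conjg N c K)"
    unfolding conjg_eq[OF F(1)] using F conjg_sub[OF assms(3) F(4)]
    by (intro inj_on_image_Int[OF conj_inj[OF F(1)], symmetric]) auto
  finally show ?thesis using rank_conjg[OF F(1), of "H \<inter> conjg N c K"] F by auto
qed

lemma dterm_dcoset:
  assumes "subgroup H (FN N)" "subgroup K (FN N)" "c \<in> FN_carrier N"
  shows "dterm N H K (H <#>\<^bsub>FN N\<^esub> {c} <#>\<^bsub>FN N\<^esub> K) = rrank N (H \<inter> conjg N c K)"
proof -
  define D where "D = H <#>\<^bsub>FN N\<^esub> {c} <#>\<^bsub>FN N\<^esub> K"
  have D: "D = {mul (mul h c) k |h k. h \<in> H \<and> k \<in> K}" unfolding D_def by (rule set_mult_dcoset)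
  have "mul (mul [] c) [] \<in> D" using assms unfolding D by (auto simp: subgroup_FN_iff)
  then have "(SOME g. g \<in> D) \<in> D" by (rule someI)
  then obtain h k where "h \<in> H" "k \<in> K" "(SOME g. g \<in> D) = mul (mul h c) k" unfolding D by blast
  then show ?thesis using rank_inter_dcoset[OF assms] unfolding dterm_def rrank_def D_def[symmetric] by simp
qed

lemma generate_empty_FN: "generate (FN N) {} = {[]}"
  using FN.generate_empty[of N] by simp

lemma rank_trivial: "rank N {[]} = 0"
  unfolding rank_def by (rule Least_equality) (auto intro!: exI[of _ "{}"] simp: generate_empty_FN)

lemma rank_eq_0:
  assumes "fg_subgroup N L" "rank N L = 0"
  shows "L = {[]}"
proof -
  obtain S where S: "finite S" "S \<subseteq> FN_carrier N" "generate (FN N) S = L" using assms by (auto simp: fg_subgroup_def)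
  have "S \<subseteq> L" using S generate.incl[of _ S "FN N"] by blast
  then have ex: "\<exists>T. finite T \<and> card T = card S \<and> T \<subseteq> L \<and> generate (FN N) T = L" using S by blast
  have "\<exists>T. finite T \<and> card T = rank N L \<and> T \<subseteq> L \<and> generate (FN N) T = L"
    unfolding rank_def using LeastI[where P="\<lambda>n. \<exists>T. finite T \<and> card T = n \<and> T \<subseteq> L \<and> generate (FN N) T = L", OF ex] .
  then show ?thesis using assms(2) generate_empty_FN by auto
qed

text \<open>Two maps with the same fibres have images in bijection. For instance, a sum over the
  vertices of a component becomes one over the orbits in a tree.\<close>

lemma sum_image_kernel:
  fixes F :: "'b \<Rightarrow> real" and q :: "'a \<Rightarrow> 'c"
  assumes "\<And>s t. s \<in> T \<Longrightarrow> t \<in> T \<Longrightarrow> P s = P t \<longleftrightarrow> q s = q t"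
  shows "(\<Sum>p\<in>P ` T. F p) = (\<Sum>C\<in>q ` T. F (P (inv_into T q C)))"
proof (rule sum.reindex_bij_witness[where i="\<lambda>C. P (inv_into T q C)" and j="\<lambda>p. q (inv_into T P p)"])
  fix p assume p: "p \<in> P ` T"
  have a: "inv_into T P p \<in> T" "P (inv_into T P p) = p" using p by (auto intro: inv_into_into f_inv_into_f)
  then show "q (inv_into T P p) \<in> q ` T" by simp
  have "inv_into T q (q (inv_into T P p)) \<in> T" "q (inv_into T q (q (inv_into T P p))) = q (inv_into T P p)"
    using a by (auto intro: inv_into_into f_inv_into_f)
  then show e: "P (inv_into T q (q (inv_into T P p))) = p" using assms a by metis
  then show "F (P (inv_into T q (q (inv_into T P p)))) = F p" by simp
next
  fix C assume C: "C \<in> q ` T"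
  have a: "inv_into T q C \<in> T" "q (inv_into T q C) = C" using C by (auto intro: inv_into_into f_inv_into_f)
  then show "P (inv_into T q C) \<in> P ` T" by simp
  have "inv_into T P (P (inv_into T q C)) \<in> T" "P (inv_into T P (P (inv_into T q C))) = P (inv_into T q C)"
    using a by (auto intro: inv_into_into f_inv_into_f)
  then show "q (inv_into T P (P (inv_into T q C))) = C" using assms a by metis
qed

lemma infinite_subgroup:
  assumes "subgroup L (FN N)" "L \<noteq> {[]}"
  shows "infinite L"
proof
  assume fin: "finite L"
  obtain \<xi> where "\<xi> \<in> limset N L" using limset_two_points[OF assms] by blast
  then obtain h where h: "h \<in> L" "agrees (Suc (Max (length ` L))) h \<xi>" unfolding mem_limset by blast
  have "length h \<le> Max (length ` L)" using fin h by (intro Max_ge) auto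
  then show False using h(2) by (simp add: agrees_def)
qed

text \<open>The orbit sum of the local terms is the reduced rank; the correction \<open>1 / card T\<close> only occurs
  for finite trees, which have trivial stabiliser and Euler characteristic 1.\<close>
lemma rrank_formula:
  assumes L: "subgroup L (FN N)" and TF: "T \<subseteq> FN_carrier N"
    and NT: "[] \<in> T" and Tpre: "\<And>w k. w \<in> T \<Longrightarrow> take k w \<in> T"
    and Linv: "\<And>l t. l \<in> L \<Longrightarrow> t \<in> T \<Longrightarrow> mul l t \<in> T"
    and fin: "finite ((\<lambda>t. L #>\<^bsub>FN N\<^esub> t) ` T)"
    and f: "\<And>t. t \<in> T \<Longrightarrow> f (L #>\<^bsub>FN N\<^esub> t) = real (card {a \<in> letters N. mul t [a] \<in> T}) / 2 - 1
      + (if finite T then 1 / card T else 0)"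
  shows "(\<Sum>C\<in>(\<lambda>t. L #>\<^bsub>FN N\<^esub> t) ` T. f C) = real (rrank N L)"
proof -
  define q where "q = (\<lambda>t. L #>\<^bsub>FN N\<^esub> t)"
  define e where "e = (if finite T then 1 / real (card T) else 0)"
  have "real (rank N L) = 1 + (\<Sum>C\<in>q ` T. f C - e)" and fg: "fg_subgroup N L"
    using rank_formula[OF L TF NT Tpre Linv fin, of "\<lambda>C. f C - e"] f unfolding q_def e_def by auto
  then have r: "(\<Sum>C\<in>q ` T. f C) = real (rank N L) - 1 + real (card (q ` T)) * e"
    by (simp add: sum_subtractf)
  have LT: "L \<subseteq> T"
  proof
    fix l assume l: "l \<in> L"
    then have "mul l [] = l" using L by (auto simp: subgroup_FN_iff mul_Nil_right FN_carrier_reduced)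
    then show "l \<in> T" using Linv[OF l NT] by simp
  qed
  have inj: "inj_on q T" if "L = {[]}"
  proof (rule inj_onI)
    fix s t assume h: "s \<in> T" "t \<in> T" "q s = q t"
    have "mul s (winv t) \<in> L" using h rcos_eq_iff[OF L, of s t] TF by (auto simp: q_def)
    then have "mul s (winv t) = []" using that by simp
    then have "mul (mul s (winv t)) t = t" using h TF by (auto simp: mul_Nil_left FN_carrier_reduced)
    then show "s = t" using h TF by (auto simp: mul_cancel_right' FN_carrier_reduced)
  qed
  show ?thesis
  proof (cases "finite T")
    case True
    then have "finite L" using LT finite_subset by blast
    then have L1: "L = {[]}" using infinite_subgroup[OF L] by blast
    then have "card (q ` T) = card T" using inj card_image by blast
    moreover have "card T \<noteq> 0" using True NT by auto
    moreover have "rank N L = 0" using L1 rank_trivial by simp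
    ultimately show ?thesis using r True by (simp add: e_def rrank_def q_def)
  next
    case False
    \<comment> \<open>An infinite tree with finitely many orbits has a nontrivial group, so the rank
      is positive and the subtraction in \<open>rrank\<close> is exact.\<close>
    then have "L \<noteq> {[]}" using inj fin[folded q_def] finite_imageD by blast
    then have "rank N L \<noteq> 0" using rank_eq_0[OF fg] by blast
    then show ?thesis using r False by (simp add: e_def rrank_def of_nat_diff q_def)
  qed
qed

lemma vcos_iff:
  assumes H: "subgroup H (FN N)" "H \<noteq> {[]}" and x: "x \<in> FN_carrier N"
  shows "H #>\<^bsub>FN N\<^esub> x \<in> vcos N H \<longleftrightarrow> x \<in> chull N (limset N H)"
proof -
  have "[] \<in> chull N (act (winv x) ` limset N H) \<longleftrightarrow> x \<in> chull N (limset N H)"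
    using mem_chull_act[of "winv x" N "[]" "limset N H"] x limset_bd[of N H]
    by (simp add: mul_Nil_right FN_carrier_reduced)
  then show ?thesis using rcosetsI[OF x, of H] csh_CN[OF H rcosetsI[OF x]]
    by (simp add: vcos_def Kc1_iff[unfolded One_nat_def] csh_coset[OF H(1) x])
qed

lemma vcosE:
  assumes H: "subgroup H (FN N)" "H \<noteq> {[]}" and C: "C \<in> vcos N H"
  obtains x where "x \<in> FN_carrier N" "C = H #>\<^bsub>FN N\<^esub> x" "x \<in> chull N (limset N H)"
proof -
  have "C \<in> rcosets\<^bsub>FN N\<^esub> H" using C by (simp add: vcos_def)
  then obtain x where x: "x \<in> FN_carrier N" "C = H #>\<^bsub>FN N\<^esub> x" using rcosetsE by blast
  then show ?thesis using that C vcos_iff[OF H x(1)] by simp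
qed

text \<open>The component of the fibre product is unwrapped from its vertex \<open>p0\<close>, which
  is moved to the identity: \<open>T\<close> is the intersection of the two translated hulls and
  \<open>\<Psi>\<close> is the covering of the component by \<open>T\<close>, whose fibres are the
  orbits of \<open>L\<close>. Then \<open>rrank_formula\<close> applies.\<close>

lemma dcoset_fiber_sum:
  assumes fH: "fg_subgroup N H" "H \<noteq> {[]}" and fK: "fg_subgroup N K" "K \<noteq> {[]}"
    and p0: "p0 \<in> vcos N H \<times> vcos N K"
  shows "(\<Sum>p\<in>{p \<in> vcos N H \<times> vcos N K. dc p = dc p0}. FF (csh N H (fst p)) (csh N K (snd p)))
    = real (dterm N H K (dc p0))"
proof -
  have H: "subgroup H (FN N)" and K: "subgroup K (FN N)" using fH fK by (auto simp: fg_subgroup_def)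
  note HF = H[unfolded subgroup_FN_iff] and KF = K[unfolded subgroup_FN_iff]
  have "fst p0 \<in> vcos N H" "snd p0 \<in> vcos N K" using p0 by auto
  then obtain x0 y0 where x0: "x0 \<in> FN_carrier N" "fst p0 = H #>\<^bsub>FN N\<^esub> x0" "x0 \<in> chull N (limset N H)"
    and y0: "y0 \<in> FN_carrier N" "snd p0 = K #>\<^bsub>FN N\<^esub> y0" "y0 \<in> chull N (limset N K)"
    using vcosE[OF H fH(2)] vcosE[OF K fK(2)] by metis
  have p0e: "p0 = (H #>\<^bsub>FN N\<^esub> x0, K #>\<^bsub>FN N\<^esub> y0)" using x0(2) y0(2) by (metis prod.collapse)
  define c where "c = mul x0 (winv y0)"
  have cF: "c \<in> FN_carrier N" using x0 y0 by (simp add: c_def)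
  have D: "dc p0 = H <#>\<^bsub>FN N\<^esub> {c} <#>\<^bsub>FN N\<^esub> K" unfolding p0e c_def by (rule dc_coset[OF H K x0(1) y0(1)])
  define S S' where "S = act (winv x0) ` limset N H" and "S' = act (winv y0) ` limset N K"
  have Sbd: "S \<subseteq> bd N" "S' \<subseteq> bd N" using x0 y0 limset_bd[of N H] limset_bd[of N K] by (auto simp: S_def S'_def)
  define T where "T = chull N S \<inter> chull N S'"
  have TF: "T \<subseteq> FN_carrier N" using chull_FN by (auto simp: T_def)
  have inS: "t \<in> chull N S \<longleftrightarrow> mul x0 t \<in> chull N (limset N H)"
    and inS': "t \<in> chull N S' \<longleftrightarrow> mul y0 t \<in> chull N (limset N K)" if "t \<in> FN_carrier N" for t
    using mem_chull_act[of "winv x0" N t "limset N H"] mem_chull_act[of "winv y0" N t "limset N K"]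
      that x0(1) y0(1) limset_bd[of N H] limset_bd[of N K] by (simp_all add: S_def S'_def)
  have NS: "[] \<in> chull N S" "[] \<in> chull N S'"
    using inS[of "[]"] inS'[of "[]"] x0 y0 by (simp_all add: mul_Nil_right FN_carrier_reduced)
  have NT: "[] \<in> T" using NS by (simp add: T_def)
  have Tpre: "take k w \<in> T" if "w \<in> T" for w k
    using that Pref_prefix_closed unfolding T_def chull_eq_Pref[OF Sbd(1) NS(1)] chull_eq_Pref[OF Sbd(2) NS(2)] by blast
  define L1 L2 where "L1 = conjg N (winv x0) H" and "L2 = conjg N (winv y0) K"
  define L where "L = L1 \<inter> L2"
  have sL: "subgroup L1 (FN N)" "subgroup L2 (FN N)" unfolding L1_def L2_def
    using subgroup_conjg H K x0 y0 by auto
  have L: "subgroup L (FN N)" using sL by (auto simp: L_def subgroup_FN_iff)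
  have lim: "limset N L1 = S" "limset N L2 = S'"
    unfolding L1_def L2_def S_def S'_def using limset_conjg HF KF x0 y0 by auto
  have Linv: "mul l t \<in> T" if "l \<in> L" "t \<in> T" for l t
  proof -
    have "l \<in> Stab N S" "l \<in> Stab N S'"
      using that subgroup_sub_Stab[OF sL(1)] subgroup_sub_Stab[OF sL(2)] lim by (auto simp: L_def)
    then show ?thesis using Stab_chull Sbd that by (auto simp: T_def)
  qed
  have L1i: "l \<in> L1 \<longleftrightarrow> mul x0 (mul l (winv x0)) \<in> H" and L2i: "l \<in> L2 \<longleftrightarrow> mul y0 (mul l (winv y0)) \<in> K"
    if "l \<in> FN_carrier N" for l
    using that mem_conjg[of "winv x0" N H l] mem_conjg[of "winv y0" N K l] HF KF x0 y0 by (auto simp: L1_def L2_def)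
  define q where "q = (\<lambda>t. L #>\<^bsub>FN N\<^esub> t)"
  define \<Psi> where "\<Psi> = (\<lambda>t. (H #>\<^bsub>FN N\<^esub> (mul x0 t), K #>\<^bsub>FN N\<^esub> (mul y0 t)))"
  have ker: "\<Psi> s = \<Psi> t \<longleftrightarrow> q s = q t" if st: "s \<in> T" "t \<in> T" for s t
  proof -
    have F: "s \<in> FN_carrier N" "t \<in> FN_carrier N" using st TF by auto
    have e: "mul (mul z s) (winv (mul z t)) = mul z (mul (mul s (winv t)) (winv z))" if "z \<in> FN_carrier N" for z
      using that F by (simp add: winv_mul_distrib[of _ N] mul_assoc)
    have "\<Psi> s = \<Psi> t \<longleftrightarrow> mul s (winv t) \<in> L1 \<and> mul s (winv t) \<in> L2"
      using rcos_eq_iff[OF H, of "mul x0 s" "mul x0 t"] rcos_eq_iff[OF K, of "mul y0 s" "mul y0 t"] F x0(1) y0(1)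
      by (simp add: \<Psi>_def e L1i L2i)
    then show ?thesis using rcos_eq_iff[OF L F] by (simp add: q_def L_def)
  qed
  have img: "\<Psi> ` T = {p \<in> vcos N H \<times> vcos N K. dc p = dc p0}"
  proof (intro equalityI subsetI)
    fix p assume "p \<in> \<Psi> ` T"
    then obtain t where t: "t \<in> T" "p = \<Psi> t" by auto
    have tF: "t \<in> FN_carrier N" using t TF by auto
    have "p \<in> vcos N H \<times> vcos N K"
      using t inS[OF tF] inS'[OF tF] vcos_iff[OF H fH(2), of "mul x0 t"] vcos_iff[OF K fK(2), of "mul y0 t"] tF x0(1) y0(1)
      by (auto simp: \<Psi>_def T_def)
    moreover have "mul (mul x0 t) (winv (mul y0 t)) = c"
      using tF y0(1) by (simp add: winv_mul_distrib[of _ N] mul_assoc mul_winv_cancel FN_carrier_reduced c_def)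
    then have "dc p = dc p0" unfolding t(2) \<Psi>_def D using dc_coset[OF H K, of "mul x0 t" "mul y0 t"] tF x0(1) y0(1) by simp
    ultimately show "p \<in> {p \<in> vcos N H \<times> vcos N K. dc p = dc p0}" by simp
  next
    fix p assume "p \<in> {p \<in> vcos N H \<times> vcos N K. dc p = dc p0}"
    then have p: "fst p \<in> vcos N H" "snd p \<in> vcos N K" "dc p = dc p0" by auto
    obtain x where x: "x \<in> FN_carrier N" "fst p = H #>\<^bsub>FN N\<^esub> x" "x \<in> chull N (limset N H)"
      using vcosE[OF H fH(2) p(1)] by blast
    obtain y where y: "y \<in> FN_carrier N" "snd p = K #>\<^bsub>FN N\<^esub> y" "y \<in> chull N (limset N K)"
      using vcosE[OF K fK(2) p(2)] by blast
    have "mul x (winv y) \<in> dc p" unfolding dc_def x(2) y(2) using rcos_self[OF H x(1)] rcos_self[OF K y(1)] by blast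
    then obtain h k where hk: "h \<in> H" "k \<in> K" "mul x (winv y) = mul (mul h c) k"
      unfolding p(3) D set_mult_dcoset by blast
    have hkF: "h \<in> FN_carrier N" "k \<in> FN_carrier N" "winv h \<in> H" using hk HF KF by auto
    \<comment> \<open>The factors \<open>h\<close> and \<open>k\<close> are moved into the
      representatives, so that \<open>mul x' (winv y')\<close> is \<open>c\<close>, as for
      \<open>x0\<close> and \<open>y0\<close>; a single \<open>t\<close> then leads from
      \<open>x0\<close> to \<open>x'\<close> and from \<open>y0\<close> to
      \<open>y'\<close>.\<close>
    define x' y' where "x' = mul (winv h) x" and "y' = mul k y"
    have F': "x' \<in> FN_carrier N" "y' \<in> FN_carrier N" using hkF x y by (auto simp: x'_def y'_def)
    have "mul x' (winv y') = mul (winv h) (mul (mul x (winv y)) (winv k))"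
      using hkF y by (simp add: x'_def y'_def winv_mul_distrib[of _ N] mul_assoc)
    also have "\<dots> = mul (winv h) (mul h c)" unfolding hk(3) by (simp add: mul_cancel_right)
    also have "\<dots> = c" using cF by (simp add: winv_mul_cancel FN_carrier_reduced)
    finally have xy: "mul x' (winv y') = mul x0 (winv y0)" by (simp add: c_def)
    define t where "t = mul (winv x0) x'"
    have tF: "t \<in> FN_carrier N" using F' x0 by (simp add: t_def)
    have x't: "mul x0 t = x'" using F' by (simp add: t_def mul_winv_cancel FN_carrier_reduced)
    have "x' = mul (mul x' (winv y')) y'" using F' by (simp add: mul_cancel_right' FN_carrier_reduced)
    then have "t = mul (winv y0) y'"
      unfolding t_def xy using y0(1) by (simp add: mul_assoc winv_mul_cancel)
    then have y't: "mul y0 t = y'" using F' by (simp add: mul_winv_cancel FN_carrier_reduced)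
    have "H #>\<^bsub>FN N\<^esub> x' = H #>\<^bsub>FN N\<^esub> x" unfolding x'_def by (rule rcos_mul_left[OF H x(1) hkF(3)])
    moreover have "K #>\<^bsub>FN N\<^esub> y' = K #>\<^bsub>FN N\<^esub> y" unfolding y'_def by (rule rcos_mul_left[OF K y(1) hk(2)])
    ultimately have pe: "p = \<Psi> t" unfolding \<Psi>_def x't y't using x(2) y(2) by (metis prod.collapse)
    have "H #>\<^bsub>FN N\<^esub> x' \<in> vcos N H" "K #>\<^bsub>FN N\<^esub> y' \<in> vcos N K" using p(1,2) pe x't y't by (auto simp: \<Psi>_def)
    then have "x' \<in> chull N (limset N H)" "y' \<in> chull N (limset N K)"
      using vcos_iff[OF H fH(2) F'(1)] vcos_iff[OF K fK(2) F'(2)] by auto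
    then have "t \<in> T" using inS[OF tF] inS'[OF tF] x't y't by (simp add: T_def)
    then show "p \<in> \<Psi> ` T" using pe by blast
  qed
  define Fv where "Fv = (\<lambda>p. FF (csh N H (fst p)) (csh N K (snd p)))"
  \<comment> \<open>Translating by \<open>winv t\<close> puts \<open>t\<close> at the identity,
    where \<open>FF\<close> reads off its degree in \<open>T\<close>; the cardinality of the tree is
    unchanged.\<close>
  have FFt: "Fv (\<Psi> t) = real (card {a \<in> letters N. mul t [a] \<in> T}) / 2 - 1 + (if finite T then 1 / card T else 0)"
    if t: "t \<in> T" for t
  proof -
    have tF: "t \<in> FN_carrier N" using t TF by auto
    have S1: "csh N H (H #>\<^bsub>FN N\<^esub> (mul x0 t)) = act (winv t) ` S"
      and S2: "csh N K (K #>\<^bsub>FN N\<^esub> (mul y0 t)) = act (winv t) ` S'"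
      using tF x0(1) y0(1) unfolding S_def S'_def
      by (simp_all add: csh_coset[OF H] csh_coset[OF K] winv_mul_distrib[of _ N] act_image_act[OF _ _ limset_bd])
    have ch: "chull N (act (winv t) ` S) = mul (winv t) ` chull N S" "chull N (act (winv t) ` S') = mul (winv t) ` chull N S'"
      using chull_act tF Sbd by auto
    have "[] \<in> chull N (act (winv t) ` S)" "[] \<in> chull N (act (winv t) ` S')"
      using t mem_chull_act[of "winv t" N "[]"] tF Sbd by (auto simp: T_def mul_Nil_right FN_carrier_reduced)
    then have P1: "Pref (act (winv t) ` S) = mul (winv t) ` chull N S" "Pref (act (winv t) ` S') = mul (winv t) ` chull N S'"
      using chull_eq_Pref[OF act_image_bd[OF winv_FN[OF tF] Sbd(1)]] chull_eq_Pref[OF act_image_bd[OF winv_FN[OF tF] Sbd(2)]] ch by auto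
    have injm: "inj_on (mul (winv t)) (FN_carrier N)" using tF by (auto simp: inj_on_def mul_left_inj[of _ N])
    have Tt: "Pref (act (winv t) ` S) \<inter> Pref (act (winv t) ` S') = mul (winv t) ` T"
      unfolding P1 T_def using inj_on_image_Int[OF injm chull_FN chull_FN] by auto
    have injT: "inj_on (mul (winv t)) T" using injm TF inj_on_subset by blast
    have "{w \<in> mul (winv t) ` T. length w = 1} = (\<lambda>a. [a]) ` {a \<in> letters N. mul t [a] \<in> T}"
    proof (intro equalityI subsetI)
      fix w assume "w \<in> {w \<in> mul (winv t) ` T. length w = 1}"
      then obtain s where s: "s \<in> T" "w = mul (winv t) s" "length w = 1" by auto
      then obtain a where a: "w = [a]" by (metis One_nat_def length_0_conv length_Suc_conv)
      have sF: "s \<in> FN_carrier N" using s TF by auto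
      then have "w \<in> FN_carrier N" using s tF by auto
      then have "a \<in> letters N" using a by (simp add: FN_carrier_def)
      moreover have "mul t [a] = s" using s a sF by (metis FN_carrier_reduced mul_winv_cancel)
      ultimately show "w \<in> (\<lambda>a. [a]) ` {a \<in> letters N. mul t [a] \<in> T}" using a s by auto
    next
      fix w assume "w \<in> (\<lambda>a. [a]) ` {a \<in> letters N. mul t [a] \<in> T}"
      then obtain a where a: "w = [a]" "mul t [a] \<in> T" by auto
      then have "w = mul (winv t) (mul t [a])" by (simp add: winv_mul_cancel)
      then show "w \<in> {w \<in> mul (winv t) ` T. length w = 1}" using a by auto
    qed
    then have "card {w \<in> mul (winv t) ` T. length w = 1} = card {a \<in> letters N. mul t [a] \<in> T}"
      by (simp add: card_image inj_on_def)
    moreover have "finite (mul (winv t) ` T) = finite T" using injT finite_image_iff by blast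
    moreover have "card (mul (winv t) ` T) = card T" using injT card_image by blast
    ultimately show ?thesis unfolding Fv_def \<Psi>_def fst_conv snd_conv S1 S2 FF_def Tt isz_def by simp
  qed
  have finP: "finite (\<Psi> ` T)"
    unfolding img using finite_csh_Kc[OF fH, of 1] finite_csh_Kc[OF fK, of 1] by (simp add: vcos_def)
  have finq: "finite (q ` T)"
    by (rule finite_image_factor[OF finP]) (use ker in blast)
  have "(\<Sum>p\<in>\<Psi> ` T. Fv p) = (\<Sum>C\<in>q ` T. Fv (\<Psi> (inv_into T q C)))"
    by (rule sum_image_kernel) (rule ker)
  also have "\<dots> = real (rrank N L)"
    unfolding q_def
  proof (rule rrank_formula[OF L TF NT Tpre Linv finq[unfolded q_def]])
    fix t assume t: "t \<in> T"
    have "q t \<in> q ` T" using t by (rule imageI)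
    then have "inv_into T q (q t) \<in> T" "q (inv_into T q (q t)) = q t" by (rule inv_into_into, rule f_inv_into_f)
    then have "\<Psi> (inv_into T q (q t)) = \<Psi> t" using ker t by blast
    then show "Fv (\<Psi> (inv_into T (\<lambda>t. L #>\<^bsub>FN N\<^esub> t) (L #>\<^bsub>FN N\<^esub> t))) = real (card {a \<in> letters N. mul t [a] \<in> T}) / 2 - 1 + (if finite T then 1 / card T else 0)"
      using FFt[OF t] by (simp add: q_def)
  qed
  also have "rrank N L = rrank N (H \<inter> conjg N c K)"
  proof -
    \<comment> \<open>\<open>L\<close> is the conjugate by \<open>winv x0\<close> of the
      intersection that occurs in \<open>dterm\<close>, so the ranks agree.\<close>
    have "conjg N (winv x0) (conjg N c K) = L2"
      using x0(1) y0(1) cF KF by (simp add: conjg_conjg c_def L2_def winv_mul_cancel FN_carrier_reduced)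
    then have "conjg N (winv x0) (H \<inter> conjg N c K) = L"
      unfolding L_def L1_def conjg_eq[OF winv_FN[OF x0(1)]] using HF conjg_sub[OF cF, of K] KF
      by (subst inj_on_image_Int[OF conj_inj[OF winv_FN[OF x0(1)]]]) auto
    moreover have "H \<inter> conjg N c K \<subseteq> FN_carrier N" using HF by blast
    ultimately show ?thesis unfolding rrank_def using rank_conjg[OF winv_FN[OF x0(1)], of "H \<inter> conjg N c K"] by simp
  qed
  also have "\<dots> = dterm N H K (dc p0)" unfolding D using dterm_dcoset[OF H K cF] by simp
  finally show ?thesis unfolding img Fv_def .
qed

text \<open>A nontrivial intersection \<open>L\<close> has a hull vertex \<open>x\<close>. By
  monotonicity it lies in the hulls of \<open>H\<close> and of the conjugate of \<open>K\<close>, so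
  the fibre product has a vertex over this double coset.\<close>

lemma dterm_nonzero:
  assumes fH: "fg_subgroup N H" "H \<noteq> {[]}" and fK: "fg_subgroup N K" "K \<noteq> {[]}"
    and D: "D \<in> dcosets N H K" "dterm N H K D \<noteq> 0"
  shows "D \<in> dc ` (vcos N H \<times> vcos N K)"
proof -
  have H: "subgroup H (FN N)" and K: "subgroup K (FN N)" using fH fK by (auto simp: fg_subgroup_def)
  note HF = H[unfolded subgroup_FN_iff] and KF = K[unfolded subgroup_FN_iff]
  obtain c where c: "c \<in> FN_carrier N" "D = H <#>\<^bsub>FN N\<^esub> {c} <#>\<^bsub>FN N\<^esub> K" using D by (auto simp: dcosets_def)
  define L where "L = H \<inter> conjg N c K"
  have "rrank N L \<noteq> 0" using D(2) c dterm_dcoset[OF H K c(1)] by (simp add: L_def)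
  then have "L \<noteq> {[]}" using rank_trivial[of N] by (auto simp: rrank_def)
  moreover have "subgroup L (FN N)" using H subgroup_conjg[OF c(1) K] by (auto simp: L_def subgroup_FN_iff)
  ultimately obtain x where x: "x \<in> chull N (limset N L)" using chull_limset_nonempty by blast
  have xF: "x \<in> FN_carrier N" using x chull_FN by auto
  have x1: "x \<in> chull N (limset N H)" using x chull_mono[OF limset_mono[of L H N], of N] by (auto simp: L_def)
  have "x \<in> chull N (limset N (conjg N c K))" using x chull_mono[OF limset_mono[of L "conjg N c K" N], of N] by (auto simp: L_def)
  then have x2: "mul (winv c) x \<in> chull N (limset N K)"
    using limset_conjg[OF c(1)] KF mem_chull_act[OF c(1) xF limset_bd] by simp
  define y where "y = mul (winv c) x"
  have yF: "y \<in> FN_carrier N" using c xF by (simp add: y_def)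
  have "mul x (winv y) = c" using c(1) xF by (simp add: y_def winv_mul_distrib[of _ N] mul_winv_cancel FN_carrier_reduced)
  then have "dc (H #>\<^bsub>FN N\<^esub> x, K #>\<^bsub>FN N\<^esub> y) = D" using dc_coset[OF H K xF yF] c(2) by simp
  moreover have "H #>\<^bsub>FN N\<^esub> x \<in> vcos N H" "K #>\<^bsub>FN N\<^esub> y \<in> vcos N K"
    using vcos_iff[OF H fH(2) xF] vcos_iff[OF K fK(2) yF] x1 x2 by (auto simp: y_def)
  ultimately show ?thesis by (metis SigmaI image_eqI)
qed

lemma Nint_eta:
  assumes fH: "fg_subgroup N H" "H \<noteq> {[]}" and fK: "fg_subgroup N K" "K \<noteq> {[]}"
  shows "Nint N (eta N H) (eta N K) = real (Nsub N H K)"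
proof -
  define A where "A = vcos N H \<times> vcos N K"
  have H: "subgroup H (FN N)" and K: "subgroup K (FN N)" using fH fK by (auto simp: fg_subgroup_def)
  have finA: "finite A" unfolding A_def using finite_csh_Kc[OF fH, of 1] finite_csh_Kc[OF fK, of 1] by (simp add: vcos_def)
  have sub: "dc ` A \<subseteq> dcosets N H K"
  proof (rule image_subsetI)
    fix p assume "p \<in> A"
    then have p: "fst p \<in> vcos N H" "snd p \<in> vcos N K" by (auto simp: A_def)
    obtain x where x: "x \<in> FN_carrier N" "fst p = H #>\<^bsub>FN N\<^esub> x" using vcosE[OF H fH(2) p(1)] by blast
    obtain y where y: "y \<in> FN_carrier N" "snd p = K #>\<^bsub>FN N\<^esub> y" using vcosE[OF K fK(2) p(2)] by blast
    have "dc p = H <#>\<^bsub>FN N\<^esub> {mul x (winv y)} <#>\<^bsub>FN N\<^esub> K"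
      using dc_coset[OF H K x(1) y(1)] x(2) y(2) by (metis prod.collapse)
    then show "dc p \<in> dcosets N H K" using x(1) y(1) unfolding dcosets_def by auto
  qed
  have "Nsub N H K = (\<Sum>D\<in>dc ` A. dterm N H K D)"
    unfolding Nsub_def
    by (rule sum.mono_neutral_left) (use finA sub dterm_nonzero[OF fH fK] A_def in auto)
  then have "real (Nsub N H K) = (\<Sum>D\<in>dc ` A. real (dterm N H K D))" by simp
  also have "\<dots> = (\<Sum>D\<in>dc ` A. \<Sum>p\<in>{p \<in> A. dc p = D}. FF (csh N H (fst p)) (csh N K (snd p)))"
    by (rule sum.cong[OF refl]) (use dcoset_fiber_sum[OF fH fK] A_def in auto)
  also have "\<dots> = (\<Sum>p\<in>A. FF (csh N H (fst p)) (csh N K (snd p)))"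
    by (rule sum.group) (use finA in auto)
  also have "\<dots> = Nint N (eta N H) (eta N K)"
    unfolding Nint_eta_sum[OF fH fK] A_def by (simp add: sum.cartesian_product case_prod_beta)
  finally show ?thesis by simp
qed

section \<open>Finite core graphs and their subgroups\<close>

text \<open>A finite graph with edges labelled by letters, where \<open>d v\<close> are the labels
  of the half-edges at \<open>v\<close>. It is folded, since \<open>st\<close> is a function, and
  has no leaves, so every reduced path extends to a ray. It may be disconnected.\<close>

locale core_graph =
  fixes N :: nat and Vs :: "'v set" and d :: "'v \<Rightarrow> int set" and st :: "'v \<Rightarrow> int \<Rightarrow> 'v"
  assumes finV: "finite Vs"
    and dl: "v \<in> Vs \<Longrightarrow> d v \<subseteq> letters N"
    and d2: "v \<in> Vs \<Longrightarrow> 2 \<le> card (d v)"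
    and st: "v \<in> Vs \<Longrightarrow> a \<in> d v \<Longrightarrow> st v a \<in> Vs"
    and st_d: "v \<in> Vs \<Longrightarrow> a \<in> d v \<Longrightarrow> - a \<in> d (st v a)"
    and st_inv: "v \<in> Vs \<Longrightarrow> a \<in> d v \<Longrightarrow> st (st v a) (- a) = v"
begin

fun ok :: "'v \<Rightarrow> int list \<Rightarrow> bool" where
  "ok v [] = True"
| "ok v (a # w) = (a \<in> d v \<and> ok (st v a) w)"

definition endp :: "'v \<Rightarrow> int list \<Rightarrow> 'v" where
  "endp v w = foldl st v w"

lemma endp_Nil [simp]: "endp v [] = v"
  and endp_Cons: "endp v (a # w) = endp (st v a) w"
  and endp_append: "endp v (u @ w) = endp (endp v u) w"
  by (simp_all add: endp_def)

lemma ok_append: "ok v (u @ w) \<longleftrightarrow> ok v u \<and> ok (endp v u) w"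
  by (induct u arbitrary: v) (auto simp: endp_Cons)

lemma ok_take: "ok v w \<Longrightarrow> ok v (take k w)"
  using ok_append[of v "take k w" "drop k w"] by simp

lemma endp_Vs: "v \<in> Vs \<Longrightarrow> ok v w \<Longrightarrow> endp v w \<in> Vs"
  by (induct w arbitrary: v) (auto simp: endp_Cons st)

lemma ok_cr:
  assumes "v \<in> Vs" "a \<in> d v" "ok (st v a) w"
  shows "ok v (cr a w) \<and> endp v (cr a w) = endp (st v a) w"
  using assms st_inv[OF assms(1,2)] by (cases w) (auto simp: cr_def endp_Cons)

lemma ok_red: "v \<in> Vs \<Longrightarrow> ok v w \<Longrightarrow> ok v (red w) \<and> endp v (red w) = endp v w"
proof (induct w arbitrary: v)
  case (Cons a w)
  then have "ok (st v a) (red w) \<and> endp (st v a) (red w) = endp (st v a) w" using st by simp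
  then show ?case using ok_cr[of v a "red w"] Cons.prems by (simp add: red_Cons endp_Cons)
qed simp

lemma ok_winv: "v \<in> Vs \<Longrightarrow> ok v w \<Longrightarrow> ok (endp v w) (winv w) \<and> endp (endp v w) (winv w) = v"
proof (induct w arbitrary: v)
  case (Cons a w)
  then have "ok (endp v (a # w)) (winv w)" "endp (endp v (a # w)) (winv w) = st v a" using st by (auto simp: endp_Cons)
  then show ?case using Cons.prems st_d st_inv by (simp add: winv_Cons ok_append endp_append endp_Cons)
qed simp

lemma ok_mul:
  assumes "v \<in> Vs" "ok v u" "ok (endp v u) w"
  shows "ok v (mul u w)" "endp v (mul u w) = endp (endp v u) w"
  using ok_red[OF assms(1), of "u @ w"] assms by (auto simp: mul_def ok_append endp_append)

text \<open>\<open>Tv\<close>, \<open>Hv\<close> and \<open>Sv\<close> are the universal cover, the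
  fundamental group and the boundary of the cover for the component of \<open>v\<close>, all based
  at \<open>v\<close> and placed inside the Cayley tree.\<close>

definition Tv :: "'v \<Rightarrow> int list set" where
  "Tv v = {w \<in> FN_carrier N. ok v w}"

definition Hv :: "'v \<Rightarrow> int list set" where
  "Hv v = {w \<in> Tv v. endp v w = v}"

definition Sv :: "'v \<Rightarrow> (nat \<Rightarrow> int) set" where
  "Sv v = {\<xi> \<in> bd N. \<forall>n. ok v (pre \<xi> n)}"

lemma Sv_bd: "Sv v \<subseteq> bd N"
  by (auto simp: Sv_def)

lemma Nil_Tv [simp]: "[] \<in> Tv v"
  by (simp add: Tv_def)

lemma subgroup_Hv: "v \<in> Vs \<Longrightarrow> subgroup (Hv v) (FN N)"
  unfolding subgroup_FN_iff using ok_mul[of v] ok_winv[of v] by (auto simp: Hv_def Tv_def) metis+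

lemma Tv_extend1:
  assumes "v \<in> Vs" "w \<in> Tv v"
  obtains b where "w @ [b] \<in> Tv v"
proof -
  define u where "u = endp v w"
  have u: "u \<in> Vs" using endp_Vs assms by (auto simp: u_def Tv_def)
  have fd: "finite (d u)" using dl[OF u] finite_subset[OF _ finite_letters] by blast
  obtain x y where xy: "x \<in> d u" "y \<in> d u" "x \<noteq> y" using d2[OF u] two_le_card_iff[OF fd] by blast
  define b where "b = (if w \<noteq> [] \<and> x = - last w then y else x)"
  have b: "b \<in> d u" "w = [] \<or> b \<noteq> - last w" using xy by (auto simp: b_def)
  have "b \<in> letters N" using b dl[OF u] by auto
  then have "w @ [b] \<in> FN_carrier N" using assms(2) b(2) by (auto simp: Tv_def FN_carrier_def reduced_append)
  moreover have "ok v (w @ [b])" using assms(2) b(1) by (auto simp: Tv_def ok_append u_def)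
  ultimately show ?thesis using that by (simp add: Tv_def)
qed

lemma Tv_extend:
  assumes v: "v \<in> Vs" and w: "w \<in> Tv v"
  obtains \<xi> where "\<xi> \<in> Sv v" "pre \<xi> (length w) = w"
proof -
  have "\<exists>x. \<forall>n. (x n \<in> Tv v \<and> (n = 0 \<longrightarrow> x n = w)) \<and> (\<exists>b. x (Suc n) = x n @ [b])"
    by (rule dependent_nat_choice) (use w Tv_extend1[OF v] in \<open>blast, metis nat.simps(3)\<close>)
  then obtain x where x: "\<And>n. x n \<in> Tv v" "x 0 = w" "\<And>n. \<exists>b. x (Suc n) = x n @ [b]" by blast
  have len: "length (x n) = length w + n" for n
  proof (induct n)
    case (Suc n)
    then show ?case using x(3)[of n] by auto
  qed (simp add: x(2))
  have chain: "take (length (x m)) (x (m + k)) = x m" for m k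
  proof (induct k)
    case (Suc k)
    obtain b where "x (Suc (m + k)) = x (m + k) @ [b]" using x(3) by blast
    then show ?case using Suc len by simp
  qed simp
  define \<xi> where "\<xi> = (\<lambda>i. x (Suc i) ! i)"
  have p: "pre \<xi> n = take n (x n)" for n
  proof (rule nth_equalityI)
    fix i assume i: "i < length (pre \<xi> n)"
    then have "take (length (x (Suc i))) (x n) = x (Suc i)" using chain[of "Suc i" "n - Suc i"] by simp
    moreover have "i < length (x (Suc i))" using len by simp
    ultimately have "x n ! i = x (Suc i) ! i" by (metis nth_take)
    then show "pre \<xi> n ! i = take n (x n) ! i" using i by (simp add: \<xi>_def)
  qed (simp add: len)
  have "agrees n (x n) \<xi>" for n using p[of n] len[of n] by (simp add: agrees_def)
  then have "\<xi> \<in> bd N" using x(1) agrees_all_bd[of N \<xi>] unfolding Tv_def by blast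
  moreover have "ok v (pre \<xi> n)" for n using x(1)[of n] ok_take p by (simp add: Tv_def)
  moreover have "pre \<xi> (length w) = w" using p[of "length w"] chain[of 0 "length w"] x(2) by simp
  ultimately show ?thesis by (intro that[of \<xi>]) (auto simp: Sv_def)
qed

lemma Pref_Sv:
  assumes "v \<in> Vs"
  shows "Pref (Sv v) = Tv v"
proof (intro equalityI subsetI)
  fix w assume "w \<in> Pref (Sv v)"
  then show "w \<in> Tv v" by (auto simp: Pref_def Sv_def Tv_def pre_FN)
next
  fix w assume "w \<in> Tv v"
  then obtain \<xi> where "\<xi> \<in> Sv v" "pre \<xi> (length w) = w" using Tv_extend[OF assms] by blast
  then show "w \<in> Pref (Sv v)" unfolding mem_Pref by blast
qed

lemma chull_Sv:
  assumes v: "v \<in> Vs"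
  shows "chull N (Sv v) = Tv v" "[] \<in> chull N (Sv v)"
proof -
  have fd: "finite (d v)" using dl[OF v] finite_subset[OF _ finite_letters] by blast
  obtain x y where xy: "x \<in> d v" "y \<in> d v" "x \<noteq> y" using d2[OF v] two_le_card_iff[OF fd] by blast
  have T: "[x] \<in> Tv v" "[y] \<in> Tv v" using xy dl[OF v] by (auto simp: Tv_def single_FN subset_iff)
  obtain \<xi> where xi: "\<xi> \<in> Sv v" "pre \<xi> (length [x]) = [x]" using Tv_extend[OF v T(1)] by blast
  obtain \<eta> where eta: "\<eta> \<in> Sv v" "pre \<eta> (length [y]) = [y]" using Tv_extend[OF v T(2)] by blast
  have "\<xi> 0 = x" "\<eta> 0 = y" using xi(2) eta(2) by (auto simp: pre_Suc)
  then show n: "[] \<in> chull N (Sv v)" unfolding Nil_chull using xi(1) eta(1) xy(3)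
    by (intro bexI[of _ \<xi>] bexI[of _ \<eta>]) auto
  show "chull N (Sv v) = Tv v" using chull_eq_Pref[OF Sv_bd n] Pref_Sv[OF v] by simp
qed

lemma act_Sv_sub:
  assumes v: "v \<in> Vs" and g: "g \<in> Tv v"
  shows "act (winv g) ` Sv v \<subseteq> Sv (endp v g)"
proof
  fix \<zeta> assume "\<zeta> \<in> act (winv g) ` Sv v"
  then obtain \<xi> where \<xi>: "\<zeta> = act (winv g) \<xi>" "\<xi> \<in> Sv v" by auto
  have gF: "winv g \<in> FN_carrier N" "ok v g" using g by (auto simp: Tv_def)
  have xb: "\<xi> \<in> bd N" using \<xi> Sv_bd by auto
  have "ok (endp v g) (pre \<zeta> k)" for k
  proof -
    define n where "n = k + length (winv g)"
    have "pre \<zeta> k = take k (mul (winv g) (pre \<xi> n))" using pre_act[OF gF(1) xb, of k n] \<xi> by (simp add: n_def)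
    moreover have "ok (endp v g) (mul (winv g) (pre \<xi> n))"
      using ok_winv[OF v gF(2)] endp_Vs[OF v gF(2)] \<xi>(2) by (intro ok_mul) (auto simp: Sv_def)
    ultimately show ?thesis using ok_take by simp
  qed
  then show "\<zeta> \<in> Sv (endp v g)" using act_bd[OF gF(1) xb] \<xi> by (simp add: Sv_def)
qed

lemma winv_Tv: "v \<in> Vs \<Longrightarrow> g \<in> Tv v \<Longrightarrow> winv g \<in> Tv (endp v g) \<and> endp (endp v g) (winv g) = v"
  using ok_winv[of v g] by (auto simp: Tv_def)

lemma act_Sv:
  assumes v: "v \<in> Vs" and g: "g \<in> Tv v"
  shows "act (winv g) ` Sv v = Sv (endp v g)"
proof
  show "act (winv g) ` Sv v \<subseteq> Sv (endp v g)" by (rule act_Sv_sub[OF assms])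
  have gF: "g \<in> FN_carrier N" "endp v g \<in> Vs" using g endp_Vs[OF v] by (auto simp: Tv_def)
  have "act (winv (winv g)) ` Sv (endp v g) \<subseteq> Sv v"
    using act_Sv_sub[OF gF(2), of "winv g"] winv_Tv[OF assms] by simp
  then have "act (winv g) ` act g ` Sv (endp v g) \<subseteq> act (winv g) ` Sv v" by (simp add: image_mono)
  then show "Sv (endp v g) \<subseteq> act (winv g) ` Sv v" by (simp add: act_image_winv[OF gF(1) Sv_bd])
qed

text \<open>Two paths differ by a loop at \<open>v\<close> exactly if they end at the same vertex,
  so the cosets that meet \<open>Tv v\<close> are the vertices of the component.\<close>

lemma Hv_coset_iff:
  assumes v: "v \<in> Vs" and g: "g \<in> Tv v" "g' \<in> Tv v"
  shows "Hv v #>\<^bsub>FN N\<^esub> g = Hv v #>\<^bsub>FN N\<^esub> g' \<longleftrightarrow> endp v g = endp v g'"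
proof -
  have F: "g \<in> FN_carrier N" "g' \<in> FN_carrier N" "ok v g" "ok v g'" using g by (auto simp: Tv_def)
  have "mul g (winv g') \<in> Hv v \<longleftrightarrow> endp v g = endp v g'"
  proof
    assume h: "mul g (winv g') \<in> Hv v"
    have "g = mul (mul g (winv g')) g'" using F by (simp add: mul_cancel_right' FN_carrier_reduced)
    then have "endp v g = endp (endp v (mul g (winv g'))) g'"
      using ok_mul(2)[OF v, of "mul g (winv g')" g'] h F by (simp add: Hv_def Tv_def)
    then show "endp v g = endp v g'" using h by (simp add: Hv_def)
  next
    assume e: "endp v g = endp v g'"
    then have "ok (endp v g) (winv g')" "endp (endp v g) (winv g') = v" using ok_winv[OF v F(4)] by auto
    then show "mul g (winv g') \<in> Hv v" using ok_mul[OF v F(3)] F by (simp add: Hv_def Tv_def)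
  qed
  then show ?thesis using rcos_eq_iff[OF subgroup_Hv[OF v] F(1,2)] by simp
qed

lemma fg_Hv:
  assumes v: "v \<in> Vs"
  shows "fg_subgroup N (Hv v)"
proof -
  have fin: "finite ((\<lambda>t. Hv v #>\<^bsub>FN N\<^esub> t) ` Tv v)"
  proof (rule finite_image_factor[where f="endp v"])
    show "finite (endp v ` Tv v)" by (rule finite_subset[OF _ finV]) (use endp_Vs[OF v] in \<open>auto simp: Tv_def\<close>)
  qed (use Hv_coset_iff[OF v] in blast)
  obtain D where "schreier N (Hv v) (Tv v) D"
  proof (rule ex_schreier[OF subgroup_Hv[OF v] _ _ _ _ fin])
    show "mul l t \<in> Tv v" if "l \<in> Hv v" "t \<in> Tv v" for l t
      using that ok_mul(1)[OF v, of l t] by (auto simp: Hv_def Tv_def)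
  qed (auto simp: Tv_def take_FN ok_take)
  then show ?thesis by (rule schreier.fg_L)
qed

text \<open>Every path from \<open>v\<close> closes up to a loop by one of finitely many return
  paths, of length at most \<open>Cm\<close>; hence every ray in \<open>Tv v\<close> is a limit of
  elements of \<open>Hv v\<close>.\<close>

lemma limset_Hv:
  assumes v: "v \<in> Vs"
  shows "limset N (Hv v) = Sv v"
proof (intro equalityI subsetI)
  fix \<xi> assume "\<xi> \<in> limset N (Hv v)"
  then have xi: "\<xi> \<in> bd N" "\<And>k. \<exists>h\<in>Hv v. agrees k h \<xi>" by (auto simp: mem_limset)
  have "ok v (pre \<xi> k)" for k
  proof -
    obtain h where "h \<in> Hv v" "agrees k h \<xi>" using xi by blast
    then have "pre \<xi> k = take k h" "ok v h" by (auto simp: agrees_def Hv_def Tv_def)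
    then show ?thesis using ok_take by simp
  qed
  then show "\<xi> \<in> Sv v" using xi by (simp add: Sv_def)
next
  fix \<xi> assume xi: "\<xi> \<in> Sv v"
  define g where "g = (\<lambda>u. SOME g. g \<in> Tv v \<and> endp v g = u)"
  define Cm where "Cm = Max (insert 0 ((\<lambda>u. length (g u)) ` Vs))"
  have "\<exists>h\<in>Hv v. agrees k h \<xi>" for k
  proof -
    define w where "w = pre \<xi> (k + Cm)"
    have w: "w \<in> Tv v" "w \<in> FN_carrier N" "ok v w" using xi pre_FN by (auto simp: w_def Sv_def Tv_def)
    have "g (endp v w) \<in> Tv v \<and> endp v (g (endp v w)) = endp v w"
      unfolding g_def by (rule someI[of _ w]) (use w in auto)
    then have gg: "g (endp v w) \<in> FN_carrier N" "ok v (g (endp v w))" "endp v (g (endp v w)) = endp v w"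
      by (auto simp: Tv_def)
    have "ok (endp v w) (winv (g (endp v w)))" "endp (endp v w) (winv (g (endp v w))) = v"
      using ok_winv[OF v gg(2)] gg(3) by auto
    then have "mul w (winv (g (endp v w))) \<in> Hv v"
      using ok_mul[OF v w(3)] w gg by (simp add: Hv_def Tv_def)
    moreover have "length (g (endp v w)) \<le> Cm"
      unfolding Cm_def using finV endp_Vs[OF v w(3)] by (intro Max_ge) auto
    then have "agrees (k + length (winv (g (endp v w)))) w \<xi>"
      by (simp add: agrees_def w_def take_pre min_absorb1)
    then have "agrees k (mul w (winv (g (endp v w)))) \<xi>"
      using w gg by (intro agrees_mul_right) (auto dest: FN_carrier_reduced)
    ultimately show ?thesis by blast
  qed
  then show "\<xi> \<in> limset N (Hv v)" using xi by (simp add: mem_limset Sv_def)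
qed

lemma Hv_nontrivial:
  assumes v: "v \<in> Vs"
  shows "Hv v \<noteq> {[]}"
proof
  assume "Hv v = {[]}"
  moreover obtain \<xi> where "\<xi> \<in> Sv v" using Tv_extend[OF v, of "[]"] by auto
  ultimately have "\<xi> \<in> limset N {[]}" using limset_Hv[OF v] by simp
  then have "agrees 1 [] \<xi>" unfolding mem_limset by blast
  then show False by (simp add: agrees_def)
qed

definition comp :: "'v \<Rightarrow> 'v set" where
  "comp v = endp v ` Tv v"

lemma comp_Vs: "v \<in> Vs \<Longrightarrow> comp v \<subseteq> Vs"
  using endp_Vs by (auto simp: comp_def Tv_def)

lemma self_comp: "v \<in> comp v"
  unfolding comp_def by (rule image_eqI[of _ _ "[]"]) auto

lemma comp_sub:
  assumes "v \<in> Vs" "u \<in> comp v"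
  shows "comp u \<subseteq> comp v"
proof
  fix z assume "z \<in> comp u"
  then obtain w where w: "w \<in> Tv u" "z = endp u w" by (auto simp: comp_def)
  obtain x where x: "x \<in> Tv v" "u = endp v x" using assms by (auto simp: comp_def)
  have "mul x w \<in> Tv v" "endp v (mul x w) = z" using ok_mul[OF assms(1), of x w] x w by (auto simp: Tv_def)
  then show "z \<in> comp v" by (auto simp: comp_def)
qed

lemma comp_sym: "v \<in> Vs \<Longrightarrow> u \<in> comp v \<Longrightarrow> v \<in> comp u"
  unfolding comp_def by (auto intro!: image_eqI[of v "endp _" "winv _"] dest: winv_Tv)

lemma comp_eq: "v \<in> Vs \<Longrightarrow> u \<in> comp v \<Longrightarrow> comp u = comp v"
  using comp_sub comp_sym comp_Vs by (metis equalityI subsetD)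

text \<open>The cosets of \<open>Hv v\<close> in the hull are the vertices of the component, and the
  limit set seen from such a vertex \<open>u\<close> is \<open>Sv u\<close>.\<close>

lemma measure_eta_Hv:
  assumes v: "v \<in> Vs" and W: "W \<in> CW N k" and k: "1 \<le> k"
  shows "measure (eta N (Hv v)) (Zc N k W) = real (card {u \<in> comp v. Pl k (Sv u) = W})"
proof -
  note s = subgroup_Hv[OF v] and nt = Hv_nontrivial[OF v]
  define A where "A = {g \<in> Tv v. Pl k (Sv (endp v g)) = W}"
  define q where "q = (\<lambda>g. Hv v #>\<^bsub>FN N\<^esub> g)"
  have cs: "csh N (Hv v) (q g) = Sv (endp v g)" if "g \<in> Tv v" for g
    using csh_coset[OF s, of g] act_Sv[OF v that] limset_Hv[OF v] that by (simp add: q_def Tv_def)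
  have "{C \<in> rcosets\<^bsub>FN N\<^esub> (Hv v). csh N (Hv v) C \<in> Zc N k W} = q ` A"
  proof (intro equalityI subsetI)
    fix C assume "C \<in> {C \<in> rcosets\<^bsub>FN N\<^esub> (Hv v). csh N (Hv v) C \<in> Zc N k W}"
    then have C: "C \<in> rcosets\<^bsub>FN N\<^esub> (Hv v)" "csh N (Hv v) C \<in> Zc N k W" by auto
    then have "C \<in> vcos N (Hv v)" using Zc_CW[OF k W] by (auto simp: vcos_def)
    then obtain x where x: "C = q x" "x \<in> chull N (limset N (Hv v))"
      using vcosE[OF s nt] unfolding q_def by blast
    then have xT: "x \<in> Tv v" using limset_Hv[OF v] chull_Sv(1)[OF v] by simp
    then show "C \<in> q ` A" using C(2) x(1) cs[OF xT] by (auto simp: A_def Zc_def)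
  next
    fix C assume "C \<in> q ` A"
    then obtain g where g: "g \<in> Tv v" "Pl k (Sv (endp v g)) = W" "C = q g" by (auto simp: A_def)
    have "C \<in> rcosets\<^bsub>FN N\<^esub> (Hv v)" using g rcosetsI[of g N "Hv v"] by (simp add: q_def Tv_def)
    then show "C \<in> {C \<in> rcosets\<^bsub>FN N\<^esub> (Hv v). csh N (Hv v) C \<in> Zc N k W}"
      using g cs[OF g(1)] csh_CN[OF s nt, of C] by (auto simp: Zc_def)
  qed
  then have "measure (eta N (Hv v)) (Zc N k W) = real (card (q ` A))"
    using measure_eta[OF fg_Hv[OF v] nt Zc_sets Zc_CW[OF k W]] by simp
  also have "\<dots> = (\<Sum>C\<in>q ` A. 1)" by simp
  also have "\<dots> = (\<Sum>u\<in>endp v ` A. 1)"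
    by (rule sum_image_kernel) (use Hv_coset_iff[OF v] in \<open>auto simp: A_def q_def\<close>)
  also have "endp v ` A = {u \<in> comp v. Pl k (Sv u) = W}" by (auto simp: A_def comp_def)
  finally show ?thesis by simp
qed

text \<open>The sum runs over base points, so each component occurs once for each of its vertices;
  the weight \<open>1 / card (comp v)\<close> compensates for this.\<close>

lemma sum_measure_eta_Hv:
  assumes W: "W \<in> CW N k" and k: "1 \<le> k"
  shows "(\<Sum>v\<in>Vs. 1 / card (comp v) * measure (eta N (Hv v)) (Zc N k W)) = real (card {u \<in> Vs. Pl k (Sv u) = W})"
proof -
  define f where "f = (\<lambda>u. if Pl k (Sv u) = W then 1 else (0::real))"
  have fc: "finite (comp v)" if "v \<in> Vs" for v using comp_Vs[OF that] finV finite_subset by blast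
  have "(\<Sum>v\<in>Vs. 1 / card (comp v) * measure (eta N (Hv v)) (Zc N k W)) = (\<Sum>v\<in>Vs. \<Sum>u\<in>Vs. if u \<in> comp v then f u / card (comp v) else 0)"
  proof (rule sum.cong[OF refl])
    fix v assume v: "v \<in> Vs"
    have "real (card {u \<in> comp v. Pl k (Sv u) = W}) = (\<Sum>u\<in>comp v. f u)"
      unfolding f_def using fc[OF v] by (simp add: sum.If_cases Int_def)
    also have "\<dots> = (\<Sum>u\<in>Vs. if u \<in> comp v then f u else 0)"
      using comp_Vs[OF v] finV by (simp add: sum.inter_restrict[symmetric] Int_absorb1)
    finally show "1 / card (comp v) * measure (eta N (Hv v)) (Zc N k W) = (\<Sum>u\<in>Vs. if u \<in> comp v then f u / card (comp v) else 0)"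
      unfolding measure_eta_Hv[OF v W k] by (simp add: sum_distrib_left sum_divide_distrib if_distrib cong: if_cong)
  qed
  also have "\<dots> = (\<Sum>u\<in>Vs. \<Sum>v\<in>Vs. if u \<in> comp v then f u / card (comp v) else 0)" by (rule sum.swap)
  also have "\<dots> = (\<Sum>u\<in>Vs. f u)"
  proof (rule sum.cong[OF refl])
    fix u assume u: "u \<in> Vs"
    have "(\<Sum>v\<in>Vs. if u \<in> comp v then f u / card (comp v) else 0) = (\<Sum>v\<in>Vs. if v \<in> comp u then f u / card (comp u) else 0)"
    proof (rule sum.cong[OF refl])
      fix v assume v: "v \<in> Vs"
      have "u \<in> comp v \<longleftrightarrow> v \<in> comp u" using comp_sym[OF u] comp_sym[OF v] by blast
      moreover have "comp v = comp u" if "v \<in> comp u" using comp_eq[OF u that] .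
      ultimately show "(if u \<in> comp v then f u / card (comp v) else 0) = (if v \<in> comp u then f u / card (comp u) else 0)"
        by simp
    qed
    also have "\<dots> = (\<Sum>v\<in>comp u. f u / card (comp u))"
      using comp_Vs[OF u] finV by (simp add: sum.inter_restrict[symmetric] Int_absorb1)
    also have "\<dots> = f u" using self_comp[of u] fc[OF u] by (auto simp: card_gt_0_iff)
    finally show "(\<Sum>v\<in>Vs. if u \<in> comp v then f u / card (comp v) else 0) = f u" .
  qed
  also have "\<dots> = real (card {u \<in> Vs. Pl k (Sv u) = W})"
    unfolding f_def using finV by (simp add: sum.If_cases Int_def)
  finally show ?thesis .
qed

end

section \<open>Density of the cone spanned by counting currents\<close>

text \<open>The cone spanned by the counting currents. The zero current enters as the zero multiple
  of a current, to start finite sums with.\<close>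

inductive_set ratc :: "nat \<Rightarrow> (nat \<Rightarrow> int) set measure set" for N :: nat where
  zero: "\<mu> \<in> SCurr N \<Longrightarrow> mscale 0 \<mu> \<in> ratc N"
| eta: "fg_subgroup N H \<Longrightarrow> H \<noteq> {[]} \<Longrightarrow> eta N H \<in> ratc N"
| scale: "\<mu> \<in> ratc N \<Longrightarrow> c \<ge> 0 \<Longrightarrow> mscale c \<mu> \<in> ratc N"
| add: "\<mu> \<in> ratc N \<Longrightarrow> \<nu> \<in> ratc N \<Longrightarrow> madd \<mu> \<nu> \<in> ratc N"

lemma ratc_SCurr: "\<mu> \<in> ratc N \<Longrightarrow> \<mu> \<in> SCurr N"
  by (induct rule: ratc.induct) (auto intro: mscale_SCurr madd_SCurr eta_SCurr)

lemma ratc_sum: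
  assumes "finite A" "\<And>v. v \<in> A \<Longrightarrow> \<mu> v \<in> ratc N" "\<And>v. v \<in> A \<Longrightarrow> c v \<ge> 0" "\<mu>0 \<in> SCurr N"
  shows "\<exists>\<nu>\<in>ratc N. \<forall>B m. B \<in> sets (borel_of (CT N)) \<and> B \<subseteq> Kc N m \<longrightarrow> measure \<nu> B = (\<Sum>v\<in>A. c v * measure (\<mu> v) B)"
  using assms(1-3)
proof (induct A)
  case empty
  show ?case using ratc.zero[OF assms(4)] measure_mscale[of 0 \<mu>0] by (intro bexI[of _ "mscale 0 \<mu>0"]) auto
next
  case (insert v A)
  then obtain \<nu> where \<nu>: "\<nu> \<in> ratc N" "\<forall>B m. B \<in> sets (borel_of (CT N)) \<and> B \<subseteq> Kc N m \<longrightarrow> measure \<nu> B = (\<Sum>v\<in>A. c v * measure (\<mu> v) B)"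
    by auto
  define \<nu>' where "\<nu>' = madd (mscale (c v) (\<mu> v)) \<nu>"
  have r: "mscale (c v) (\<mu> v) \<in> ratc N" using insert by (auto intro: ratc.scale)
  have "\<nu>' \<in> ratc N" unfolding \<nu>'_def using r \<nu>(1) by (rule ratc.add)
  moreover have "measure \<nu>' B = (\<Sum>v\<in>insert v A. c v * measure (\<mu> v) B)"
    if "B \<in> sets (borel_of (CT N))" "B \<subseteq> Kc N m" for B m
    unfolding \<nu>'_def measure_madd[OF ratc_SCurr[OF r] ratc_SCurr[OF \<nu>(1)] that]
    using \<nu>(2) that insert measure_mscale[of "c v" "\<mu> v" B] by auto
  ultimately show ?case by blast
qed

text \<open>The type of the half-edge labelled \<open>a\<close>: the branches in front of and behind that edge. The
  opposite half-edge has the swapped type.\<close>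
definition tau :: "nat \<Rightarrow> int \<Rightarrow> int list set \<Rightarrow> int list set \<times> int list set" where
  "tau R a W = (tl ` {w \<in> W. hd w = a}, take (R - 1) ` {w \<in> W. hd w \<noteq> a})"

lemma tau_Pl:
  "tau (Suc r) a (Pl (Suc r) S) = ((\<lambda>\<xi>. pre (\<lambda>n. \<xi> (Suc n)) r) ` {\<xi> \<in> S. \<xi> 0 = a}, (\<lambda>\<xi>. pre \<xi> r) ` {\<xi> \<in> S. \<xi> 0 \<noteq> a})"
proof -
  have 1: "{w \<in> Pl (Suc r) S. hd w = a} = (\<lambda>\<xi>. pre \<xi> (Suc r)) ` {\<xi> \<in> S. \<xi> 0 = a}"
    and 2: "{w \<in> Pl (Suc r) S. hd w \<noteq> a} = (\<lambda>\<xi>. pre \<xi> (Suc r)) ` {\<xi> \<in> S. \<xi> 0 \<noteq> a}"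
  proof -
    have "hd (pre \<xi> (Suc r)) = \<xi> 0" for \<xi> by (simp add: pre_Suc_Cons)
    then show "{w \<in> Pl (Suc r) S. hd w = a} = (\<lambda>\<xi>. pre \<xi> (Suc r)) ` {\<xi> \<in> S. \<xi> 0 = a}"
      "{w \<in> Pl (Suc r) S. hd w \<noteq> a} = (\<lambda>\<xi>. pre \<xi> (Suc r)) ` {\<xi> \<in> S. \<xi> 0 \<noteq> a}"
      unfolding Pl_def by auto
  qed
  have "tl (pre \<xi> (Suc r)) = pre (\<lambda>n. \<xi> (Suc n)) r" for \<xi> by (simp add: pre_Suc_Cons)
  then show ?thesis unfolding tau_def 1 2 image_image by (simp add: take_pre min_absorb1)
qed

text \<open>Crossing the edge \<open>a\<close> moves the base point to its other end: rays through
  the edge lose their first letter, all others gain \<open>- a\<close>.\<close>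

lemma tau_act:
  assumes "S \<subseteq> bd N"
  shows "tau (Suc r) (- a) (Pl (Suc r) (act [- a] ` S)) = prod.swap (tau (Suc r) a (Pl (Suc r) S))"
proof -
  have v: "act [- a] \<xi> = (if \<xi> 0 = a then (\<lambda>n. \<xi> (Suc n)) else case_nat (- a) \<xi>)" for \<xi>
    by (simp add: act_Cons lact_def)
  have "{\<zeta> \<in> act [- a] ` S. \<zeta> 0 = - a} = case_nat (- a) ` {\<xi> \<in> S. \<xi> 0 \<noteq> a}"
    using bd_reduced[of _ N 0] assms by (auto simp: v image_iff split: if_splits; blast)
  moreover have "{\<zeta> \<in> act [- a] ` S. \<zeta> 0 \<noteq> - a} = (\<lambda>\<xi> n. \<xi> (Suc n)) ` {\<xi> \<in> S. \<xi> 0 = a}"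
    using bd_reduced[of _ N 0] assms by (auto simp: v image_iff split: if_splits; blast)
  ultimately show ?thesis by (simp add: tau_Pl image_image)
qed

text \<open>Both halves being non-empty means that the edge \<open>a\<close> lies in the hull; hence
  so does its other end, which the translation moves to the identity.\<close>

lemma tau_level_act:
  assumes a: "a \<in> letters N" and XY: "Xs \<noteq> {}" "Ys \<noteq> {}"
  shows "(\<lambda>S. act [- a] ` S) ` {S \<in> Kc N 1. tau (Suc r) a (Pl (Suc r) S) = (Xs, Ys)}
    \<subseteq> {S \<in> Kc N 1. tau (Suc r) (- a) (Pl (Suc r) S) = (Ys, Xs)}"
proof (rule image_subsetI)
  fix S assume "S \<in> {S \<in> Kc N 1. tau (Suc r) a (Pl (Suc r) S) = (Xs, Ys)}"
  then have S: "S \<in> CN N" "tau (Suc r) a (Pl (Suc r) S) = (Xs, Ys)" by (auto simp: Kc_def)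
  define S' where "S' = act [- a] ` S"
  have t: "tau (Suc r) (- a) (Pl (Suc r) S') = (Ys, Xs)"
    using tau_act[OF CN_bd[OF S(1)], of r a] S(2) by (simp add: S'_def)
  have c: "S' \<in> CN N" unfolding S'_def using a by (intro act_CN[OF _ S(1)]) (simp add: single_FN)
  have "{\<xi> \<in> S'. \<xi> 0 = - a} \<noteq> {}" "{\<xi> \<in> S'. \<xi> 0 \<noteq> - a} \<noteq> {}" using t XY by (auto simp: tau_Pl)
  then obtain \<xi> \<eta> where "\<xi> \<in> S'" "\<xi> 0 = - a" "\<eta> \<in> S'" "\<eta> 0 \<noteq> - a" by blast
  then have "[] \<in> chull N S'" unfolding Nil_chull by (intro bexI[of _ \<xi>] bexI[of _ \<eta>]) auto
  then show "S' \<in> {S \<in> Kc N 1. tau (Suc r) (- a) (Pl (Suc r) S) = (Ys, Xs)}" using t c Kc1_iff by blast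
qed

text \<open>The translation by \<open>[- a]\<close> is a bijection between sets with a half-edge
  \<open>a\<close> of the given type and sets with a half-edge \<open>- a\<close> of the swapped
  type, and the current is invariant under it.\<close>

lemma matching_equations:
  assumes \<mu>: "\<mu> \<in> SCurr N" and a: "a \<in> letters N" and XY: "Xs \<noteq> {}" "Ys \<noteq> {}"
  shows "(\<Sum>W\<in>{W \<in> CW N (Suc r). tau (Suc r) a W = (Xs, Ys)}. measure \<mu> (Zc N (Suc r) W)) =
    (\<Sum>W\<in>{W \<in> CW N (Suc r). tau (Suc r) (- a) W = (Ys, Xs)}. measure \<mu> (Zc N (Suc r) W))"
proof -
  define A where "A = (\<lambda>a Xs Ys. {S \<in> Kc N 1. tau (Suc r) a (Pl (Suc r) S) = (Xs, Ys)})"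
  have m: "A a Xs Ys \<in> sets (borel_of (CT N))" for a Xs Ys
  proof -
    have "A a Xs Ys = Kc N 1 \<inter> {S \<in> CN N. tau (Suc r) a (Pl (Suc r) S) = (Xs, Ys)}" by (auto simp: A_def Kc_def)
    then show ?thesis using sets.Int[OF Kc_sets[of N 1] level_sets[of N "\<lambda>P. tau (Suc r) a P = (Xs, Ys)" "Suc r"]] by simp
  qed
  have gF: "[- a] \<in> FN_carrier N" "[a] \<in> FN_carrier N" using a by (simp_all add: single_FN)
  have w: "winv [- a] = [a]" by (simp add: winv_def)
  have s1: "(\<lambda>S. act [- a] ` S) ` A a Xs Ys \<subseteq> A (- a) Ys Xs"
    unfolding A_def by (rule tau_level_act[OF a XY])
  have s2: "(\<lambda>S. act [a] ` S) ` A (- a) Ys Xs \<subseteq> A a Xs Ys"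
    using tau_level_act[of "- a" N Ys Xs r] a XY unfolding A_def by simp
  have "A (- a) Ys Xs \<subseteq> (\<lambda>S. act [- a] ` S) ` A a Xs Ys"
  proof
    fix S assume S: "S \<in> A (- a) Ys Xs"
    then have "S \<subseteq> bd N" using CN_bd by (auto simp: A_def Kc_def)
    then have "S = act [- a] ` act [a] ` S" using act_image_winv'[OF gF(1)] w by simp
    then show "S \<in> (\<lambda>S. act [- a] ` S) ` A a Xs Ys" using s2 S by blast
  qed
  then have "measure \<mu> (A (- a) Ys Xs) = measure \<mu> ((\<lambda>S. act [- a] ` S) ` A a Xs Ys)" using s1 by (metis equalityI)
  also have "\<dots> = measure \<mu> (A a Xs Ys)" by (rule SCurr_measure_act[OF \<mu> gF(1) m])
  finally show ?thesis unfolding A_def CW_def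
    using measure_level[OF \<mu>, of 1 "Suc r" "\<lambda>W. tau (Suc r) a W = (Xs, Ys)"]
      measure_level[OF \<mu>, of 1 "Suc r" "\<lambda>W. tau (Suc r) (- a) W = (Ys, Xs)"] by simp
qed

lemma CW_words:
  assumes "W \<in> CW N R" "w \<in> W"
  shows "w \<in> FN_carrier N" "length w = R"
  using assms CN_bd pre_FN by (auto simp: CW_def Pl_def Kc_def) blast

lemma CW_hd:
  assumes "W \<in> CW N (Suc r)"
  shows "hd ` W \<subseteq> letters N" "2 \<le> card (hd ` W)"
proof -
  show l: "hd ` W \<subseteq> letters N"
  proof (rule image_subsetI)
    fix w assume "w \<in> W"
    then show "hd w \<in> letters N" using CW_words[OF assms, of w] by (cases w) (auto simp: FN_carrier_def)
  qed
  obtain S where S: "S \<in> Kc N 1" "W = Pl (Suc r) S" using assms by (auto simp: CW_def)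
  then have "[] \<in> chull N S" using Kc1_iff by blast
  then obtain \<xi> \<eta> where x: "\<xi> \<in> S" "\<eta> \<in> S" "\<xi> 0 \<noteq> \<eta> 0" by (auto simp: Nil_chull)
  have "\<xi> 0 \<in> hd ` W" "\<eta> 0 \<in> hd ` W" using x S(2) by (auto simp: Pl_def image_image pre_Suc_Cons)
  moreover have "finite (hd ` W)" using l finite_letters finite_subset by blast
  ultimately show "2 \<le> card (hd ` W)" unfolding two_le_card_iff[OF \<open>finite (hd ` W)\<close>] using x(3) by blast
qed

text \<open>An integral solution of the matching equations is realised by a finite graph: take \<open>p W\<close> vertices
  of local type \<open>W\<close> and glue their half-edges of matching edge types.\<close>
lemma realize_weights:
  fixes p :: "int list set \<Rightarrow> nat"
  assumes match: "\<And>a Xs Ys. a \<in> letters N \<Longrightarrow> Xs \<noteq> {} \<Longrightarrow> Ys \<noteq> {} \<Longrightarrow>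
      (\<Sum>W\<in>{W \<in> CW N (Suc r). tau (Suc r) a W = (Xs, Ys)}. p W) = (\<Sum>W\<in>{W \<in> CW N (Suc r). tau (Suc r) (- a) W = (Ys, Xs)}. p W)"
    and \<mu>0: "\<mu>0 \<in> SCurr N"
  shows "\<exists>\<nu>\<in>ratc N. \<forall>W\<in>CW N (Suc r). measure \<nu> (Zc N (Suc r) W) = real (p W)"
proof -
  define ta where "ta = tau (Suc r)"
  define Vs where "Vs = (SIGMA W:CW N (Suc r). {..<p W})"
  define d where "d = (\<lambda>v :: int list set \<times> nat. hd ` fst v)"
  have finV: "finite Vs" unfolding Vs_def using finite_CW by blast
  have VW: "fst v \<in> CW N (Suc r)" if "v \<in> Vs" for v using that by (auto simp: Vs_def)
  \<comment> \<open>The vertices whose half-edge \<open>a\<close> has type \<open>XY\<close>; their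
    number is one side of a matching equation.\<close>
  define Ou where "Ou = (\<lambda>a XY. {v \<in> Vs. ta a (fst v) = XY})"
  have cardO: "card (Ou a XY) = (\<Sum>W\<in>{W \<in> CW N (Suc r). ta a W = XY}. p W)" for a XY
  proof -
    have "Ou a XY = (SIGMA W:{W \<in> CW N (Suc r). ta a W = XY}. {..<p W})" by (auto simp: Ou_def Vs_def)
    then show ?thesis using finite_CW by simp
  qed
  have finO: "finite (Ou a XY)" for a XY using finV by (simp add: Ou_def)
  have ne: "fst (ta a (fst v)) \<noteq> {} \<longleftrightarrow> a \<in> d v" "a \<in> letters N \<Longrightarrow> v \<in> Vs \<Longrightarrow> snd (ta a (fst v)) \<noteq> {}" for a v
  proof -
    show "fst (ta a (fst v)) \<noteq> {} \<longleftrightarrow> a \<in> d v" by (auto simp: ta_def tau_def d_def)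
    assume "v \<in> Vs"
    then have c: "2 \<le> card (hd ` fst v)" using CW_hd VW by blast
    have "finite (hd ` fst v)" using CW_hd(1)[OF VW[OF \<open>v \<in> Vs\<close>]] finite_subset[OF _ finite_letters] by blast
    then obtain x y where "x \<in> hd ` fst v" "y \<in> hd ` fst v" "x \<noteq> y" using c two_le_card_iff by blast
    then show "snd (ta a (fst v)) \<noteq> {}" by (cases "x = a") (auto simp: ta_def tau_def)
  qed
  have exb: "\<exists>f. bij_betw f (Ou a (Xs, Ys)) (Ou (- a) (Ys, Xs))" if "a \<in> letters N" "Xs \<noteq> {}" "Ys \<noteq> {}" for a Xs Ys
    using match[OF that] finO cardO by (intro finite_same_card_bij) (auto simp: ta_def)
  define \<beta> where "\<beta> = (\<lambda>a XY. SOME f. bij_betw f (Ou a XY) (Ou (- a) (prod.swap XY)))"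
  have \<beta>: "bij_betw (\<beta> a XY) (Ou a XY) (Ou (- a) (prod.swap XY))"
    if "a \<in> letters N" "fst XY \<noteq> {}" "snd XY \<noteq> {}" for a XY
  proof -
    have "\<exists>f. bij_betw f (Ou a XY) (Ou (- a) (prod.swap XY))" using exb[OF that] by (simp add: prod.swap_def)
    then show ?thesis unfolding \<beta>_def by (rule someI_ex)
  qed
  \<comment> \<open>A gluing is used directly for positive letters only; negative letters take its
    inverse, so that crossing an edge forth and back is the identity.\<close>
  define st where "st = (\<lambda>v a. if a > 0 then \<beta> a (ta a (fst v)) v
      else inv_into (Ou (- a) (prod.swap (ta a (fst v)))) (\<beta> (- a) (prod.swap (ta a (fst v)))) v)"
  have stp: "st v a \<in> Ou (- a) (prod.swap (ta a (fst v))) \<and> st (st v a) (- a) = v"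
    if v: "v \<in> Vs" and a: "a \<in> d v" for v a
  proof -
    have al: "a \<in> letters N" using a CW_hd(1)[OF VW[OF v]] by (auto simp: d_def)
    then have a0: "a \<noteq> 0" by (simp add: letters_def)
    define XY where "XY = ta a (fst v)"
    have XY: "fst XY \<noteq> {}" "snd XY \<noteq> {}" using ne a al v by (auto simp: XY_def)
    have vO: "v \<in> Ou a XY" using v by (simp add: Ou_def XY_def)
    show ?thesis
    proof (cases "a > 0")
      case True
      note b = \<beta>[OF al XY]
      define u where "u = \<beta> a XY v"
      have u: "st v a = u" using True by (simp add: st_def u_def XY_def)
      have uO: "u \<in> Ou (- a) (prod.swap XY)" using b vO by (auto simp: u_def bij_betw_def)
      then have "ta (- a) (fst u) = prod.swap XY" by (simp add: Ou_def)
      then have "st u (- a) = inv_into (Ou a XY) (\<beta> a XY) u" using True by (simp add: st_def)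
      also have "\<dots> = v" unfolding u_def using b vO by (simp add: bij_betw_def)
      finally show ?thesis using u uO by (simp add: XY_def)
    next
      case False
      then have na: "- a > 0" using a0 by simp
      have b: "bij_betw (\<beta> (- a) (prod.swap XY)) (Ou (- a) (prod.swap XY)) (Ou a XY)"
        using \<beta>[of "- a" "prod.swap XY"] al XY by simp
      define u where "u = inv_into (Ou (- a) (prod.swap XY)) (\<beta> (- a) (prod.swap XY)) v"
      have u: "st v a = u" using False by (simp add: st_def u_def XY_def)
      have "v \<in> \<beta> (- a) (prod.swap XY) ` Ou (- a) (prod.swap XY)" using b vO by (simp add: bij_betw_def)
      then have uO: "u \<in> Ou (- a) (prod.swap XY)" "\<beta> (- a) (prod.swap XY) u = v"
        unfolding u_def by (auto intro: inv_into_into f_inv_into_f)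
      then have "ta (- a) (fst u) = prod.swap XY" by (simp add: Ou_def)
      then have "st u (- a) = v" using na uO(2) by (simp add: st_def)
      then show ?thesis using u uO by (simp add: XY_def)
    qed
  qed
  have stt: "ta (- a) (fst (st v a)) = prod.swap (ta a (fst v))" if "v \<in> Vs" "a \<in> d v" for v a
    using stp[OF that] by (simp add: Ou_def)
  interpret core_graph N Vs d st
  proof
    show "finite Vs" by (rule finV)
    fix v assume v: "v \<in> Vs"
    show "d v \<subseteq> letters N" "2 \<le> card (d v)" using CW_hd[OF VW[OF v]] by (auto simp: d_def)
    fix a assume a: "a \<in> d v"
    then have al: "a \<in> letters N" using CW_hd(1)[OF VW[OF v]] by (auto simp: d_def)
    show "st v a \<in> Vs" "st (st v a) (- a) = v" using stp[OF v a] by (auto simp: Ou_def)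
    have "fst (ta (- a) (fst (st v a))) \<noteq> {}" using stt[OF v a] ne(2)[OF al v] by simp
    then show "- a \<in> d (st v a)" using ne(1) by blast
  qed
  \<comment> \<open>Glued half-edges have swapped types, so the branch in front of an edge agrees up
    to depth \<open>r\<close> with what the vertex at its end shows apart from the way back. By
    induction on \<open>k\<close>, the words readable at \<open>v\<close> are the prefixes of its
    local type.\<close>
  have words: "v \<in> Vs \<Longrightarrow> k \<le> Suc r \<Longrightarrow> {w \<in> Tv v. length w = k} = take k ` fst v" for v k
  proof (induct k arbitrary: v)
    case 0
    have "fst v \<noteq> {}" using CW_hd(2)[OF VW[OF 0(1)]] by auto
    then show ?case by auto
  next
    case (Suc k)
    have v: "v \<in> Vs" by fact
    note W = CW_words[OF VW[OF v]]
    show ?case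
    proof (intro equalityI subsetI)
      fix w assume "w \<in> {w \<in> Tv v. length w = Suc k}"
      then obtain a w' where w: "w = a # w'" "w \<in> Tv v" "length w' = k" by (cases w) auto
      have ad: "a \<in> d v" and okw: "ok (st v a) w'" using w by (auto simp: Tv_def)
      have v': "st v a \<in> Vs" by (rule st[OF v ad])
      have rw: "a # w' \<in> FN_carrier N" using w by (simp add: Tv_def)
      then have w'F: "w' \<in> FN_carrier N" "w' = [] \<or> hd w' \<noteq> - a" by (auto simp: FN_carrier_def reduced_Cons)
      show "w \<in> take (Suc k) ` fst v"
      proof (cases "w' = []")
        case True
        obtain z where z: "z \<in> fst v" "hd z = a" using ad by (auto simp: d_def)
        then have "take (Suc k) z = w" using w True W(2)[OF z(1)] by (cases z) auto
        then show ?thesis using z by blast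
      next
        case False
        have "w' \<in> take k ` fst (st v a)" using Suc.hyps[OF v'] Suc.prems(2) okw w'F w(3) by (auto simp: Tv_def)
        then obtain z where z: "z \<in> fst (st v a)" "w' = take k z" by auto
        \<comment> \<open>A reduced path does not turn back, so \<open>z\<close> lies on the side
          away from the edge just crossed.\<close>
        have hz: "hd z \<noteq> - a" using w'F(2) False z(2) by (cases z; cases k) auto
        then have "take r z \<in> snd (ta (- a) (fst (st v a)))" using z(1) by (auto simp: ta_def tau_def)
        then have "take r z \<in> fst (ta a (fst v))" using stt[OF v ad] by simp
        then obtain y where y: "y \<in> fst v" "hd y = a" "take r z = tl y" by (auto simp: ta_def tau_def)
        have "w' = take k (take r z)" using z(2) Suc.prems(2) by (simp add: min_absorb1)
        then have "w = take (Suc k) y" using w(1) y W(2)[OF y(1)] by (cases y) auto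
        then show ?thesis using y(1) by blast
      qed
    next
      fix w assume "w \<in> take (Suc k) ` fst v"
      then obtain y where y: "y \<in> fst v" "w = take (Suc k) y" by auto
      obtain a y' where ay: "y = a # y'" using W(2)[OF y(1)] by (cases y) auto
      have ad: "a \<in> d v" unfolding d_def by (rule image_eqI[of _ _ y]) (use y ay in auto)
      have v': "st v a \<in> Vs" by (rule st[OF v ad])
      have "y' \<in> fst (ta a (fst v))" unfolding ta_def tau_def fst_conv by (rule image_eqI[of _ _ y]) (use y ay in auto)
      then have "y' \<in> snd (ta (- a) (fst (st v a)))" using stt[OF v ad] by simp
      then obtain z where z: "z \<in> fst (st v a)" "y' = take r z" by (auto simp: ta_def tau_def)
      have "take k y' = take k z" using z(2) Suc.prems(2) by (simp add: min_absorb1)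
      then have "take k y' \<in> take k ` fst (st v a)" using z(1) by auto
      then have "ok (st v a) (take k y')" using Suc.hyps[OF v'] Suc.prems(2) by (auto simp: Tv_def)
      moreover have "w \<in> FN_carrier N" using take_FN[OF W(1)[OF y(1)]] y by simp
      moreover have "length w = Suc k" using y W(2)[OF y(1)] Suc.prems(2) by simp
      ultimately show "w \<in> {w \<in> Tv v. length w = Suc k}" using ad y(2) ay by (simp add: Tv_def)
    qed
  qed
  have PlS: "Pl (Suc r) (Sv v) = fst v" if v: "v \<in> Vs" for v
  proof -
    have "Pl (Suc r) (Sv v) = {w \<in> Pref (Sv v). length w = Suc r}" by (auto simp: Pl_def Pref_def)
    also have "\<dots> = take (Suc r) ` fst v" using words[OF v, of "Suc r"] Pref_Sv[OF v] by simp
    also have "\<dots> = (\<lambda>w. w) ` fst v" by (rule image_cong) (use CW_words(2)[OF VW[OF v]] in auto)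
    finally show ?thesis by simp
  qed
  obtain \<nu> where \<nu>: "\<nu> \<in> ratc N" "\<forall>B m. B \<in> sets (borel_of (CT N)) \<and> B \<subseteq> Kc N m \<longrightarrow>
      measure \<nu> B = (\<Sum>v\<in>Vs. 1 / card (comp v) * measure (eta N (Hv v)) B)"
    using ratc_sum[OF finV, of "\<lambda>v. eta N (Hv v)" N "\<lambda>v. 1 / card (comp v)", OF _ _ \<mu>0]
      ratc.eta[OF fg_Hv Hv_nontrivial] by auto
  have "measure \<nu> (Zc N (Suc r) W) = real (p W)" if W: "W \<in> CW N (Suc r)" for W
  proof -
    have "measure \<nu> (Zc N (Suc r) W) = (\<Sum>v\<in>Vs. 1 / card (comp v) * measure (eta N (Hv v)) (Zc N (Suc r) W))"
      using \<nu>(2) Zc_sets Zc_CW[OF _ W] by auto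
    also have "\<dots> = real (card {u \<in> Vs. Pl (Suc r) (Sv u) = W})" by (rule sum_measure_eta_Hv[OF W]) simp
    also have "{u \<in> Vs. Pl (Suc r) (Sv u) = W} = Pair W ` {..<p W}"
      using PlS W by (auto simp: Vs_def)
    also have "card (Pair W ` {..<p W}) = p W" by (simp add: card_image inj_on_def)
    finally show ?thesis .
  qed
  then show ?thesis using \<nu>(1) by blast
qed

section \<open>Rounding the masses of cells\<close>

lemma Dirichlet_finite:
  fixes x :: "'a \<Rightarrow> real"
  assumes "finite A" "M > (0::nat)"
  obtains q :: int and p :: "'a \<Rightarrow> int" where "q > 0" "\<And>i. i \<in> A \<Longrightarrow> \<bar>of_int q * x i - of_int (p i)\<bar> < 1 / M"
proof -
  obtain h where h: "bij_betw h {0..<card A} A" using ex_bij_betw_nat_finite[OF assms(1)] by blast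
  obtain q p where qp: "0 < q" "\<And>i. i < card A \<Longrightarrow> \<bar>of_int q * x (h i) - of_int (p i)\<bar> < 1 / M"
    using Dirichlet_approx_simult[OF assms(2), of "card A" "\<lambda>i. x (h i)"] by blast
  define h' where "h' = inv_into {0..<card A} h"
  have "h' i < card A \<and> h (h' i) = i" if "i \<in> A" for i
    using that h unfolding h'_def bij_betw_def by (metis atLeastLessThan_iff f_inv_into_f inv_into_into)
  then show ?thesis using that[of q "\<lambda>i. p (h' i)"] qp by metis
qed

text \<open>After rounding \<open>q\<close> times the masses to integers, the two sides of a
  matching equation differ by at most \<open>2 * card CC / M\<close>, which is less than 1. Being
  integers, they are equal, so the rounded weights satisfy the equations exactly and can be
  realised; dividing by \<open>q\<close> returns to the given masses.\<close>

lemma approx_CW: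
  assumes \<mu>: "\<mu> \<in> SCurr N" and "\<epsilon> > 0"
  shows "\<exists>\<nu>\<in>ratc N. \<forall>W\<in>CW N (Suc r). \<bar>measure \<mu> (Zc N (Suc r) W) - measure \<nu> (Zc N (Suc r) W)\<bar> < \<epsilon>"
proof -
  define CC where "CC = CW N (Suc r)"
  define \<theta> where "\<theta> = (\<lambda>W. measure \<mu> (Zc N (Suc r) W))"
  have fC: "finite CC" by (simp add: CC_def finite_CW)
  \<comment> \<open>The first bound makes the rounded matching equations exact, the second keeps the
    error below \<open>\<epsilon>\<close>.\<close>
  obtain M0 :: nat where M0: "max (2 * real (card CC)) (1 / \<epsilon>) < M0" using reals_Archimedean2 by blast
  define M where "M = Suc M0"
  have M: "2 * real (card CC) < M" "1 / \<epsilon> < M" "M > 0" using M0 by (auto simp: M_def)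
  obtain q :: int and pz where q: "q > 0" "\<And>W. W \<in> CC \<Longrightarrow> \<bar>of_int q * \<theta> W - of_int (pz W)\<bar> < 1 / M"
    using Dirichlet_finite[OF fC M(3), of \<theta>] by blast
  have M1: "1 / real M \<le> 1" using M(3) by simp
  have pos: "pz W \<ge> 0" if "W \<in> CC" for W
  proof -
    have "of_int q * \<theta> W \<ge> 0" using q(1) by (simp add: \<theta>_def)
    then have "real_of_int (pz W) > - 1" using q(2)[OF that] M1 by linarith
    then show ?thesis by linarith
  qed
  define p where "p = (\<lambda>W. nat (pz W))"
  have pp: "real (p W) = of_int (pz W)" if "W \<in> CC" for W using pos[OF that] by (simp add: p_def)
  have close: "\<bar>of_int q * (\<Sum>W\<in>A. \<theta> W) - real (\<Sum>W\<in>A. p W)\<bar> \<le> card CC * (1 / M)" if A: "A \<subseteq> CC" for A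
  proof -
    have "\<bar>of_int q * (\<Sum>W\<in>A. \<theta> W) - real (\<Sum>W\<in>A. p W)\<bar> = \<bar>\<Sum>W\<in>A. of_int q * \<theta> W - real (p W)\<bar>"
      by (simp add: sum_subtractf sum_distrib_left)
    also have "\<dots> \<le> (\<Sum>W\<in>A. \<bar>of_int q * \<theta> W - real (p W)\<bar>)" by (rule sum_abs)
    also have "\<dots> \<le> (\<Sum>W\<in>A. 1 / M)" by (rule sum_mono) (use q(2) pp A in \<open>force intro: less_imp_le\<close>)
    also have "\<dots> = card A * (1 / M)" by simp
    also have "\<dots> \<le> card CC * (1 / M)" using card_mono[OF fC A] by (intro mult_right_mono) auto
    finally show ?thesis .
  qed
  have "(\<Sum>W\<in>{W \<in> CC. tau (Suc r) a W = (Xs, Ys)}. p W) = (\<Sum>W\<in>{W \<in> CC. tau (Suc r) (- a) W = (Ys, Xs)}. p W)"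
    if "a \<in> letters N" "Xs \<noteq> {}" "Ys \<noteq> {}" for a Xs Ys
  proof -
    define A B where "A = {W \<in> CC. tau (Suc r) a W = (Xs, Ys)}" and "B = {W \<in> CC. tau (Suc r) (- a) W = (Ys, Xs)}"
    have eq: "(\<Sum>W\<in>A. \<theta> W) = (\<Sum>W\<in>B. \<theta> W)"
      unfolding A_def B_def \<theta>_def CC_def by (rule matching_equations[OF \<mu> that])
    have "\<bar>of_int q * (\<Sum>W\<in>A. \<theta> W) - real (\<Sum>W\<in>A. p W)\<bar> \<le> card CC * (1 / M)"
      "\<bar>of_int q * (\<Sum>W\<in>B. \<theta> W) - real (\<Sum>W\<in>B. p W)\<bar> \<le> card CC * (1 / M)" by (rule close; auto simp: A_def B_def)+
    moreover have "2 * (card CC * (1 / M)) < 1" using M by (simp add: field_simps)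
    ultimately have "\<bar>real (\<Sum>W\<in>A. p W) - real (\<Sum>W\<in>B. p W)\<bar> < 1" unfolding eq by linarith
    then show ?thesis unfolding A_def[symmetric] B_def[symmetric] by linarith
  qed
  then obtain \<nu> where \<nu>: "\<nu> \<in> ratc N" "\<forall>W\<in>CC. measure \<nu> (Zc N (Suc r) W) = real (p W)"
    using realize_weights[of N p r, OF _ \<mu>] unfolding CC_def by blast
  define \<nu>' where "\<nu>' = mscale (1 / of_int q) \<nu>"
  have q1: "real_of_int q \<ge> 1" using q(1) by linarith
  have "\<bar>\<theta> W - measure \<nu>' (Zc N (Suc r) W)\<bar> < \<epsilon>" if W: "W \<in> CC" for W
  proof -
    have "\<theta> W - measure \<nu>' (Zc N (Suc r) W) = (of_int q * \<theta> W - of_int (pz W)) / of_int q"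
      using \<nu>(2) W q1 pp[OF W] by (simp add: \<nu>'_def measure_mscale field_simps)
    then have "\<bar>\<theta> W - measure \<nu>' (Zc N (Suc r) W)\<bar> = \<bar>of_int q * \<theta> W - of_int (pz W)\<bar> / of_int q" using q1 by simp
    also have "\<dots> \<le> \<bar>of_int q * \<theta> W - of_int (pz W)\<bar> / 1" using q1 by (intro divide_left_mono) auto
    also have "\<dots> < 1 / M" using q(2)[OF W] by simp
    also have "\<dots> < \<epsilon>" using M(2,3) assms(2) by (simp add: field_simps)
    finally show ?thesis .
  qed
  moreover have "\<nu>' \<in> ratc N" unfolding \<nu>'_def using \<nu>(1) q1 by (intro ratc.scale) auto
  ultimately show ?thesis unfolding CC_def \<theta>_def by blast
qed

text \<open>A level set is translated so that the identity lies in all hulls; there it is determined at level \<open>2n\<close>.\<close>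
lemma Zc_translate:
  assumes W: "W \<in> Pl n ` Kc N n"
  obtains \<W> where "\<W> \<subseteq> CW N (2 * n)"
    "\<And>\<mu>. \<mu> \<in> SCurr N \<Longrightarrow> measure \<mu> (Zc N n W) = (\<Sum>W'\<in>\<W>. measure \<mu> (Zc N (2 * n) W'))"
proof -
  obtain S0 where S0: "S0 \<in> Kc N n" "W = Pl n S0" using W by blast
  have S0b: "S0 \<subseteq> bd N" "2 \<le> card (Pl n S0)" using S0 CN_bd by (auto simp: Kc_def)
  obtain \<xi> \<eta> where x: "\<xi> \<in> S0" "\<eta> \<in> S0" "pre \<xi> n \<noteq> pre \<eta> n"
    using S0b(2) unfolding two_le_card_iff[OF finite_Pl[OF S0b(1)]] by (auto simp: Pl_def)
  then have "\<xi> \<noteq> \<eta>" by auto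
  then obtain j where j: "pre \<xi> j = pre \<eta> j" "\<xi> j \<noteq> \<eta> j" using chull_nonempty[OF S0b(1) x(1,2)] by blast
  have jn: "j < n" using j(1) x(3) pre_eq_mono[of \<xi> j \<eta> n] by force
  define u where "u = pre \<xi> j"
  have uF: "u \<in> FN_carrier N" "winv u \<in> FN_carrier N" "length u = j" using x S0b pre_FN by (auto simp: u_def)
  have uh: "u \<in> chull N S" if S: "S \<in> CN N" "Pl n S = W" for S
  proof -
    have Sb: "S \<subseteq> bd N" by (rule CN_bd[OF S(1)])
    have "pre \<xi> n \<in> Pl n S" "pre \<eta> n \<in> Pl n S" using S(2) S0(2) x by (auto simp: Pl_def)
    then obtain \<xi>' \<eta>' where y: "\<xi>' \<in> S" "pre \<xi>' n = pre \<xi> n" "\<eta>' \<in> S" "pre \<eta>' n = pre \<eta> n" by (auto simp: Pl_def)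
    have "pre \<xi>' j = u" "pre \<eta>' j = u" using y jn j(1) pre_eq_mono[of \<xi>' n \<xi> j] pre_eq_mono[of \<eta>' n \<eta> j] by (auto simp: u_def)
    moreover have "\<xi>' j = \<xi> j" "\<eta>' j = \<eta> j" using y jn by (auto simp: pre_eq_iff)
    moreover have "dir (pre \<xi>' j) \<xi>' = \<xi>' j" "dir (pre \<eta>' j) \<eta>' = \<eta>' j" using dir_prefix y Sb by blast+
    ultimately have "dir u \<xi>' \<noteq> dir u \<eta>'" using j(2) by simp
    then show ?thesis using y uF by (auto simp: chull_def)
  qed
  define A where "A = {S \<in> Kc N 1. Pl n (act u ` S) = W}"
  have im: "(\<lambda>S. act (winv u) ` S) ` Zc N n W = A"
  proof (intro equalityI subsetI)
    fix S assume "S \<in> (\<lambda>S. act (winv u) ` S) ` Zc N n W"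
    then obtain S' where S': "S' \<in> CN N" "Pl n S' = W" "S = act (winv u) ` S'" by (auto simp: Zc_def)
    have "S \<in> CN N" using act_CN[OF uF(2) S'(1)] S'(3) by simp
    moreover have "[] \<in> chull N S" using uh[OF S'(1,2)] mem_chull_act[OF uF(2), of "[]" S'] CN_bd[OF S'(1)] uF(1) S'(3)
      by (simp add: mul_Nil_right FN_carrier_reduced)
    moreover have "act u ` S = S'" using act_image_winv'[OF uF(1) CN_bd[OF S'(1)]] S'(3) by simp
    ultimately show "S \<in> A" using S'(2) Kc1_iff unfolding A_def by blast
  next
    fix S assume S: "S \<in> A"
    then have c: "S \<in> CN N" by (simp add: A_def Kc_def)
    have "act u ` S \<in> Zc N n W" using S act_CN[OF uF(1) c] by (simp add: A_def Zc_def)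
    moreover have "act (winv u) ` act u ` S = S" by (rule act_image_winv[OF uF(1) CN_bd[OF c]])
    ultimately show "S \<in> (\<lambda>S. act (winv u) ` S) ` Zc N n W" by (metis imageI)
  qed
  define R where "R = (\<lambda>P. P \<in> Pl (2 * n) ` A)"
  have AR: "A = {S \<in> Kc N 1. R (Pl (2 * n) S)}"
  proof (intro equalityI subsetI)
    fix S assume "S \<in> {S \<in> Kc N 1. R (Pl (2 * n) S)}"
    then obtain S' where S: "S \<in> Kc N 1" "S' \<in> A" "Pl (2 * n) S = Pl (2 * n) S'" by (auto simp: R_def)
    have b: "S \<subseteq> bd N" "S' \<subseteq> bd N" using S CN_bd by (auto simp: A_def Kc_def)
    have sub: "Pl n (act u ` S1) \<subseteq> Pl n (act u ` S2)" if h: "Pl (2 * n) S1 = Pl (2 * n) S2" "S1 \<subseteq> bd N" "S2 \<subseteq> bd N" for S1 S2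
    proof
      fix w assume "w \<in> Pl n (act u ` S1)"
      then obtain \<alpha> where \<alpha>: "\<alpha> \<in> S1" "w = pre (act u \<alpha>) n" by (auto simp: Pl_def)
      have "pre \<alpha> (2 * n) \<in> Pl (2 * n) S2" using \<alpha> h(1) by (auto simp: Pl_def)
      then obtain \<gamma> where \<gamma>: "\<gamma> \<in> S2" "pre \<alpha> (2 * n) = pre \<gamma> (2 * n)" by (auto simp: Pl_def)
      \<comment> \<open>The translation by \<open>u\<close> costs \<open>length u < n\<close>
        letters, which is why level \<open>2 * n\<close> suffices.\<close>
      then have "pre \<alpha> (n + length u) = pre \<gamma> (n + length u)" using uF(3) jn by (intro pre_eq_mono[OF \<gamma>(2)]) auto
      then have "w = pre (act u \<gamma>) n" using act_modulus[OF uF(1), of \<alpha> \<gamma> n] \<alpha> \<gamma> h by auto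
      then show "w \<in> Pl n (act u ` S2)" using \<gamma> by (auto simp: Pl_def)
    qed
    have "Pl n (act u ` S) = Pl n (act u ` S')" using sub[OF S(3) b] sub[OF S(3)[symmetric] b(2,1)] by (rule equalityI)
    then show "S \<in> A" using S by (simp add: A_def)
  qed (auto simp: A_def R_def)
  have "measure \<mu> (Zc N n W) = (\<Sum>W'\<in>{W' \<in> CW N (2 * n). R W'}. measure \<mu> (Zc N (2 * n) W'))" if \<mu>: "\<mu> \<in> SCurr N" for \<mu>
  proof -
    have "measure \<mu> (Zc N n W) = measure \<mu> A" using SCurr_measure_act[OF \<mu> uF(2) Zc_sets] im by metis
    also have "\<dots> = (\<Sum>W'\<in>{W' \<in> CW N (2 * n). R W'}. measure \<mu> (Zc N (2 * n) W'))"
      unfolding AR CW_def by (rule measure_level[OF \<mu>]) (use jn in simp)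
    finally show ?thesis .
  qed
  then show ?thesis using that[of "{W' \<in> CW N (2 * n). R W'}"] by blast
qed

lemma ratc_near:
  assumes \<mu>: "\<mu> \<in> SCurr N" and "\<delta> > 0"
  shows "\<exists>\<nu>\<in>ratc N. near N n \<delta> \<mu> \<nu>"
proof (cases "n = 0")
  case True
  have "card (Pl 0 S) < 2" for S
  proof -
    have "Pl 0 S \<subseteq> {[]}" by (auto simp: Pl_def)
    then have "card (Pl 0 S) \<le> card {[]::int list}" by (intro card_mono) auto
    then show ?thesis by simp
  qed
  then have "Kc N 0 = {}" by (auto simp: Kc_def not_le)
  then show ?thesis using True ratc.zero[OF \<mu>] by (auto simp: near_def)
next
  case False
  define c where "c = real (card (CW N (2 * n)))"
  define \<epsilon> where "\<epsilon> = \<delta> / (c + 1)"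
  have c: "c \<ge> 0" by (simp add: c_def)
  then have e: "\<epsilon> > 0" "c * \<epsilon> < \<delta>" using assms(2) by (auto simp: \<epsilon>_def field_simps)
  obtain r where r: "2 * n = Suc r" using False by (cases "2 * n") auto
  obtain \<nu> where \<nu>: "\<nu> \<in> ratc N" "\<forall>W\<in>CW N (2 * n). \<bar>measure \<mu> (Zc N (2 * n) W) - measure \<nu> (Zc N (2 * n) W)\<bar> < \<epsilon>"
    using approx_CW[OF \<mu> e(1), of r] unfolding r by blast
  have "\<bar>measure \<mu> (Zc N n W) - measure \<nu> (Zc N n W)\<bar> < \<delta>" if W: "W \<in> Pl n ` Kc N n" for W
  proof -
    obtain \<W> where \<W>: "\<W> \<subseteq> CW N (2 * n)"
      "\<And>\<mu>. \<mu> \<in> SCurr N \<Longrightarrow> measure \<mu> (Zc N n W) = (\<Sum>W'\<in>\<W>. measure \<mu> (Zc N (2 * n) W'))"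
      using Zc_translate[OF W] by blast
    have "\<bar>measure \<mu> (Zc N n W) - measure \<nu> (Zc N n W)\<bar> =
        \<bar>\<Sum>W'\<in>\<W>. measure \<mu> (Zc N (2 * n) W') - measure \<nu> (Zc N (2 * n) W')\<bar>"
      using \<W>(2)[OF \<mu>] \<W>(2)[OF ratc_SCurr[OF \<nu>(1)]] by (simp add: sum_subtractf)
    also have "\<dots> \<le> (\<Sum>W'\<in>\<W>. \<bar>measure \<mu> (Zc N (2 * n) W') - measure \<nu> (Zc N (2 * n) W')\<bar>)" by (rule sum_abs)
    also have "\<dots> \<le> (\<Sum>W'\<in>\<W>. \<epsilon>)" by (rule sum_mono) (use \<nu>(2) \<W>(1) in \<open>force intro: less_imp_le\<close>)
    also have "\<dots> = card \<W> * \<epsilon>" by simp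
    also have "\<dots> \<le> c * \<epsilon>" using card_mono[OF finite_CW \<W>(1)] e(1) by (intro mult_right_mono) (auto simp: c_def)
    finally show ?thesis using e(2) by simp
  qed
  then show ?thesis using \<nu>(1) by (auto simp: near_def)
qed

lemma ratc_dense: "weakT N closure_of ratc N = SCurr N"
proof
  show "weakT N closure_of ratc N \<subseteq> SCurr N" using closure_of_subset_topspace[of "weakT N"] by simp
  show "SCurr N \<subseteq> weakT N closure_of ratc N"
  proof
    fix \<mu> assume \<mu>: "\<mu> \<in> SCurr N"
    have "\<exists>\<nu>. \<nu> \<in> ratc N \<and> \<nu> \<in> U" if U: "\<mu> \<in> U" "openin (weakT N) U" for U
    proof -
      obtain n \<delta> where d: "\<delta> > 0" "\<forall>\<nu>\<in>SCurr N. near N n \<delta> \<mu> \<nu> \<longrightarrow> \<nu> \<in> U"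
        using weakT_nbhd[OF U(2,1)] by blast
      obtain \<nu> where "\<nu> \<in> ratc N" "near N n \<delta> \<mu> \<nu>" using ratc_near[OF \<mu> d(1)] by blast
      then show ?thesis using ratc_SCurr d(2) by blast
    qed
    then show "\<mu> \<in> weakT N closure_of ratc N" using \<mu> by (auto simp: in_closure_of)
  qed
qed

section \<open>Automorphisms\<close>

lemma hom_lipschitz:
  assumes "\<phi> \<in> hom (FN N) (FN N)"
  obtains C where "\<And>w. w \<in> FN_carrier N \<Longrightarrow> length (\<phi> w) \<le> C * length w"
proof -
  have hF: "\<phi> w \<in> FN_carrier N" if "w \<in> FN_carrier N" for w using assms that by (auto simp: hom_def)
  have hm: "\<phi> (mul u w) = mul (\<phi> u) (\<phi> w)" if "u \<in> FN_carrier N" "w \<in> FN_carrier N" for u w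
    using assms that by (auto simp: hom_def)
  define C where "C = Max (insert 0 ((\<lambda>a. length (\<phi> [a])) ` letters N))"
  have C: "length (\<phi> [a]) \<le> C" if "a \<in> letters N" for a unfolding C_def using that by (intro Max_ge) auto
  have "length (\<phi> w) \<le> C * length w" if "w \<in> FN_carrier N" for w
    using that
  proof (induct w)
    case Nil
    have "\<phi> [] = []" using hom_one[OF assms group_FN group_FN] by simp
    then show ?case by simp
  next
    case (Cons a w)
    have F: "[a] \<in> FN_carrier N" "w \<in> FN_carrier N" "a \<in> letters N"
      using append_FN[of "[a]" w N] Cons.prems by (auto simp: FN_carrier_def)
    have "\<phi> (a # w) = mul (\<phi> [a]) (\<phi> w)"
      using hm[OF F(1,2)] mul_append_reduced[of "[a]" w] FN_carrier_reduced[OF Cons.prems] by simp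
    then have "length (\<phi> (a # w)) \<le> length (\<phi> [a]) + length (\<phi> w)"
      using length_mul_le[of "\<phi> [a]" "\<phi> w"] hF[OF F(1)] hF[OF F(2)] FN_carrier_reduced by metis
    then show ?case using C[OF F(3)] Cons.hyps[OF F(2)] by simp
  qed
  then show ?thesis using that by blast
qed

lemma conv_bd_unique:
  assumes "conv_bd s \<xi>" "conv_bd s \<eta>"
  shows "\<xi> = \<eta>"
proof (rule ext_pre)
  fix k
  have "\<forall>\<^sub>F n in sequentially. agrees k (s n) \<xi> \<and> agrees k (s n) \<eta>"
    using assms unfolding conv_bd_iff by (auto intro: eventually_conj)
  then obtain n where "agrees k (s n) \<xi>" "agrees k (s n) \<eta>" using eventually_happens'[OF sequentially_bot] by blast
  then show "pre \<xi> k = pre \<eta> k" by (simp add: agrees_def)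
qed

text \<open>One constant \<open>C\<close> for the automorphism and its inverse makes the assumptions
  symmetric, so every result holds for \<open>\<psi>\<close> as well
  (\<open>fn_aut_sym\<close>).\<close>

locale fn_aut =
  fixes N :: nat and \<phi> \<psi> :: "int list \<Rightarrow> int list" and C :: nat
  assumes hom: "\<phi> \<in> hom (FN N) (FN N)" "\<psi> \<in> hom (FN N) (FN N)"
    and inv: "\<And>w. w \<in> FN_carrier N \<Longrightarrow> \<psi> (\<phi> w) = w" "\<And>w. w \<in> FN_carrier N \<Longrightarrow> \<phi> (\<psi> w) = w"
    and lip: "\<And>w. w \<in> FN_carrier N \<Longrightarrow> length (\<phi> w) \<le> C * length w" "\<And>w. w \<in> FN_carrier N \<Longrightarrow> length (\<psi> w) \<le> C * length w"
    and C1: "C \<ge> 1"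
begin

lemma hF: "w \<in> FN_carrier N \<Longrightarrow> \<phi> w \<in> FN_carrier N"
  and hm: "u \<in> FN_carrier N \<Longrightarrow> w \<in> FN_carrier N \<Longrightarrow> \<phi> (mul u w) = mul (\<phi> u) (\<phi> w)"
  using hom(1) by (auto simp: hom_def)

lemma hNil: "\<phi> [] = []"
  using hom_one[OF hom(1) group_FN group_FN] by simp

lemma hwinv: "w \<in> FN_carrier N \<Longrightarrow> \<phi> (winv w) = winv (\<phi> w)"
  using group_hom.hom_inv[of "FN N" "FN N" \<phi> w] hom(1) hF[of w] group_FN
  by (simp add: group_hom_def group_hom_axioms_def)

lemma hinj: "inj_on \<phi> (FN_carrier N)"
  using inv by (metis inj_onI)

text \<open>By the Lipschitz bound for the inverse, words of length at least \<open>mm k\<close>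
  have images of length at least \<open>k + C\<close>; the extra \<open>C\<close> absorbs the effect
  of one more letter.\<close>

definition mm :: "nat \<Rightarrow> nat" where
  "mm k = C * (k + C)"

lemma length_lower:
  assumes "w \<in> FN_carrier N" "mm k \<le> length w"
  shows "k + C \<le> length (\<phi> w)"
proof -
  have "length w \<le> C * length (\<phi> w)" using lip(2)[OF hF[OF assms(1)]] inv(1)[OF assms(1)] by simp
  then have "C * (k + C) \<le> C * length (\<phi> w)" using assms(2) unfolding mm_def by (rule order_trans[rotated])
  then show ?thesis using C1 by simp
qed

text \<open>Bounded cancellation: successive images of prefixes are \<open>C\<close>-close and eventually far from the identity.\<close>
lemma coarse_prefix:
  "w \<in> FN_carrier N \<Longrightarrow> mm k \<le> length w \<Longrightarrow> take k (\<phi> w) = take k (\<phi> (take (mm k) w))"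
proof (induct w rule: rev_induct)
  case Nil
  then show ?case by simp
next
  case (snoc a w)
  show ?case
  proof (cases "mm k \<le> length w")
    case False
    then have "take (mm k) (w @ [a]) = w @ [a]" using snoc.prems(2) by simp
    then show ?thesis by simp
  next
    case True
    have F: "w \<in> FN_carrier N" "[a] \<in> FN_carrier N" using append_FN[OF snoc.prems(1)] by auto
    have e: "\<phi> (w @ [a]) = mul (\<phi> w) (\<phi> [a])"
      using hm[OF F] mul_append_reduced[of w "[a]"] FN_carrier_reduced[OF snoc.prems(1)] by simp
    have "mul (winv (\<phi> w)) (\<phi> (w @ [a])) = \<phi> [a]"
      unfolding e using hF[OF F(2)] by (simp add: winv_mul_cancel FN_carrier_reduced)
    then have "length (mul (winv (\<phi> w)) (\<phi> (w @ [a]))) \<le> C" using lip(1)[OF F(2)] by simp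
    then have "take k (\<phi> w) = take k (\<phi> (w @ [a])) \<and> k \<le> length (\<phi> (w @ [a]))"
      using length_lower[OF F(1) True] hF[OF F(1)] hF[OF snoc.prems(1)]
      by (intro take_eq_if_close) (auto dest: FN_carrier_reduced)
    then show ?thesis using snoc.hyps[OF F(1) True] True by simp
  qed
qed

lemma mm_mono: "j \<le> k \<Longrightarrow> mm j \<le> mm k"
  by (simp add: mm_def)

text \<open>By \<open>coarse_prefix\<close> the images of prefixes stabilise, so the limit
  \<open>\<zeta>\<close> is written down letter by letter and shown to be the point described by
  \<open>THE\<close>.\<close>

lemma bdext:
  assumes \<xi>: "\<xi> \<in> bd N"
  shows "bdext N \<phi> \<xi> \<in> bd N" "pre (bdext N \<phi> \<xi>) k = take k (\<phi> (pre \<xi> (mm k)))"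
proof -
  define \<zeta> where "\<zeta> = (\<lambda>i. \<phi> (pre \<xi> (mm (Suc i))) ! i)"
  have len: "k \<le> length (\<phi> (pre \<xi> n))" if "mm k \<le> n" for k n
    using length_lower[OF pre_FN[OF \<xi>], of k n] that by simp
  have st: "take k (\<phi> (pre \<xi> n)) = take k (\<phi> (pre \<xi> (mm k)))" if "mm k \<le> n" for k n
    using coarse_prefix[OF pre_FN[OF \<xi>], of k n] that by (simp add: take_pre min_absorb1)
  have p: "pre \<zeta> k = take k (\<phi> (pre \<xi> (mm k)))" for k
  proof (rule nth_equalityI)
    show "length (pre \<zeta> k) = length (take k (\<phi> (pre \<xi> (mm k))))" using len[of k "mm k"] by simp
    fix i assume i: "i < length (pre \<zeta> k)"
    then have "mm (Suc i) \<le> mm k" by (intro mm_mono) simp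
    then have "take (Suc i) (\<phi> (pre \<xi> (mm k))) = take (Suc i) (\<phi> (pre \<xi> (mm (Suc i))))" by (rule st)
    then have "\<phi> (pre \<xi> (mm k)) ! i = \<phi> (pre \<xi> (mm (Suc i))) ! i" by (metis lessI nth_take)
    then show "pre \<zeta> k ! i = take k (\<phi> (pre \<xi> (mm k))) ! i" using i by (simp add: \<zeta>_def)
  qed
  have ag: "agrees k (\<phi> (pre \<xi> n)) \<zeta>" if "mm k \<le> n" for k n
    using p[of k] st[OF that] len[OF that] by (simp add: agrees_def)
  then have cv: "conv_bd (\<lambda>n. \<phi> (pre \<xi> n)) \<zeta>" unfolding conv_bd_iff eventually_sequentially by blast
  have zb: "\<zeta> \<in> bd N" by (rule agrees_all_bd) (use ag hF[OF pre_FN[OF \<xi>]] in blast)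
  have "bdext N \<phi> \<xi> = \<zeta>" unfolding bdext_def
    by (rule the_equality) (use cv zb conv_bd_unique in blast)+
  then show "bdext N \<phi> \<xi> \<in> bd N" "pre (bdext N \<phi> \<xi>) k = take k (\<phi> (pre \<xi> (mm k)))" using zb p by auto
qed

lemma bdext_agrees:
  assumes "\<xi> \<in> bd N" "w \<in> FN_carrier N" "agrees (mm k) w \<xi>"
  shows "agrees k (\<phi> w) (bdext N \<phi> \<xi>)"
proof -
  have m: "mm k \<le> length w" "take (mm k) w = pre \<xi> (mm k)" using assms(3) by (auto simp: agrees_def)
  then show ?thesis unfolding agrees_def
    using coarse_prefix[OF assms(2) m(1)] length_lower[OF assms(2) m(1)] bdext(2)[OF assms(1), of k] by simp
qed

lemma agrees_pre: "k \<le> n \<Longrightarrow> agrees k (pre \<xi> n) \<xi>"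
  by (simp add: agrees_def take_pre min_absorb1)

lemma bdext_equivariant:
  assumes g: "g \<in> FN_carrier N" and \<xi>: "\<xi> \<in> bd N"
  shows "bdext N \<phi> (act g \<xi>) = act (\<phi> g) (bdext N \<phi> \<xi>)"
proof (rule ext_pre)
  fix k
  define n where "n = max (mm k + length g) (mm (k + length (\<phi> g)))"
  have wF: "pre \<xi> n \<in> FN_carrier N" by (rule pre_FN[OF \<xi>])
  have "agrees (mm k) (mul g (pre \<xi> n)) (act g \<xi>)"
    by (rule agrees_mul_left[OF g wF \<xi> agrees_pre]) (simp add: n_def)
  then have 1: "agrees k (\<phi> (mul g (pre \<xi> n))) (bdext N \<phi> (act g \<xi>))"
    by (rule bdext_agrees[OF act_bd[OF g \<xi>] mul_FN[OF g wF]])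
  have "agrees (k + length (\<phi> g)) (\<phi> (pre \<xi> n)) (bdext N \<phi> \<xi>)"
    by (rule bdext_agrees[OF \<xi> wF agrees_pre]) (simp add: n_def)
  then have "agrees k (mul (\<phi> g) (\<phi> (pre \<xi> n))) (act (\<phi> g) (bdext N \<phi> \<xi>))"
    by (rule agrees_mul_left[OF hF[OF g] hF[OF wF] bdext(1)[OF \<xi>]])
  then show "pre (bdext N \<phi> (act g \<xi>)) k = pre (act (\<phi> g) (bdext N \<phi> \<xi>)) k"
    using 1 hm[OF g wF] by (simp add: agrees_def)
qed

lemma bdext_equivariant_image:
  "g \<in> FN_carrier N \<Longrightarrow> S \<subseteq> bd N \<Longrightarrow> bdext N \<phi> ` act g ` S = act (\<phi> g) ` bdext N \<phi> ` S"
  unfolding image_image by (intro image_cong refl) (auto simp: bdext_equivariant)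

lemma limset_image_sub:
  assumes "H \<subseteq> FN_carrier N"
  shows "bdext N \<phi> ` limset N H \<subseteq> limset N (\<phi> ` H)"
proof (rule image_subsetI)
  fix \<xi> assume "\<xi> \<in> limset N H"
  then have \<xi>: "\<xi> \<in> bd N" "\<And>k. \<exists>h\<in>H. agrees k h \<xi>" by (auto simp: mem_limset)
  have "\<exists>h\<in>\<phi> ` H. agrees k h (bdext N \<phi> \<xi>)" for k
  proof -
    obtain h where h: "h \<in> H" "agrees (mm k) h \<xi>" using \<xi> by blast
    then have "agrees k (\<phi> h) (bdext N \<phi> \<xi>)" using assms \<xi> by (intro bdext_agrees) auto
    then show ?thesis using h by blast
  qed
  then show "bdext N \<phi> \<xi> \<in> limset N (\<phi> ` H)" using bdext(1)[OF \<xi>(1)] by (simp add: mem_limset)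
qed

end

lemma fn_aut_sym: "fn_aut N \<phi> \<psi> C \<Longrightarrow> fn_aut N \<psi> \<phi> C"
  unfolding fn_aut_def by blast

lemma bdext_inverse:
  assumes a: "fn_aut N \<phi> \<psi> C" and \<xi>: "\<xi> \<in> bd N"
  shows "bdext N \<psi> (bdext N \<phi> \<xi>) = \<xi>"
proof (rule ext_pre)
  interpret p: fn_aut N \<phi> \<psi> C by (rule a)
  interpret q: fn_aut N \<psi> \<phi> C by (rule fn_aut_sym[OF a])
  fix k
  define n where "n = max k (p.mm (q.mm k))"
  have wF: "pre \<xi> n \<in> FN_carrier N" by (rule pre_FN[OF \<xi>])
  have "agrees (q.mm k) (\<phi> (pre \<xi> n)) (bdext N \<phi> \<xi>)"
    by (rule p.bdext_agrees[OF \<xi> wF p.agrees_pre]) (simp add: n_def)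
  then have "agrees k (\<psi> (\<phi> (pre \<xi> n))) (bdext N \<psi> (bdext N \<phi> \<xi>))"
    by (rule q.bdext_agrees[OF p.bdext(1)[OF \<xi>] p.hF[OF wF]])
  then show "pre (bdext N \<psi> (bdext N \<phi> \<xi>)) k = pre \<xi> k"
    using p.inv(1)[OF wF] by (simp add: agrees_def take_pre n_def min_absorb1)
qed

context fn_aut
begin

lemma aut_sym: "fn_aut N \<psi> \<phi> C"
  by (rule fn_aut_sym) unfold_locales

lemma aut_self: "fn_aut N \<phi> \<psi> C"
  by unfold_locales

lemma bdhomeo_bdext: "bdhomeo N (bdext N \<phi>) (bdext N \<psi>)"
proof -
  have m: "\<exists>m. \<forall>\<xi>\<in>bd N. \<forall>\<eta>\<in>bd N. pre \<xi> m = pre \<eta> m \<longrightarrow> pre (bdext N \<phi> \<xi>) k = pre (bdext N \<phi> \<eta>) k" for k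
    using bdext(2) by (intro exI[of _ "mm k"]) simp
  interpret q: fn_aut N \<psi> \<phi> C by (rule aut_sym)
  have m': "\<exists>m. \<forall>\<xi>\<in>bd N. \<forall>\<eta>\<in>bd N. pre \<xi> m = pre \<eta> m \<longrightarrow> pre (bdext N \<psi> \<xi>) k = pre (bdext N \<psi> \<eta>) k" for k
    using q.bdext(2) by (intro exI[of _ "q.mm k"]) simp
  show ?thesis unfolding bdhomeo_def
    using m m' bdext(1) q.bdext(1) bdext_inverse[OF aut_self] bdext_inverse[OF aut_sym] by blast
qed

lemma limset_image:
  assumes "H \<subseteq> FN_carrier N"
  shows "limset N (\<phi> ` H) = bdext N \<phi> ` limset N H"
proof
  show "bdext N \<phi> ` limset N H \<subseteq> limset N (\<phi> ` H)" by (rule limset_image_sub[OF assms])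
  interpret q: fn_aut N \<psi> \<phi> C by (rule aut_sym)
  have "\<phi> ` H \<subseteq> FN_carrier N" using assms hF by auto
  then have "bdext N \<psi> ` limset N (\<phi> ` H) \<subseteq> limset N (\<psi> ` \<phi> ` H)" by (rule q.limset_image_sub)
  also have "\<psi> ` \<phi> ` H = (\<lambda>w. w) ` H" unfolding image_image by (rule image_cong) (use inv assms in auto)
  finally have "bdext N \<phi> ` bdext N \<psi> ` limset N (\<phi> ` H) \<subseteq> bdext N \<phi> ` limset N H" by (simp add: image_mono)
  then show "limset N (\<phi> ` H) \<subseteq> bdext N \<phi> ` limset N H"
    using bdhomeo_image_inv(2)[OF bdhomeo_bdext limset_bd] by simp
qed

section \<open>Push-forward of currents\<close>

lemma autc_sets [simp]: "sets (autc N \<phi> \<mu>) = sets (borel_of (CT N))"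
  by (simp add: autc_def)

lemma measurable_bdext: "\<mu> \<in> SCurr N \<Longrightarrow> (\<lambda>S. bdext N \<phi> ` S) \<in> measurable \<mu> (borel_of (CT N))"
  using bdhomeo_measurable[OF bdhomeo_bdext] measurable_cong_sets[OF SCurr_sets refl] by blast

lemma emeasure_autc:
  assumes "\<mu> \<in> SCurr N" "A \<in> sets (borel_of (CT N))"
  shows "emeasure (autc N \<phi> \<mu>) A = emeasure \<mu> ((\<lambda>S. bdext N \<phi> ` S) -` A \<inter> CN N)"
  unfolding autc_def using emeasure_distr[OF measurable_bdext[OF assms(1)] assms(2)] SCurr_space[OF assms(1)] by simp

lemma emeasure_autc':
  assumes "\<mu> \<in> SCurr N" "A \<in> sets (borel_of (CT N))"
  shows "emeasure (autc N \<phi> \<mu>) A = emeasure \<mu> ((\<lambda>S. bdext N \<psi> ` S) ` A)"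
  unfolding emeasure_autc[OF assms] bdhomeo_sets_image(1)[OF bdhomeo_sym[OF bdhomeo_bdext] assms(2)] ..

text \<open>Pulling back by the automorphism turns translation by \<open>g\<close> into translation
  by \<open>\<psi> g\<close>, under which the current is invariant.\<close>

lemma autc_SCurr:
  assumes \<mu>: "\<mu> \<in> SCurr N"
  shows "autc N \<phi> \<mu> \<in> SCurr N"
proof (rule SCurrI)
  interpret q: fn_aut N \<psi> \<phi> C by (rule aut_sym)
  fix g A assume g: "g \<in> FN_carrier N" and A: "A \<in> sets (borel_of (CT N))"
  note gA = bdhomeo_sets_image(2)[OF bdhomeo_act[OF g] A]
  note pA = bdhomeo_sets_image(2)[OF q.bdhomeo_bdext A]
  have Ab: "S \<subseteq> bd N" if "S \<in> A" for S using that sets.sets_into_space[OF A] CN_bd by auto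
  have "emeasure (autc N \<phi> \<mu>) ((\<lambda>S. act g ` S) ` A) = emeasure \<mu> ((\<lambda>S. bdext N \<psi> ` S) ` (\<lambda>S. act g ` S) ` A)"
    by (rule emeasure_autc'[OF \<mu> gA])
  also have "(\<lambda>S. bdext N \<psi> ` S) ` (\<lambda>S. act g ` S) ` A = (\<lambda>S. act (\<psi> g) ` S) ` (\<lambda>S. bdext N \<psi> ` S) ` A"
  proof -
    have "(\<lambda>S. bdext N \<psi> ` S) ` (\<lambda>S. act g ` S) ` A = (\<lambda>S. bdext N \<psi> ` act g ` S) ` A" by (rule image_image)
    also have "\<dots> = (\<lambda>S. act (\<psi> g) ` bdext N \<psi> ` S) ` A"
      by (rule image_cong[OF refl], rule q.bdext_equivariant_image[OF g Ab])
    also have "\<dots> = (\<lambda>S. act (\<psi> g) ` S) ` (\<lambda>S. bdext N \<psi> ` S) ` A" by (rule image_image[symmetric])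
    finally show ?thesis .
  qed
  also have "emeasure \<mu> \<dots> = emeasure \<mu> ((\<lambda>S. bdext N \<psi> ` S) ` A)" by (rule SCurr_emeasure_act[OF \<mu> q.hF[OF g] pA])
  also have "\<dots> = emeasure (autc N \<phi> \<mu>) A" by (rule emeasure_autc'[OF \<mu> A, symmetric])
  finally show "emeasure (autc N \<phi> \<mu>) ((\<lambda>S. act g ` S) ` A) = emeasure (autc N \<phi> \<mu>) A" .
next
  fix k
  obtain m where m: "\<And>S. S \<subseteq> bd N \<Longrightarrow> 2 \<le> card (Pl k (bdext N \<phi> ` S)) \<Longrightarrow> 2 \<le> card (Pl m S)"
    using bdhomeo_Pl[OF bdhomeo_bdext, of k] by metis
  have "(\<lambda>S. bdext N \<phi> ` S) -` Kc N k \<inter> CN N \<subseteq> Kc N m" using m CN_bd by (auto simp: Kc_def)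
  then show "emeasure (autc N \<phi> \<mu>) (Kc N k) < \<infinity>"
    unfolding emeasure_autc[OF \<mu> Kc_sets] by (rule SCurr_emeasure_finite[OF \<mu>])
qed simp

lemma integral_autc:
  assumes "\<mu> \<in> SCurr N" "f \<in> Cc (CT N)"
  shows "integral\<^sup>L (autc N \<phi> \<mu>) f = integral\<^sup>L \<mu> (\<lambda>S. f (bdext N \<phi> ` S))"
  unfolding autc_def
  by (rule integral_distr[OF measurable_bdext[OF assms(1)] continuous_map_measurable]) (use assms in \<open>simp add: Cc_def\<close>)

lemma continuous_autc: "continuous_map (weakT N) (weakT N) (autc N \<phi>)"
proof -
  define B where "B = {{\<mu> \<in> SCurr N. integral\<^sup>L \<mu> f \<in> V} | f V. f \<in> Cc (CT N) \<and> open (V :: real set)}"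
  have "openin (weakT N) (autc N \<phi> -` U \<inter> topspace (weakT N))" if U: "U \<in> B" for U
  proof -
    obtain f V where fV: "f \<in> Cc (CT N)" "open V" "U = {\<mu> \<in> SCurr N. integral\<^sup>L \<mu> f \<in> V}" using U by (auto simp: B_def)
    have "autc N \<phi> -` U \<inter> topspace (weakT N) = {\<mu> \<in> topspace (weakT N). integral\<^sup>L \<mu> (\<lambda>S. f (bdext N \<phi> ` S)) \<in> V}"
      using autc_SCurr integral_autc[OF _ fV(1)] by (auto simp: fV(3))
    then show ?thesis
      using openin_continuous_map_preimage[OF continuous_integral[OF bdhomeo_Cc[OF bdhomeo_bdext fV(1)]], of V] fV(2) by simp
  qed
  moreover have "autc N \<phi> ` topspace (weakT N) \<subseteq> \<Union>B"
    using autc_SCurr topspace_weakT[of N] unfolding weakT_def B_def topology_generated_by_topspace by auto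
  ultimately have "continuous_map (weakT N) (topology_generated_by B) (autc N \<phi>)"
    unfolding continuous_on_generated_topo_iff by blast
  then show ?thesis by (simp add: weakT_def B_def)
qed

lemma autc_madd:
  assumes "\<mu> \<in> SCurr N" "\<nu> \<in> SCurr N"
  shows "autc N \<phi> (madd \<mu> \<nu>) = madd (autc N \<phi> \<mu>) (autc N \<phi> \<nu>)"
proof (rule measure_eqI)
  show "sets (autc N \<phi> (madd \<mu> \<nu>)) = sets (madd (autc N \<phi> \<mu>) (autc N \<phi> \<nu>))" by simp
  fix A assume "A \<in> sets (autc N \<phi> (madd \<mu> \<nu>))"
  then have A: "A \<in> sets (borel_of (CT N))" by simp
  have "(\<lambda>S. bdext N \<phi> ` S) -` A \<inter> CN N \<in> sets (borel_of (CT N))"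
    using measurable_sets[OF bdhomeo_measurable[OF bdhomeo_bdext] A] by simp
  then show "emeasure (autc N \<phi> (madd \<mu> \<nu>)) A = emeasure (madd (autc N \<phi> \<mu>) (autc N \<phi> \<nu>)) A"
    by (simp add: emeasure_autc[OF madd_SCurr[OF assms] A] emeasure_madd[OF assms]
      emeasure_madd[OF autc_SCurr[OF assms(1)] autc_SCurr[OF assms(2)] A] emeasure_autc[OF assms(1) A] emeasure_autc[OF assms(2) A])
qed

lemma autc_mscale:
  assumes "\<mu> \<in> SCurr N"
  shows "autc N \<phi> (mscale c \<mu>) = mscale c (autc N \<phi> \<mu>)"
proof (rule measure_eqI)
  show "sets (autc N \<phi> (mscale c \<mu>)) = sets (mscale c (autc N \<phi> \<mu>))" by (simp add: mscale_def)
  fix A assume "A \<in> sets (autc N \<phi> (mscale c \<mu>))"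
  then have A: "A \<in> sets (borel_of (CT N))" by simp
  show "emeasure (autc N \<phi> (mscale c \<mu>)) A = emeasure (mscale c (autc N \<phi> \<mu>)) A"
    unfolding emeasure_autc[OF mscale_SCurr[OF assms] A]
    by (simp add: mscale_def emeasure_autc[OF assms A])
qed

section \<open>Images of subgroups and counting currents\<close>

lemma subgroup_image: "subgroup H (FN N) \<Longrightarrow> subgroup (\<phi> ` H) (FN N)"
  using group_hom.subgroup_img_is_subgroup[of "FN N" "FN N" \<phi> H] hom(1) group_FN
  by (simp add: group_hom_def group_hom_axioms_def)

lemma fg_image:
  assumes "fg_subgroup N H"
  shows "fg_subgroup N (\<phi> ` H)"
proof -
  obtain S where "finite S" "S \<subseteq> FN_carrier N" "generate (FN N) S = H" using assms by (auto simp: fg_subgroup_def)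
  then show ?thesis unfolding fg_subgroup_def
    using assms subgroup_image[of H] hF generate_image[OF hom(1), of S]
    by (intro conjI exI[of _ "\<phi> ` S"]) (auto simp: fg_subgroup_def)
qed

lemma image_nontrivial:
  assumes "subgroup H (FN N)" "H \<noteq> {[]}"
  shows "\<phi> ` H \<noteq> {[]}"
proof
  assume e: "\<phi> ` H = {[]}"
  have "h = []" if "h \<in> H" for h
  proof -
    have "\<phi> h = []" using that e by blast
    moreover have "h \<in> FN_carrier N" using that assms by (auto simp: subgroup_FN_iff)
    ultimately show ?thesis using inv(1)[of h] inv(1)[of "[]"] hNil by simp
  qed
  then show False using assms by (auto simp: subgroup_FN_iff)
qed

lemma rcoset_image:
  assumes "H \<subseteq> FN_carrier N" "x \<in> FN_carrier N"
  shows "\<phi> ` (H #>\<^bsub>FN N\<^esub> x) = \<phi> ` H #>\<^bsub>FN N\<^esub> \<phi> x"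
  unfolding r_coset_eq image_image by (intro image_cong refl) (use hm assms in auto)

text \<open>\<open>\<phi>\<close> maps the right cosets of \<open>H\<close> bijectively to those of
  its image, and equivariance of \<open>bdext\<close> matches the limit sets seen from them; with
  currents counted over cosets, no commensurator has to be transported.\<close>

lemma autc_eta:
  assumes fg: "fg_subgroup N H" and nt: "H \<noteq> {[]}"
  shows "autc N \<phi> (eta N H) = eta N (\<phi> ` H)"
proof (rule measure_eqI)
  interpret q: fn_aut N \<psi> \<phi> C by (rule aut_sym)
  have H: "subgroup H (FN N)" using fg by (auto simp: fg_subgroup_def)
  have HF: "H \<subseteq> FN_carrier N" using H by (simp add: subgroup_FN_iff)
  note fg' = fg_image[OF fg] and nt' = image_nontrivial[OF H nt] and H' = subgroup_image[OF H]
  show "sets (autc N \<phi> (eta N H)) = sets (eta N (\<phi> ` H))" using SCurr_sets[OF eta_SCurr[OF fg' nt']] by simp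
  fix A assume "A \<in> sets (autc N \<phi> (eta N H))"
  then have A: "A \<in> sets (borel_of (CT N))" by simp
  define A' where "A' = (\<lambda>S. bdext N \<phi> ` S) -` A \<inter> CN N"
  have A': "A' \<in> sets (borel_of (CT N))"
    using measurable_sets[OF bdhomeo_measurable[OF bdhomeo_bdext] A] by (simp add: A'_def)
  define X1 where "X1 = {D \<in> rcosets\<^bsub>FN N\<^esub> H. csh N H D \<in> A'}"
  define X2 where "X2 = {D \<in> rcosets\<^bsub>FN N\<^esub> (\<phi> ` H). csh N (\<phi> ` H) D \<in> A}"
  have cs: "csh N (\<phi> ` H) (\<phi> ` D) = bdext N \<phi> ` csh N H D" if D: "D \<in> rcosets\<^bsub>FN N\<^esub> H" for D
  proof -
    obtain x where x: "x \<in> FN_carrier N" "D = H #>\<^bsub>FN N\<^esub> x" using rcosetsE[OF D] by blast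
    have "csh N (\<phi> ` H) (\<phi> ` D) = act (\<phi> (winv x)) ` bdext N \<phi> ` limset N H"
      unfolding x(2) rcoset_image[OF HF x(1)] csh_coset[OF H' hF[OF x(1)]] limset_image[OF HF] hwinv[OF x(1)] ..
    also have "\<dots> = bdext N \<phi> ` act (winv x) ` limset N H"
      using bdext_equivariant_image[OF winv_FN[OF x(1)] limset_bd] by simp
    finally show ?thesis by (simp add: x(2) csh_coset[OF H x(1)])
  qed
  have rc: "\<phi> ` D \<in> rcosets\<^bsub>FN N\<^esub> (\<phi> ` H)" if D: "D \<in> rcosets\<^bsub>FN N\<^esub> H" for D
    using rcosetsE[OF D] rcoset_image[OF HF] rcosetsI[OF hF] by metis
  have DF: "D \<subseteq> FN_carrier N" if D: "D \<in> rcosets\<^bsub>FN N\<^esub> L" "L \<subseteq> FN_carrier N" for D L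
  proof -
    obtain x where "x \<in> FN_carrier N" "D = L #>\<^bsub>FN N\<^esub> x" using rcosetsE[OF D(1)] by blast
    then show ?thesis using D(2) by (auto simp: r_coset_eq)
  qed
  have "(\<lambda>D. \<phi> ` D) ` X1 = X2"
  proof (intro equalityI subsetI)
    fix E assume "E \<in> (\<lambda>D. \<phi> ` D) ` X1"
    then obtain D where D: "D \<in> rcosets\<^bsub>FN N\<^esub> H" "csh N H D \<in> A'" "E = \<phi> ` D" by (auto simp: X1_def)
    then show "E \<in> X2" using rc[OF D(1)] cs[OF D(1)] by (simp add: X2_def A'_def)
  next
    fix E assume E: "E \<in> X2"
    then obtain y where y: "y \<in> FN_carrier N" "E = \<phi> ` H #>\<^bsub>FN N\<^esub> y" using rcosetsE[of E N "\<phi> ` H"] by (auto simp: X2_def)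
    define D where "D = H #>\<^bsub>FN N\<^esub> (\<psi> y)"
    have e: "E = \<phi> ` D" using rcoset_image[OF HF q.hF[OF y(1)]] inv(2)[OF y(1)] y(2) by (simp add: D_def)
    have D: "D \<in> rcosets\<^bsub>FN N\<^esub> H" unfolding D_def by (rule rcosetsI[OF q.hF[OF y(1)]])
    have "csh N H D \<in> A'" using E cs[OF D] e csh_CN[OF H nt D] by (simp add: X2_def A'_def)
    then show "E \<in> (\<lambda>D. \<phi> ` D) ` X1" using D e by (auto simp: X1_def)
  qed
  moreover have "inj_on (\<lambda>D. \<phi> ` D) X1"
  proof (rule inj_onI)
    fix D E assume h: "D \<in> X1" "E \<in> X1" "\<phi> ` D = \<phi> ` E"
    then have "D \<subseteq> FN_carrier N" "E \<subseteq> FN_carrier N" using DF[OF _ HF] by (auto simp: X1_def)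
    then show "D = E" using h(3) hinj inj_on_image_eq_iff by blast
  qed
  ultimately have "card X1 = card X2" "finite X1 \<longleftrightarrow> finite X2" using card_image finite_image_iff by metis+
  then have "emeasure (count_space UNIV) X1 = emeasure (count_space UNIV) X2" by (cases "finite X1") auto
  then show "emeasure (autc N \<phi> (eta N H)) A = emeasure (eta N (\<phi> ` H)) A"
    unfolding emeasure_autc[OF eta_SCurr[OF fg nt] A] A'_def[symmetric] emeasure_eta[OF fg nt A'] emeasure_eta[OF fg' nt' A]
    by (simp add: X1_def X2_def)
qed

lemma conjg_image:
  assumes "c \<in> FN_carrier N" "K \<subseteq> FN_carrier N"
  shows "\<phi> ` conjg N c K = conjg N (\<phi> c) (\<phi> ` K)"
  unfolding conjg_eq[OF assms(1)] conjg_eq[OF hF[OF assms(1)]] image_image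
  using assms hm hwinv by (intro image_cong refl) (auto simp: subset_iff)

lemma Nsub_image:
  assumes H: "subgroup H (FN N)" and K: "subgroup K (FN N)"
  shows "Nsub N (\<phi> ` H) (\<phi> ` K) = Nsub N H K"
proof -
  have HF: "H \<subseteq> FN_carrier N" "K \<subseteq> FN_carrier N" using H K by (auto simp: subgroup_FN_iff)
  interpret q: fn_aut N \<psi> \<phi> C by (rule aut_sym)
  note H' = subgroup_image[OF H] and K' = subgroup_image[OF K]
  have dcF: "\<phi> ` (H <#>\<^bsub>FN N\<^esub> {c} <#>\<^bsub>FN N\<^esub> K) = \<phi> ` H <#>\<^bsub>FN N\<^esub> {\<phi> c} <#>\<^bsub>FN N\<^esub> \<phi> ` K" if c: "c \<in> FN_carrier N" for c
  proof -
    have e: "\<phi> (mul (mul h c) k) = mul (mul (\<phi> h) (\<phi> c)) (\<phi> k)" if "h \<in> H" "k \<in> K" for h k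
    proof -
      have F: "h \<in> FN_carrier N" "k \<in> FN_carrier N" using that HF by auto
      show ?thesis using hm[OF mul_FN[OF F(1) c] F(2)] hm[OF F(1) c] by simp
    qed
    show ?thesis unfolding set_mult_dcoset
    proof (intro equalityI subsetI)
      fix z assume "z \<in> \<phi> ` {mul (mul h c) k |h k. h \<in> H \<and> k \<in> K}"
      then obtain h k where "h \<in> H" "k \<in> K" "z = \<phi> (mul (mul h c) k)" by blast
      then show "z \<in> {mul (mul h (\<phi> c)) k |h k. h \<in> \<phi> ` H \<and> k \<in> \<phi> ` K}" using e by blast
    next
      fix z assume "z \<in> {mul (mul h (\<phi> c)) k |h k. h \<in> \<phi> ` H \<and> k \<in> \<phi> ` K}"
      then obtain h k where hk: "h \<in> H" "k \<in> K" "z = mul (mul (\<phi> h) (\<phi> c)) (\<phi> k)" by blast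
      then have "z = \<phi> (mul (mul h c) k)" using e by simp
      then show "z \<in> \<phi> ` {mul (mul h c) k |h k. h \<in> H \<and> k \<in> K}" using hk by blast
    qed
  qed
  have dt: "dterm N (\<phi> ` H) (\<phi> ` K) (\<phi> ` D) = dterm N H K D" if D: "D \<in> dcosets N H K" for D
  proof -
    obtain c where c: "c \<in> FN_carrier N" "D = H <#>\<^bsub>FN N\<^esub> {c} <#>\<^bsub>FN N\<^esub> K" using D by (auto simp: dcosets_def)
    have sub: "conjg N c K \<subseteq> FN_carrier N" by (rule conjg_sub[OF c(1) HF(2)])
    have "\<phi> ` H \<inter> conjg N (\<phi> c) (\<phi> ` K) = \<phi> ` (H \<inter> conjg N c K)"
      unfolding conjg_image[OF c(1) HF(2), symmetric] by (rule inj_on_image_Int[OF hinj HF(1) sub, symmetric])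
    moreover have "rank N (\<phi> ` (H \<inter> conjg N c K)) = rank N (H \<inter> conjg N c K)"
      by (rule rank_image[OF hom(1) hinj]) (use HF in blast)
    ultimately show ?thesis
      unfolding c(2) dcF[OF c(1)] dterm_dcoset[OF H K c(1)] dterm_dcoset[OF H' K' hF[OF c(1)]] rrank_def by simp
  qed
  have DF: "D \<subseteq> FN_carrier N" if "D \<in> dcosets N H K" for D
    using that HF unfolding dcosets_def set_mult_dcoset by auto
  have bij: "bij_betw (\<lambda>D. \<phi> ` D) {D \<in> dcosets N H K. dterm N H K D \<noteq> 0}
      {D \<in> dcosets N (\<phi> ` H) (\<phi> ` K). dterm N (\<phi> ` H) (\<phi> ` K) D \<noteq> 0}"
    unfolding bij_betw_def
  proof (intro conjI equalityI subsetI)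
    show "inj_on (\<lambda>D. \<phi> ` D) {D \<in> dcosets N H K. dterm N H K D \<noteq> 0}"
      using DF hinj by (auto intro!: inj_onI simp: inj_on_image_eq_iff)
    fix E assume "E \<in> (\<lambda>D. \<phi> ` D) ` {D \<in> dcosets N H K. dterm N H K D \<noteq> 0}"
    then obtain D where D: "D \<in> dcosets N H K" "dterm N H K D \<noteq> 0" "E = \<phi> ` D" by blast
    obtain c where c: "c \<in> FN_carrier N" "D = H <#>\<^bsub>FN N\<^esub> {c} <#>\<^bsub>FN N\<^esub> K" using D by (auto simp: dcosets_def)
    have "E \<in> dcosets N (\<phi> ` H) (\<phi> ` K)" using D(3) c dcF hF[OF c(1)] unfolding dcosets_def FN_simps by blast
    then show "E \<in> {D \<in> dcosets N (\<phi> ` H) (\<phi> ` K). dterm N (\<phi> ` H) (\<phi> ` K) D \<noteq> 0}" using D dt by simp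
  next
    fix E assume "E \<in> {D \<in> dcosets N (\<phi> ` H) (\<phi> ` K). dterm N (\<phi> ` H) (\<phi> ` K) D \<noteq> 0}"
    then obtain c' where c': "c' \<in> FN_carrier N" "E = \<phi> ` H <#>\<^bsub>FN N\<^esub> {c'} <#>\<^bsub>FN N\<^esub> \<phi> ` K"
      and E: "dterm N (\<phi> ` H) (\<phi> ` K) E \<noteq> 0" by (auto simp: dcosets_def)
    define D where "D = H <#>\<^bsub>FN N\<^esub> {\<psi> c'} <#>\<^bsub>FN N\<^esub> K"
    have e: "E = \<phi> ` D" using dcF[OF q.hF[OF c'(1)]] c' inv(2)[OF c'(1)] by (simp add: D_def)
    have "D \<in> dcosets N H K" using q.hF[OF c'(1)] by (auto simp: D_def dcosets_def)
    then show "E \<in> (\<lambda>D. \<phi> ` D) ` {D \<in> dcosets N H K. dterm N H K D \<noteq> 0}" using e E dt by auto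
  qed
  have "Nsub N H K = (\<Sum>D\<in>{D \<in> dcosets N H K. dterm N H K D \<noteq> 0}. dterm N (\<phi> ` H) (\<phi> ` K) (\<phi> ` D))"
    unfolding Nsub_def by (rule sum.cong) (auto simp: dt)
  also have "\<dots> = Nsub N (\<phi> ` H) (\<phi> ` K)"
    unfolding Nsub_def by (rule sum.reindex_bij_betw[OF bij])
  finally show ?thesis by simp
qed

end

lemma iso_fn_aut:
  assumes "\<phi> \<in> iso (FN N) (FN N)"
  obtains \<psi> C where "fn_aut N \<phi> \<psi> C"
proof -
  define \<psi> where "\<psi> = inv_into (FN_carrier N) \<phi>"
  have b: "bij_betw \<phi> (FN_carrier N) (FN_carrier N)" and h: "\<phi> \<in> hom (FN N) (FN N)" using assms by (auto simp: iso_def)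
  have h': "\<psi> \<in> hom (FN N) (FN N)" using FN.iso_set_sym[OF assms] by (simp add: iso_def \<psi>_def)
  obtain C1 where C1: "\<And>w. w \<in> FN_carrier N \<Longrightarrow> length (\<phi> w) \<le> C1 * length w" using hom_lipschitz[OF h] by blast
  obtain C2 where C2: "\<And>w. w \<in> FN_carrier N \<Longrightarrow> length (\<psi> w) \<le> C2 * length w" using hom_lipschitz[OF h'] by blast
  define C where "C = C1 + C2 + 1"
  have "fn_aut N \<phi> \<psi> C"
  proof
    fix w assume w: "w \<in> FN_carrier N"
    show "\<psi> (\<phi> w) = w" "\<phi> (\<psi> w) = w" using b w by (simp_all add: \<psi>_def bij_betw_def f_inv_into_f)
    show "length (\<phi> w) \<le> C * length w" "length (\<psi> w) \<le> C * length w"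
      using C1[OF w] C2[OF w] by (auto simp: C_def algebra_simps)
  qed (auto simp: h h' C_def)
  then show ?thesis using that by blast
qed

section \<open>Uniqueness and invariance\<close>

text \<open>Separated from \<open>is_intersection_functional\<close> so that the uniqueness argument
  can compare \<open>Nint\<close> both with another intersection functional and with its own
  pull-back under an automorphism.\<close>

definition bilinear_curr :: "nat \<Rightarrow> ((nat \<Rightarrow> int) set measure \<Rightarrow> (nat \<Rightarrow> int) set measure \<Rightarrow> real) \<Rightarrow> bool" where
  "bilinear_curr N F \<longleftrightarrow>
     continuous_map (prod_topology (weakT N) (weakT N)) euclideanreal (\<lambda>(\<mu>, \<nu>). F \<mu> \<nu>) \<and>
     (\<forall>\<mu>\<in>SCurr N. \<forall>\<nu>\<in>SCurr N. F \<mu> \<nu> = F \<nu> \<mu>) \<and>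
     (\<forall>\<mu>1\<in>SCurr N. \<forall>\<mu>2\<in>SCurr N. \<forall>\<nu>\<in>SCurr N. F (madd \<mu>1 \<mu>2) \<nu> = F \<mu>1 \<nu> + F \<mu>2 \<nu>) \<and>
     (\<forall>c\<ge>0. \<forall>\<mu>\<in>SCurr N. \<forall>\<nu>\<in>SCurr N. F (mscale c \<mu>) \<nu> = c * F \<mu> \<nu>)"

text \<open>Linearity extends the equality to the cone in the first variable; symmetry exchanges the
  variables, and linearity is used once more. Two continuous functions into a Hausdorff space that
  agree on the dense product of cones are equal.\<close>

lemma bilinear_curr_unique:
  assumes F: "bilinear_curr N F" and G: "bilinear_curr N G"
    and eq: "\<And>H K. fg_subgroup N H \<Longrightarrow> H \<noteq> {[]} \<Longrightarrow> fg_subgroup N K \<Longrightarrow> K \<noteq> {[]} \<Longrightarrow> F (eta N H) (eta N K) = G (eta N H) (eta N K)"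
    and \<mu>\<nu>: "\<mu> \<in> SCurr N" "\<nu> \<in> SCurr N"
  shows "F \<mu> \<nu> = G \<mu> \<nu>"
proof -
  note Fd = F[unfolded bilinear_curr_def] and Gd = G[unfolded bilinear_curr_def]
  have lift: "F \<alpha> \<nu> = G \<alpha> \<nu>"
    if \<alpha>: "\<alpha> \<in> ratc N" and \<nu>: "\<nu> \<in> SCurr N"
      and base: "\<And>H. fg_subgroup N H \<Longrightarrow> H \<noteq> {[]} \<Longrightarrow> F (eta N H) \<nu> = G (eta N H) \<nu>" for \<alpha> \<nu>
    using \<alpha>
  proof induct
    case (zero \<mu>)
    have "F (mscale 0 \<mu>) \<nu> = 0 * F \<mu> \<nu>" "G (mscale 0 \<mu>) \<nu> = 0 * G \<mu> \<nu>" using Fd Gd zero \<nu> by blast+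
    then show ?case by simp
  next
    case (eta H)
    then show ?case by (rule base)
  next
    case (scale \<mu> c)
    have "F (mscale c \<mu>) \<nu> = c * F \<mu> \<nu>" "G (mscale c \<mu>) \<nu> = c * G \<mu> \<nu>"
      using Fd Gd scale ratc_SCurr[of \<mu> N] \<nu> by blast+
    then show ?case using scale by simp
  next
    case (add \<mu>1 \<mu>2)
    have "F (madd \<mu>1 \<mu>2) \<nu> = F \<mu>1 \<nu> + F \<mu>2 \<nu>" "G (madd \<mu>1 \<mu>2) \<nu> = G \<mu>1 \<nu> + G \<mu>2 \<nu>"
      using Fd Gd ratc_SCurr[OF add(1)] ratc_SCurr[OF add(3)] \<nu> by blast+
    then show ?case using add by simp
  qed
  have 1: "F \<alpha> (eta N K) = G \<alpha> (eta N K)" if "\<alpha> \<in> ratc N" "fg_subgroup N K" "K \<noteq> {[]}" for \<alpha> K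
    by (rule lift[OF that(1) eta_SCurr[OF that(2,3)]]) (use eq that in blast)
  have 2: "F \<alpha> \<beta> = G \<alpha> \<beta>" if "\<alpha> \<in> ratc N" "\<beta> \<in> ratc N" for \<alpha> \<beta>
  proof (rule lift[OF that(1) ratc_SCurr[OF that(2)]])
    fix H assume H: "fg_subgroup N H" "H \<noteq> {[]}"
    have "F (eta N H) \<beta> = F \<beta> (eta N H)" "G (eta N H) \<beta> = G \<beta> (eta N H)"
      using Fd Gd eta_SCurr[OF H] ratc_SCurr[OF that(2)] by blast+
    then show "F (eta N H) \<beta> = G (eta N H) \<beta>" using 1[OF that(2) H] by simp
  qed
  have "(\<mu>, \<nu>) \<in> prod_topology (weakT N) (weakT N) closure_of (ratc N \<times> ratc N)"
    using \<mu>\<nu> by (simp add: closure_of_Times ratc_dense)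
  then have "(\<lambda>(\<mu>, \<nu>). F \<mu> \<nu>) (\<mu>, \<nu>) = (\<lambda>(\<mu>, \<nu>). G \<mu> \<nu>) (\<mu>, \<nu>)"
    by (rule forall_in_closure_of_eq[where Y=euclideanreal]) (use Fd Gd 2 in auto)
  then show ?thesis by simp
qed

lemma bilinear_Nint: "bilinear_curr N (Nint N)"
  unfolding bilinear_curr_def using continuous_Nint Nint_sym Nint_add Nint_scale by blast

text \<open>The local term takes negative values, so positivity is drawn from the reduced ranks on
  counting currents, extended to the cone by linearity and to its closure by continuity.\<close>

lemma Nint_nonneg:
  assumes "\<mu> \<in> SCurr N" "\<nu> \<in> SCurr N"
  shows "Nint N \<mu> \<nu> \<ge> 0"
proof -
  have lift: "Nint N \<alpha> \<nu> \<ge> 0"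
    if \<alpha>: "\<alpha> \<in> ratc N" and \<nu>: "\<nu> \<in> SCurr N"
      and base: "\<And>H. fg_subgroup N H \<Longrightarrow> H \<noteq> {[]} \<Longrightarrow> Nint N (eta N H) \<nu> \<ge> 0" for \<alpha> \<nu>
    using \<alpha>
  proof induct
    case (zero \<mu>)
    then show ?case using Nint_scale[OF zero \<nu>, of 0] by simp
  next
    case (eta H)
    then show ?case by (rule base)
  next
    case (scale \<mu> c)
    then show ?case using Nint_scale[OF ratc_SCurr \<nu>, of \<mu> c] by simp
  next
    case (add \<mu>1 \<mu>2)
    then show ?case using Nint_add[OF ratc_SCurr ratc_SCurr \<nu>, of \<mu>1 \<mu>2] by simp
  qed
  have 1: "Nint N \<alpha> (eta N K) \<ge> 0" if "\<alpha> \<in> ratc N" "fg_subgroup N K" "K \<noteq> {[]}" for \<alpha> K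
    by (rule lift[OF that(1) eta_SCurr[OF that(2,3)]]) (use Nint_eta that in simp)
  have 2: "Nint N \<alpha> \<beta> \<ge> 0" if "\<alpha> \<in> ratc N" "\<beta> \<in> ratc N" for \<alpha> \<beta>
  proof (rule lift[OF that(1) ratc_SCurr[OF that(2)]])
    fix H assume H: "fg_subgroup N H" "H \<noteq> {[]}"
    show "Nint N (eta N H) \<beta> \<ge> 0"
      using 1[OF that(2) H] Nint_sym[OF eta_SCurr[OF H] ratc_SCurr[OF that(2)]] by simp
  qed
  define PP where "PP = prod_topology (weakT N) (weakT N)"
  have "closedin PP {p \<in> topspace PP. (case p of (\<mu>, \<nu>) \<Rightarrow> Nint N \<mu> \<nu>) \<in> {0..}}"
    by (rule closedin_continuous_map_preimage[OF continuous_Nint[of N, folded PP_def]]) auto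
  then have "PP closure_of (ratc N \<times> ratc N) \<subseteq> {p \<in> topspace PP. (case p of (\<mu>, \<nu>) \<Rightarrow> Nint N \<mu> \<nu>) \<in> {0..}}"
    by (rule closure_of_minimal[rotated]) (use 2 ratc_SCurr in \<open>auto simp: PP_def\<close>)
  moreover have "(\<mu>, \<nu>) \<in> PP closure_of (ratc N \<times> ratc N)"
    using assms by (simp add: PP_def closure_of_Times ratc_dense)
  ultimately show ?thesis by auto
qed

lemma Nint_intersection_functional: "is_intersection_functional N (Nint N)"
  unfolding is_intersection_functional_def
  using continuous_Nint[of N] Nint_nonneg[of _ N] Nint_sym[of _ N] Nint_add[of _ N] Nint_scale[of _ N] Nint_eta[of N]
  by simp

text \<open>The pull-back of \<open>Nint\<close> by \<open>\<phi>\<close> is again continuous,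
  symmetric and bilinear, and it has the same values on counting currents because
  \<open>\<phi>\<close> preserves double cosets and ranks of intersections.\<close>

lemma Nint_autc:
  assumes \<phi>: "\<phi> \<in> iso (FN N) (FN N)" and "\<mu> \<in> SCurr N" "\<nu> \<in> SCurr N"
  shows "Nint N (autc N \<phi> \<mu>) (autc N \<phi> \<nu>) = Nint N \<mu> \<nu>"
proof -
  obtain \<psi> C where "fn_aut N \<phi> \<psi> C" using iso_fn_aut[OF \<phi>] by blast
  then interpret fn_aut N \<phi> \<psi> C .
  define F where "F = (\<lambda>\<mu> \<nu>. Nint N (autc N \<phi> \<mu>) (autc N \<phi> \<nu>))"
  have "continuous_map (prod_topology (weakT N) (weakT N)) (prod_topology (weakT N) (weakT N)) (\<lambda>(\<mu>, \<nu>). (autc N \<phi> \<mu>, autc N \<phi> \<nu>))"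
    using continuous_autc by (simp add: continuous_map_prod_top)
  from continuous_map_compose[OF this continuous_Nint]
  have "continuous_map (prod_topology (weakT N) (weakT N)) euclideanreal (\<lambda>(\<mu>, \<nu>). F \<mu> \<nu>)"
    by (simp add: o_def case_prod_unfold F_def)
  moreover have "F (madd \<mu>1 \<mu>2) \<nu> = F \<mu>1 \<nu> + F \<mu>2 \<nu>" if "\<mu>1 \<in> SCurr N" "\<mu>2 \<in> SCurr N" "\<nu> \<in> SCurr N" for \<mu>1 \<mu>2 \<nu>
    unfolding F_def autc_madd[OF that(1,2)] by (rule Nint_add[OF autc_SCurr autc_SCurr autc_SCurr, OF that])
  moreover have "F (mscale c \<mu>) \<nu> = c * F \<mu> \<nu>" if "c \<ge> 0" "\<mu> \<in> SCurr N" "\<nu> \<in> SCurr N" for c \<mu> \<nu>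
    unfolding F_def autc_mscale[OF that(2)] by (rule Nint_scale[OF autc_SCurr autc_SCurr, OF that(2,3,1)])
  moreover have "F \<mu> \<nu> = F \<nu> \<mu>" if "\<mu> \<in> SCurr N" "\<nu> \<in> SCurr N" for \<mu> \<nu>
    unfolding F_def by (rule Nint_sym[OF autc_SCurr autc_SCurr, OF that])
  ultimately have "bilinear_curr N F" unfolding bilinear_curr_def by blast
  moreover have "F (eta N H) (eta N K) = Nint N (eta N H) (eta N K)"
    if H: "fg_subgroup N H" "H \<noteq> {[]}" and K: "fg_subgroup N K" "K \<noteq> {[]}" for H K
  proof -
    have s: "subgroup H (FN N)" "subgroup K (FN N)" using H K by (auto simp: fg_subgroup_def)
    show ?thesis unfolding F_def autc_eta[OF H] autc_eta[OF K]
      using Nint_eta[OF fg_image[OF H(1)] image_nontrivial[OF s(1) H(2)] fg_image[OF K(1)] image_nontrivial[OF s(2) K(2)]]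
        Nint_eta[OF H K] Nsub_image[OF s] by simp
  qed
  ultimately have "F \<mu> \<nu> = Nint N \<mu> \<nu>" using bilinear_curr_unique[OF _ bilinear_Nint _ assms(2,3)] by blast
  then show ?thesis by (simp add: F_def)
qed

theorem mainTheorem1:
  fixes N :: nat
  assumes "N \<ge> 2"
  shows "\<exists>Nf. is_intersection_functional N Nf \<and>
           (\<forall>Nf'. is_intersection_functional N Nf' \<longrightarrow>
              (\<forall>\<mu> \<in> SCurr N. \<forall>\<nu> \<in> SCurr N. Nf' \<mu> \<nu> = Nf \<mu> \<nu>)) \<and>
           (\<forall>\<phi> \<in> iso (FN N) (FN N). \<forall>\<mu> \<in> SCurr N. \<forall>\<nu> \<in> SCurr N.
              Nf (autc N \<phi> \<mu>) (autc N \<phi> \<nu>) = Nf \<mu> \<nu>)"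
proof (intro exI[of _ "Nint N"] conjI allI impI ballI)
  show "is_intersection_functional N (Nint N)" by (rule Nint_intersection_functional)
  show "Nint N (autc N \<phi> \<mu>) (autc N \<phi> \<nu>) = Nint N \<mu> \<nu>"
    if "\<phi> \<in> iso (FN N) (FN N)" "\<mu> \<in> SCurr N" "\<nu> \<in> SCurr N" for \<phi> \<mu> \<nu>
    by (rule Nint_autc[OF that])
  fix Nf' \<mu> \<nu> assume h: "is_intersection_functional N Nf'" and \<mu>\<nu>: "\<mu> \<in> SCurr N" "\<nu> \<in> SCurr N"
  have "bilinear_curr N Nf'"
    using h unfolding is_intersection_functional_def bilinear_curr_def by blast
  moreover have "Nf' (eta N H) (eta N K) = Nint N (eta N H) (eta N K)"
    if "fg_subgroup N H" "H \<noteq> {[]}" "fg_subgroup N K" "K \<noteq> {[]}" for H K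
    using h Nint_eta[OF that] that unfolding is_intersection_functional_def by simp
  ultimately show "Nf' \<mu> \<nu> = Nint N \<mu> \<nu>"
    using bilinear_curr_unique[OF _ bilinear_Nint _ \<mu>\<nu>] by blast
qed

end
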